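(* Let $\{c_j\}_{j\ge 1}$ be a sequence of non-zero real numbers such that $\sum_{j=1}^{\infty}|c_j|<\infty$. Let $\{\lambda_j\}_{j\ge1}$ be a bounded sequence of distinct real numbers which attains its bounds. Let $\mathfrak{D}$ denote the region of the complex $z$-plane given by $$|\mathrm{Re}(z)-\mathrm{Im}(z)|<\sqrt{\tfrac{\pi}{2}}-\sqrt{\tfrac{2}{\pi}}\,\mathrm{Re}(z)\,\mathrm{Im}(z).$$ Then for any $z\in\mathfrak{D}$, the function $$F_z(s):=\sum_{j=1}^{\infty}c_j\,\eta(s+i\lambda_j)\left\{{}_1F_1\!\left(\frac{1-(s+i\lambda_j)}{2};\frac12;\frac{z^2}{4}\right)+{}_1F_1\!\left(\frac{1-(\bar s-i\lambda_j)}{2};\frac12;\frac{\bar z^2}{4}\right)\right\}$$ has infinitely many zeros on the critical line $\mathrm{Re}(s)=\tfrac12$.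
   Context: $\zeta(s)$ is the Riemann zeta function and $\eta(s):=\pi^{-s/2}\Gamma(s/2)\zeta(s)$, a meromorphic function with poles at $s=0,1$. ${}_1F_1(c;d;w):=\sum_{n=0}^{\infty}\frac{(c)_n w^n}{(d)_n\, n!}$ is the confluent hypergeometric function, where $(c)_n=\Gamma(c+n)/\Gamma(c)$. $\bar s,\bar z$ denote complex conjugates. *)

theory Defs
  imports "HOL-Complex_Analysis.Complex_Analysis"
begin

text \<open>
  The Riemann zeta function, as the analytic continuation of its Dirichlet series to the
  plane punctured at 1. The value at the pole is fixed to 0 only to make the description unique.
\<close>

definition zeta :: "complex \<Rightarrow> complex" where
  "zeta = (THE f. f holomorphic_on (- {1}) \<and>
                  (\<forall>s. Re s > 1 \<longrightarrow> f s = (\<Sum>n. 1 / of_nat (Suc n) powr s)) \<and>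
                  f 1 = 0)"

text \<open>
  The product below is meant as a meromorphic function with poles at 0 and 1. As \<^const>\<open>Gamma\<close>
  is 0 at its poles, the pointwise product agrees with it except possibly at the
  non-positive even integers and at 1, none of which has real part 1/2.
\<close>

definition completed_zeta :: "complex \<Rightarrow> complex" where
  "completed_zeta s = of_real pi powr (- s / 2) * Gamma (s / 2) * zeta s"

definition hyp_1F1 :: "complex \<Rightarrow> complex \<Rightarrow> complex \<Rightarrow> complex" where
  "hyp_1F1 c d w = (\<Sum>n. pochhammer c n * w ^ n / (pochhammer d n * fact n))"

definition region_D :: "complex set" where
  "region_D = {z. \<bar>Re z - Im z\<bar> < sqrt (pi / 2) - sqrt (2 / pi) * Re z * Im z}"

text \<open>
  Sequences are indexed from 0 here, so the coefficient and shift with index 1 in the usual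
  numbering are \<open>c 0\<close> and \<open>l 0\<close>.
\<close>

definition F :: "(nat \<Rightarrow> real) \<Rightarrow> (nat \<Rightarrow> real) \<Rightarrow> complex \<Rightarrow> complex \<Rightarrow> complex" where
  "F c l z s = (\<Sum>j. of_real (c j) * completed_zeta (s + \<i> * of_real (l j)) *
     (hyp_1F1 ((1 - (s + \<i> * of_real (l j))) / 2) (1 / 2) (z ^ 2 / 4) +
      hyp_1F1 ((1 - (cnj s - \<i> * of_real (l j))) / 2) (1 / 2) (cnj z ^ 2 / 4)))"

end

theory Submission
  imports Defs "HOL-Probability.Probability" "HOL-Real_Asymp.Real_Asymp"
begin

text \<open>
  On the critical line the summand is real and \<open>F c l z (1/2 - i t)\<close> equals \<open>2 G(t)\<close> with
  \<open>G(t) = \<Sum>j. c j * h(t - l j)\<close>, where \<open>h\<close> is the Fourier transform of a combination of two theta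
  functions with parameter \<open>z\<close>. Hence for \<open>\<bar>\<theta>\<bar> < pi/4\<close> the transform of \<open>exp (t \<theta>) G(t)\<close> at \<open>y\<close> is
  \<open>2 pi C(y + i \<theta>) E(y + i \<theta>)\<close>, with \<open>C\<close> the almost periodic function built from \<open>c\<close>, \<open>l\<close> and \<open>E\<close> the
  theta function. If \<open>G\<close> had finitely many zeros, it would have constant sign near infinity, and
  these transforms would, up to a bounded error, form a positive definite kernel in \<open>y\<close>, uniformly as
  \<open>\<theta> \<rightarrow> pi/4\<close>. In that limit the modular variable of the theta function tends to the real line: to
  the cusp \<open>1\<close> at \<open>y = 0\<close> and to \<open>2 k\<close> at \<open>y = ln (2 k) / 2\<close>. Approaching \<open>2 k\<close> along
  suitable directions produces characters at which the kernel is as large as its singularity permits,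
  while they are asymptotically orthogonal to each other. If the kernel is negligible on the diagonal,
  a single such character contradicts positivity; otherwise the Bessel inequality bounds the sum of
  their squares, which has the size of a divergent harmonic series. The integer \<open>k\<close> is chosen
  by almost periodicity such that \<open>C\<close> does not vanish.
\<close>

section \<open>Gaussian integrals\<close>

text \<open>At the cusp \<open>i * r\<close>, Poisson summation turns the theta series into
  Gaussians \<open>exp (- pi * A * (m + X)^2)\<close>. On the path \<open>x = s * a\<close>,
  \<open>A\<close> grows like \<open>1 / a\<close> and \<open>X\<close> tends to
  \<open>q + sqrt r * (u + s * v)\<close>, so relative to \<open>cuspM\<close> the theta function
  survives exactly when this limit is an integer: a resonance. The reflected term of the summand
  grows at the same rate, so size alone cannot exclude cancellation; but its limit has
  \<open>u - s * v\<close>, and at \<open>r = 2 * k\<close> both can be integers only if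
  \<open>2 * u * sqrt (2 * k)\<close> is one. Hence the condition imposed on \<open>k\<close>. On
  the diagonal \<open>r = 1\<close>, \<open>q = 1/2\<close>, \<open>s = 0\<close>, so the kernel is
  negligible there unless \<open>1/2 + u\<close> is an integer; this is the case distinction. In the
  exceptional case infinitely many slopes \<open>s\<close> resonate at the cusp
  \<open>2 * k\<close>, with squared limits of order \<open>1 / \<bar>s\<bar>\<close>. Slopes act
  only through \<open>s * v\<close>: the case \<open>v = 0\<close>, \<open>u \<noteq> 0\<close> is
  moved away by conjugating \<open>z\<close>, and for \<open>u = 0\<close> the two terms agree up to
  a constant factor.\<close>

lemma integral_symmetric_limit:
  fixes f :: "real \<Rightarrow> complex"
  assumes "integrable lborel f"
  shows "(\<lambda>n. LBINT x:{- real n..real n}. f x) \<longlonglongrightarrow> (LBINT x. f x)"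
  unfolding set_lebesgue_integral_def
proof (rule integral_dominated_convergence)
  show "f \<in> borel_measurable lborel" using assms by auto
  show "integrable lborel (\<lambda>x. norm (f x))" using assms by auto
  show "AE x in lborel. (\<lambda>n. indicator {- real n..real n} x *\<^sub>R f x) \<longlonglongrightarrow> f x"
  proof (rule AE_I2)
    fix x :: real
    have "eventually (\<lambda>n. real n \<ge> \<bar>x\<bar>) sequentially" by real_asymp
    then have "eventually (\<lambda>n. indicator {- real n..real n} x *\<^sub>R f x = f x) sequentially"
      by eventually_elim (auto simp: indicator_def)
    then show "(\<lambda>n. indicator {- real n..real n} x *\<^sub>R f x) \<longlonglongrightarrow> f x"
      by (rule tendsto_eventually)
  qed
qed (use assms in \<open>auto simp: indicator_def\<close>)

lemma integrable_exp_quadratic_real: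
  fixes A B C :: real
  assumes "A > 0"
  shows "integrable lborel (\<lambda>x. exp (- A * x\<^sup>2 + B * x + C))"
proof -
  define \<sigma> where "\<sigma> = sqrt (1 / (2 * A))"
  define \<mu> where "\<mu> = B / (2 * A)"
  have s: "\<sigma>\<^sup>2 = 1 / (2 * A)" "\<sigma> > 0" using assms by (auto simp: \<sigma>_def)
  have "integrable lborel (\<lambda>x. (sqrt (2 * pi * \<sigma>\<^sup>2) * exp (C + A * \<mu>\<^sup>2)) * normal_density \<mu> \<sigma> x)"
    using s(2) by (intro integrable_mult_right integrable_normal_density)
  also have "(\<lambda>x. (sqrt (2 * pi * \<sigma>\<^sup>2) * exp (C + A * \<mu>\<^sup>2)) * normal_density \<mu> \<sigma> x) =
       (\<lambda>x. exp (- A * x\<^sup>2 + B * x + C))"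
  proof
    fix x
    have "sqrt (2 * pi * \<sigma>\<^sup>2) \<noteq> 0" using s by auto
    then have "(sqrt (2 * pi * \<sigma>\<^sup>2) * exp (C + A * \<mu>\<^sup>2)) * normal_density \<mu> \<sigma> x =
       exp (C + A * \<mu>\<^sup>2 + - (x - \<mu>)\<^sup>2 / (2 * \<sigma>\<^sup>2))"
      unfolding normal_density_def by (simp add: exp_add[symmetric])
    also have "C + A * \<mu>\<^sup>2 + - (x - \<mu>)\<^sup>2 / (2 * \<sigma>\<^sup>2) = - A * x\<^sup>2 + B * x + C"
      unfolding s(1) \<mu>_def using assms by (simp add: field_simps power2_eq_square)
    finally show "(sqrt (2 * pi * \<sigma>\<^sup>2) * exp (C + A * \<mu>\<^sup>2)) * normal_density \<mu> \<sigma> x =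
      exp (- A * x\<^sup>2 + B * x + C)" .
  qed
  finally show ?thesis .
qed

lemma gaussian_integrable:
  fixes a b c :: complex
  assumes "Re a > 0"
  shows "integrable lborel (\<lambda>x::real. exp (- a * (of_real x)\<^sup>2 + b * of_real x + c))"
proof (rule Bochner_Integration.integrable_bound[OF integrable_exp_quadratic_real[OF assms, of "Re b" "Re c"]])
  show "(\<lambda>x::real. exp (- a * (of_real x)\<^sup>2 + b * of_real x + c)) \<in> borel_measurable lborel"
    using borel_measurable_continuous_onI[of "\<lambda>x::real. exp (- a * (of_real x)\<^sup>2 + b * of_real x + c)"]
    by (simp add: continuous_intros)
  show "AE x in lborel. norm (exp (- a * (of_real x)\<^sup>2 + b * of_real x + c))
        \<le> norm (exp (- Re a * x\<^sup>2 + Re b * x + Re c))"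
    by (auto simp: power2_eq_square simp flip: of_real_mult)
qed

text \<open>The minimum over \<open>l\<close> is attained at \<open>l = 1 / (1 + \<rho>)\<close>;
  times \<open>1 + \<rho>\<close>, the difference of the two sides is the square in the
  proof.\<close>

lemma quadratic_form_lower_bound:
  fixes \<rho> l :: real
  assumes "0 \<le> l" "l \<le> 1" "\<rho> > 0"
  shows "(1 - l)\<^sup>2 + l\<^sup>2 * \<rho> \<ge> \<rho> / (1 + \<rho>)"
proof -
  have "0 \<le> ((1 + \<rho>) * l - 1)\<^sup>2" by simp
  then have "\<rho> \<le> ((1 - l)\<^sup>2 + l\<^sup>2 * \<rho>) * (1 + \<rho>)"
    by (simp add: power2_eq_square algebra_simps)
  then show ?thesis using assms by (simp add: divide_le_eq)
qed

text \<open>Closes the contour when a Gaussian is integrated along a tilted line instead of the real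
  axis. On the segment from \<open>n\<close> to \<open>\<kappa> * n + d\<close> the real part of the
  square stays above \<open>\<delta> * n^2 - K * n - L\<close>, so the integral over the segment
  vanishes in the limit.\<close>

lemma gaussian_primitive_limit:
  fixes \<kappa> d :: complex
  assumes P: "\<And>x. (P has_field_derivative P' x) (at x)"
    and P': "\<And>x. norm (P' x) = exp (- pi * Re (x\<^sup>2))"
    and k: "Re (\<kappa>\<^sup>2) > 0" "Re \<kappa> > 0"
  shows "(\<lambda>n. P (\<kappa> * of_nat n + d) - P (of_nat n)) \<longlonglongrightarrow> 0"
proof (rule Lim_null_comparison)
  define \<delta> where "\<delta> = Re (\<kappa>\<^sup>2) / (1 + Re (\<kappa>\<^sup>2))"
  define K where "K = 2 * (1 + norm \<kappa>) * norm d"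
  define L where "L = (norm d)\<^sup>2"
  have d: "\<delta> > 0" using k by (simp add: \<delta>_def)
  let ?g = "\<lambda>n::nat. (norm (\<kappa> - 1) * real n + norm d) * exp (- pi * (\<delta> * (real n)\<^sup>2 - K * real n - L))"
  show "?g \<longlonglongrightarrow> 0" using d by real_asymp
  show "eventually (\<lambda>n. norm (P (\<kappa> * of_nat n + d) - P (of_nat n)) \<le> ?g n) sequentially"
  proof (rule always_eventually, rule allI)
    fix n :: nat
    let ?S = "closed_segment (of_nat n :: complex) (\<kappa> * of_nat n + d)"
    have "norm (P (\<kappa> * of_nat n + d) - P (of_nat n)) \<le>
       exp (- pi * (\<delta> * (real n)\<^sup>2 - K * real n - L)) * norm ((\<kappa> * of_nat n + d) - of_nat n)"
    proof (rule field_differentiable_bound[of ?S P P'])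
      fix x assume "x \<in> ?S"
      then obtain l where l: "0 \<le> l" "l \<le> 1" "x = (1 - of_real l) * of_nat n + of_real l * (\<kappa> * of_nat n + d)"
        by (auto simp: closed_segment_def scaleR_conv_of_real)
      define m where "m = (1 - of_real l) + of_real l * \<kappa>"
      have x: "x = m * of_nat n + of_real l * d" using l(3) by (simp add: m_def algebra_simps)
      have "Re (m\<^sup>2) = (1 - l)\<^sup>2 + 2 * l * (1 - l) * Re \<kappa> + l\<^sup>2 * Re (\<kappa>\<^sup>2)"
        by (simp add: m_def power2_eq_square algebra_simps)
      moreover have "2 * l * (1 - l) * Re \<kappa> \<ge> 0" using l k by auto
      ultimately have mr: "Re (m\<^sup>2) \<ge> \<delta>"
        using quadratic_form_lower_bound[OF l(1,2) k(1)] unfolding \<delta>_def by linarith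
      have "norm m \<le> norm (1 - complex_of_real l) + norm (of_real l * \<kappa>)" unfolding m_def by (rule norm_triangle_ineq)
      also have "norm (1 - complex_of_real l) = 1 - l" using l by (metis abs_of_nonneg diff_ge_0_iff_ge norm_of_real of_real_1 of_real_diff)
      also have "norm (of_real l * \<kappa>) \<le> 1 * norm \<kappa>" using l by (simp add: norm_mult mult_left_le_one_le)
      finally have mn: "norm m \<le> 1 + norm \<kappa>" using l by simp
      have e: "Re (x\<^sup>2) = Re (m\<^sup>2) * (real n)\<^sup>2 + real n * Re (2 * m * of_real l * d) + Re ((of_real l * d)\<^sup>2)"
        unfolding x by (simp add: power2_eq_square algebra_simps)
      have "\<bar>Re (2 * m * of_real l * d)\<bar> \<le> norm (2 * m * of_real l * d)" by (rule abs_Re_le_cmod)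
      also have "\<dots> = 2 * norm m * l * norm d" using l by (simp add: norm_mult)
      also have "\<dots> \<le> 2 * (1 + norm \<kappa>) * 1 * norm d" using l mn by (intro mult_right_mono mult_mono) auto
      finally have a: "Re (2 * m * of_real l * d) \<ge> - K" by (simp add: K_def)
      have "\<bar>Re ((of_real l * d)\<^sup>2)\<bar> \<le> norm ((of_real l * d)\<^sup>2)" by (rule abs_Re_le_cmod)
      also have "\<dots> = l\<^sup>2 * L" by (simp add: norm_mult norm_power L_def power_mult_distrib)
      also have "\<dots> \<le> 1 * L" using l by (intro mult_right_mono) (auto simp: L_def power_le_one)
      finally have b: "Re ((of_real l * d)\<^sup>2) \<ge> - L" by simp
      have "real n * Re (2 * m * of_real l * d) \<ge> real n * (- K)" using a by (intro mult_left_mono) auto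
      moreover have "Re (m\<^sup>2) * (real n)\<^sup>2 \<ge> \<delta> * (real n)\<^sup>2" using mr by (intro mult_right_mono) auto
      ultimately have "Re (x\<^sup>2) \<ge> \<delta> * (real n)\<^sup>2 - K * real n - L" using e b by (simp add: algebra_simps)
      then show "norm (P' x) \<le> exp (- pi * (\<delta> * (real n)\<^sup>2 - K * real n - L))"
        unfolding P' by simp
    next
      fix x show "(P has_field_derivative P' x) (at x within ?S)" using P has_field_derivative_at_within by blast
    qed auto
    also have "norm ((\<kappa> * of_nat n + d) - of_nat n) \<le> norm (\<kappa> - 1) * real n + norm d"
    proof -
      have "(\<kappa> * of_nat n + d) - of_nat n = (\<kappa> - 1) * of_nat n + d" by (simp add: algebra_simps)
      then show ?thesis using norm_triangle_ineq[of "(\<kappa> - 1) * of_nat n" d] by (simp only:) (simp add: norm_mult)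
    qed
    finally show "norm (P (\<kappa> * of_nat n + d) - P (of_nat n)) \<le> ?g n" by (simp add: mult.commute)
  qed
qed

lemma gaussian_integral_real_pi: "has_bochner_integral lborel (\<lambda>x::real. exp (- pi * x\<^sup>2)) 1"
proof -
  have s: "sqrt (1 / (2 * pi)) > 0" by simp
  have "has_bochner_integral lborel (normal_density 0 (sqrt (1 / (2 * pi)))) 1"
    using integrable_normal_density[OF s, of 0] integral_normal_density[OF s, of 0]
    by (simp add: has_bochner_integral_iff)
  also have "normal_density 0 (sqrt (1 / (2 * pi))) = (\<lambda>x::real. exp (- pi * x\<^sup>2))"
    by (auto simp: fun_eq_iff normal_density_def power_divide real_sqrt_divide mult.commute)
  finally show ?thesis .
qed

lemma Re_one_divide_pos: "Re x > 0 \<Longrightarrow> Re (1 / x) > 0" for x :: complex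
  by (cases "x = 0") (auto simp: Re_divide')

text \<open>Substituting \<open>\<kappa> * (x + c)\<close> with
  \<open>\<kappa> = 1 / csqrt \<eta>\<close> leaves \<open>exp (- pi * x^2)\<close> on a tilted
  line. The principal root has positive real part, so the line can be rotated to the real axis
  without leaving the region where the Gaussian decays.\<close>

lemma gaussian_integral_complex:
  fixes \<eta> c :: complex
  assumes "Re \<eta> > 0"
  shows "has_bochner_integral lborel (\<lambda>x::real. exp (- (of_real pi * (of_real x + c)\<^sup>2 / \<eta>))) (csqrt \<eta>)"
proof -
  define \<kappa> where "\<kappa> = 1 / csqrt \<eta>"
  have eta0: "\<eta> \<noteq> 0" using assms by auto
  have k2: "\<kappa>\<^sup>2 = 1 / \<eta>" by (simp add: \<kappa>_def power_divide)
  have k: "Re (\<kappa>\<^sup>2) > 0" unfolding k2 using assms by (simp add: Re_divide' eta0)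
  have "Re (csqrt \<eta>) > 0" using assms csqrt_principal[of \<eta>] eta0
    by (metis assms csqrt_of_real_nonneg less_eq_real_def power2_csqrt zero_less_norm_iff complex.sel Re_csqrt
        complex_eqI less_irrefl mult_zero_left Re_power2 not_less power2_eq_square zero_complex.sel(1) diff_0 neg_less_0_iff_less zero_le_power2 not_le) 
  then have kr: "Re \<kappa> > 0" unfolding \<kappa>_def by (rule Re_one_divide_pos)
  have k0: "\<kappa> \<noteq> 0" using kr by auto
  let ?E = "\<lambda>\<zeta>::complex. exp (- (of_real pi * \<zeta>\<^sup>2))"
  have "?E holomorphic_on UNIV" by (intro holomorphic_intros)
  then obtain P where P: "\<And>x. (P has_field_derivative ?E x) (at x)"
    using holomorphic_convex_primitive'[of UNIV ?E] by auto
  let ?f = "\<lambda>x::real. exp (- (of_real pi * (of_real x + c)\<^sup>2 / \<eta>)) :: complex"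
  have fE: "?f x = ?E (\<kappa> * (of_real x + c))" for x by (simp add: power_mult_distrib k2)
  have int: "integrable lborel ?f"
  proof -
    have "?f = (\<lambda>x. exp (- (of_real pi / \<eta>) * (of_real x)\<^sup>2 + (- 2 * of_real pi * c / \<eta>) * of_real x + (- of_real pi * c\<^sup>2 / \<eta>)))"
      by (auto simp: fun_eq_iff power2_eq_square algebra_simps diff_divide_distrib add_divide_distrib)
    moreover have "Re (of_real pi / \<eta>) > 0" using k unfolding k2 by (simp add: Re_divide' assms eta0)
    ultimately show ?thesis
      using gaussian_integrable[of "of_real pi / \<eta>" "- 2 * of_real pi * c / \<eta>" "- of_real pi * c\<^sup>2 / \<eta>"] by (simp only:)
  qed
  have I1: "(LBINT x:{- real n..real n}. ?f x) = (P (\<kappa> * (of_nat n + c)) - P (\<kappa> * (- of_nat n + c))) / \<kappa>" for n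
  proof -
    have "(LBINT x. indicator {- real n..real n} x *\<^sub>R ?f x) =
      P (\<kappa> * (of_real (real n) + c)) / \<kappa> - P (\<kappa> * (of_real (- real n) + c)) / \<kappa>"
    proof (rule integral_FTC_Icc)
      fix x assume "- real n \<le> x" "x \<le> real n"
      have "((\<lambda>\<zeta>. P (\<kappa> * (\<zeta> + c)) / \<kappa>) has_field_derivative (?E (\<kappa> * (of_real x + c)) * \<kappa>) / \<kappa>) (at (of_real x))"
        by (auto intro!: derivative_eq_intros DERIV_chain2[OF P])
      then have "((\<lambda>\<zeta>. P (\<kappa> * (\<zeta> + c)) / \<kappa>) has_field_derivative ?f x) (at (of_real x))"
        unfolding fE using k0 by simp
      then show "((\<lambda>x. P (\<kappa> * (of_real x + c)) / \<kappa>) has_vector_derivative ?f x) (at x within {- real n..real n})"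
        by (rule has_vector_derivative_real_field[THEN has_vector_derivative_at_within])
    qed (auto intro!: continuous_intros eta0)
    then show ?thesis by (simp add: set_lebesgue_integral_def diff_divide_distrib)
  qed
  have I0: "(LBINT x:{- real n..real n}. exp (- (of_real pi * (of_real x)\<^sup>2))) = P (of_nat n) - P (- of_nat n)" for n
  proof -
    have "(LBINT x. indicator {- real n..real n} x *\<^sub>R ?E (of_real x)) =
      P (of_real (real n)) - P (of_real (- real n))"
    proof (rule integral_FTC_Icc)
      fix x assume "- real n \<le> x" "x \<le> real n"
      show "((\<lambda>x. P (of_real x)) has_vector_derivative ?E (of_real x)) (at x within {- real n..real n})"
        by (rule has_vector_derivative_real_field[THEN has_vector_derivative_at_within, OF P])
    qed (auto intro!: continuous_intros)
    then show ?thesis by (simp add: set_lebesgue_integral_def)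
  qed
  have E0: "has_bochner_integral lborel (\<lambda>x. ?E (of_real x)) 1"
  proof -
    have "has_bochner_integral lborel (\<lambda>x::real. of_real (exp (- pi * x\<^sup>2)) :: complex) (of_real 1)"
      by (rule has_bochner_integral_of_real[OF gaussian_integral_real_pi])
    moreover have "(\<lambda>x::real. of_real (exp (- pi * x\<^sup>2)) :: complex) = (\<lambda>x. ?E (of_real x))"
      by (auto simp: fun_eq_iff exp_of_real[symmetric])
    ultimately show ?thesis by simp
  qed
  have L0: "(\<lambda>n. P (of_nat n) - P (- of_nat n)) \<longlonglongrightarrow> 1"
    using integral_symmetric_limit[of "\<lambda>x. ?E (of_real x)"] E0
    unfolding I0 has_bochner_integral_iff by simp
  have nE: "norm (?E x) = exp (- pi * Re (x\<^sup>2))" for x by simp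
  have L1: "(\<lambda>n. P (\<kappa> * of_nat n + \<kappa> * c) - P (of_nat n)) \<longlonglongrightarrow> 0"
    by (rule gaussian_primitive_limit[OF P nE k kr])
  \<comment> \<open>The left end of the line is the right end for the reflected primitive
    \<open>P (- x)\<close>.\<close>
  have L2: "(\<lambda>n. P (- (\<kappa> * of_nat n + - \<kappa> * c)) - P (- of_nat n)) \<longlonglongrightarrow> 0"
  proof (rule gaussian_primitive_limit[of "\<lambda>x. P (- x)" "\<lambda>x. - ?E x"])
    fix x :: complex
    have "((\<lambda>x. - x) has_field_derivative - 1) (at x)" by (auto intro!: derivative_eq_intros)
    from DERIV_chain2[OF P this] show "((\<lambda>x. P (- x)) has_field_derivative - ?E x) (at x)" by simp
    show "norm (- ?E x) = exp (- pi * Re (x\<^sup>2))" by simp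
  qed (use k kr in auto)
  have "(\<lambda>n. ((P (\<kappa> * of_nat n + \<kappa> * c) - P (of_nat n)) - (P (- (\<kappa> * of_nat n + - \<kappa> * c)) - P (- of_nat n))
      + (P (of_nat n) - P (- of_nat n))) / \<kappa>) \<longlonglongrightarrow> (0 - 0 + 1) / \<kappa>"
    by (intro tendsto_intros L0 L1 L2 k0)
  also have "(\<lambda>n. ((P (\<kappa> * of_nat n + \<kappa> * c) - P (of_nat n)) - (P (- (\<kappa> * of_nat n + - \<kappa> * c)) - P (- of_nat n))
      + (P (of_nat n) - P (- of_nat n))) / \<kappa>) = (\<lambda>n. (LBINT x:{- real n..real n}. ?f x))"
    unfolding I1 by (simp add: algebra_simps)
  finally have "(LBINT x. ?f x) = 1 / \<kappa>"
    using integral_symmetric_limit[OF int] LIMSEQ_unique by fastforce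
  then show ?thesis using int by (simp add: has_bochner_integral_iff \<kappa>_def)
qed

section \<open>Holomorphy of infinite sums and exchange of sum and integral\<close>

lemma holomorphic_infsum:
  fixes f :: "'i \<Rightarrow> complex \<Rightarrow> complex"
  assumes S: "open S" and hol: "\<And>i. i \<in> I \<Longrightarrow> f i holomorphic_on S"
    and bnd: "\<And>x. x \<in> S \<Longrightarrow> \<exists>d>0. \<exists>M. M summable_on I \<and> cball x d \<subseteq> S \<and> (\<forall>i\<in>I. \<forall>y\<in>cball x d. norm (f i y) \<le> M i)"
  shows "(\<lambda>x. \<Sum>\<^sub>\<infinity>i\<in>I. f i x) holomorphic_on S"
proof -
  have "\<exists>g'. ((\<lambda>x. \<Sum>\<^sub>\<infinity>i\<in>I. f i x) has_field_derivative g') (at x)" if xS: "x \<in> S" for x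
  proof -
    obtain d M where d: "d > 0" "M summable_on I" "cball x d \<subseteq> S" "\<And>i y. i \<in> I \<Longrightarrow> y \<in> cball x d \<Longrightarrow> norm (f i y) \<le> M i"
      using bnd[OF xS] by blast
    have ul: "uniform_limit (cball x d) (\<lambda>X y. \<Sum>i\<in>X. f i y) (\<lambda>y. \<Sum>\<^sub>\<infinity>i\<in>I. f i y) (finite_subsets_at_top I)"
      using d by (intro Weierstrass_m_test_general) auto
    have "eventually (\<lambda>X. X \<subseteq> I) (finite_subsets_at_top I)"
      by (simp add: eventually_finite_subsets_at_top_weakI)
    then have ev: "eventually (\<lambda>X. continuous_on (cball x d) (\<lambda>y. \<Sum>i\<in>X. f i y) \<and> (\<lambda>y. \<Sum>i\<in>X. f i y) holomorphic_on ball x d) (finite_subsets_at_top I)"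
    proof eventually_elim
      case (elim X)
      have "(\<lambda>y. \<Sum>i\<in>X. f i y) holomorphic_on S" using elim hol by (intro holomorphic_intros) auto
      then have "(\<lambda>y. \<Sum>i\<in>X. f i y) holomorphic_on cball x d" using d(3) by (rule holomorphic_on_subset)
      then show ?case by (meson holomorphic_on_imp_continuous_on holomorphic_on_subset ball_subset_cball)
    qed
    obtain "(\<lambda>y. \<Sum>\<^sub>\<infinity>i\<in>I. f i y) holomorphic_on ball x d"
      using holomorphic_uniform_limit[OF ev ul] by auto
    then show ?thesis using d(1) by (meson centre_in_ball holomorphic_on_open open_ball)
  qed
  then show ?thesis using S by (auto simp: holomorphic_on_open)
qed

text \<open>Enumerating the index type reduces this to the theorems on series, so that families on
  \<open>int\<close> need no chosen order later.\<close>

lemma integral_infsum: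
  fixes f :: "'i::countable \<Rightarrow> 'a \<Rightarrow> complex"
  assumes inf: "infinite (UNIV :: 'i set)"
    and int: "\<And>i. integrable M (f i)"
    and ae: "\<And>x. (\<lambda>i. norm (f i x)) summable_on UNIV"
    and sm: "(\<lambda>i. LINT x|M. norm (f i x)) summable_on UNIV"
  shows "integrable M (\<lambda>x. \<Sum>\<^sub>\<infinity>i. f i x)"
    and "((\<lambda>i. LINT x|M. f i x) has_sum (LINT x|M. (\<Sum>\<^sub>\<infinity>i. f i x))) UNIV"
proof -
  define h where "h = from_nat_into (UNIV :: 'i set)"
  have h: "bij_betw h UNIV UNIV" unfolding h_def using inf by (intro bij_betw_from_nat_into) auto
  have s: "summable (\<lambda>n. norm (f (h n) x))" for x
  proof -
    have "(\<lambda>n. norm (f (h n) x)) summable_on UNIV"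
      using ae[of x] summable_on_reindex_bij_betw[OF h, of "\<lambda>i. norm (f i x)"] by simp
    then show ?thesis by (rule summable_on_imp_summable)
  qed
  have ae': "AE x in M. summable (\<lambda>n. norm (f (h n) x))" using s by simp
  have sm': "summable (\<lambda>n. LINT x|M. norm (f (h n) x))"
  proof -
    have "(\<lambda>n. LINT x|M. norm (f (h n) x)) summable_on UNIV"
      using sm summable_on_reindex_bij_betw[OF h, of "\<lambda>i. LINT x|M. norm (f i x)"] by simp
    then show ?thesis by (rule summable_on_imp_summable)
  qed
  have eq: "(\<Sum>\<^sub>\<infinity>i. f i x) = (\<Sum>n. f (h n) x)" for x
  proof -
    have "((\<lambda>n. f (h n) x) has_sum (\<Sum>n. f (h n) x)) UNIV"
      using s[of x] by (intro norm_summable_imp_has_sum) (auto dest: summable_norm_cancel simp: summable_sums)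
    then have "((\<lambda>i. f i x) has_sum (\<Sum>n. f (h n) x)) UNIV"
      using has_sum_reindex_bij_betw[OF h, of "\<lambda>i. f i x"] by simp
    then show ?thesis by (simp add: infsumI)
  qed
  note ii = integrable_suminf[OF int ae' sm'] sums_integral[OF int ae' sm']
  show "integrable M (\<lambda>x. \<Sum>\<^sub>\<infinity>i. f i x)" unfolding eq by (rule ii)
  have "summable (\<lambda>n. norm (LINT x|M. f (h n) x))"
    by (rule summable_comparison_test[OF _ sm']) (auto intro!: exI[of _ 0] integral_norm_bound)
  then have "((\<lambda>n. LINT x|M. f (h n) x) has_sum (LINT x|M. (\<Sum>n. f (h n) x))) UNIV"
    using ii(2) by (intro norm_summable_imp_has_sum)
  then show "((\<lambda>i. LINT x|M. f i x) has_sum (LINT x|M. (\<Sum>\<^sub>\<infinity>i. f i x))) UNIV"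
    unfolding eq using has_sum_reindex_bij_betw[OF h, of "\<lambda>i. LINT x|M. f i x"] by simp
qed

section \<open>Poisson summation for Gaussians\<close>

lemma integral_Icc_exp_int:
  fixes k :: int
  shows "(LBINT x:{-1/2..1/2}. exp (- (2 * of_real pi * \<i> * of_int k * of_real x))) = (if k = 0 then 1 else 0)"
proof (cases "k = 0")
  case True
  then show ?thesis by (simp add: set_lebesgue_integral_def)
next
  case False
  let ?c = "- (2 * of_real pi * \<i> * of_int k) :: complex"
  have c: "?c \<noteq> 0" using False by simp
  have "(LBINT x. indicator {-1/2..1/2} x *\<^sub>R exp (- (2 * of_real pi * \<i> * of_int k * of_real x))) =
     exp (?c * of_real (1/2)) / ?c - exp (?c * of_real (-1/2)) / ?c"
  proof (rule integral_FTC_Icc)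
    fix x :: real
    have "((\<lambda>z. exp (?c * z) / ?c) has_field_derivative exp (?c * of_real x)) (at (of_real x))"
      using False by (auto intro!: derivative_eq_intros)
    then show "((\<lambda>x. exp (?c * of_real x) / ?c) has_vector_derivative exp (- (2 * of_real pi * \<i> * of_int k * of_real x))) (at x within {-1/2..1/2})"
      using has_vector_derivative_real_field has_vector_derivative_at_within by fastforce
  qed (auto intro!: continuous_intros)
  also have "exp (?c * of_real (1/2)) = exp (?c * of_real (-1/2))"
  proof -
    have "exp (?c * of_real (1/2)) = exp (?c * of_real (-1/2) + \<i> * (of_int (- k) * (of_real pi * 2)))"
      by (rule arg_cong[of _ _ exp]) (simp add: field_simps)
    then show ?thesis by (simp only: exp_plus_2pin)
  qed
  finally show ?thesis using False by (simp add: set_lebesgue_integral_def)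
qed

text \<open>Pointwise convergence without a Dirichlet kernel: in
  \<open>g = g 0 + q * (E - 1)\<close> with \<open>E x = exp (2 * pi * i * x)\<close>,
  multiplication by \<open>E\<close> shifts Fourier coefficients by one. Those of
  \<open>g - g 0\<close> are therefore differences \<open>d (k - 1) - d k\<close>, and the partial
  sums telescope.\<close>

lemma fourier_partial_sums_at_0:
  fixes g :: "complex \<Rightarrow> complex"
  assumes hol: "g holomorphic_on UNIV" and per: "\<And>x. g (x + 1) = g x"
  shows "(\<lambda>N. \<Sum>k\<in>{- int N..int N}. LBINT x:{-1/2..1/2}. g (of_real x) * exp (- (2 * of_real pi * \<i> * of_int k * of_real x)))
    \<longlonglongrightarrow> g 0"
proof -
  define e :: "int \<Rightarrow> complex \<Rightarrow> complex" where "e = (\<lambda>k x. exp (- (2 * of_real pi * \<i> * of_int k * x)))"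
  define E :: "complex \<Rightarrow> complex" where "E = (\<lambda>x. exp (2 * of_real pi * \<i> * x))"
  define G1 where "G1 = (\<lambda>z. if z = 0 then deriv g 0 else (g z - g 0) / (z - 0))"
  define G2 where "G2 = (\<lambda>z. if z = 0 then deriv E 0 else (E z - E 0) / (z - 0))"
  define q where "q = (\<lambda>z. G1 z / G2 z)"
  \<comment> \<open>Wide enough to contain the closed period interval, narrow enough that
    \<open>E\<close> equals 1 only at 0; hence the quotient \<open>q\<close> is holomorphic on
    it.\<close>
  define S where "S = {z::complex. -1 < Re z} \<inter> {z. Re z < 1}"
  define d where "d = (\<lambda>k. LBINT x:{-1/2..1/2}. q (of_real x) * e k (of_real x))"
  have oS: "open S" unfolding S_def by (intro open_Int open_halfspace_Re_gt open_halfspace_Re_lt)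
  have E1: "E z \<noteq> 1" if "z \<in> S" "z \<noteq> 0" for z
  proof
    assume "E z = 1"
    then obtain n :: int where n: "Im (2 * of_real pi * \<i> * z) = of_int (2 * n) * pi" "Re (2 * of_real pi * \<i> * z) = 0"
      unfolding E_def exp_eq_1 by auto
    then have "Im z = 0" "Re z = of_int n" by auto
    moreover from this that have "n = 0" by (auto simp: S_def)
    ultimately show False using that by (simp add: complex_eq_iff)
  qed
  have E0: "E 0 = 1" by (simp add: E_def)
  have dE: "(E has_field_derivative 2 * of_real pi * \<i>) (at 0)"
    unfolding E_def by (auto intro!: derivative_eq_intros)
  have G20: "G2 z \<noteq> 0" if "z \<in> S" for z
    using E1[OF that] E0 DERIV_imp_deriv[OF dE] by (auto simp: G2_def)
  have E_hol: "E holomorphic_on UNIV" unfolding E_def by (intro holomorphic_intros)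
  have "G1 holomorphic_on UNIV" unfolding G1_def by (rule pole_lemma[OF hol]) simp
  moreover have "G2 holomorphic_on UNIV" unfolding G2_def by (rule pole_lemma[OF E_hol]) simp
  ultimately have "G1 holomorphic_on S" "G2 holomorphic_on S" using holomorphic_on_subset by blast+
  then have q_hol: "q holomorphic_on S"
    unfolding q_def using G20 by (intro holomorphic_on_divide) auto
  have inS: "of_real x \<in> S" if "x \<in> {-1/2..1/2}" for x using that by (auto simp: S_def)
  have gq: "g x = g 0 + q x * (E x - 1)" if "x \<in> S" for x
    using G20[OF that] E1[OF that] by (cases "x = 0") (auto simp: q_def G1_def G2_def E0)
  have Ee: "E x * e k x = e (k - 1) x" for k x
    by (simp add: E_def e_def exp_add[symmetric] algebra_simps)
  have [continuous_intros]: "continuous_on {-1/2..1/2} (\<lambda>x. e k (of_real x))" for k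
    unfolding e_def by (intro continuous_intros)
  have q_cont[continuous_intros]: "continuous_on {-1/2..1/2} (\<lambda>x. q (of_real x))"
    by (rule continuous_on_compose2[OF holomorphic_on_imp_continuous_on[OF q_hol]]) (auto intro!: continuous_intros inS)
  have dq_cont[continuous_intros]: "continuous_on {-1/2..1/2} (\<lambda>x. deriv q (of_real x))"
    by (rule continuous_on_compose2[OF holomorphic_on_imp_continuous_on[OF holomorphic_deriv[OF q_hol oS]]]) (auto intro!: continuous_intros inS)
  have intq: "set_integrable lborel {-1/2..1/2} (\<lambda>x. q (of_real x) * e k (of_real x))" for k
    by (rule borel_integrable_atLeastAtMost') (intro continuous_intros)
  have inte: "set_integrable lborel {-1/2..1/2} (\<lambda>x. g 0 * e k (of_real x))" for k
    by (rule borel_integrable_atLeastAtMost') (intro continuous_intros)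
  define c where "c = (\<lambda>k. LBINT x:{-1/2..1/2}. g (of_real x) * e k (of_real x))"
  have ck: "c k = (if k = 0 then g 0 else 0) + (d (k - 1) - d k)" for k
  proof -
    have "(LBINT x:{-1/2..1/2}. g (of_real x) * e k (of_real x)) =
       (LBINT x:{-1/2..1/2}. g 0 * e k (of_real x) + (q (of_real x) * e (k - 1) (of_real x) - q (of_real x) * e k (of_real x)))"
    proof (rule set_lebesgue_integral_cong)
      show "\<forall>x. x \<in> {- 1 / 2..1 / 2} \<longrightarrow> g (complex_of_real x) * e k (complex_of_real x) =
           g 0 * e k (complex_of_real x) + (q (complex_of_real x) * e (k - 1) (complex_of_real x) - q (complex_of_real x) * e k (complex_of_real x))"
      proof (intro allI impI)
        fix x :: real assume x: "x \<in> {- 1 / 2..1 / 2}"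
        show "g (complex_of_real x) * e k (complex_of_real x) =
           g 0 * e k (complex_of_real x) + (q (complex_of_real x) * e (k - 1) (complex_of_real x) - q (complex_of_real x) * e k (complex_of_real x))"
          unfolding gq[OF inS[OF x]] Ee[symmetric] by (simp add: algebra_simps)
      qed
    qed auto
    also have "\<dots> = (LBINT x:{-1/2..1/2}. g 0 * e k (of_real x)) + (d (k - 1) - d k)"
      using set_integral_add(2)[OF inte set_integral_diff(1)[OF intq intq], of k "k - 1" k] set_integral_diff(2)[OF intq intq, of "k - 1" k]
      by (simp only: d_def)
    also have "(LBINT x:{-1/2..1/2}. g 0 * e k (of_real x)) = (if k = 0 then g 0 else 0)"
      using integral_Icc_exp_int[of k] by (simp add: e_def)
    finally show ?thesis unfolding c_def .
  qed
  have sum: "(\<Sum>k\<in>{- int N..int N}. c k) = g 0 + (d (- int N - 1) - d (int N))" for N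
  proof (induction N)
    case 0 then show ?case by (simp add: ck)
  next
    case (Suc N)
    have "{- int (Suc N)..int (Suc N)} = insert (- int N - 1) (insert (int N + 1) {- int N..int N})" by auto
    then have "(\<Sum>k\<in>{- int (Suc N)..int (Suc N)}. c k) =
      c (- int N - 1) + (c (int N + 1) + (\<Sum>k\<in>{- int N..int N}. c k))"
      by simp
    also have "\<dots> = g 0 + (d (- int (Suc N) - 1) - d (int (Suc N)))"
      unfolding Suc using ck[of "- int N - 1"] ck[of "int N + 1"] by (simp add: algebra_simps)
    finally show ?case .
  qed
  define K where "K = (LBINT x:{-1/2..1/2}. norm (deriv q (of_real x)))"
  \<comment> \<open>One integration by parts. Periodicity of \<open>g\<close> and \<open>E\<close>
    makes \<open>q\<close> agree at both endpoints, so no boundary term remains and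
    \<open>d k\<close> is of order \<open>1 / \<bar>k\<bar>\<close>.\<close>
  have dbound: "norm (d k) \<le> K / (2 * pi * \<bar>of_int k\<bar>)" if "k \<noteq> 0" for k
  proof -
    let ?c = "- (2 * of_real pi * \<i> * of_int k) :: complex"
    have c: "?c \<noteq> 0" using that by simp
    have ends: "q (of_real (1/2)) = q (of_real (-1/2))"
    proof -
      have a: "g (of_real (1/2)) = g (of_real (-1/2))" using per[of "of_real (-1/2)"] by simp
      have h: "of_real (1/2) \<in> S" "of_real (-1/2) \<in> S" by (auto simp: S_def)
      have b: "E (of_real (1/2)) = E (of_real (-1/2))"
      proof -
        have "E (of_real (1/2)) = exp (2 * of_real pi * \<i> * of_real (-1/2) + \<i> * (of_int 1 * (of_real pi * 2)))"
          unfolding E_def by (rule arg_cong[of _ _ exp]) (simp add: field_simps)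
        then show ?thesis unfolding E_def by (simp only: exp_plus_2pin)
      qed
      have "E (of_real (-1/2)) \<noteq> 1" by (rule E1) (use h in auto)
      with gq[OF h(1)] gq[OF h(2)] a b show ?thesis by simp
    qed
    have eends: "e k (of_real (1/2)) = e k (of_real (-1/2))"
    proof -
      have "e k (of_real (1/2)) = exp (- (2 * of_real pi * \<i> * of_int k * of_real (-1/2)) + \<i> * (of_int (- k) * (of_real pi * 2)))"
        unfolding e_def by (rule arg_cong[of _ _ exp]) (simp add: field_simps)
      then show ?thesis unfolding e_def by (simp only: exp_plus_2pin)
    qed
    have "(LBINT x. indicator {-1/2..1/2} x *\<^sub>R (q (of_real x) * e k (of_real x) + deriv q (of_real x) * e k (of_real x) / ?c)) =
      q (of_real (1/2)) * e k (of_real (1/2)) / ?c - q (of_real (-1/2)) * e k (of_real (-1/2)) / ?c"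
    proof (rule integral_FTC_Icc)
      fix x :: real assume x: "-1/2 \<le> x" "x \<le> 1/2"
      have xs: "of_real x \<in> S" using x by (intro inS) auto
      have dq: "(q has_field_derivative deriv q (of_real x)) (at (of_real x))"
        by (rule holomorphic_derivI[OF q_hol oS xs])
      have de: "(e k has_field_derivative e k (of_real x) * ?c) (at (of_real x))"
        unfolding e_def by (auto intro!: derivative_eq_intros)
      note DERIV_cdivide[OF DERIV_mult[OF dq de], of ?c]
      also have "(deriv q (of_real x) * e k (of_real x) + e k (of_real x) * ?c * q (of_real x)) / ?c =
         q (of_real x) * e k (of_real x) + deriv q (of_real x) * e k (of_real x) / ?c"
      proof -
        have "(D * f + f * C * Q) / C = Q * f + D * f / C" if "C \<noteq> 0" for C D f Q :: complex
          using that by (simp add: field_simps)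
        then show ?thesis using c by blast
      qed
      finally show "((\<lambda>x. q (of_real x) * e k (of_real x) / ?c) has_vector_derivative
        q (of_real x) * e k (of_real x) + deriv q (of_real x) * e k (of_real x) / ?c) (at x within {-1/2..1/2})"
        by (rule has_vector_derivative_real_field[THEN has_vector_derivative_at_within])
    qed (simp, (intro continuous_intros; use c in simp))
    also have "\<dots> = 0" unfolding ends eends by simp
    finally have z: "(LBINT x:{-1/2..1/2}. q (of_real x) * e k (of_real x) + deriv q (of_real x) * e k (of_real x) / ?c) = 0"
      by (simp add: set_lebesgue_integral_def)
    have i1: "set_integrable lborel {-1/2..1/2} (\<lambda>x. deriv q (of_real x) * e k (of_real x) / ?c)"
      using c by (intro borel_integrable_atLeastAtMost' continuous_intros) auto
    have "d k = - (LBINT x:{-1/2..1/2}. deriv q (of_real x) * e k (of_real x) / ?c)"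
      using z unfolding d_def set_integral_add(2)[OF intq i1] by (simp only: eq_neg_iff_add_eq_0)
    then have "norm (d k) \<le> (LBINT x:{-1/2..1/2}. norm (deriv q (of_real x) * e k (of_real x) / ?c))"
      using set_integral_norm_bound[OF i1] by simp
    also have "\<dots> = (LBINT x:{-1/2..1/2}. norm (deriv q (of_real x)) / (2 * pi * \<bar>of_int k\<bar>))"
      by (rule set_lebesgue_integral_cong) (auto simp: norm_divide norm_mult e_def)
    also have "\<dots> = K / (2 * pi * \<bar>of_int k\<bar>)" unfolding K_def by (simp add: set_lebesgue_integral_def)
    finally show ?thesis .
  qed
  have l1: "(\<lambda>N. d (- int N - 1)) \<longlonglongrightarrow> 0"
  proof (rule Lim_null_comparison)
    show "eventually (\<lambda>N. norm (d (- int N - 1)) \<le> K / (2 * pi * (real N + 1))) sequentially"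
    proof (intro always_eventually allI)
      fix N
      have "\<bar>real_of_int (- int N - 1)\<bar> = real N + 1" by simp
      then show "norm (d (- int N - 1)) \<le> K / (2 * pi * (real N + 1))" using dbound[of "- int N - 1"] by (simp add: add.commute)
    qed
  qed real_asymp
  have l2: "(\<lambda>N. d (int N)) \<longlonglongrightarrow> 0"
  proof (rule Lim_null_comparison)
    show "eventually (\<lambda>N. norm (d (int N)) \<le> K / (2 * pi * real N)) sequentially"
      using eventually_gt_at_top[of 0]
    proof eventually_elim
      case (elim N)
      then show ?case using dbound[of "int N"] by simp
    qed
  qed real_asymp
  have "(\<lambda>N. g 0 + (d (- int N - 1) - d (int N))) \<longlonglongrightarrow> g 0 + (0 - 0)"
    by (intro tendsto_intros l1 l2)
  then show ?thesis unfolding sum[symmetric] c_def e_def by simp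
qed

section \<open>Exponential integrals and shifts of the line of integration\<close>

lemma integral_exp_atLeast_0:
  fixes s :: complex
  assumes s: "Re s > 0"
  shows "has_bochner_integral lborel (\<lambda>y::real. indicator {0..} y *\<^sub>R exp (- s * of_real y)) (1 / s)"
proof -
  let ?f = "\<lambda>y::real. indicator {0..} y *\<^sub>R exp (- s * of_real y)"
  have s0: "s \<noteq> 0" using s by auto
  have meas: "?f \<in> borel_measurable lborel"
  proof -
    have [measurable]: "(\<lambda>y::real. exp (- s * of_real y)) \<in> borel_measurable borel"
      by (intro borel_measurable_continuous_onI continuous_intros)
    show ?thesis by measurable
  qed
  have nn: "(\<integral>\<^sup>+y. ennreal (exp (- Re s * y)) * indicator {0..} y \<partial>lborel) = 0 - (- exp (- Re s * 0) / Re s)"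
  proof (rule nn_integral_FTC_atLeast)
    show "((\<lambda>y. - exp (- Re s * y) / Re s) \<longlongrightarrow> 0) at_top" using s by real_asymp
  qed (use s in \<open>auto intro!: derivative_eq_intros\<close>)
  have int: "integrable lborel ?f"
  proof (rule integrableI_bounded[OF meas])
    have "(\<integral>\<^sup>+y. ennreal (norm (?f y)) \<partial>lborel) = (\<integral>\<^sup>+y. ennreal (exp (- Re s * y)) * indicator {0..} y \<partial>lborel)"
      by (intro nn_integral_cong) (auto simp: indicator_def)
    then show "(\<integral>\<^sup>+y. ennreal (norm (?f y)) \<partial>lborel) < \<infinity>" unfolding nn by simp
  qed
  have I: "(LBINT y:{- real n..real n}. ?f y) = (1 - exp (- s * of_nat n)) / s" for n
  proof -
    have "(LBINT y:{- real n..real n}. ?f y) = (LBINT y. indicator {0..real n} y *\<^sub>R exp (- s * of_real y))"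
      unfolding set_lebesgue_integral_def by (rule Bochner_Integration.integral_cong) (auto simp: indicator_def)
    also have "\<dots> = - exp (- s * of_real (real n)) / s - (- exp (- s * of_real 0) / s)"
    proof (rule integral_FTC_Icc)
      fix x :: real
      have "((\<lambda>z. - exp (- s * z) / s) has_field_derivative exp (- s * of_real x)) (at (of_real x))"
        using s0 by (auto intro!: derivative_eq_intros)
      then show "((\<lambda>x. - exp (- s * of_real x) / s) has_vector_derivative exp (- s * of_real x)) (at x within {0..real n})"
        by (rule has_vector_derivative_real_field[THEN has_vector_derivative_at_within])
    qed (auto intro!: continuous_intros)
    finally show ?thesis by (simp add: diff_divide_distrib)
  qed
  have "(\<lambda>n. (1 - exp (- s * of_nat n)) / s) \<longlonglongrightarrow> (1 - 0) / s"
  proof (intro tendsto_intros s0)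
    show "(\<lambda>n. exp (- s * of_nat n)) \<longlonglongrightarrow> 0"
    proof (rule Lim_null_comparison)
      show "eventually (\<lambda>n. norm (exp (- s * of_nat n)) \<le> exp (- Re s * real n)) sequentially" by simp
      show "(\<lambda>n. exp (- Re s * real n)) \<longlonglongrightarrow> 0" using s by real_asymp
    qed
  qed
  then have "(LBINT y. ?f y) = 1 / s"
    using integral_symmetric_limit[OF int] LIMSEQ_unique unfolding I by force
  with int show ?thesis by (simp add: has_bochner_integral_iff)
qed

lemma integrable_exp_neg_abs:
  assumes "a > 0"
  shows "integrable lborel (\<lambda>y::real. exp (- a * \<bar>y\<bar>))"
proof -
  have 1: "integrable lborel (\<lambda>y::real. indicator {0..} y * exp (- a * y))"
  proof -
    have "integrable lborel (\<lambda>y::real. norm (indicator {0..} y *\<^sub>R exp (- complex_of_real a * of_real y)))"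
      using integral_exp_atLeast_0[of "of_real a"] assms by (intro integrable_norm) (auto simp: has_bochner_integral_iff)
    then show ?thesis by simp
  qed
  have 2: "integrable lborel (\<lambda>y::real. indicator {0..} (- y) * exp (- a * (- y)))"
    using lborel_integrable_real_affine[OF 1, of "-1" 0] by simp
  show ?thesis
    by (rule Bochner_Integration.integrable_bound[OF Bochner_Integration.integrable_add[OF 1 2]])
       (auto simp: indicator_def)
qed

text \<open>The strip is convex, so \<open>g\<close> has a primitive there. The integrals over
  \<open>{- n..n}\<close> at the two heights then differ by the vertical sides, which are of order
  \<open>exp (- c * n)\<close>.\<close>

lemma integral_strip_shift:
  assumes hol: "g holomorphic_on {\<zeta>. \<bar>Im \<zeta>\<bar> < a}" and th: "\<bar>\<theta>\<bar> < a" and c: "c > 0"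
    and bnd: "\<And>\<zeta>. \<bar>Im \<zeta>\<bar> \<le> \<bar>\<theta>\<bar> \<Longrightarrow> norm (g \<zeta>) \<le> C * exp (- c * \<bar>Re \<zeta>\<bar>)"
  shows "integrable lborel (\<lambda>y. g (of_real y + \<i> * of_real \<theta>))"
    and "(LBINT y. g (of_real y + \<i> * of_real \<theta>)) = (LBINT y. g (of_real y))"
proof -
  let ?S = "{\<zeta>::complex. \<bar>Im \<zeta>\<bar> < a}"
  have op: "open ?S" by (intro open_Collect_less continuous_intros)
  have "?S = {\<zeta>. Im \<zeta> < a} \<inter> {\<zeta>. Im \<zeta> > - a}" by auto
  then have cv: "convex ?S" by (simp add: convex_Int convex_halfspace_Im_lt convex_halfspace_Im_gt)
  obtain P where P: "\<And>x. x \<in> ?S \<Longrightarrow> (P has_field_derivative g x) (at x)"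
    using holomorphic_convex_primitive'[OF cv op hol] op at_within_open by metis
  have int: "integrable lborel (\<lambda>y. g (of_real y + \<i> * of_real t))" if t: "\<bar>t\<bar> \<le> \<bar>\<theta>\<bar>" for t
  proof (rule Bochner_Integration.integrable_bound)
    show "integrable lborel (\<lambda>y. C * exp (- c * \<bar>y\<bar>))"
      by (intro integrable_mult_right integrable_exp_neg_abs c)
    have "continuous_on UNIV (\<lambda>y. g (of_real y + \<i> * of_real t))"
      by (rule continuous_on_compose2[OF holomorphic_on_imp_continuous_on[OF hol]])
         (use t th in \<open>auto intro!: continuous_intros\<close>)
    then show "(\<lambda>y. g (of_real y + \<i> * of_real t)) \<in> borel_measurable lborel"
      using borel_measurable_continuous_onI by simp
    show "AE y in lborel. norm (g (of_real y + \<i> * of_real t)) \<le> norm (C * exp (- c * \<bar>y\<bar>))"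
    proof (rule AE_I2)
      fix y
      have "norm (g (of_real y + \<i> * of_real t)) \<le> C * exp (- c * \<bar>y\<bar>)"
        using bnd[of "of_real y + \<i> * of_real t"] t by simp
      then show "norm (g (of_real y + \<i> * of_real t)) \<le> norm (C * exp (- c * \<bar>y\<bar>))" by (simp add: abs_le_iff)
    qed
  qed
  show "integrable lborel (\<lambda>y. g (of_real y + \<i> * of_real \<theta>))" by (rule int) simp
  have I: "(LBINT y:{- real n..real n}. g (of_real y + \<i> * of_real t)) =
      P (of_nat n + \<i> * of_real t) - P (- of_nat n + \<i> * of_real t)" if t: "\<bar>t\<bar> \<le> \<bar>\<theta>\<bar>" for t n
  proof -
    have "(LBINT y. indicator {- real n..real n} y *\<^sub>R g (of_real y + \<i> * of_real t)) =
       P (of_real (real n) + \<i> * of_real t) - P (of_real (- real n) + \<i> * of_real t)"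
    proof (rule integral_FTC_Icc)
      fix x :: real
      have "((\<lambda>z. z + \<i> * of_real t) has_field_derivative 1) (at (of_real x))"
        by (auto intro!: derivative_eq_intros)
      moreover have "(P has_field_derivative g (of_real x + \<i> * of_real t)) (at (of_real x + \<i> * of_real t))"
        by (rule P) (use t th in auto)
      ultimately have "((\<lambda>z. P (z + \<i> * of_real t)) has_field_derivative g (of_real x + \<i> * of_real t) * 1) (at (of_real x))"
        using DERIV_chain2[of P _ "\<lambda>z. z + \<i> * of_real t"] by blast
      then show "((\<lambda>x. P (of_real x + \<i> * of_real t)) has_vector_derivative g (of_real x + \<i> * of_real t)) (at x within {- real n..real n})"
        using has_vector_derivative_real_field[THEN has_vector_derivative_at_within] by fastforce
    next
      show "continuous_on {- real n..real n} (\<lambda>y. g (of_real y + \<i> * of_real t))"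
        by (rule continuous_on_compose2[OF holomorphic_on_imp_continuous_on[OF hol]])
           (use t th in \<open>auto intro!: continuous_intros\<close>)
    qed simp
    then show ?thesis by (simp add: set_lebesgue_integral_def)
  qed
  have side: "(\<lambda>n. P (f n + \<i> * of_real \<theta>) - P (f n)) \<longlonglongrightarrow> 0" if f: "\<And>n. Im (f n) = 0" "\<And>n. \<bar>Re (f n)\<bar> = real n" for f :: "nat \<Rightarrow> complex"
  proof (rule Lim_null_comparison)
    show "(\<lambda>n. C * exp (- c * real n) * \<bar>\<theta>\<bar>) \<longlonglongrightarrow> 0" using c by real_asymp
    show "eventually (\<lambda>n. norm (P (f n + \<i> * of_real \<theta>) - P (f n)) \<le> C * exp (- c * real n) * \<bar>\<theta>\<bar>) sequentially"
    proof (intro always_eventually allI)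
      fix n
      have "norm (P (f n + \<i> * of_real \<theta>) - P (f n)) \<le> C * exp (- c * real n) * norm (f n + \<i> * of_real \<theta> - f n)"
      proof (rule field_differentiable_bound[of "closed_segment (f n) (f n + \<i> * of_real \<theta>)" P g])
        fix x assume "x \<in> closed_segment (f n) (f n + \<i> * of_real \<theta>)"
        then obtain u where u: "0 \<le> u" "u \<le> 1" "x = f n + of_real u * (\<i> * of_real \<theta>)"
          by (auto simp: closed_segment_def scaleR_conv_of_real algebra_simps)
        have "\<bar>Im x\<bar> \<le> \<bar>\<theta>\<bar>" "\<bar>Re x\<bar> = real n" using u f by (auto simp: abs_mult mult_left_le_one_le)
        then show "norm (g x) \<le> C * exp (- c * real n)" "(P has_field_derivative g x) (at x within closed_segment (f n) (f n + \<i> * of_real \<theta>))"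
          using bnd[of x] th by (auto intro!: has_field_derivative_at_within[OF P])
      qed auto
      then show "norm (P (f n + \<i> * of_real \<theta>) - P (f n)) \<le> C * exp (- c * real n) * \<bar>\<theta>\<bar>" by (simp add: norm_mult)
    qed
  qed
  have "(\<lambda>n. (P (of_nat n + \<i> * of_real \<theta>) - P (of_nat n)) - (P (- of_nat n + \<i> * of_real \<theta>) - P (- of_nat n))
     + (P (of_nat n + \<i> * of_real 0) - P (- of_nat n + \<i> * of_real 0))) \<longlonglongrightarrow> 0 - 0 + (LBINT y. g (of_real y + \<i> * of_real 0))"
  proof (intro tendsto_add tendsto_diff side)
    show "(\<lambda>n. P (of_nat n + \<i> * of_real 0) - P (- of_nat n + \<i> * of_real 0)) \<longlonglongrightarrow> (LBINT y. g (of_real y + \<i> * of_real 0))"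
      using integral_symmetric_limit[OF int[of 0]] I[of 0] by simp
  qed auto
  also have "(\<lambda>n. (P (of_nat n + \<i> * of_real \<theta>) - P (of_nat n)) - (P (- of_nat n + \<i> * of_real \<theta>) - P (- of_nat n))
     + (P (of_nat n + \<i> * of_real 0) - P (- of_nat n + \<i> * of_real 0))) =
     (\<lambda>n. LBINT y:{- real n..real n}. g (of_real y + \<i> * of_real \<theta>))"
    by (simp add: I)
  finally show "(LBINT y. g (of_real y + \<i> * of_real \<theta>)) = (LBINT y. g (of_real y))"
    using integral_symmetric_limit[OF int[of \<theta>]] LIMSEQ_unique by fastforce
qed

lemma summable_on_int_exp_abs: "(\<lambda>m::int. C * exp (- real_of_int \<bar>m\<bar>)) summable_on UNIV"
proof -
  have "summable (\<lambda>n. exp (- 1 :: real) ^ n)" by (rule summable_geometric) simp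
  then have "summable (\<lambda>n. norm (exp (- real n)))" by (simp add: exp_of_nat_mult[symmetric])
  then have s: "(\<lambda>n. exp (- real n)) summable_on UNIV" by (rule norm_summable_imp_summable_on)
  have "(\<lambda>m::int. exp (- real_of_int \<bar>m\<bar>)) summable_on range int"
    by (subst summable_on_reindex) (use s in \<open>auto simp: o_def\<close>)
  moreover have "(\<lambda>m::int. exp (- real_of_int \<bar>m\<bar>)) summable_on range (\<lambda>n. - int n)"
    by (subst summable_on_reindex) (use s in \<open>auto simp: o_def inj_def\<close>)
  ultimately have "(\<lambda>m::int. exp (- real_of_int \<bar>m\<bar>)) summable_on (range int \<union> range (\<lambda>n. - int n))"
    by (rule summable_on_union)
  also have "range int \<union> range (\<lambda>n. - int n) = UNIV"
  proof -
    have "x \<in> range int \<union> range (\<lambda>n. - int n)" for x by (cases x rule: int_cases2) auto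
    then show ?thesis by blast
  qed
  finally show ?thesis by (rule summable_on_cmult_right)
qed

lemma gaussian_term_bound:
  fixes a :: complex
  assumes "Re a > 0"
  obtains C where "C > 0" "\<And>\<zeta> m. norm \<zeta> \<le> R \<Longrightarrow> norm (exp (- (of_real pi * a * (\<zeta> + of_int m)\<^sup>2))) \<le> C * exp (- real_of_int \<bar>m\<bar>)"
proof
  define A where "A = Re a"
  define B where "B = norm a * \<bar>R\<bar>"
  define D where "D = norm a * R\<^sup>2"
  \<comment> \<open>The exponent is the maximum over real \<open>x\<close> of
    \<open>- pi * A * x^2 + (2 * pi * B + 1) * x + pi * D\<close>; the extra 1 in the linear
    coefficient pays for the factor \<open>exp (- \<bar>m\<bar>)\<close>.\<close>
  define C where "C = exp ((2 * pi * B + 1)\<^sup>2 / (4 * pi * A) + pi * D)"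
  show "C > 0" by (simp add: C_def)
  fix \<zeta> :: complex and m :: int assume z: "norm \<zeta> \<le> R"
  have A: "A > 0" using assms by (simp add: A_def)
  have r: "Re (a * (\<zeta> + of_int m)\<^sup>2) = A * (of_int m)\<^sup>2 + 2 * of_int m * Re (a * \<zeta>) + Re (a * \<zeta>\<^sup>2)"
    by (simp add: A_def power2_eq_square algebra_simps)
  have "\<bar>Re (a * \<zeta>)\<bar> \<le> norm (a * \<zeta>)" by (rule abs_Re_le_cmod)
  also have "\<dots> \<le> B" using z by (auto simp: norm_mult B_def intro!: mult_left_mono)
  finally have 1: "\<bar>Re (a * \<zeta>)\<bar> \<le> B" .
  have "\<bar>Re (a * \<zeta>\<^sup>2)\<bar> \<le> norm (a * \<zeta>\<^sup>2)" by (rule abs_Re_le_cmod)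
  also have "\<dots> \<le> D" using z by (auto simp: norm_mult norm_power D_def intro!: mult_left_mono power_mono)
  finally have 2: "\<bar>Re (a * \<zeta>\<^sup>2)\<bar> \<le> D" .
  have "\<bar>2 * of_int m * Re (a * \<zeta>)\<bar> \<le> 2 * \<bar>of_int m\<bar> * B"
    using 1 by (auto simp: abs_mult intro!: mult_left_mono)
  then have 3: "Re (a * (\<zeta> + of_int m)\<^sup>2) \<ge> A * (of_int m)\<^sup>2 - 2 * \<bar>of_int m\<bar> * B - D"
    using r 2 by linarith
  define x where "x = \<bar>real_of_int m\<bar>"
  have x2: "(real_of_int m)\<^sup>2 = x\<^sup>2" by (simp add: x_def)
  have "T\<^sup>2 / (4 * P) - T * x + P * x\<^sup>2 = (2 * P * x - T)\<^sup>2 / (4 * P)" if "P > 0" for P T :: real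
    using that by (simp add: field_simps power2_eq_square)
  from this[of "pi * A" "2 * pi * B + 1"] A
  have "(2 * pi * B + 1)\<^sup>2 / (4 * (pi * A)) - (2 * pi * B + 1) * x + pi * A * x\<^sup>2 \<ge> 0" by simp
  then have 4: "- pi * (A * x\<^sup>2 - 2 * x * B - D) \<le> (2 * pi * B + 1)\<^sup>2 / (4 * pi * A) + pi * D - x"
    by (simp add: algebra_simps)
  have "norm (exp (- (of_real pi * a * (\<zeta> + of_int m)\<^sup>2))) = exp (- pi * Re (a * (\<zeta> + of_int m)\<^sup>2))"
    by (simp add: mult.assoc)
  also have "\<dots> \<le> exp (- pi * (A * x\<^sup>2 - 2 * x * B - D))"
    using 3 unfolding x2 by (auto simp: x_def)
  also have "\<dots> \<le> exp ((2 * pi * B + 1)\<^sup>2 / (4 * pi * A) + pi * D - x)" using 4 by simp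
  also have "\<dots> = C * exp (- real_of_int \<bar>m\<bar>)" by (simp add: C_def x_def flip: exp_add)
  finally show "norm (exp (- (of_real pi * a * (\<zeta> + of_int m)\<^sup>2))) \<le> C * exp (- real_of_int \<bar>m\<bar>)" .
qed


text \<open>The periodisation \<open>g\<close> of the Gaussian \<open>\<phi>\<close> has Fourier
  coefficients \<open>csqrt \<eta> * P k\<close>, found by unfolding to an integral over the real
  line. Its Fourier series at 0 is the identity.\<close>

theorem poisson_summation_gaussian:
  fixes \<eta> b :: complex
  assumes eta: "Re \<eta> > 0"
  defines "P \<equiv> (\<lambda>k::int. exp (- (of_real pi * \<eta> * (of_int k)\<^sup>2) + 2 * of_real pi * \<i> * of_int k * b))"
  defines "Q \<equiv> (\<lambda>m::int. exp (- (of_real pi * (of_int m + b)\<^sup>2 / \<eta>)))"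
  shows "P summable_on UNIV" "Q summable_on UNIV" "infsum Q UNIV = csqrt \<eta> * infsum P UNIV"
proof -
  have eta0: "\<eta> \<noteq> 0" using eta by auto
  have Rei: "Re (1 / \<eta>) > 0" by (rule Re_one_divide_pos[OF eta])
  \<comment> \<open>Completing the square exhibits \<open>P k\<close> as a constant times a shifted
    Gaussian, so that one term bound serves both families.\<close>
  have Pn: "norm (P k) = norm (exp (- (of_real pi * \<eta> * (- \<i> * b / \<eta> + of_int k)\<^sup>2))) * norm (exp (- of_real pi * b\<^sup>2 / \<eta>))" for k
  proof -
    have "- (of_real pi * \<eta> * (of_int k)\<^sup>2) + 2 * of_real pi * \<i> * of_int k * b =
       - (of_real pi * \<eta> * (- \<i> * b / \<eta> + of_int k)\<^sup>2) + (- of_real pi * b\<^sup>2 / \<eta>)"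
      using eta0 by (simp add: field_simps power2_eq_square)
    then show ?thesis unfolding P_def by (simp only: exp_add norm_mult)
  qed
  obtain C1 where C1: "C1 > 0" "\<And>m. norm (exp (- (of_real pi * \<eta> * (- \<i> * b / \<eta> + of_int m)\<^sup>2))) \<le> C1 * exp (- real_of_int \<bar>m\<bar>)"
    using gaussian_term_bound[OF eta, of "norm (- \<i> * b / \<eta>)"] by (metis order_refl)
  have Pb: "norm (P k) \<le> (C1 * norm (exp (- of_real pi * b\<^sup>2 / \<eta>))) * exp (- real_of_int \<bar>k\<bar>)" for k
  proof -
    have "norm (P k) \<le> (C1 * exp (- real_of_int \<bar>k\<bar>)) * norm (exp (- of_real pi * b\<^sup>2 / \<eta>))"
      unfolding Pn by (rule mult_right_mono[OF C1(2)]) simp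
    then show ?thesis by (simp add: mult_ac)
  qed
  have "(\<lambda>k. norm (P k)) summable_on UNIV"
    by (rule summable_on_comparison_test[OF summable_on_int_exp_abs Pb]) auto
  then show Ps: "P summable_on UNIV" by (rule abs_summable_summable)
  define \<phi> where "\<phi> = (\<lambda>x. exp (- (of_real pi * (x + b)\<^sup>2 / \<eta>)))"
  have phi_bound: "\<exists>C>0. \<forall>x m. norm x \<le> R \<longrightarrow> norm (\<phi> (x + of_int m)) \<le> C * exp (- real_of_int \<bar>m\<bar>)" for R
  proof -
    obtain C where C: "C > 0" "\<And>\<zeta> m. norm \<zeta> \<le> R + norm b \<Longrightarrow> norm (exp (- (of_real pi * (1 / \<eta>) * (\<zeta> + of_int m)\<^sup>2))) \<le> C * exp (- real_of_int \<bar>m\<bar>)"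
      using gaussian_term_bound[OF Rei, of "R + norm b"] by metis
    show ?thesis
    proof (intro exI[of _ C] conjI allI impI C(1))
      fix x :: complex and m :: int assume "norm x \<le> R"
      then have "norm (x + b) \<le> R + norm b" using norm_triangle_ineq[of x b] by linarith
      from C(2)[OF this, of m] show "norm (\<phi> (x + of_int m)) \<le> C * exp (- real_of_int \<bar>m\<bar>)"
        by (simp add: \<phi>_def algebra_simps)
    qed
  qed
  define g where "g = (\<lambda>x. \<Sum>\<^sub>\<infinity>m::int. \<phi> (x + of_int m))"
  have g0: "g 0 = infsum Q UNIV" by (simp add: g_def \<phi>_def Q_def)
  obtain C0 where "C0 > 0" "\<And>x m. norm x \<le> 0 \<Longrightarrow> norm (\<phi> (x + of_int m)) \<le> C0 * exp (- real_of_int \<bar>m\<bar>)"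
    using phi_bound[of 0] by blast
  then have Qb: "norm (Q m) \<le> C0 * exp (- real_of_int \<bar>m\<bar>)" for m
    by (metis Q_def \<phi>_def add_0 norm_zero order_refl)
  have "(\<lambda>k. norm (Q k)) summable_on UNIV"
    by (rule summable_on_comparison_test[OF summable_on_int_exp_abs Qb]) auto
  then show Qs: "Q summable_on UNIV" by (rule abs_summable_summable)
  have phol: "\<phi> holomorphic_on A" for A unfolding \<phi>_def using eta0 by (intro holomorphic_intros) auto
  have hol: "g holomorphic_on UNIV"
    unfolding g_def
  proof (rule holomorphic_infsum)
    fix m :: int
    show "(\<lambda>x. \<phi> (x + of_int m)) holomorphic_on UNIV"
      unfolding \<phi>_def using eta0 by (intro holomorphic_intros) auto
  next
    fix x :: complex
    obtain C where C: "C > 0" "\<And>y m. norm y \<le> norm x + 1 \<Longrightarrow> norm (\<phi> (y + of_int m)) \<le> C * exp (- real_of_int \<bar>m\<bar>)"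
      using phi_bound[of "norm x + 1"] by blast
    have "norm y \<le> norm x + 1" if "y \<in> cball x 1" for y
      using that norm_triangle_ineq[of x "y - x"] by (auto simp: dist_norm norm_minus_commute)
    with C show "\<exists>d>0. \<exists>M. M summable_on (UNIV :: int set) \<and> cball x d \<subseteq> UNIV \<and> (\<forall>i\<in>UNIV. \<forall>y\<in>cball x d. norm (\<phi> (y + of_int i)) \<le> M i)"
      by (intro exI[of _ 1] conjI exI[of _ "\<lambda>m. C * exp (- real_of_int \<bar>m\<bar>)"] summable_on_int_exp_abs) auto
  qed auto
  have per: "g (x + 1) = g x" for x
  proof -
    have "bij (\<lambda>m::int. m + 1)" by (rule bij_betw_byWitness[of _ "\<lambda>m. m - 1"]) auto
    from infsum_reindex_bij_betw[OF this, of "\<lambda>m. \<phi> (x + of_int m)"]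
    show ?thesis by (simp add: g_def add_ac)
  qed
  define e :: "int \<Rightarrow> real \<Rightarrow> complex" where "e = (\<lambda>k x. exp (- (2 * of_real pi * \<i> * of_int k * of_real x)))"
  have ne: "norm (e k x) = 1" for k x by (simp add: e_def)
  have e_shift: "e k (x + of_int m) = e k x" for k m x
  proof -
    have "e k (x + of_int m) = exp (- (2 * of_real pi * \<i> * of_int k * of_real x) + \<i> * (of_int (- k * m) * (of_real pi * 2)))"
      unfolding e_def by (rule arg_cong[of _ _ exp]) (simp add: algebra_simps)
    then show ?thesis unfolding e_def by (simp only: exp_plus_2pin)
  qed
  have me[measurable]: "e k \<in> borel_measurable borel" for k
    unfolding e_def by (intro borel_measurable_continuous_onI continuous_intros)
  have mphi[measurable]: "(\<lambda>x. \<phi> (of_real x + of_int m)) \<in> borel_measurable borel" for m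
    unfolding \<phi>_def using eta0 by (intro borel_measurable_continuous_onI continuous_intros) auto
  have mphi0[measurable]: "(\<lambda>x. \<phi> (of_real x)) \<in> borel_measurable borel"
    using mphi[of 0] by simp
  \<comment> \<open>The character moves the centre of the Gaussian by the complex amount
    \<open>- \<i> * \<eta> * of_int k\<close>; the constant released by completing the square is
    \<open>P k\<close>.\<close>
  have phie: "has_bochner_integral lborel (\<lambda>x. \<phi> (of_real x) * e k x) (csqrt \<eta> * P k)" for k
  proof -
    have "has_bochner_integral lborel (\<lambda>x. P k * exp (- (of_real pi * (of_real x + (b + \<i> * \<eta> * of_int k))\<^sup>2 / \<eta>))) (P k * csqrt \<eta>)"
      by (intro has_bochner_integral_mult_right gaussian_integral_complex eta)
    moreover have "P k * exp (- (of_real pi * (of_real x + (b + \<i> * \<eta> * of_int k))\<^sup>2 / \<eta>)) = \<phi> (of_real x) * e k x" for x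
    proof -
      have "(- (of_real pi * \<eta> * (of_int k)\<^sup>2) + 2 * of_real pi * \<i> * of_int k * b) + (- (of_real pi * (of_real x + (b + \<i> * \<eta> * of_int k))\<^sup>2 / \<eta>)) =
        - (of_real pi * (of_real x + b)\<^sup>2 / \<eta>) + (- (2 * of_real pi * \<i> * of_int k * of_real x))"
        using eta0 by (simp add: field_simps power2_eq_square)
      then show ?thesis unfolding P_def \<phi>_def e_def by (simp only: exp_add[symmetric])
    qed
    ultimately show ?thesis by (simp add: mult.commute)
  qed
  \<comment> \<open>The integral over the unit cell around \<open>m\<close>. Summed over
    \<open>m\<close>, it gives the whole line (\<open>T1\<close>); with every cell translated to the
    central one, it gives the coefficient of \<open>g\<close> (\<open>T2\<close>), since
    \<open>e k\<close> has period 1. The cells are half-open so that they partition the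
    line.\<close>
  define T where "T = (\<lambda>k m. LBINT x:{of_int m - 1/2..<of_int m + 1/2}. \<phi> (of_real x) * e k x)"
  have T1: "(T k has_sum (csqrt \<eta> * P k)) UNIV" for k
  proof -
    let ?f = "\<lambda>m x. indicator {of_int m - 1/2..<of_int m + 1/2::real} x *\<^sub>R (\<phi> (of_real x) * e k x)"
    have fin: "finite {m::int. ?f m x \<noteq> 0}" for x
      by (rule finite_subset[of _ "{\<lfloor>x - 1\<rfloor>..\<lceil>x + 1\<rceil>}"]) (auto simp: indicator_def split: if_splits, linarith+)
    have eqx: "(\<Sum>\<^sub>\<infinity>m. ?f m x) = \<phi> (of_real x) * e k x" for x
    proof -
      have "(\<Sum>\<^sub>\<infinity>m. ?f m x) = (\<Sum>\<^sub>\<infinity>m\<in>{\<lfloor>x + 1/2\<rfloor>}. ?f m x)"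
        by (rule infsum_cong_neutral) (auto simp: indicator_def split: if_splits, linarith+)
      also have "\<dots> = \<phi> (of_real x) * e k x" by (simp add: indicator_def) linarith
      finally show ?thesis .
    qed
    have int1: "integrable lborel (\<lambda>x. norm (\<phi> (of_real x) * e k x))"
      using phie[of k] by (auto simp: has_bochner_integral_iff)
    have "((\<lambda>m. LINT x|lborel. ?f m x) has_sum (LINT x|lborel. (\<Sum>\<^sub>\<infinity>m. ?f m x))) UNIV"
    proof (rule integral_infsum)
      show "infinite (UNIV :: int set)" by simp
      show "integrable lborel (?f m)" for m
        using phie[of k] by (intro integrable_mult_indicator) (auto simp: has_bochner_integral_iff)
      show "(\<lambda>m. norm (?f m x)) summable_on UNIV" for x
        using fin[of x] by (intro finite_nonzero_values_imp_summable_on) simp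
      show "(\<lambda>m. LINT x|lborel. norm (?f m x)) summable_on UNIV"
      proof -
        obtain C where C: "C > 0" "\<And>y m. norm y \<le> 1/2 \<Longrightarrow> norm (\<phi> (y + of_int m)) \<le> C * exp (- real_of_int \<bar>m\<bar>)"
          using phi_bound[of "1/2"] by blast
        have "(LINT x|lborel. norm (?f m x)) \<le> C * exp (- real_of_int \<bar>m\<bar>)" for m
        proof -
          have "(LINT x|lborel. norm (?f m x)) \<le> (LINT x|lborel. indicator {real_of_int m - 1/2..<real_of_int m + 1/2} x * (C * exp (- real_of_int \<bar>m\<bar>)))"
          proof (rule integral_mono)
            show "integrable lborel (\<lambda>x. norm (?f m x))"
              using phie[of k] by (intro integrable_norm integrable_mult_indicator) (auto simp: has_bochner_integral_iff)
            fix x :: real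
            have "norm (\<phi> (of_real x)) \<le> C * exp (- real_of_int \<bar>m\<bar>)" if "x \<in> {real_of_int m - 1/2..<real_of_int m + 1/2}"
            proof -
              have "\<bar>x - of_int m\<bar> \<le> 1/2" using that by (simp only: atLeastLessThan_iff) linarith
              then have "norm (of_real x - of_int m :: complex) \<le> 1/2" by (metis norm_of_real of_real_diff of_real_of_int_eq)
              from C(2)[OF this, of m] show ?thesis by simp
            qed
            then show "norm (?f m x) \<le> indicator {real_of_int m - 1/2..<real_of_int m + 1/2} x * (C * exp (- real_of_int \<bar>m\<bar>))"
              by (auto simp: indicator_def norm_mult ne)
          qed (auto intro!: integrable_mult_left simp: integrable_indicator_iff)
          also have "\<dots> = C * exp (- real_of_int \<bar>m\<bar>)" by simp
          finally show ?thesis .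
        qed
        then show ?thesis
          by (intro summable_on_comparison_test[OF summable_on_int_exp_abs[of C]]) auto
      qed
    qed
    then show ?thesis using phie[of k] unfolding eqx T_def set_lebesgue_integral_def has_bochner_integral_iff by simp
  qed
  have T2: "(T k has_sum (LBINT x:{-1/2..1/2}. g (of_real x) * e k x)) UNIV" for k
  proof -
    let ?f = "\<lambda>m x. indicator {-1/2..<1/2::real} x *\<^sub>R (\<phi> (of_real x + of_int m) * e k x)"
    obtain C where C: "C > 0" "\<And>y m. norm y \<le> 1/2 \<Longrightarrow> norm (\<phi> (y + of_int m)) \<le> C * exp (- real_of_int \<bar>m\<bar>)"
      using phi_bound[of "1/2"] by blast
    have fb: "norm (?f m x) \<le> C * exp (- real_of_int \<bar>m\<bar>) * indicator {-1/2..<1/2::real} x" for m x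
    proof (cases "x \<in> {-1/2..<1/2}")
      case True
      then have "norm (of_real x :: complex) \<le> 1/2" by auto
      from C(2)[OF this, of m] True show ?thesis by (simp add: norm_mult ne)
    qed simp
    have ib: "integrable lborel (\<lambda>x. C * exp (- real_of_int \<bar>m\<bar>) * indicator {-1/2..<1/2::real} x)" for m
      by (auto intro!: integrable_mult_right simp: integrable_indicator_iff)
    have intf: "integrable lborel (?f m)" for m
      by (rule Bochner_Integration.integrable_bound[OF ib[of m]]) (simp, rule AE_I2, use fb[where m = m] in \<open>force intro: order_trans[OF _ abs_ge_self]\<close>)
    have "((\<lambda>m. LINT x|lborel. ?f m x) has_sum (LINT x|lborel. (\<Sum>\<^sub>\<infinity>m. ?f m x))) UNIV"
    proof (rule integral_infsum)
      show "infinite (UNIV :: int set)" by simp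
      show "integrable lborel (?f m)" for m by (rule intf)
      show "(\<lambda>m. norm (?f m x)) summable_on UNIV" for x
      proof (rule summable_on_comparison_test[OF summable_on_int_exp_abs[of C]])
        fix m :: int
        have "C * exp (- real_of_int \<bar>m\<bar>) * indicator {-1/2..<1/2::real} x \<le> C * exp (- real_of_int \<bar>m\<bar>)"
          using C(1) by (auto simp: indicator_def)
        then show "norm (?f m x) \<le> C * exp (- real_of_int \<bar>m\<bar>)" using fb[where m = m and x = x] by linarith
      qed auto
      show "(\<lambda>m. LINT x|lborel. norm (?f m x)) summable_on UNIV"
      proof (rule summable_on_comparison_test[OF summable_on_int_exp_abs[of C]])
        fix m :: int
        have "(LINT x|lborel. norm (?f m x)) \<le> (LINT x|lborel. C * exp (- real_of_int \<bar>m\<bar>) * indicator {-1/2..<1/2::real} x)"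
          by (rule integral_mono[OF integrable_norm[OF intf] ib fb])
        also have "\<dots> = C * exp (- real_of_int \<bar>m\<bar>)" by simp
        finally show "(LINT x|lborel. norm (?f m x)) \<le> C * exp (- real_of_int \<bar>m\<bar>)" .
      qed auto
    qed
    moreover have "(LINT x|lborel. ?f m x) = T k m" for m
    proof -
      have "T k m = (LINT x|lborel. indicator {of_int m - 1/2..<of_int m + 1/2} (of_int m + 1 * x) *\<^sub>R (\<phi> (of_real (of_int m + 1 * x)) * e k (of_int m + 1 * x)))"
        unfolding T_def set_lebesgue_integral_def
        by (subst lborel_integral_real_affine[of 1 _ "of_int m"]) auto
      also have "\<dots> = (LINT x|lborel. ?f m x)"
        by (rule Bochner_Integration.integral_cong[OF refl])
           (use e_shift[of k _ m] in \<open>auto simp: indicator_def add.commute\<close>)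
      finally show ?thesis ..
    qed
    moreover have "(LINT x|lborel. (\<Sum>\<^sub>\<infinity>m. ?f m x)) = (LBINT x:{-1/2..1/2}. g (of_real x) * e k x)"
    proof -
      have "(\<Sum>\<^sub>\<infinity>m. ?f m x) = indicator {-1/2..<1/2::real} x *\<^sub>R (g (of_real x) * e k x)" for x
        by (cases "x \<in> {-1/2..<1/2}") (auto simp: g_def infsum_cmult_left')
      moreover have "(LINT x|lborel. indicator {-1/2..<1/2::real} x *\<^sub>R (g (of_real x) * e k x)) = 
         (LINT x|lborel. indicator {-1/2..1/2} x *\<^sub>R (g (of_real x) * e k x))"
      proof (rule integral_cong_AE)
        have "continuous_on UNIV (\<lambda>x. g (of_real x))"
          by (rule continuous_on_compose2[OF holomorphic_on_imp_continuous_on[OF hol]]) (auto intro!: continuous_intros)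
        then have [measurable]: "(\<lambda>x::real. g (of_real x)) \<in> borel_measurable borel"
          by (rule borel_measurable_continuous_onI)
        show "(\<lambda>x. indicator {-1/2..<1/2::real} x *\<^sub>R (g (of_real x) * e k x)) \<in> borel_measurable lborel" by measurable
        show "(\<lambda>x. indicator {-1/2..1/2} x *\<^sub>R (g (of_real x) * e k x)) \<in> borel_measurable lborel" by measurable
        show "AE x in lborel. indicator {-1/2..<1/2::real} x *\<^sub>R (g (of_real x) * e k x) = indicator {-1/2..1/2} x *\<^sub>R (g (of_real x) * e k x)"
          using AE_lborel_singleton[of "1/2"] by eventually_elim (auto simp: indicator_def)
      qed
      ultimately show ?thesis by (simp only: set_lebesgue_integral_def)
    qed
    ultimately show ?thesis by (simp only:)
  qed
  have ck: "(LBINT x:{-1/2..1/2}. g (of_real x) * e k x) = csqrt \<eta> * P k" for k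
    using T1 T2 has_sum_unique by blast
  have "(\<lambda>N. \<Sum>k\<in>{- int N..int N}. csqrt \<eta> * P k) \<longlonglongrightarrow> g 0"
    using fourier_partial_sums_at_0[OF hol per] ck unfolding e_def by (simp only:)
  moreover have "(\<lambda>N. \<Sum>k\<in>{- int N..int N}. csqrt \<eta> * P k) \<longlonglongrightarrow> csqrt \<eta> * infsum P UNIV"
  proof -
    have "(P has_sum infsum P UNIV) UNIV" using Ps by simp
    then have "((\<lambda>k. csqrt \<eta> * P k) has_sum (csqrt \<eta> * infsum P UNIV)) UNIV" by (rule has_sum_cmult_right)
    then have "((\<lambda>X. \<Sum>k\<in>X. csqrt \<eta> * P k) \<longlongrightarrow> csqrt \<eta> * infsum P UNIV) (finite_subsets_at_top UNIV)"
      by (simp add: has_sum_def)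
    \<comment> \<open>Symmetric intervals eventually contain every finite set of integers, so the
      ordered Fourier partial sums converge to the unordered sum.\<close>
    moreover have "filterlim (\<lambda>N. {- int N..int N}) (finite_subsets_at_top UNIV) sequentially"
      unfolding filterlim_iff eventually_finite_subsets_at_top
    proof (intro allI impI, elim exE conjE)
      fix R :: "int set \<Rightarrow> bool" and X :: "int set"
      assume X: "finite X" "\<forall>Y. finite Y \<and> X \<subseteq> Y \<and> Y \<subseteq> UNIV \<longrightarrow> R Y"
      obtain B where B: "\<And>x. x \<in> X \<Longrightarrow> \<bar>x\<bar> \<le> B"
        using finite_imageI[OF X(1), of abs] Max_ge[of "abs ` X"] by (metis image_eqI)
      show "eventually (\<lambda>N. R {- int N..int N}) sequentially"
        using eventually_ge_at_top[of "nat B"]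
      proof eventually_elim
        case (elim N)
        have "X \<subseteq> {- int N..int N}"
        proof
          fix x assume "x \<in> X"
          from B[OF this] elim show "x \<in> {- int N..int N}" by auto
        qed
        then show ?case using X(2) by auto
      qed
    qed
    ultimately show ?thesis by (rule filterlim_compose)
  qed
  ultimately show "infsum Q UNIV = csqrt \<eta> * infsum P UNIV"
    using LIMSEQ_unique g0 by metis
qed

section \<open>Theta functions with a parameter\<close>

text \<open>Jacobi's theta series with modular variable \<open>i * \<beta>^2\<close>. The scale
  \<open>sqrt pi\<close> in the linear term is chosen so that the inversion
  \<open>\<beta> \<mapsto> 1 / \<beta>\<close> acts on the parameter by
  \<open>z \<mapsto> i * z\<close>.\<close>

definition gtheta :: "complex \<Rightarrow> complex \<Rightarrow> complex" where
  "gtheta z \<beta> = (\<Sum>\<^sub>\<infinity>n::int. exp (- (of_real pi * \<beta>\<^sup>2 * (of_int n)\<^sup>2) + of_real (sqrt pi) * \<beta> * of_int n * z))"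

definition ctheta_term :: "complex \<Rightarrow> nat \<Rightarrow> complex \<Rightarrow> complex" where
  "ctheta_term z n \<beta> = exp (- (of_real pi * \<beta>\<^sup>2 * (of_nat (Suc n))\<^sup>2)) * cosh (of_real (sqrt pi) * \<beta> * of_nat (Suc n) * z)"

definition ctheta :: "complex \<Rightarrow> complex \<Rightarrow> complex" where
  "ctheta z \<beta> = (\<Sum>\<^sub>\<infinity>n. ctheta_term z n \<beta>)"

lemma sqrt_pi_squared_complex: "(complex_of_real (sqrt pi))\<^sup>2 = of_real pi"
  by (metis of_real_power pi_ge_zero real_sqrt_pow2)

lemma gtheta_summable:
  assumes "Re (\<beta>\<^sup>2) > 0"
  shows "(\<lambda>n::int. exp (- (of_real pi * \<beta>\<^sup>2 * (of_int n)\<^sup>2) + of_real (sqrt pi) * \<beta> * of_int n * z)) summable_on UNIV"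
proof -
  have e: "2 * of_real pi * \<i> * of_int n * (- \<i> * of_real (sqrt pi) * \<beta> * z / (2 * of_real pi)) = of_real (sqrt pi) * \<beta> * of_int n * z" for n :: int
    by (simp add: field_simps)
  show ?thesis using poisson_summation_gaussian(1)[OF assms, of "- \<i> * of_real (sqrt pi) * \<beta> * z / (2 * of_real pi)"]
    unfolding e .
qed

lemma gtheta_inversion:
  assumes b: "Re (\<beta>\<^sup>2) > 0" "Re \<beta> > 0"
  shows "gtheta z (1 / \<beta>) = \<beta> * exp (z\<^sup>2 / 4) * gtheta (\<i> * z) \<beta>"
proof -
  have b0: "\<beta> \<noteq> 0" using b by auto
  define s where "s = complex_of_real (sqrt pi)"
  have s2: "of_real pi = s * s" using sqrt_pi_squared_complex by (simp add: s_def power2_eq_square)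
  have s0: "s \<noteq> 0" by (simp add: s_def)
  define \<eta> where "\<eta> = 1 / \<beta>\<^sup>2"
  define c where "c = - \<i> * z / (2 * s * \<beta>)"
  have eta: "Re \<eta> > 0" unfolding \<eta>_def by (rule Re_one_divide_pos[OF b(1)])
  \<comment> \<open>The sign of the root is settled by \<open>Re \<beta> > 0\<close>.\<close>
  have cs: "csqrt \<eta> = 1 / \<beta>"
  proof -
    have "csqrt ((1 / \<beta>)\<^sup>2) = 1 / \<beta>" by (rule csqrt_square) (use Re_one_divide_pos[OF b(2)] in simp)
    then show ?thesis by (simp add: \<eta>_def power_divide)
  qed
  have 1: "exp (- (of_real pi * \<eta> * (of_int k)\<^sup>2) + 2 * of_real pi * \<i> * of_int k * c) =
     exp (- (of_real pi * (1 / \<beta>)\<^sup>2 * (of_int k)\<^sup>2) + of_real (sqrt pi) * (1 / \<beta>) * of_int k * z)" for k :: int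
    unfolding \<eta>_def c_def s2 s_def[symmetric] using b0 s0 by (intro arg_cong[of _ _ exp]) (simp add: field_simps power2_eq_square)
  have 2: "exp (- (of_real pi * (of_int m + c)\<^sup>2 / \<eta>)) =
     exp (z\<^sup>2 / 4) * exp (- (of_real pi * \<beta>\<^sup>2 * (of_int m)\<^sup>2) + of_real (sqrt pi) * \<beta> * of_int m * (\<i> * z))" for m :: int
    unfolding exp_add[symmetric] \<eta>_def c_def s2 s_def[symmetric] using b0 s0 
    by (intro arg_cong[of _ _ exp]) (simp add: field_simps power2_eq_square)
  show ?thesis
    using poisson_summation_gaussian(3)[OF eta, of c] b0
    unfolding 1 2 cs gtheta_def[symmetric] infsum_cmult_right' by (simp add: field_simps)
qed

text \<open>In the sector the Gaussian factor is at most \<open>exp (- pi * \<kappa> * X^2)\<close>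
  with \<open>X = norm \<beta> * (n + 1)\<close>. This beats the growth of \<open>cosh\<close> and
  any prescribed rate \<open>N\<close>, with a constant independent of \<open>\<beta>\<close> and
  \<open>n\<close>.\<close>

lemma ctheta_term_bound:
  assumes "\<kappa> > 0"
  obtains C where "C > 0" "\<And>\<beta> n. Re (\<beta>\<^sup>2) \<ge> \<kappa> * (norm \<beta>)\<^sup>2 \<Longrightarrow> norm (ctheta_term z n \<beta>) \<le> C * exp (- N * norm \<beta> * real (Suc n))"
proof
  define B where "B = N + sqrt pi * norm z"
  define C where "C = exp (B\<^sup>2 / (4 * (pi * \<kappa>)))"
  show "C > 0" by (simp add: C_def)
  fix \<beta> :: complex and n :: nat
  assume b: "Re (\<beta>\<^sup>2) \<ge> \<kappa> * (norm \<beta>)\<^sup>2"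
  define m where "m = real (Suc n)"
  define X where "X = norm \<beta> * m"
  have sq: "T\<^sup>2 / (4 * P) - T * x + P * x\<^sup>2 = (2 * P * x - T)\<^sup>2 / (4 * P)" if "P > 0" for P T x :: real
    using that by (simp add: field_simps power2_eq_square)
  have "B\<^sup>2 / (4 * (pi * \<kappa>)) - B * X + pi * \<kappa> * X\<^sup>2 \<ge> 0"
    using sq[of "pi * \<kappa>" B X] assms by simp
  then have 1: "- (pi * \<kappa> * X\<^sup>2) + sqrt pi * norm z * X \<le> B\<^sup>2 / (4 * (pi * \<kappa>)) - N * X"
    by (simp add: B_def algebra_simps)
  have "norm (exp (- (of_real pi * \<beta>\<^sup>2 * (of_nat (Suc n))\<^sup>2))) = exp (- (pi * m\<^sup>2 * Re (\<beta>\<^sup>2)))"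
  proof -
    have "Re (of_real pi * \<beta>\<^sup>2 * (of_nat (Suc n))\<^sup>2) = pi * m\<^sup>2 * Re (\<beta>\<^sup>2)"
    proof -
      have "of_real pi * \<beta>\<^sup>2 * (of_nat (Suc n))\<^sup>2 = of_real (pi * m\<^sup>2) * \<beta>\<^sup>2" by (simp add: m_def)
      then show ?thesis by (simp only: scaleR_conv_of_real[symmetric] scaleR_complex.sel)
    qed
    then show ?thesis by (simp add: norm_exp_eq_Re del: of_nat_Suc)
  qed
  also have "\<dots> \<le> exp (- (pi * \<kappa> * X\<^sup>2))"
  proof -
    have "pi * m\<^sup>2 * (\<kappa> * (norm \<beta>)\<^sup>2) \<le> pi * m\<^sup>2 * Re (\<beta>\<^sup>2)" using b by (intro mult_left_mono) auto
    then show ?thesis by (simp add: X_def power_mult_distrib mult_ac)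
  qed
  finally have a: "norm (exp (- (of_real pi * \<beta>\<^sup>2 * (of_nat (Suc n))\<^sup>2))) \<le> exp (- (pi * \<kappa> * X\<^sup>2))" .
  have "norm (cosh x) \<le> exp (norm x)" for x :: complex
  proof -
    have "norm (cosh x) \<le> (norm (exp x) + norm (exp (- x))) / 2"
      unfolding cosh_def using norm_triangle_ineq[of "exp x" "exp (- x)"] by simp
    also have "\<dots> \<le> exp (norm x)"
    proof -
      have "norm (exp x) \<le> exp (norm x)" "norm (exp (- x)) \<le> exp (norm x)"
        using norm_exp[of x] norm_exp[of "- x"] by (simp_all only: norm_minus_cancel)
      moreover have "(a + b) / 2 \<le> c" if "a \<le> c" "b \<le> c" for a b c :: real using that by simp
      ultimately show ?thesis by blast
    qed
    finally show ?thesis .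
  qed
  from this[of "of_real (sqrt pi) * \<beta> * of_nat (Suc n) * z"]
  have c: "norm (cosh (of_real (sqrt pi) * \<beta> * of_nat (Suc n) * z)) \<le> exp (sqrt pi * norm z * X)"
    by (simp add: norm_mult X_def m_def mult_ac del: of_nat_Suc)
  have "norm (ctheta_term z n \<beta>) \<le> exp (- (pi * \<kappa> * X\<^sup>2)) * exp (sqrt pi * norm z * X)"
    unfolding ctheta_term_def norm_mult by (rule mult_mono[OF a c]) auto
  also have "\<dots> = exp (- (pi * \<kappa> * X\<^sup>2) + sqrt pi * norm z * X)" by (simp only: exp_add)
  also have "\<dots> \<le> exp (B\<^sup>2 / (4 * (pi * \<kappa>)) - N * X)" using 1 by simp
  also have "\<dots> = C * exp (- N * norm \<beta> * real (Suc n))"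
    unfolding C_def exp_add[symmetric] by (simp add: X_def m_def mult.assoc)
  finally show "norm (ctheta_term z n \<beta>) \<le> C * exp (- N * norm \<beta> * real (Suc n))" .
qed

lemma summable_on_exp_nat: "a > 0 \<Longrightarrow> (\<lambda>n. C * exp (- a * real (Suc n))) summable_on UNIV"
proof -
  assume a: "a > 0"
  have "summable (\<lambda>n. exp (- a) ^ n)" using a by (intro summable_geometric) simp
  then have "summable (\<lambda>n. exp (- a) ^ Suc n)" by (simp only: summable_Suc_iff)
  also have "(\<lambda>n. exp (- a) ^ Suc n) = (\<lambda>n. exp (- a * real (Suc n)))"
    by (auto simp: exp_of_nat2_mult[symmetric] simp del: power_Suc of_nat_Suc)
  finally have "(\<lambda>n. exp (- a * real (Suc n))) summable_on UNIV"
    by (intro norm_summable_imp_summable_on) (simp del: of_nat_Suc)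
  then show ?thesis by (rule summable_on_cmult_right)
qed

lemma sector_ge:
  fixes \<beta> :: complex assumes "Re (\<beta>\<^sup>2) > 0"
  shows "\<exists>\<kappa>>0. Re (\<beta>\<^sup>2) \<ge> \<kappa> * (norm \<beta>)\<^sup>2"
  using assms by (intro exI[of _ "Re (\<beta>\<^sup>2) / (norm \<beta>)\<^sup>2"]) auto

lemma ctheta_summable:
  assumes "Re (\<beta>\<^sup>2) > 0"
  shows "(\<lambda>n. ctheta_term z n \<beta>) summable_on UNIV" "(\<lambda>n. norm (ctheta_term z n \<beta>)) summable_on UNIV"
proof -
  obtain \<kappa> where k: "\<kappa> > 0" "Re (\<beta>\<^sup>2) \<ge> \<kappa> * (norm \<beta>)\<^sup>2" using sector_ge[OF assms] by blast
  obtain C where C: "C > 0" "\<And>\<beta> n. Re (\<beta>\<^sup>2) \<ge> \<kappa> * (norm \<beta>)\<^sup>2 \<Longrightarrow> norm (ctheta_term z n \<beta>) \<le> C * exp (- 1 * norm \<beta> * real (Suc n))"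
    using ctheta_term_bound[OF k(1), of z 1] by metis
  have b: "norm \<beta> > 0" using assms by auto
  show 1: "(\<lambda>n. norm (ctheta_term z n \<beta>)) summable_on UNIV"
    by (rule summable_on_comparison_test[OF summable_on_exp_nat[OF b, of C]])
       (use C(2)[OF k(2)] in \<open>auto simp del: of_nat_Suc\<close>)
  then show "(\<lambda>n. ctheta_term z n \<beta>) summable_on UNIV" by (rule abs_summable_summable)
qed

lemma gtheta_eq_ctheta:
  assumes "Re (\<beta>\<^sup>2) > 0"
  shows "gtheta z \<beta> = 1 + 2 * ctheta z \<beta>"
proof -
  define t where "t = (\<lambda>n::int. exp (- (of_real pi * \<beta>\<^sup>2 * (of_int n)\<^sup>2) + of_real (sqrt pi) * \<beta> * of_int n * z))"
  have t: "t summable_on UNIV" unfolding t_def by (rule gtheta_summable[OF assms])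
  then have ts: "t summable_on A" for A by (rule summable_on_subset_banach) auto
  define p where "p = (\<lambda>n::nat. int (Suc n))"
  define q where "q = (\<lambda>n::nat. - int (Suc n))"
  have inj: "inj p" "inj q" by (auto simp: p_def q_def inj_def)
  have tp: "(\<lambda>n. t (p n)) summable_on UNIV" and tq: "(\<lambda>n. t (q n)) summable_on UNIV"
    using ts[of "range p"] ts[of "range q"] inj by (auto simp: summable_on_reindex o_def)
  have u: "(UNIV :: int set) = {0} \<union> (range p \<union> range q)"
  proof -
    have "x \<in> {0} \<union> (range p \<union> range q)" for x :: int
    proof (cases x rule: int_cases2)
      case (nonneg n) then show ?thesis by (cases n) (auto simp: p_def)
    next
      case (nonpos n) then show ?thesis by (cases n) (auto simp: q_def)
    qed
    then show ?thesis by blast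
  qed
  have "infsum t UNIV = infsum t {0} + infsum t (range p \<union> range q)"
    by (subst u, rule infsum_Un_disjoint) (auto intro!: ts simp: p_def q_def)
  also have "infsum t (range p \<union> range q) = infsum t (range p) + infsum t (range q)"
    by (rule infsum_Un_disjoint) (auto intro!: ts simp: p_def q_def)
  also have "infsum t (range p) = (\<Sum>\<^sub>\<infinity>n. t (p n))" by (simp add: infsum_reindex inj o_def)
  also have "infsum t (range q) = (\<Sum>\<^sub>\<infinity>n. t (q n))" by (simp add: infsum_reindex inj o_def)
  also have "(\<Sum>\<^sub>\<infinity>n. t (p n)) + (\<Sum>\<^sub>\<infinity>n. t (q n)) = (\<Sum>\<^sub>\<infinity>n. t (p n) + t (q n))"
    by (rule infsum_add[symmetric, OF tp tq])
  also have "(\<lambda>n. t (p n) + t (q n)) = (\<lambda>n. 2 * ctheta_term z n \<beta>)"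
    unfolding t_def p_def q_def ctheta_term_def cosh_def exp_add
    by (auto simp: fun_eq_iff algebra_simps scaleR_conv_of_real simp del: of_nat_Suc)
  also have "(\<Sum>\<^sub>\<infinity>n. 2 * ctheta_term z n \<beta>) = 2 * ctheta z \<beta>"
    unfolding ctheta_def by (rule infsum_cmult_right')
  also have "infsum t {0} = 1" by (simp add: t_def)
  finally show ?thesis by (simp add: gtheta_def t_def)
qed

lemma ctheta_inversion:
  assumes "Re (\<beta>\<^sup>2) > 0" "Re \<beta> > 0"
  shows "ctheta z (1 / \<beta>) = \<beta> * exp (z\<^sup>2 / 4) * ctheta (\<i> * z) \<beta> + \<beta> * exp (z\<^sup>2 / 4) / 2 - 1 / 2"
proof -
  have "Re ((1 / \<beta>)\<^sup>2) > 0" using Re_one_divide_pos[OF assms(1)] by (simp add: power_divide)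
  from gtheta_eq_ctheta[OF this, of z] gtheta_eq_ctheta[OF assms(1), of "\<i> * z"] gtheta_inversion[OF assms, of z]
  have "2 * ctheta z (1 / \<beta>) = \<beta> * exp (z\<^sup>2 / 4) * (1 + 2 * ctheta (\<i> * z) \<beta>) - 1" by (simp add: algebra_simps)
  from arg_cong[OF this, of "\<lambda>x. x / 2"] show ?thesis by (simp add: algebra_simps add_divide_distrib diff_divide_distrib)
qed

lemma ctheta_decay:
  assumes "\<kappa> > 0"
  obtains C where "C > 0" "\<And>\<beta>. Re (\<beta>\<^sup>2) \<ge> \<kappa> * (norm \<beta>)\<^sup>2 \<Longrightarrow> norm \<beta> \<ge> 1 \<Longrightarrow> norm (ctheta z \<beta>) \<le> C * exp (- N * norm \<beta>)"
proof -
  \<comment> \<open>For \<open>norm \<beta>\<close> and \<open>m\<close> at least 1, their product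
    is at least the mean of the two. Half of the rate then gives
    \<open>exp (- N * norm \<beta>)\<close>, and the other half gives the summable
    \<open>exp (- m / 2)\<close>.\<close>
  define N' where "N' = 2 * \<bar>N\<bar> + 1"
  obtain C where C: "C > 0" "\<And>\<beta> n. Re (\<beta>\<^sup>2) \<ge> \<kappa> * (norm \<beta>)\<^sup>2 \<Longrightarrow> norm (ctheta_term z n \<beta>) \<le> C * exp (- N' * norm \<beta> * real (Suc n))"
    using ctheta_term_bound[OF assms, of z N'] by metis
  define D where "D = (\<Sum>\<^sub>\<infinity>n. C * exp (- (1/2) * real (Suc n)))"
  have s: "(\<lambda>n. C * exp (- (1/2) * real (Suc n))) summable_on UNIV" by (rule summable_on_exp_nat) simp
  have D0: "D \<ge> 0" unfolding D_def using C(1) by (intro infsum_nonneg) auto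
  show ?thesis
  proof (rule that[of "D + 1"])
    show "D + 1 > 0" using D0 by simp
    fix \<beta> :: complex assume b: "Re (\<beta>\<^sup>2) \<ge> \<kappa> * (norm \<beta>)\<^sup>2" "norm \<beta> \<ge> 1"
    have tb: "norm (ctheta_term z n \<beta>) \<le> exp (- N * norm \<beta>) * (C * exp (- (1/2) * real (Suc n)))" for n
    proof -
      define m where "m = real (Suc n)"
      have m: "m \<ge> 1" by (simp add: m_def)
      have "(norm \<beta> - 1) * (m - 1) \<ge> 0" using b m by simp
      then have h: "norm \<beta> * m \<ge> norm \<beta> / 2 + m / 2" using b m by (simp add: algebra_simps)
      have "N' * (norm \<beta> * m) \<ge> N' * (norm \<beta> / 2 + m / 2)" using h by (intro mult_left_mono) (auto simp: N'_def)
      moreover have "N' * (m / 2) \<ge> 1 * (m / 2)" using m by (intro mult_right_mono) (auto simp: N'_def)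
      moreover have "N' * (norm \<beta> / 2) \<ge> (2 * N) * (norm \<beta> / 2)" by (intro mult_right_mono) (auto simp: N'_def)
      ultimately have "- N' * norm \<beta> * m \<le> - N * norm \<beta> + - (1/2) * m" by (simp add: algebra_simps)
      then have "exp (- N' * norm \<beta> * m) \<le> exp (- N * norm \<beta>) * exp (- (1/2) * m)"
        unfolding exp_add[symmetric] by simp
      with C(1) have "C * exp (- N' * norm \<beta> * m) \<le> C * (exp (- N * norm \<beta>) * exp (- (1/2) * m))" by simp
      with C(2)[OF b(1), of n] show ?thesis by (simp add: m_def mult_ac)
    qed
    have "\<kappa> * (norm \<beta>)\<^sup>2 > 0" using assms b(2) by (intro mult_pos_pos) auto
    then have rb: "Re (\<beta>\<^sup>2) > 0" using b(1) by linarith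
    have "norm (ctheta z \<beta>) \<le> (\<Sum>\<^sub>\<infinity>n. exp (- N * norm \<beta>) * (C * exp (- (1/2) * real (Suc n))))"
      unfolding ctheta_def by (rule norm_infsum_le[OF has_sum_infsum has_sum_infsum])
        (use tb s rb in \<open>auto intro!: ctheta_summable summable_on_cmult_right simp del: of_nat_Suc\<close>)
    also have "\<dots> = exp (- N * norm \<beta>) * D" unfolding D_def by (rule infsum_cmult_right')
    also have "\<dots> \<le> (D + 1) * exp (- N * norm \<beta>)" by (simp add: algebra_simps)
    finally show "norm (ctheta z \<beta>) \<le> (D + 1) * exp (- N * norm \<beta>)" .
  qed
qed

lemma ctheta_holomorphic: "ctheta z holomorphic_on {\<beta>. Re (\<beta>\<^sup>2) > 0}"
  unfolding ctheta_def
proof (rule holomorphic_infsum)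
  show op: "open {\<beta>::complex. Re (\<beta>\<^sup>2) > 0}"
    by (intro open_Collect_less continuous_intros)
  show "ctheta_term z n holomorphic_on {\<beta>. Re (\<beta>\<^sup>2) > 0}" for n
    unfolding ctheta_term_def cosh_def scaleR_conv_of_real by (intro holomorphic_intros)
  fix \<beta>0 :: complex assume "\<beta>0 \<in> {\<beta>. Re (\<beta>\<^sup>2) > 0}"
  then have b0: "Re (\<beta>0\<^sup>2) > 0" "norm \<beta>0 > 0" by auto
  define \<kappa> where "\<kappa> = Re (\<beta>0\<^sup>2) / (norm \<beta>0)\<^sup>2 / 2"
  have k: "\<kappa> > 0" using b0 by (simp add: \<kappa>_def)
  \<comment> \<open>A slightly wider sector, bounded away from 0, on which one summable majorant
    serves all terms.\<close>
  define S where "S = {\<beta>::complex. Re (\<beta>\<^sup>2) > \<kappa> * (norm \<beta>)\<^sup>2} \<inter> {\<beta>. norm \<beta> > norm \<beta>0 / 2}"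
  have "open S" unfolding S_def by (intro open_Int open_Collect_less continuous_intros)
  moreover have "\<beta>0 \<in> S" using b0 by (auto simp: S_def \<kappa>_def)
  ultimately obtain d where d: "d > 0" "cball \<beta>0 d \<subseteq> S" by (meson open_contains_cball)
  obtain C where C: "C > 0" "\<And>\<beta> n. Re (\<beta>\<^sup>2) \<ge> \<kappa> * (norm \<beta>)\<^sup>2 \<Longrightarrow> norm (ctheta_term z n \<beta>) \<le> C * exp (- 1 * norm \<beta> * real (Suc n))"
    using ctheta_term_bound[OF k(1), of z 1] by metis
  show "\<exists>d>0. \<exists>M. M summable_on UNIV \<and> cball \<beta>0 d \<subseteq> {\<beta>. Re (\<beta>\<^sup>2) > 0} \<and> (\<forall>i\<in>UNIV. \<forall>y\<in>cball \<beta>0 d. norm (ctheta_term z i y) \<le> M i)"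
  proof (intro exI conjI ballI)
    show "d > 0" by fact
    show "(\<lambda>n. C * exp (- (norm \<beta>0 / 2) * real (Suc n))) summable_on UNIV"
      using b0 by (intro summable_on_exp_nat) simp
    show "cball \<beta>0 d \<subseteq> {\<beta>. Re (\<beta>\<^sup>2) > 0}"
    proof
      fix y assume "y \<in> cball \<beta>0 d"
      then have "Re (y\<^sup>2) > \<kappa> * (norm y)\<^sup>2" using d by (auto simp: S_def)
      moreover have "\<kappa> * (norm y)\<^sup>2 \<ge> 0" using k by simp
      ultimately show "y \<in> {\<beta>. Re (\<beta>\<^sup>2) > 0}" by simp
    qed
    fix n y assume y: "y \<in> cball \<beta>0 d"
    then have y1: "Re (y\<^sup>2) \<ge> \<kappa> * (norm y)\<^sup>2" "norm y > norm \<beta>0 / 2" using d by (auto simp: S_def)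
    have "C * exp (- 1 * norm y * real (Suc n)) \<le> C * exp (- (norm \<beta>0 / 2) * real (Suc n))"
    proof -
      have "norm \<beta>0 / 2 * real (Suc n) \<le> norm y * real (Suc n)" using y1(2) by (intro mult_right_mono) auto
      then show ?thesis using C(1) by (simp del: of_nat_Suc)
    qed
    with C(2)[OF y1(1), of n] show "norm (ctheta_term z n y) \<le> C * exp (- (norm \<beta>0 / 2) * real (Suc n))" by linarith
  qed
qed

text \<open>
  Subtracting the singular part of \<open>ctheta\<close> at 0 makes this decay at both ends of the strip.
\<close>

definition etheta :: "complex \<Rightarrow> complex \<Rightarrow> complex" where
  "etheta z \<zeta> = exp (\<zeta> / 2) * (ctheta z (exp \<zeta>) - exp (z\<^sup>2 / 4) * exp (- \<zeta>) / 2)"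

definition strip :: "real \<Rightarrow> complex set" where
  "strip a = {\<zeta>. \<bar>Im \<zeta>\<bar> < a}"

text \<open>\<open>exp\<close> maps the strip of half-width \<open>\<theta>\<close> onto the sector
  of arguments at most \<open>\<theta>\<close> in modulus, where squaring doubles the argument. The
  bound degenerates at \<open>pi / 4\<close>, which is why this angle limits everything that
  follows.\<close>

lemma exp_strip_bound:
  assumes "\<bar>Im \<zeta>\<bar> \<le> \<theta>" "\<theta> < pi / 4"
  shows "Re ((exp \<zeta>)\<^sup>2) \<ge> cos (2 * \<theta>) * (norm (exp \<zeta>))\<^sup>2" "cos (2 * \<theta>) > 0" "Re (exp \<zeta>) > 0"
    "Re ((exp \<zeta>)\<^sup>2) > 0"
proof -
  have th: "\<theta> \<ge> 0" using assms by linarith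
  have c2: "cos (2 * \<theta>) \<le> cos (2 * Im \<zeta>)"
  proof -
    have "cos (2 * \<theta>) \<le> cos (2 * \<bar>Im \<zeta>\<bar>)" using assms th pi_gt_zero by (intro cos_monotone_0_pi_le) auto
    also have "cos (2 * \<bar>Im \<zeta>\<bar>) = cos (2 * Im \<zeta>)" by (cases "Im \<zeta> \<ge> 0") (auto simp: abs_if)
    finally show ?thesis .
  qed
  have e: "(exp \<zeta>)\<^sup>2 = exp (2 * \<zeta>)" by (simp add: exp_double)
  have n: "(norm (exp \<zeta>))\<^sup>2 = exp (2 * Re \<zeta>)" by (simp add: exp_double)
  show 1: "Re ((exp \<zeta>)\<^sup>2) \<ge> cos (2 * \<theta>) * (norm (exp \<zeta>))\<^sup>2"
    unfolding e n using c2 by (simp add: Re_exp mult.commute)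
  show 2: "cos (2 * \<theta>) > 0" using assms th by (intro cos_gt_zero_pi) auto
  have "cos (Im \<zeta>) > 0" using assms pi_gt_zero by (intro cos_gt_zero_pi) auto
  then show "Re (exp \<zeta>) > 0" by (simp add: Re_exp)
  have "cos (2 * \<theta>) * (norm (exp \<zeta>))\<^sup>2 > 0" using 2 by simp
  with 1 show "Re ((exp \<zeta>)\<^sup>2) > 0" by linarith
qed

text \<open>Of the elementary terms in \<open>ctheta_inversion\<close>, one cancels against the term
  subtracted in \<open>etheta\<close> at \<open>- \<zeta>\<close>, and the constant
  \<open>- 1 / 2\<close> becomes the subtracted term for the parameter \<open>i * z\<close>.\<close>

lemma etheta_uminus:
  assumes "\<zeta> \<in> strip (pi / 4)"
  shows "etheta z (- \<zeta>) = exp (z\<^sup>2 / 4) * etheta (\<i> * z) \<zeta>"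
proof -
  have s: "\<bar>Im \<zeta>\<bar> \<le> \<bar>Im \<zeta>\<bar>" "\<bar>Im \<zeta>\<bar> < pi / 4" using assms by (auto simp: strip_def)
  note h = exp_strip_bound[OF s]
  define w where "w = exp (\<zeta> / 2)"
  define a where "a = exp (z\<^sup>2 / 4)"
  have w: "exp \<zeta> = w * w" "w \<noteq> 0" "exp (- \<zeta> / 2) = 1 / w" "exp (- \<zeta>) = 1 / (w * w)"
    by (auto simp: w_def exp_minus inverse_eq_divide simp flip: exp_add)
  have a: "exp ((\<i> * z)\<^sup>2 / 4) = 1 / a" "a \<noteq> 0"
    by (auto simp: a_def power_mult_distrib exp_minus inverse_eq_divide)
  have "ctheta z (exp (- \<zeta>)) = exp \<zeta> * a * ctheta (\<i> * z) (exp \<zeta>) + exp \<zeta> * a / 2 - 1 / 2"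
    using ctheta_inversion[OF h(4,3), of z] by (simp add: exp_minus inverse_eq_divide a_def)
  then have c: "ctheta z (1 / (w * w)) = w * w * a * ctheta (\<i> * z) (w * w) + w * w * a / 2 - 1 / 2"
    by (simp only: w)
  show ?thesis
    unfolding etheta_def minus_minus w a a_def[symmetric] w_def[symmetric] c
    using w(2) a(2) by (simp add: field_simps)
qed

lemma etheta_holomorphic: "etheta z holomorphic_on strip (pi / 4)"
proof -
  have "(\<lambda>\<zeta>. ctheta z (exp \<zeta>)) holomorphic_on strip (pi / 4)"
    using holomorphic_on_compose_gen[of exp "strip (pi / 4)" "ctheta z" "{\<beta>. Re (\<beta>\<^sup>2) > 0}"] ctheta_holomorphic
      exp_strip_bound(4)[OF order_refl] by (auto simp: o_def strip_def intro: holomorphic_intros)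
  then show ?thesis unfolding etheta_def by (intro holomorphic_intros) auto
qed

text \<open>On the right half \<open>ctheta\<close> decays fast and the subtracted term determines
  the rate \<open>1 / 2\<close>; \<open>etheta_uminus\<close> carries the bound to the left
  half.\<close>

lemma etheta_decay:
  assumes "\<theta> < pi / 4"
  obtains C where "C > 0" "\<And>\<zeta>. \<bar>Im \<zeta>\<bar> \<le> \<theta> \<Longrightarrow> norm (etheta z \<zeta>) \<le> C * exp (- \<bar>Re \<zeta>\<bar> / 2)"
proof (cases "\<theta> \<ge> 0")
  case False
  then show ?thesis by (intro that[of 1]) auto
next
  case True
  have k: "cos (2 * \<theta>) > 0" using assms True by (intro cos_gt_zero_pi) auto
  have half: "\<exists>C>0. \<forall>\<zeta>. \<bar>Im \<zeta>\<bar> \<le> \<theta> \<and> Re \<zeta> \<ge> 0 \<longrightarrow> norm (etheta z \<zeta>) \<le> C * exp (- \<bar>Re \<zeta>\<bar> / 2)" for z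
  proof -
    obtain C where C: "C > 0" "\<And>\<beta>. Re (\<beta>\<^sup>2) \<ge> cos (2 * \<theta>) * (norm \<beta>)\<^sup>2 \<Longrightarrow> norm \<beta> \<ge> 1 \<Longrightarrow> norm (ctheta z \<beta>) \<le> C * exp (- 1 * norm \<beta>)"
      using ctheta_decay[OF k, of z 1] by metis
    show ?thesis
    proof (intro exI[of _ "C + norm (exp (z\<^sup>2 / 4))"] conjI allI impI)
      show "C + norm (exp (z\<^sup>2 / 4)) > 0" using C(1) by (simp add: add_pos_nonneg)
      fix \<zeta> assume z: "\<bar>Im \<zeta>\<bar> \<le> \<theta> \<and> Re \<zeta> \<ge> 0"
      have "norm (ctheta z (exp \<zeta>)) \<le> C * exp (- 1 * norm (exp \<zeta>))"
        by (rule C(2)) (use z exp_strip_bound[OF _ assms] in auto)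
      also have "\<dots> \<le> C * exp (- Re \<zeta>)"
      proof -
        have "Re \<zeta> \<le> exp (Re \<zeta>)" using exp_ge_add_one_self[of "Re \<zeta>"] by linarith
        then show ?thesis using C(1) by simp
      qed
      finally have 1: "norm (ctheta z (exp \<zeta>)) \<le> C * exp (- Re \<zeta>)" .
      have 2: "norm (exp (z\<^sup>2 / 4) * exp (- \<zeta>) / 2) \<le> norm (exp (z\<^sup>2 / 4)) * exp (- Re \<zeta>)"
        by (simp add: norm_mult norm_divide)
      have "norm (etheta z \<zeta>) = exp (Re \<zeta> / 2) * norm (ctheta z (exp \<zeta>) - exp (z\<^sup>2 / 4) * exp (- \<zeta>) / 2)"
        by (simp add: etheta_def norm_mult)
      also have "\<dots> \<le> exp (Re \<zeta> / 2) * ((C + norm (exp (z\<^sup>2 / 4))) * exp (- Re \<zeta>))"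
        using norm_triangle_ineq4[of "ctheta z (exp \<zeta>)" "exp (z\<^sup>2 / 4) * exp (- \<zeta>) / 2"] 1 2
        by (intro mult_left_mono) (auto simp: algebra_simps)
      also have "\<dots> = (C + norm (exp (z\<^sup>2 / 4))) * (exp (Re \<zeta> / 2) * exp (- Re \<zeta>))" by simp
      also have "exp (Re \<zeta> / 2) * exp (- Re \<zeta>) = exp (- \<bar>Re \<zeta>\<bar> / 2)"
        using z by (simp flip: exp_add)
      finally show "norm (etheta z \<zeta>) \<le> (C + norm (exp (z\<^sup>2 / 4))) * exp (- \<bar>Re \<zeta>\<bar> / 2)" .
    qed
  qed
  obtain C1 where C1: "C1 > 0" "\<And>\<zeta>. \<bar>Im \<zeta>\<bar> \<le> \<theta> \<Longrightarrow> Re \<zeta> \<ge> 0 \<Longrightarrow> norm (etheta z \<zeta>) \<le> C1 * exp (- \<bar>Re \<zeta>\<bar> / 2)"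
    using half[of z] by blast
  obtain C2 where C2: "C2 > 0" "\<And>\<zeta>. \<bar>Im \<zeta>\<bar> \<le> \<theta> \<Longrightarrow> Re \<zeta> \<ge> 0 \<Longrightarrow> norm (etheta (\<i> * z) \<zeta>) \<le> C2 * exp (- \<bar>Re \<zeta>\<bar> / 2)"
    using half[of "\<i> * z"] by blast
  show ?thesis
  proof (rule that[of "C1 + norm (exp (z\<^sup>2 / 4)) * C2"])
    show "C1 + norm (exp (z\<^sup>2 / 4)) * C2 > 0" using C1(1) C2(1) by (simp add: add_pos_nonneg)
    fix \<zeta> :: complex assume z: "\<bar>Im \<zeta>\<bar> \<le> \<theta>"
    show "norm (etheta z \<zeta>) \<le> (C1 + norm (exp (z\<^sup>2 / 4)) * C2) * exp (- \<bar>Re \<zeta>\<bar> / 2)"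
    proof (cases "Re \<zeta> \<ge> 0")
      case True
      have "C1 * exp (- \<bar>Re \<zeta>\<bar> / 2) \<le> (C1 + norm (exp (z\<^sup>2 / 4)) * C2) * exp (- \<bar>Re \<zeta>\<bar> / 2)"
        using C2(1) by (intro mult_right_mono) auto
      then show ?thesis using C1(2)[OF z True] by linarith
    next
      case False
      have "etheta z \<zeta> = exp (z\<^sup>2 / 4) * etheta (\<i> * z) (- \<zeta>)"
        using etheta_uminus[of "- \<zeta>" z] z assms by (simp add: strip_def)
      moreover have "norm (etheta (\<i> * z) (- \<zeta>)) \<le> C2 * exp (- \<bar>Re (- \<zeta>)\<bar> / 2)"
        by (rule C2(2)) (use z False in auto)
      ultimately have "norm (etheta z \<zeta>) \<le> norm (exp (z\<^sup>2 / 4)) * (C2 * exp (- \<bar>Re \<zeta>\<bar> / 2))"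
        by (simp add: norm_mult mult_left_mono del: norm_exp_eq_Re)
      also have "\<dots> \<le> (C1 + norm (exp (z\<^sup>2 / 4)) * C2) * exp (- \<bar>Re \<zeta>\<bar> / 2)"
        using C1(1) by (simp add: algebra_simps)
      finally show ?thesis .
    qed
  qed
qed

lemma ctheta_cnj: "cnj (ctheta z \<beta>) = ctheta (cnj z) (cnj \<beta>)"
proof -
  have "cnj (ctheta_term z n \<beta>) = ctheta_term (cnj z) n (cnj \<beta>)" for n
    unfolding ctheta_term_def cosh_def scaleR_conv_of_real by (simp add: exp_cnj)
  then show ?thesis unfolding ctheta_def infsum_cnj[symmetric] by simp
qed

lemma etheta_cnj: "cnj (etheta z \<zeta>) = etheta (cnj z) (cnj \<zeta>)"
  unfolding etheta_def by (simp add: ctheta_cnj exp_cnj)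

section \<open>Mellin transform of the theta function\<close>

text \<open>Expanding \<open>exp (p * y)\<close> and integrating term by term yields a power series
  in \<open>p\<close>. Decay of \<open>k\<close> beyond every exponential makes it converge
  everywhere.\<close>

lemma laplace_transform_entire:
  fixes k :: "real \<Rightarrow> complex"
  assumes meas: "k \<in> borel_measurable borel"
    and bnd: "\<And>N. \<exists>C. \<forall>y. norm (k y) \<le> C * exp (- N * \<bar>y\<bar>)"
  shows "integrable lborel (\<lambda>y. k y * exp (p * of_real y))"
    and "(\<lambda>p. LBINT y. k y * exp (p * of_real y)) holomorphic_on UNIV"
proof -
  have i1: "integrable lborel (\<lambda>y. norm (k y) * exp (R * \<bar>y\<bar>))" for R
  proof -
    obtain C where C: "\<And>y. norm (k y) \<le> C * exp (- (R + 1) * \<bar>y\<bar>)" using bnd[of "R + 1"] by blast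
    show ?thesis
    proof (rule Bochner_Integration.integrable_bound)
      show "integrable lborel (\<lambda>y. C * exp (- 1 * \<bar>y\<bar>))" by (intro integrable_mult_right integrable_exp_neg_abs) simp
      show "(\<lambda>y. norm (k y) * exp (R * \<bar>y\<bar>)) \<in> borel_measurable lborel" using meas by measurable
      show "AE y in lborel. norm (norm (k y) * exp (R * \<bar>y\<bar>)) \<le> norm (C * exp (- 1 * \<bar>y\<bar>))"
      proof (rule AE_I2)
        fix y
        have "norm (k y) * exp (R * \<bar>y\<bar>) \<le> C * exp (- (R + 1) * \<bar>y\<bar>) * exp (R * \<bar>y\<bar>)"
          by (intro mult_right_mono C) simp
        also have "\<dots> = C * exp (- 1 * \<bar>y\<bar>)" by (simp add: algebra_simps flip: exp_add)
        finally show "norm (norm (k y) * exp (R * \<bar>y\<bar>)) \<le> norm (C * exp (- 1 * \<bar>y\<bar>))" by (simp add: abs_le_iff)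
      qed
    qed
  qed
  define f where "f = (\<lambda>p n y. k y * ((p * of_real y) ^ n / fact n))"
  have nf: "norm (f p n y) = norm (k y) * ((norm p * \<bar>y\<bar>) ^ n / fact n)" for p n y
    by (simp add: f_def norm_mult norm_divide norm_power)
  have term_le: "(norm p * \<bar>y\<bar>) ^ n / fact n \<le> exp (norm p * \<bar>y\<bar>)" for p :: complex and n y
  proof -
    have s: "(\<lambda>n. (norm p * \<bar>y\<bar>) ^ n / fact n) sums exp (norm p * \<bar>y\<bar>)"
      using exp_converges[of "norm p * \<bar>y\<bar>"] by (simp add: divide_inverse mult.commute)
    have "sum (\<lambda>n. (norm p * \<bar>y\<bar>) ^ n / fact n) {n} \<le> exp (norm p * \<bar>y\<bar>)"
      using sum_le_suminf[OF sums_summable[OF s], of "{n}"] sums_unique[OF s] by simp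
    then show ?thesis by simp
  qed
  have fi: "integrable lborel (f p n)" for p n
  proof (rule Bochner_Integration.integrable_bound[OF i1[of "norm p"]])
    show "f p n \<in> borel_measurable lborel" unfolding f_def using meas by measurable
    show "AE y in lborel. norm (f p n y) \<le> norm (norm (k y) * exp (norm p * \<bar>y\<bar>))"
    proof (rule AE_I2)
      fix y
      have "norm (k y) * ((norm p * \<bar>y\<bar>) ^ n / fact n) \<le> norm (k y) * exp (norm p * \<bar>y\<bar>)"
        by (rule mult_left_mono[OF term_le]) simp
      then show "norm (f p n y) \<le> norm (norm (k y) * exp (norm p * \<bar>y\<bar>))" unfolding nf by simp
    qed
  qed
  have ks: "(\<lambda>n. norm (k y) * ((norm p * \<bar>y\<bar>) ^ n / fact n)) sums (norm (k y) * exp (norm p * \<bar>y\<bar>))" for p :: complex and y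
    using exp_converges[of "norm p * \<bar>y\<bar>"] by (intro sums_mult) (simp add: divide_inverse mult.commute)
  have fs: "(\<lambda>n. f p n y) sums (k y * exp (p * of_real y))" for p y
    unfolding f_def using exp_converges[of "p * of_real y"] by (intro sums_mult) (simp add: scaleR_conv_of_real divide_inverse mult.commute)
  have nsum: "(\<lambda>n. norm (f p n y)) summable_on UNIV" for p y
    unfolding nf using ks[of y p] by (intro norm_summable_imp_summable_on) (simp add: sums_iff)
  have inf: "(\<Sum>\<^sub>\<infinity>n. f p n y) = k y * exp (p * of_real y)" for p y
    using sums_unique2[OF fs has_sum_imp_sums[OF has_sum_infsum[OF abs_summable_summable[OF nsum]]], of y p] by simp
  have isum: "(\<lambda>n. LBINT y. norm (f p n y)) summable_on UNIV" for p
  proof (rule nonneg_bdd_above_summable_on)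
    show "bdd_above (sum (\<lambda>n. LBINT y. norm (f p n y)) ` {F. F \<subseteq> UNIV \<and> finite F})"
    proof (rule bdd_aboveI2)
      fix F :: "nat set" assume F: "F \<in> {F. F \<subseteq> UNIV \<and> finite F}"
      have "(\<Sum>n\<in>F. LBINT y. norm (f p n y)) = (LBINT y. (\<Sum>n\<in>F. norm (f p n y)))"
        by (rule Bochner_Integration.integral_sum[symmetric]) (auto intro: fi)
      also have "\<dots> \<le> (LBINT y. norm (k y) * exp (norm p * \<bar>y\<bar>))"
      proof (rule integral_mono)
        show "integrable lborel (\<lambda>y. \<Sum>n\<in>F. norm (f p n y))" by (intro Bochner_Integration.integrable_sum integrable_norm fi)
        show "integrable lborel (\<lambda>y. norm (k y) * exp (norm p * \<bar>y\<bar>))" by (rule i1)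
        fix y
        show "(\<Sum>n\<in>F. norm (f p n y)) \<le> norm (k y) * exp (norm p * \<bar>y\<bar>)"
          unfolding nf sums_unique[OF ks]
          by (rule sum_le_suminf) (use F ks[of y p] in \<open>auto simp: sums_iff\<close>)
      qed
      finally show "(\<Sum>n\<in>F. LBINT y. norm (f p n y)) \<le> (LBINT y. norm (k y) * exp (norm p * \<bar>y\<bar>))" .
    qed
  qed simp
  have ii: "integrable lborel (\<lambda>y. \<Sum>\<^sub>\<infinity>n. f p n y)"
    "((\<lambda>n. LBINT y. f p n y) has_sum (LBINT y. (\<Sum>\<^sub>\<infinity>n. f p n y))) UNIV" for p
    by (rule integral_infsum[OF _ fi nsum isum]; simp)+
  show "integrable lborel (\<lambda>y. k y * exp (p * of_real y))" using ii(1)[of p] unfolding inf by simp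
  define a where "a = (\<lambda>n. LBINT y. k y * (of_real y ^ n / fact n))"
  have fa: "(LBINT y. f p n y) = a n * p ^ n" for p n
  proof -
    have "(LBINT y. f p n y) = (LBINT y. p ^ n * (k y * (of_real y ^ n / fact n)))"
      by (rule Bochner_Integration.integral_cong) (auto simp: f_def power_mult_distrib)
    then show ?thesis by (simp add: a_def mult.commute)
  qed
  have ps: "(\<lambda>n. a n * (p - 0) ^ n) sums (LBINT y. k y * exp (p * of_real y))" for p
    using has_sum_imp_sums[OF ii(2)[of p]] unfolding inf fa by simp
  have hol: "(\<lambda>p. LBINT y. k y * exp (p * of_real y)) holomorphic_on ball 0 r" for r
    by (rule power_series_holomorphic[of 0 r a]) (use ps in auto)
  show "(\<lambda>p. LBINT y. k y * exp (p * of_real y)) holomorphic_on UNIV"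
    unfolding holomorphic_on_def
  proof
    fix p :: complex
    show "(\<lambda>p. LBINT y. k y * exp (p * of_real y)) field_differentiable at p within UNIV"
      using holomorphic_on_imp_differentiable_at[OF hol[of "norm p + 1"] open_ball, of p] by simp
  qed
qed

text \<open>Euler's integral for \<open>Gamma (q / 2)\<close> under the substitution
  \<open>t = pi * exp (2 * y)\<close>.\<close>

lemma gamma_moment:
  fixes q :: complex
  assumes q: "Re q > 0"
  shows "has_bochner_integral lborel (\<lambda>y::real. exp (- of_real (pi * exp (2 * y))) * exp (q * of_real y)) (of_real pi powr (- q / 2) * Gamma (q / 2) / 2)"
proof -
  define w where "w = q / 2"
  have w: "Re w > 0" using q by (simp add: w_def)
  define F where "F = (\<lambda>t::real. complex_of_real t powr (w - 1) / of_real (exp t))"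
  define g where "g = (\<lambda>y::real. pi * exp (2 * y))"
  define h where "h = (\<lambda>y::real. exp (- complex_of_real (pi * exp (2 * y))) * exp (q * of_real y))"
  have gd: "(g has_field_derivative 2 * g y) (at y within UNIV)" for y
    unfolding g_def by (auto intro!: derivative_eq_intros)
  have gi: "inj g" unfolding g_def by (auto simp: inj_def)
  have gr: "range g = {0<..}"
  proof -
    have "t = g (ln (t / pi) / 2)" if "t > 0" for t using that by (simp add: g_def)
    then have "{0<..} \<subseteq> range g" by blast
    moreover have "range g \<subseteq> {0<..}" by (auto simp: g_def)
    ultimately show ?thesis by blast
  qed
  have eq: "\<bar>2 * g y\<bar> *\<^sub>R F (g y) = 2 * of_real pi powr w * h y" for y
  proof -
    have gp: "g y > 0" by (simp add: g_def)
    have lg: "ln (g y) = ln pi + 2 * y" by (simp add: g_def ln_mult)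
    have "of_real (g y) powr w = complex_of_real (g y) powr (w - 1) * of_real (g y)"
      using gp by (simp add: powr_diff)
    then have "\<bar>2 * g y\<bar> *\<^sub>R F (g y) = 2 * (of_real (g y) powr w) / of_real (exp (g y))"
      using gp by (simp add: F_def scaleR_conv_of_real)
    also have "complex_of_real (g y) powr w = exp (w * of_real (ln (g y)))"
      using gp by (simp add: powr_def Ln_of_real)
    also have "\<dots> = of_real pi powr w * exp (q * of_real y)"
      unfolding lg by (simp add: powr_def Ln_of_real w_def algebra_simps exp_add)
    finally have 1: "\<bar>2 * g y\<bar> *\<^sub>R F (g y) = 2 * (of_real pi powr w * exp (q * of_real y)) / exp (of_real (g y))"
      by (simp only: exp_of_real)
    have gy: "pi * exp (2 * y) = g y" by (simp add: g_def)
    show ?thesis unfolding 1 h_def gy exp_minus divide_inverse by (simp only: mult_ac)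
  qed
  \<comment> \<open>The change of variables is applied to real integrands, so it is carried out for
    an arbitrary bounded real functional \<open>r\<close> and then used with \<open>Re\<close> and
    \<open>Im\<close>.\<close>
  have part: "has_bochner_integral lborel (\<lambda>y. r (2 * of_real pi powr w * h y)) (r (Gamma w))"
    if r: "bounded_linear r" for r :: "complex \<Rightarrow> real"
  proof -
    have 1: "(\<lambda>t. r (F t)) absolutely_integrable_on {0<..}"
      using absolutely_integrable_linear[OF absolutely_integrable_Gamma_integral'[OF w] r] by (simp add: F_def o_def)
    have 2: "integral {0<..} (\<lambda>t. r (F t)) = r (Gamma w)"
      using has_integral_linear[OF Gamma_integral_complex'[OF w] r] by (simp add: F_def o_def integral_unique)
    have "(\<lambda>y. \<bar>2 * g y\<bar> * r (F (g y))) absolutely_integrable_on UNIV \<and> integral UNIV (\<lambda>y. \<bar>2 * g y\<bar> * r (F (g y))) = r (Gamma w)"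
      by (subst has_absolute_integral_change_of_variables_1'[of UNIV g "\<lambda>y. 2 * g y"]) (use gd gi gr 1 2 in auto)
    moreover have "\<bar>2 * g y\<bar> * r (F (g y)) = r (2 * of_real pi powr w * h y)" for y
      using linear_scale[OF bounded_linear.linear[OF r]] eq[of y, symmetric] by simp
    ultimately have 3: "(\<lambda>y. r (2 * of_real pi powr w * h y)) absolutely_integrable_on UNIV" "integral UNIV (\<lambda>y. r (2 * of_real pi powr w * h y)) = r (Gamma w)"
      by auto
    have m: "(\<lambda>y. r (2 * of_real pi powr w * h y)) \<in> borel_measurable lborel"
    proof -
      have "continuous_on UNIV (\<lambda>y. r (2 * of_real pi powr w * h y))"
        unfolding h_def by (intro bounded_linear.continuous_on[OF r] continuous_intros)
      then show ?thesis using borel_measurable_continuous_onI by simp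
    qed
    have 4: "integrable lborel (\<lambda>y. r (2 * of_real pi powr w * h y))"
      using 3(1) integrable_completion[OF m] by (simp add: set_integrable_def)
    show ?thesis
      using 4 integral_lborel[OF 4] 3(2) by (simp add: has_bochner_integral_iff)
  qed
  have "has_bochner_integral lborel (\<lambda>y. of_real (Re (2 * of_real pi powr w * h y)) + \<i> * of_real (Im (2 * of_real pi powr w * h y)))
      (of_real (Re (Gamma w)) + \<i> * of_real (Im (Gamma w)))"
    by (intro has_bochner_integral_add has_bochner_integral_mult_right has_bochner_integral_of_real part bounded_linear_Re bounded_linear_Im)
  then have "has_bochner_integral lborel (\<lambda>y. 2 * of_real pi powr w * h y) (Gamma w)"
    by (simp only: complex_eq[symmetric])
  then have "has_bochner_integral lborel (\<lambda>y. (1 / (2 * of_real pi powr w)) * (2 * of_real pi powr w * h y)) ((1 / (2 * of_real pi powr w)) * Gamma w)"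
    by (rule has_bochner_integral_mult_right)
  moreover have "(1 / (2 * of_real pi powr w)) * (2 * of_real pi powr w * h y) = h y" for y by simp
  moreover have "(1 / (2 * of_real pi powr w)) * Gamma w = of_real pi powr (- q / 2) * Gamma (q / 2) / 2"
  proof -
    have "- q / 2 = - w" by (simp add: w_def)
    then show ?thesis by (simp add: powr_minus w_def[symmetric] field_simps)
  qed
  ultimately have "has_bochner_integral lborel h (of_real pi powr (- q / 2) * Gamma (q / 2) / 2)" by (simp only:)
  then show ?thesis by (simp only: h_def)
qed

section \<open>Riemann's continuation of the Mellin transform\<close>

lemma exp_real_sector: "Re ((exp (complex_of_real y))\<^sup>2) \<ge> 1 * (norm (exp (complex_of_real y)))\<^sup>2" "Re ((exp (complex_of_real y))\<^sup>2) > 0"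
proof -
  have "(exp (complex_of_real y))\<^sup>2 = of_real ((exp y)\<^sup>2)" by (simp add: exp_of_real)
  then have r: "Re ((exp (complex_of_real y))\<^sup>2) = (exp y)\<^sup>2" by (simp only: Re_complex_of_real)
  show "Re ((exp (complex_of_real y))\<^sup>2) \<ge> 1 * (norm (exp (complex_of_real y)))\<^sup>2" unfolding r by simp
  show "Re ((exp (complex_of_real y))\<^sup>2) > 0" unfolding r by simp
qed

lemma ctheta_exp_continuous: "continuous_on UNIV (\<lambda>y. ctheta z (exp (complex_of_real y)))"
  by (rule continuous_on_compose2[OF holomorphic_on_imp_continuous_on[OF ctheta_holomorphic]])
     (use exp_real_sector(2) in \<open>auto intro!: continuous_intros\<close>)

lemma ctheta_exp_measurable[measurable]: "(\<lambda>y. ctheta z (exp (complex_of_real y))) \<in> borel_measurable borel"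
  by (rule borel_measurable_continuous_onI[OF ctheta_exp_continuous])

text \<open>The part of the Mellin integral over arguments \<open>exp y\<close> of at least 1, where
  the decay of \<open>ctheta\<close> makes it entire in \<open>p\<close>.\<close>

definition atheta :: "complex \<Rightarrow> complex \<Rightarrow> complex" where
  "atheta z p = (LBINT y. (indicator {0..} y *\<^sub>R ctheta z (exp (of_real y))) * exp (p * of_real y))"

lemma ctheta_exp_bound: "\<exists>C. \<forall>y. norm (indicator {0..} y *\<^sub>R ctheta z (exp (complex_of_real y))) \<le> C * exp (- N * \<bar>y\<bar>)"
proof -
  obtain C where C: "C > 0" "\<And>\<beta>. Re (\<beta>\<^sup>2) \<ge> 1 * (norm \<beta>)\<^sup>2 \<Longrightarrow> norm \<beta> \<ge> 1 \<Longrightarrow> norm (ctheta z \<beta>) \<le> C * exp (- \<bar>N\<bar> * norm \<beta>)"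
    using ctheta_decay[of 1 z "\<bar>N\<bar>"] by (metis zero_less_one)
  have "norm (indicator {0..} y *\<^sub>R ctheta z (exp (complex_of_real y))) \<le> C * exp (- N * \<bar>y\<bar>)" for y
  proof (cases "y \<ge> 0")
    case True
    have "norm (ctheta z (exp (complex_of_real y))) \<le> C * exp (- \<bar>N\<bar> * norm (exp (complex_of_real y)))"
      by (rule C(2)[OF exp_real_sector(1)]) (use True in simp)
    also have "\<dots> \<le> C * exp (- N * \<bar>y\<bar>)"
    proof -
      have "N * y \<le> \<bar>N\<bar> * y" using True by (intro mult_right_mono) auto
      also have "\<dots> \<le> \<bar>N\<bar> * exp y" 
      proof (intro mult_left_mono)
        show "y \<le> exp y" using exp_ge_add_one_self[of y] by linarith
      qed simp
      finally show ?thesis using C(1) True by simp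
    qed
    finally show ?thesis using True by simp
  qed (use C(1) in simp)
  then show ?thesis by blast
qed

lemma atheta_integrable: "integrable lborel (\<lambda>y. (indicator {0..} y *\<^sub>R ctheta z (exp (of_real y))) * exp (p * of_real y))"
  by (rule laplace_transform_entire(1)[OF _ ctheta_exp_bound]) measurable

lemma atheta_bochner: "has_bochner_integral lborel (\<lambda>y. (indicator {0..} y *\<^sub>R ctheta z (exp (of_real y))) * exp (p * of_real y)) (atheta z p)"
  using atheta_integrable by (simp add: has_bochner_integral_iff atheta_def)

lemma atheta_holomorphic: "atheta z holomorphic_on UNIV"
  unfolding atheta_def by (rule laplace_transform_entire(2)[OF _ ctheta_exp_bound]) measurable

lemma atheta_holomorphic_compose[holomorphic_intros]: "g holomorphic_on A \<Longrightarrow> (\<lambda>p. atheta z (g p)) holomorphic_on A"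
  using holomorphic_on_compose_gen[OF _ atheta_holomorphic, of g A] by (simp add: o_def)

text \<open>Riemann's form of the continued Mellin transform: the part with \<open>y < 0\<close> is
  folded back by \<open>ctheta_inversion\<close>, whose two elementary terms integrate to the poles
  at 1 and 0.\<close>

definition ltheta :: "complex \<Rightarrow> complex \<Rightarrow> complex" where
  "ltheta z p = atheta z p + exp (z\<^sup>2 / 4) * atheta (\<i> * z) (1 - p) + exp (z\<^sup>2 / 4) / (2 * (p - 1)) - 1 / (2 * p)"

lemma ltheta_holomorphic: "ltheta z holomorphic_on - {0, 1}"
  unfolding ltheta_def by (intro holomorphic_intros) auto

lemma has_bochner_integral_split_at_0:
  fixes f :: "real \<Rightarrow> complex"
  assumes 1: "has_bochner_integral lborel (\<lambda>y. indicator {0..} y *\<^sub>R f y) a"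
    and 2: "has_bochner_integral lborel (\<lambda>y. indicator {0..} y *\<^sub>R f (- y)) b"
    and m: "f \<in> borel_measurable borel"
  shows "has_bochner_integral lborel f (a + b)"
proof -
  have 3: "has_bochner_integral lborel (\<lambda>y. indicator {0..} (- y) *\<^sub>R f y) b"
    using lborel_has_bochner_integral_real_affine_iff[of "-1" "\<lambda>y. indicator {0..} (- y) *\<^sub>R f y" b 0] 2 by simp
  have 4: "has_bochner_integral lborel (\<lambda>y. indicator {0..} y *\<^sub>R f y + indicator {0..} (- y) *\<^sub>R f y) (a + b)"
    by (rule has_bochner_integral_add[OF 1 3])
  have ae: "AE y in lborel. indicator {0..} y *\<^sub>R f y + indicator {0..} (- y) *\<^sub>R f y = f y"
    using AE_lborel_singleton[of 0] by eventually_elim (auto simp: indicator_def)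
  have m2: "(\<lambda>y. indicator {0..} y *\<^sub>R f y + indicator {0..} (- y) *\<^sub>R f y) \<in> borel_measurable lborel"
    using 4 by (auto simp: has_bochner_integral_iff)
  from m m2 have ms: "f \<in> borel_measurable lborel" "(\<lambda>y. indicator {0..} y *\<^sub>R f y + indicator {0..} (- y) *\<^sub>R f y) \<in> borel_measurable lborel" by simp_all
  show ?thesis
    using 4 integrable_cong_AE[OF ms(2,1) ae] integral_cong_AE[OF ms(2,1) ae]
    unfolding has_bochner_integral_iff by simp
qed

lemma ctheta_exp_uminus:
  "ctheta z (exp (- complex_of_real y)) = exp (of_real y) * exp (z\<^sup>2 / 4) * ctheta (\<i> * z) (exp (of_real y)) + exp (of_real y) * exp (z\<^sup>2 / 4) / 2 - 1 / 2"
proof -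
  have "Re (exp (complex_of_real y)) > 0" by (simp add: Re_exp)
  from ctheta_inversion[OF exp_real_sector(2) this, of z]
  show ?thesis by (simp add: exp_minus inverse_eq_divide)
qed

lemma mellin_ctheta_ltheta:
  assumes p: "Re p > 1"
  shows "has_bochner_integral lborel (\<lambda>y. ctheta z (exp (of_real y)) * exp (p * of_real y)) (ltheta z p)"
proof -
  let ?f = "\<lambda>y. ctheta z (exp (complex_of_real y)) * exp (p * of_real y)"
  have 1: "has_bochner_integral lborel (\<lambda>y. indicator {0..} y *\<^sub>R ?f y) (atheta z p)"
    using atheta_bochner[of z p] by simp
  have "has_bochner_integral lborel (\<lambda>y. exp (z\<^sup>2 / 4) * ((indicator {0..} y *\<^sub>R ctheta (\<i> * z) (exp (of_real y))) * exp ((1 - p) * of_real y))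
      + (exp (z\<^sup>2 / 4) / 2) * (indicator {0..} y *\<^sub>R exp (- (p - 1) * of_real y)) - (1 / 2) * (indicator {0..} y *\<^sub>R exp (- p * of_real y)))
     (exp (z\<^sup>2 / 4) * atheta (\<i> * z) (1 - p) + (exp (z\<^sup>2 / 4) / 2) * (1 / (p - 1)) - (1 / 2) * (1 / p))"
    by (intro has_bochner_integral_diff has_bochner_integral_add has_bochner_integral_mult_right atheta_bochner integral_exp_atLeast_0)
       (use p in auto)
  also have "(\<lambda>y. exp (z\<^sup>2 / 4) * ((indicator {0..} y *\<^sub>R ctheta (\<i> * z) (exp (of_real y))) * exp ((1 - p) * of_real y))
      + (exp (z\<^sup>2 / 4) / 2) * (indicator {0..} y *\<^sub>R exp (- (p - 1) * of_real y)) - (1 / 2) * (indicator {0..} y *\<^sub>R exp (- p * of_real y))) =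
     (\<lambda>y. indicator {0..} y *\<^sub>R ?f (- y))"
  proof
    fix y :: real
    have e: "exp ((1 - p) * of_real y) = exp (of_real y) * exp (- (p * of_real y))" 
      "exp (- (p - 1) * of_real y) = exp (of_real y) * exp (- (p * of_real y))"
      by (simp_all add: algebra_simps flip: exp_add)
    have "?f (- y) = exp (z\<^sup>2 / 4) * (ctheta (\<i> * z) (exp (of_real y)) * exp ((1 - p) * of_real y)) + (exp (z\<^sup>2 / 4) / 2) * exp (- (p - 1) * of_real y) - (1 / 2) * exp (- p * of_real y)"
      unfolding e by (simp add: ctheta_exp_uminus algebra_simps)
    then show "exp (z\<^sup>2 / 4) * ((indicator {0..} y *\<^sub>R ctheta (\<i> * z) (exp (of_real y))) * exp ((1 - p) * of_real y))
      + (exp (z\<^sup>2 / 4) / 2) * (indicator {0..} y *\<^sub>R exp (- (p - 1) * of_real y)) - (1 / 2) * (indicator {0..} y *\<^sub>R exp (- p * of_real y)) =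
       indicator {0..} y *\<^sub>R ?f (- y)" by (cases "y \<ge> 0") auto
  qed
  finally have 2: "has_bochner_integral lborel (\<lambda>y. indicator {0..} y *\<^sub>R ?f (- y))
     (exp (z\<^sup>2 / 4) * atheta (\<i> * z) (1 - p) + (exp (z\<^sup>2 / 4) / 2) * (1 / (p - 1)) - (1 / 2) * (1 / p))" .
  have m: "?f \<in> borel_measurable borel" by measurable
  from has_bochner_integral_split_at_0[OF 1 2 m] show ?thesis
    by (simp add: ltheta_def algebra_simps)
qed

section \<open>The confluent hypergeometric function and the zeta function\<close>

lemma summable_hyp_1F1_real:
  fixes a x :: real
  assumes a: "a > 0" and x: "x \<ge> 0"
  shows "summable (\<lambda>n. pochhammer a n * x ^ n / (pochhammer (1 / 2) n * fact n))"
proof -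
  let ?f = "\<lambda>n. pochhammer a n * x ^ n / (pochhammer (1 / 2) n * fact n)"
  \<comment> \<open>Since \<open>(a + n) / (1 / 2 + n) \<le> 2 * a + 1\<close>, the ratio of
    consecutive terms is at most \<open>(2 * a + 1) * x / (n + 1)\<close>, hence at most
    \<open>1 / 2\<close> from here on.\<close>
  define N where "N = nat \<lceil>2 * (2 * a + 1) * x\<rceil>"
  show ?thesis
  proof (rule summable_ratio_test[of "1/2" N])
    fix n assume n: "n \<ge> N"
    have pos: "pochhammer a n \<ge> 0" "pochhammer (1 / 2 :: real) n > 0" using a by (auto intro: pochhammer_nonneg pochhammer_pos)
    have nn: "2 * (2 * a + 1) * x \<le> real n" using n unfolding N_def by linarith
    have fs: "?f (Suc n) = ((a + n) * x / ((1 / 2 + n) * (n + 1))) * ?f n"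
      using pos by (simp add: pochhammer_Suc field_simps)
    have "a + n \<le> (2 * a + 1) * (1 / 2 + n)" using a by (simp add: algebra_simps)
    then have "(a + n) * x \<le> (2 * a + 1) * (1 / 2 + n) * x" using x by (intro mult_right_mono) auto
    also have "\<dots> = (1 / 2 + n) * (1/2) * (2 * (2 * a + 1) * x)" by (simp add: algebra_simps)
    also have "\<dots> \<le> (1 / 2 + n) * (1/2) * (n + 1)" using nn by (intro mult_left_mono) auto
    finally have "(a + n) * x / ((1 / 2 + n) * (n + 1)) \<le> 1 / 2" by (simp add: divide_le_eq mult_ac)
    moreover have "?f n \<ge> 0" using pos x by simp
    ultimately have "((a + n) * x / ((1 / 2 + n) * (n + 1))) * ?f n \<le> 1 / 2 * ?f n" by (intro mult_right_mono) auto
    moreover have "?f (Suc n) \<ge> 0" using a x by (auto intro!: divide_nonneg_nonneg mult_nonneg_nonneg pochhammer_nonneg)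
    ultimately have "norm (?f (Suc n)) = ?f (Suc n)" "norm (?f n) = ?f n" "?f (Suc n) \<le> 1 / 2 * ?f n"
      using \<open>?f n \<ge> 0\<close> fs by (simp_all only: real_norm_def abs_of_nonneg)
    then show "norm (?f (Suc n)) \<le> 1 / 2 * norm (?f n)" by (simp only:)
  qed simp
qed

lemma norm_pochhammer_le:
  fixes a :: complex
  assumes "norm a \<le> R" shows "norm (pochhammer a n) \<le> pochhammer R n"
  unfolding pochhammer_prod prod_norm[symmetric]
proof (rule prod_mono)
  fix i :: nat
  show "0 \<le> norm (a + of_nat i) \<and> norm (a + of_nat i) \<le> R + of_nat i"
    using norm_triangle_ineq[of a "of_nat i"] assms by auto
qed

lemma pochhammer_half_complex: "pochhammer (1/2 :: complex) n = of_real (pochhammer (1/2) n)"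
  by (metis pochhammer_of_real of_real_divide of_real_1 of_real_numeral)

lemma norm_hyp_term_le:
  fixes a w :: complex
  assumes "norm a \<le> R"
  shows "norm (pochhammer a n * w ^ n / (pochhammer (1/2) n * fact n)) \<le> pochhammer R n * (norm w) ^ n / (pochhammer (1 / 2) n * fact n)"
proof -
  note pochhammer_half_complex[of n]
  moreover have "pochhammer (1/2 :: real) n > 0" by (rule pochhammer_pos) simp
  ultimately have n2: "norm (pochhammer (1/2 :: complex) n) = pochhammer (1/2) n" by simp
  show ?thesis unfolding norm_divide norm_mult norm_power n2 norm_fact
    using \<open>pochhammer (1/2 :: real) n > 0\<close>
    by (intro divide_right_mono mult_right_mono norm_pochhammer_le assms) auto
qed

lemma summable_norm_hyp_1F1: "summable (\<lambda>n. norm (pochhammer (a::complex) n * w ^ n / (pochhammer (1/2) n * fact n)))"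
proof (rule summable_comparison_test)
  show "summable (\<lambda>n. pochhammer (norm a + 1) n * (norm w) ^ n / (pochhammer (1 / 2) n * fact n))"
    by (rule summable_hyp_1F1_real) (auto intro: add_nonneg_pos)
  show "\<exists>N. \<forall>n\<ge>N. norm (norm (pochhammer a n * w ^ n / (pochhammer (1/2) n * fact n))) \<le> pochhammer (norm a + 1) n * (norm w) ^ n / (pochhammer (1 / 2) n * fact n)"
    using norm_hyp_term_le[of a "norm a + 1"] by auto
qed

lemma hyp_1F1_infsum: "hyp_1F1 a (1/2) w = (\<Sum>\<^sub>\<infinity>n. pochhammer a n * w ^ n / (pochhammer (1/2) n * fact n))"
proof -
  have "((\<lambda>n. pochhammer a n * w ^ n / (pochhammer (1/2) n * fact n)) has_sum (\<Sum>n. pochhammer a n * w ^ n / (pochhammer (1/2) n * fact n))) UNIV"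
    by (rule norm_summable_imp_has_sum[OF summable_norm_hyp_1F1 summable_sums[OF summable_norm_cancel[OF summable_norm_hyp_1F1]]])
  from infsumI[OF this] show ?thesis unfolding hyp_1F1_def by (rule sym)
qed

lemma hyp_1F1_holomorphic: "(\<lambda>a. hyp_1F1 a (1/2) w) holomorphic_on UNIV"
  unfolding hyp_1F1_infsum
proof (rule holomorphic_infsum)
  fix n show "(\<lambda>a. pochhammer a n * w ^ n / (pochhammer (1/2) n * fact n)) holomorphic_on UNIV"
  proof -
    have "pochhammer (1/2 :: complex) n \<noteq> 0"
      unfolding pochhammer_half_complex using pochhammer_pos[of "1/2 :: real" n] by simp
    then have "(\<Prod>i = 0..<n. 1 / 2 + of_nat i :: complex) * fact n \<noteq> 0" by (simp add: pochhammer_prod)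
    then show ?thesis unfolding pochhammer_prod by (intro holomorphic_intros) auto
  qed
next
  fix x :: complex
  have "norm y \<le> norm x + 1" if "y \<in> cball x 1" for y
    using that norm_triangle_ineq[of x "y - x"] by (auto simp: dist_norm norm_minus_commute)
  then have "\<forall>i\<in>UNIV. \<forall>y\<in>cball x 1. norm (pochhammer y i * w ^ i / (pochhammer (1/2) i * fact i)) \<le> pochhammer (norm x + 1) i * (norm w) ^ i / (pochhammer (1 / 2) i * fact i)"
    using norm_hyp_term_le by blast
  moreover have "(\<lambda>n. pochhammer (norm x + 1) n * (norm w) ^ n / (pochhammer (1 / 2) n * fact n)) summable_on UNIV"
  proof (rule norm_summable_imp_summable_on)
    have "pochhammer (norm x + 1) n * (norm w) ^ n / (pochhammer (1 / 2) n * fact n) \<ge> 0" for n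
      by (auto intro!: divide_nonneg_nonneg mult_nonneg_nonneg pochhammer_nonneg intro: add_nonneg_pos)
    then have "norm (pochhammer (norm x + 1) n * (norm w) ^ n / (pochhammer (1 / 2) n * fact n)) = pochhammer (norm x + 1) n * (norm w) ^ n / (pochhammer (1 / 2) n * fact n)" for n
      by (simp only: real_norm_def abs_of_nonneg)
    moreover have "summable (\<lambda>n. pochhammer (norm x + 1) n * (norm w) ^ n / (pochhammer (1 / 2) n * fact n))"
      by (rule summable_hyp_1F1_real) (auto intro: add_nonneg_pos)
    ultimately show "summable (\<lambda>n. norm (pochhammer (norm x + 1) n * (norm w) ^ n / (pochhammer (1 / 2) n * fact n)))"
      by (simp only:)
  qed
  ultimately show "\<exists>d>0. \<exists>M. M summable_on UNIV \<and> cball x d \<subseteq> UNIV \<and> (\<forall>i\<in>UNIV. \<forall>y\<in>cball x d. norm (pochhammer y i * w ^ i / (pochhammer (1/2) i * fact i)) \<le> M i)"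
    by (intro exI[of _ 1] conjI exI[of _ "\<lambda>n. pochhammer (norm x + 1) n * (norm w) ^ n / (pochhammer (1 / 2) n * fact n)"]) auto
qed auto

text \<open>Expanding \<open>cosh\<close> makes every term a Gamma moment. The rising factorial of
  \<open>p / 2\<close> comes from the Gamma quotient, that of \<open>1 / 2\<close> from
  \<open>(2 k)! = 4^k (1/2)_k k!\<close>; together they form the confluent hypergeometric
  series.\<close>

lemma mellin_ctheta_term_0:
  assumes p: "Re p > 0"
  shows "has_bochner_integral lborel (\<lambda>y. ctheta_term z 0 (exp (of_real y)) * exp (p * of_real y))
    (of_real pi powr (- p / 2) * Gamma (p / 2) / 2 * hyp_1F1 (p / 2) (1 / 2) (z\<^sup>2 / 4))"
proof -
  define s where "s = complex_of_real (sqrt pi)"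
  have s2: "s\<^sup>2 = of_real pi" by (simp add: s_def sqrt_pi_squared_complex)
  define f where "f = (\<lambda>k y. (of_real pi ^ k * z ^ (2 * k) / fact (2 * k)) * (exp (- complex_of_real (pi * exp (2 * y))) * exp ((p + 2 * of_nat k) * of_real y)))"
  define G where "G = of_real pi powr (- p / 2) * Gamma (p / 2) / 2"
  have powr_k: "of_real pi powr (- (q + 2 * of_nat k) / 2) = of_real pi powr (- q / 2) / of_real pi ^ k" for q :: complex and k
  proof -
    have "- (q + 2 * of_nat k) / 2 = - q / 2 - of_nat k" by (simp add: field_simps)
    then show ?thesis by (simp only: powr_diff powr_nat) simp
  qed
  have gam_k: "Gamma ((q + 2 * of_nat k) / 2) = Gamma (q / 2) * pochhammer (q / 2) k" if q: "Re q > 0" for q :: complex and k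
  proof -
    have "q / 2 \<notin> \<int>\<^sub>\<le>\<^sub>0" using q by (auto elim!: nonpos_Ints_cases simp: complex_eq_iff)
    then have "pochhammer (q / 2) k = Gamma (q / 2 + of_nat k) / Gamma (q / 2)" "Gamma (q / 2) \<noteq> 0"
      by (simp_all add: pochhammer_Gamma Gamma_eq_zero_iff)
    then show ?thesis by (simp add: add_divide_distrib)
  qed
  have fact_k: "fact (2 * k) = (4 ^ k * pochhammer (1/2) k * fact k :: complex)" for k
    by (simp add: fact_double power_mult)
  have pz: "a ^ (2 * k) = (a\<^sup>2) ^ k" for a :: complex and k by (simp add: power_mult)
  have base: "has_bochner_integral lborel (\<lambda>y::real. exp (- complex_of_real (pi * exp (2 * y))) * exp ((q + 2 * of_nat k) * of_real y))
     (of_real pi powr (- q / 2) / of_real pi ^ k * (Gamma (q / 2) * pochhammer (q / 2) k) / 2)" if "Re q > 0" for q k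
    using gamma_moment[of "q + 2 * of_nat k"] that unfolding powr_k gam_k[OF that] by simp
  have fint: "has_bochner_integral lborel (f k) (G * (pochhammer (p / 2) k * (z\<^sup>2 / 4) ^ k / (pochhammer (1/2) k * fact k)))" for k
  proof -
    have "has_bochner_integral lborel (f k) ((of_real pi ^ k * z ^ (2 * k) / fact (2 * k)) * (of_real pi powr (- p / 2) / of_real pi ^ k * (Gamma (p / 2) * pochhammer (p / 2) k) / 2))"
      unfolding f_def by (rule has_bochner_integral_mult_right[OF base[OF p]])
    also have "(of_real pi ^ k * z ^ (2 * k) / fact (2 * k)) * (of_real pi powr (- p / 2) / of_real pi ^ k * (Gamma (p / 2) * pochhammer (p / 2) k) / 2) =
       G * (pochhammer (p / 2) k * (z\<^sup>2 / 4) ^ k / (pochhammer (1/2) k * fact k))"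
      unfolding fact_k G_def pz by (simp add: power_divide mult_ac)
    finally show ?thesis .
  qed
  define \<sigma> where "\<sigma> = Re p"
  have sig: "\<sigma> > 0" using p by (simp add: \<sigma>_def)
  \<comment> \<open>The norm has the same shape with \<open>z\<close> and \<open>p\<close> replaced
    by \<open>norm z\<close> and \<open>Re p\<close>. The integrals of the norms are thus terms of
    another convergent hypergeometric series, which justifies the exchange.\<close>
  have nf: "norm (f k y) = Re ((of_real pi ^ k * of_real (norm z) ^ (2 * k) / fact (2 * k)) * (exp (- complex_of_real (pi * exp (2 * y))) * exp ((of_real \<sigma> + 2 * of_nat k) * of_real y)))" for k y
  proof -
    have "(of_real pi ^ k * of_real (norm z) ^ (2 * k) / fact (2 * k)) * (exp (- complex_of_real (pi * exp (2 * y))) * exp ((of_real \<sigma> + 2 * of_nat k) * of_real y))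
      = complex_of_real ((pi ^ k * (norm z) ^ (2 * k) / fact (2 * k)) * (exp (- (pi * exp (2 * y))) * exp ((\<sigma> + 2 * real k) * y)))"
      by (simp add: exp_of_real[symmetric])
    then have "Re ((of_real pi ^ k * of_real (norm z) ^ (2 * k) / fact (2 * k)) * (exp (- complex_of_real (pi * exp (2 * y))) * exp ((of_real \<sigma> + 2 * of_nat k) * of_real y))) =
      (pi ^ k * (norm z) ^ (2 * k) / fact (2 * k)) * (exp (- (pi * exp (2 * y))) * exp ((\<sigma> + 2 * real k) * y))"
      by (simp only: Re_complex_of_real)
    moreover have "norm (f k y) = (pi ^ k * (norm z) ^ (2 * k) / fact (2 * k)) * (exp (- (pi * exp (2 * y))) * exp ((\<sigma> + 2 * real k) * y))"
      by (simp add: f_def norm_mult norm_divide norm_power \<sigma>_def)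
    ultimately show ?thesis by simp
  qed
  have fsm: "summable (\<lambda>k. norm (f k y))" for y
  proof -
    define X where "X = pi * exp (2 * y) * (norm z)\<^sup>2"
    define E where "E = exp (- (pi * exp (2 * y))) * exp (\<sigma> * y)"
    have "summable (\<lambda>k. X ^ k /\<^sub>R fact k)" by (rule summable_exp_generic)
    then have s1: "summable (\<lambda>k. X ^ k / fact k * E)" by (intro summable_mult2) (simp add: divide_inverse mult.commute)
    have "norm (f k y) \<le> X ^ k / fact k * E" for k
    proof -
      have e: "exp ((\<sigma> + 2 * real k) * y) = exp (2 * y) ^ k * exp (\<sigma> * y)"
        by (simp add: exp_of_nat2_mult[symmetric] algebra_simps flip: exp_add)
      have "norm (f k y) = (pi ^ k * (norm z) ^ (2 * k) / fact (2 * k)) * (exp (- (pi * exp (2 * y))) * exp ((\<sigma> + 2 * real k) * y))"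
        by (simp add: f_def norm_mult norm_divide norm_power \<sigma>_def)
      then have "norm (f k y) = X ^ k / fact (2 * k) * E" unfolding e X_def E_def by (simp add: power_mult_distrib power_mult)
      also have "\<dots> \<le> X ^ k / fact k * E"
      proof (intro mult_right_mono divide_left_mono)
        show "(fact k :: real) \<le> fact (2 * k)" by (rule fact_mono) simp
      qed (auto simp: X_def E_def)
      finally show ?thesis .
    qed
    then show ?thesis by (intro summable_comparison_test[OF _ s1]) auto
  qed
  have ii: "((\<lambda>k. LBINT y. f k y) has_sum (LBINT y. (\<Sum>\<^sub>\<infinity>k. f k y))) UNIV \<and> integrable lborel (\<lambda>y. (\<Sum>\<^sub>\<infinity>k. f k y))"
  proof (intro conjI integral_infsum)
    show "integrable lborel (f k)" "integrable lborel (f k)" for k using fint[of k] by (simp_all add: has_bochner_integral_iff)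
    show fsum: "(\<lambda>k. norm (f k y)) summable_on UNIV" for y
      by (rule norm_summable_imp_summable_on) (simp add: fsm)
    show "(\<lambda>k. norm (f k y)) summable_on UNIV" for y by (rule fsum)
    show isum: "(\<lambda>k. LBINT y. norm (f k y)) summable_on UNIV"
    proof (rule norm_summable_imp_summable_on, rule summable_comparison_test)
      define G' where "G' = of_real pi powr (- of_real \<sigma> / 2) * Gamma (of_real \<sigma> / 2 :: complex) / 2"
      let ?h = "\<lambda>k. pochhammer (of_real \<sigma> / 2) k * ((of_real (norm z))\<^sup>2 / 4) ^ k / (pochhammer (1/2) k * fact k) :: complex"
      show "summable (\<lambda>k. norm G' * norm (?h k))"
        by (intro summable_mult summable_norm_hyp_1F1)
      have "norm (LBINT y. norm (f k y)) \<le> norm G' * norm (?h k)" for k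
      proof -
        have "has_bochner_integral lborel (\<lambda>y. (of_real pi ^ k * of_real (norm z) ^ (2 * k) / fact (2 * k)) * (exp (- complex_of_real (pi * exp (2 * y))) * exp ((of_real \<sigma> + 2 * of_nat k) * of_real y)))
           ((of_real pi ^ k * of_real (norm z) ^ (2 * k) / fact (2 * k)) * (of_real pi powr (- of_real \<sigma> / 2) / of_real pi ^ k * (Gamma (of_real \<sigma> / 2) * pochhammer (of_real \<sigma> / 2) k) / 2))"
          by (rule has_bochner_integral_mult_right[OF base]) (use sig in simp)
        also have "((of_real pi ^ k * of_real (norm z) ^ (2 * k) / fact (2 * k)) * (of_real pi powr (- of_real \<sigma> / 2) / of_real pi ^ k * (Gamma (of_real \<sigma> / 2) * pochhammer (of_real \<sigma> / 2) k) / 2)) = G' * ?h k"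
          unfolding fact_k G'_def pz by (simp add: power_divide mult_ac)
        finally have "has_bochner_integral lborel (\<lambda>y. Re ((of_real pi ^ k * of_real (norm z) ^ (2 * k) / fact (2 * k)) * (exp (- complex_of_real (pi * exp (2 * y))) * exp ((of_real \<sigma> + 2 * of_nat k) * of_real y)))) (Re (G' * ?h k))"
          by (rule has_bochner_integral_Re)
        then have "(LBINT y. norm (f k y)) = Re (G' * ?h k)" unfolding nf by (rule has_bochner_integral_integral_eq)
        then show ?thesis using abs_Re_le_cmod[of "G' * ?h k"] by (simp only: real_norm_def norm_mult)
      qed
      then show "\<exists>N. \<forall>k\<ge>N. norm (norm (LBINT y. norm (f k y))) \<le> norm G' * norm (?h k)" by auto
    qed
    show "(\<lambda>k. LBINT y. norm (f k y)) summable_on UNIV" by (rule isum)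
  qed simp_all
  have fval: "(\<Sum>\<^sub>\<infinity>k. f k y) = ctheta_term z 0 (exp (of_real y)) * exp (p * of_real y)" for y
  proof -
    define x where "x = s * exp (of_real y) * z"
    have "(\<lambda>n. if even n then x ^ n /\<^sub>R fact n else 0) sums cosh x" by (rule cosh_converges)
    then have "(\<lambda>k. (if even (2 * k) then x ^ (2 * k) /\<^sub>R fact (2 * k) else 0)) sums cosh x"
      by (subst sums_mono_reindex[of "\<lambda>k. 2 * k"]) (auto simp: strict_mono_def elim!: evenE)
    then have "(\<lambda>k. x ^ (2 * k) / fact (2 * k)) sums cosh x"
      by (simp add: scaleR_conv_of_real divide_inverse mult.commute)
    then have "(\<lambda>k. (exp (- complex_of_real (pi * exp (2 * y))) * exp (p * of_real y)) * (x ^ (2 * k) / fact (2 * k))) sums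
        ((exp (- complex_of_real (pi * exp (2 * y))) * exp (p * of_real y)) * cosh x)"
      by (rule sums_mult)
    moreover have "(exp (- complex_of_real (pi * exp (2 * y))) * exp (p * of_real y)) * (x ^ (2 * k) / fact (2 * k)) = f k y" for k
    proof -
      have "exp ((p + 2 * of_nat k) * of_real y) = exp (p * of_real y) * (exp (of_real y)) ^ (2 * k)"
        by (simp add: exp_of_nat_mult[symmetric] algebra_simps flip: exp_add)
      then show ?thesis by (simp add: f_def x_def power_mult_distrib power_mult s2)
    qed
    ultimately have 1: "(\<lambda>k. f k y) sums ((exp (- complex_of_real (pi * exp (2 * y))) * exp (p * of_real y)) * cosh x)" by simp
    have "(exp (complex_of_real y))\<^sup>2 = of_real (exp (2 * y))"
      by (simp add: exp_double[symmetric] exp_of_real[symmetric])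
    then have 2: "(exp (- complex_of_real (pi * exp (2 * y))) * exp (p * of_real y)) * cosh x = ctheta_term z 0 (exp (of_real y)) * exp (p * of_real y)"
      by (simp add: ctheta_term_def x_def s_def)
    from infsumI[OF norm_summable_imp_has_sum[OF fsm 1]] show ?thesis unfolding 2 .
  qed
  have "((\<lambda>k. G * (pochhammer (p / 2) k * (z\<^sup>2 / 4) ^ k / (pochhammer (1/2) k * fact k))) has_sum (LBINT y. ctheta_term z 0 (exp (of_real y)) * exp (p * of_real y))) UNIV"
    using ii has_bochner_integral_integral_eq[OF fint] unfolding fval by simp
  moreover have "((\<lambda>k. G * (pochhammer (p / 2) k * (z\<^sup>2 / 4) ^ k / (pochhammer (1/2) k * fact k))) has_sum (G * hyp_1F1 (p / 2) (1/2) (z\<^sup>2 / 4))) UNIV"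
    unfolding hyp_1F1_infsum
    by (intro has_sum_cmult_right has_sum_infsum norm_summable_imp_summable_on summable_norm_hyp_1F1)
  ultimately have "(LBINT y. ctheta_term z 0 (exp (of_real y)) * exp (p * of_real y)) = G * hyp_1F1 (p / 2) (1/2) (z\<^sup>2 / 4)"
    by (rule has_sum_unique)
  with ii show ?thesis unfolding fval G_def has_bochner_integral_iff by simp
qed

lemma ctheta_term_scale:
  "ctheta_term z n \<beta> = ctheta_term z 0 (\<beta> * of_nat (Suc n))"
  unfolding ctheta_term_def by (simp add: power_mult_distrib mult_ac del: of_nat_Suc) (simp add: mult_ac)

text \<open>By \<open>ctheta_term_scale\<close> the term with index \<open>n\<close> is the one with
  index 0 translated in \<open>y\<close> by \<open>ln (n + 1)\<close>, and the translation
  contributes the factor \<open>(n + 1) powr (- p)\<close>.\<close>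

lemma mellin_ctheta_dirichlet:
  fixes p z :: complex
  assumes p: "Re p > 1"
  defines "I \<equiv> of_real pi powr (- p / 2) * Gamma (p / 2) / 2 * hyp_1F1 (p / 2) (1 / 2) (z\<^sup>2 / 4)"
  shows "(LBINT y. ctheta z (exp (of_real y)) * exp (p * of_real y)) = (\<Sum>n. 1 / of_nat (Suc n) powr p) * I"
proof -
  define B where "B = (\<lambda>y. ctheta_term z 0 (exp (of_real y)) * exp (p * of_real y))"
  have Bi: "has_bochner_integral lborel B I" unfolding B_def I_def by (rule mellin_ctheta_term_0) (use p in simp)
  define t where "t = (\<lambda>n. ln (real (Suc n)))"
  define f where "f = (\<lambda>n y. ctheta_term z n (exp (of_real y)) * exp (p * of_real y))"
  have et: "exp (complex_of_real (t n)) = of_nat (Suc n)" for n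
    by (simp add: t_def exp_of_real del: of_nat_Suc)
  have pt: "exp (- p * of_real (t n)) = 1 / of_nat (Suc n) powr p" for n
  proof -
    have "of_nat (Suc n) powr p = exp (p * of_real (t n))"
      unfolding powr_def t_def by (simp add: Ln_of_nat del: of_nat_Suc)
    then show ?thesis by (simp add: exp_minus inverse_eq_divide)
  qed
  have fB: "f n y = exp (- p * of_real (t n)) * B (t n + 1 * y)" for n y
  proof -
    have "exp (complex_of_real (t n + 1 * y)) = exp (of_real y) * of_nat (Suc n)" by (simp add: exp_add et mult.commute del: of_nat_Suc)
    moreover have "exp (- p * of_real (t n)) * exp (p * of_real (t n + 1 * y)) = exp (p * of_real y)"
      by (simp add: algebra_simps flip: exp_add)
    ultimately show ?thesis unfolding f_def B_def ctheta_term_scale[of z n] by (simp add: mult_ac)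
  qed
  have Bs: "has_bochner_integral lborel (\<lambda>y. B (t n + 1 * y)) I" for n
    using Bi lborel_has_bochner_integral_real_affine_iff[of 1 B I "t n"] by simp
  have fi: "has_bochner_integral lborel (f n) (exp (- p * of_real (t n)) * I)" for n
    unfolding fB[abs_def] by (rule has_bochner_integral_mult_right[OF Bs])
  define K where "K = (LBINT y. norm (B y))"
  have nfi: "(LBINT y. norm (f n y)) = real (Suc n) powr (- Re p) * K" for n
  proof -
    have "(LBINT y. norm (f n y)) = (LBINT y. norm (exp (- p * of_real (t n))) * norm (B (t n + 1 * y)))"
      unfolding fB norm_mult ..
    also have "\<dots> = norm (exp (- p * of_real (t n))) * (LBINT y. norm (B (t n + 1 * y)))" by simp
    also have "(LBINT y. norm (B (t n + 1 * y))) = K"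
      unfolding K_def using lborel_integral_real_affine[of 1 "\<lambda>y. norm (B y)" "t n"] by simp
    also have "norm (exp (- p * of_real (t n))) = real (Suc n) powr (- Re p)"
      by (simp add: powr_def t_def del: of_nat_Suc)
    finally show ?thesis .
  qed
  have "((\<lambda>n. LBINT y. f n y) has_sum (LBINT y. (\<Sum>\<^sub>\<infinity>n. f n y))) UNIV"
  proof (rule integral_infsum)
    show "integrable lborel (f n)" for n using fi[of n] by (simp add: has_bochner_integral_iff)
    show "(\<lambda>n. norm (f n y)) summable_on UNIV" for y
      unfolding f_def norm_mult by (intro summable_on_cmult_left ctheta_summable exp_real_sector)
    show "(\<lambda>n. LBINT y. norm (f n y)) summable_on UNIV"
    proof (rule norm_summable_imp_summable_on)
      have "summable (\<lambda>n. real n powr (- Re p))" using p by (subst summable_real_powr_iff) simp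
      then have "summable (\<lambda>n. real (Suc n) powr (- Re p))" by (subst summable_Suc_iff)
      then have "summable (\<lambda>n. real (Suc n) powr (- Re p) * K)" by (rule summable_mult2)
      moreover have "K \<ge> 0" unfolding K_def by simp
      ultimately show "summable (\<lambda>n. norm (LBINT y. norm (f n y)))" unfolding nfi by (simp del: of_nat_Suc)
    qed
  qed simp
  then have "(\<lambda>n. exp (- p * of_real (t n)) * I) sums (LBINT y. (\<Sum>\<^sub>\<infinity>n. f n y))"
    using has_bochner_integral_integral_eq[OF fi] has_sum_imp_sums by fastforce
  moreover have "(\<Sum>\<^sub>\<infinity>n. f n y) = ctheta z (exp (of_real y)) * exp (p * of_real y)" for y
    unfolding f_def ctheta_def by (rule infsum_cmult_left')
  ultimately have 1: "(\<lambda>n. (1 / of_nat (Suc n) powr p) * I) sums (LBINT y. ctheta z (exp (of_real y)) * exp (p * of_real y))"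
    unfolding pt by simp
  have "summable (\<lambda>n. 1 / of_nat (Suc n) powr p)"
  proof (rule summable_norm_cancel)
    have "summable (\<lambda>n. real n powr (- Re p))" using p by (subst summable_real_powr_iff) simp
    then have "summable (\<lambda>n. real (Suc n) powr (- Re p))" by (subst summable_Suc_iff)
    moreover have "norm (1 / of_nat (Suc n) powr p) = real (Suc n) powr (- Re p)" for n
      unfolding pt[symmetric] by (simp add: powr_def t_def del: of_nat_Suc)
    ultimately show "summable (\<lambda>n. norm (1 / of_nat (Suc n) powr p))" by simp
  qed
  from sums_unique2[OF 1 sums_mult2[OF summable_sums[OF this]]] show ?thesis .
qed

lemma ltheta_dirichlet:
  assumes p: "Re p > 1"
  shows "ltheta z p = (\<Sum>n. 1 / of_nat (Suc n) powr p) * (of_real pi powr (- p / 2) * Gamma (p / 2) / 2 * hyp_1F1 (p / 2) (1 / 2) (z\<^sup>2 / 4))"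
  using mellin_ctheta_dirichlet[OF p, of z] has_bochner_integral_integral_eq[OF mellin_ctheta_ltheta[OF p, of z]] by simp

section \<open>Identification with the zeta function\<close>

lemma hyp_1F1_0: "hyp_1F1 a d 0 = 1"
proof -
  have "hyp_1F1 a d 0 = (\<Sum>n\<in>{0}. pochhammer a n * 0 ^ n / (pochhammer d n * fact n))"
    unfolding hyp_1F1_def by (rule suminf_finite) auto
  then show ?thesis by simp
qed

text \<open>\<open>ltheta 0\<close> divided by the Gamma factor. The pole at 0 is removed by writing
  \<open>rGamma (p / 2) / (2 * p)\<close> as \<open>rGamma (p / 2 + 1) / 4\<close>; the value 0 at 1
  is the convention made for \<open>zeta\<close>.\<close>

definition zeta_cont :: "complex \<Rightarrow> complex" where
  "zeta_cont p = (if p = 1 then 0 else 2 * of_real pi powr (p / 2) *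
     (rGamma (p / 2) * (atheta 0 p + atheta 0 (1 - p) + 1 / (2 * (p - 1))) - rGamma (p / 2 + 1) / 4))"

lemma zeta_cont_holomorphic: "zeta_cont holomorphic_on - {1}"
proof -
  have "(\<lambda>p. 2 * of_real pi powr (p / 2) *
     (rGamma (p / 2) * (atheta 0 p + atheta 0 (1 - p) + 1 / (2 * (p - 1))) - rGamma (p / 2 + 1) / 4)) holomorphic_on - {1}"
    by (intro holomorphic_intros) auto
  then show ?thesis by (rule holomorphic_transform) (auto simp: zeta_cont_def)
qed

lemma zeta_cont_eq_ltheta:
  assumes "p \<noteq> 0" "p \<noteq> 1"
  shows "zeta_cont p = 2 * of_real pi powr (p / 2) * rGamma (p / 2) * ltheta 0 p"
proof -
  have "rGamma (p / 2) = p / 2 * rGamma (p / 2 + 1)" by (simp add: rGamma_plus1)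
  then have "rGamma (p / 2 + 1) / 4 = rGamma (p / 2) * (1 / (2 * p))" using assms by (simp add: field_simps)
  then show ?thesis using assms unfolding zeta_cont_def ltheta_def by (simp add: algebra_simps)
qed

lemma zeta_cont_dirichlet:
  assumes p: "Re p > 1"
  shows "zeta_cont p = (\<Sum>n. 1 / of_nat (Suc n) powr p)"
proof -
  have n: "p / 2 \<notin> \<int>\<^sub>\<le>\<^sub>0" using p by (auto elim!: nonpos_Ints_cases simp: complex_eq_iff)
  then have g: "rGamma (p / 2) * Gamma (p / 2) = 1" by (simp add: rGamma_inverse_Gamma Gamma_eq_zero_iff)
  have h: "of_real pi powr (p / 2) * of_real pi powr (- p / 2) = (1::complex)" by (simp flip: powr_add)
  have p01: "p \<noteq> 0" "p \<noteq> 1" using p by auto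
  define D where "D = (\<Sum>n. 1 / of_nat (Suc n) powr p)"
  have "zeta_cont p = D * (of_real pi powr (p / 2) * of_real pi powr (- p / 2)) * (rGamma (p / 2) * Gamma (p / 2))"
    unfolding zeta_cont_eq_ltheta[OF p01] ltheta_dirichlet[OF p] D_def[symmetric] by (simp add: hyp_1F1_0)
  then show ?thesis unfolding g h D_def by simp
qed

lemma zeta_eq_zeta_cont: "zeta = zeta_cont"
  unfolding zeta_def
proof (rule the_equality)
  show "zeta_cont holomorphic_on - {1} \<and> (\<forall>s. Re s > 1 \<longrightarrow> zeta_cont s = (\<Sum>n. 1 / of_nat (Suc n) powr s)) \<and> zeta_cont 1 = 0"
    using zeta_cont_holomorphic zeta_cont_dirichlet by (auto simp: zeta_cont_def)
  fix f assume f: "f holomorphic_on - {1} \<and> (\<forall>s. Re s > 1 \<longrightarrow> f s = (\<Sum>n. 1 / of_nat (Suc n) powr s)) \<and> f 1 = 0"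
  show "f = zeta_cont"
  proof
    fix s show "f s = zeta_cont s"
    proof (cases "s = 1")
      case True then show ?thesis using f by (simp add: zeta_cont_def)
    next
      case False
      have c: "connected (- {1::complex})" using connected_open_delete[OF open_UNIV connected_UNIV, of "1::complex"] by (simp add: Compl_eq_Diff_UNIV)
      have ne: "{s::complex. Re s > 1} \<noteq> {}" by (auto intro: exI[of _ 2])
      show ?thesis
        by (rule analytic_continuation_open[of "{s. Re s > 1}" "- {1}" f zeta_cont])
           (use f c ne False zeta_cont_holomorphic zeta_cont_dirichlet in \<open>auto simp: open_halfspace_Re_gt\<close>)
    qed
  qed
qed

lemma completed_zeta_eq_ltheta:
  assumes "Re p > 0" "p \<noteq> 1"
  shows "completed_zeta p = 2 * ltheta 0 p"
proof -
  have n: "p / 2 \<notin> \<int>\<^sub>\<le>\<^sub>0" using assms by (auto elim!: nonpos_Ints_cases simp: complex_eq_iff)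
  then have g: "rGamma (p / 2) * Gamma (p / 2) = 1" by (simp add: rGamma_inverse_Gamma Gamma_eq_zero_iff)
  have h: "of_real pi powr (p / 2) * of_real pi powr (- p / 2) = (1::complex)" by (simp flip: powr_add)
  have p0: "p \<noteq> 0" using assms by auto
  have "completed_zeta p = 2 * (of_real pi powr (p / 2) * of_real pi powr (- p / 2)) * (rGamma (p / 2) * Gamma (p / 2)) * ltheta 0 p"
    unfolding completed_zeta_def zeta_eq_zeta_cont zeta_cont_eq_ltheta[OF p0 assms(2)] by (simp add: mult_ac)
  then show ?thesis unfolding g h by simp
qed

text \<open>For \<open>Re p > 1\<close> this compares \<open>ltheta_dirichlet\<close> at
  \<open>z\<close> and at 0: the Dirichlet series is the same. The critical line lies outside that
  half-plane and is reached by analytic continuation in the punctured right half-plane.\<close>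

lemma completed_zeta_hyp_1F1:
  assumes p: "Re p > 0" "p \<noteq> 1"
  shows "completed_zeta p * hyp_1F1 (p / 2) (1 / 2) (z\<^sup>2 / 4) = 2 * ltheta z p"
proof -
  let ?S = "{p::complex. Re p > 0} - {1}"
  have op: "open ?S" by (intro open_Diff open_halfspace_Re_gt) auto
  have cn: "connected ?S"
    by (rule connected_open_delete) (auto intro!: open_halfspace_Re_gt convex_connected convex_halfspace_Re_gt)
  have lh: "ltheta w holomorphic_on ?S" for w
    by (rule holomorphic_on_subset[OF ltheta_holomorphic]) auto
  have hh: "(\<lambda>p. hyp_1F1 (p / 2) (1 / 2) (z\<^sup>2 / 4)) holomorphic_on ?S"
  proof -
    have "(\<lambda>p::complex. p / 2) holomorphic_on ?S" by (intro holomorphic_intros) auto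
    from holomorphic_on_compose_gen[OF this hyp_1F1_holomorphic[of "z\<^sup>2 / 4"]] show ?thesis by (simp add: o_def)
  qed
  have "2 * ltheta 0 p * hyp_1F1 (p / 2) (1 / 2) (z\<^sup>2 / 4) = 2 * ltheta z p"
  proof (rule analytic_continuation_open[of "{p. Re p > 1}" ?S "\<lambda>p. 2 * ltheta 0 p * hyp_1F1 (p / 2) (1 / 2) (z\<^sup>2 / 4)" "\<lambda>p. 2 * ltheta z p"])
    show "open {p::complex. Re p > 1}" by (rule open_halfspace_Re_gt)
    show "{p::complex. Re p > 1} \<noteq> {}" by (auto intro: exI[of _ 2])
    fix q :: complex assume "q \<in> {p. Re p > 1}"
    then have q: "Re q > 1" by simp
    show "2 * ltheta 0 q * hyp_1F1 (q / 2) (1 / 2) (z\<^sup>2 / 4) = 2 * ltheta z q"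
      unfolding ltheta_dirichlet[OF q] by (simp add: hyp_1F1_0)
  qed (use op cn lh hh p in \<open>auto intro!: holomorphic_intros\<close>)
  then show ?thesis by (simp add: completed_zeta_eq_ltheta[OF p])
qed

section \<open>The critical line\<close>

lemma etheta_measurable: "(\<lambda>y. etheta z (complex_of_real y)) \<in> borel_measurable borel"
  unfolding etheta_def by measurable

text \<open>The term subtracted in \<open>etheta\<close> makes the integral converge at real part
  \<open>1 / 2\<close>, and its integrals over the two half-lines supply the polar terms of
  \<open>ltheta\<close>. The half-line \<open>y < 0\<close> is treated by
  \<open>etheta_uminus\<close>.\<close>

lemma ltheta_critical_line:
  "has_bochner_integral lborel (\<lambda>y. etheta z (of_real y) * exp (\<i> * of_real t * of_real y)) (ltheta z (1 / 2 + \<i> * of_real t))"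
proof -
  define p where "p = 1 / 2 + \<i> * of_real t"
  have p: "Re p = 1 / 2" by (simp add: p_def)
  have part: "has_bochner_integral lborel (\<lambda>y. indicator {0..} y *\<^sub>R (etheta w (of_real y) * exp ((q - 1 / 2) * of_real y)))
     (atheta w q - exp (w\<^sup>2 / 4) / 2 * (1 / (1 - q)))" if q: "Re q < 1" for w q
  proof -
    have "has_bochner_integral lborel (\<lambda>y. (indicator {0..} y *\<^sub>R ctheta w (exp (of_real y))) * exp (q * of_real y) - (exp (w\<^sup>2 / 4) / 2) * (indicator {0..} y *\<^sub>R exp (- (1 - q) * of_real y)))
       (atheta w q - exp (w\<^sup>2 / 4) / 2 * (1 / (1 - q)))"
      by (intro has_bochner_integral_diff has_bochner_integral_mult_right atheta_bochner integral_exp_atLeast_0) (use q in simp)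
    also have "(\<lambda>y. (indicator {0..} y *\<^sub>R ctheta w (exp (of_real y))) * exp (q * of_real y) - (exp (w\<^sup>2 / 4) / 2) * (indicator {0..} y *\<^sub>R exp (- (1 - q) * of_real y))) =
      (\<lambda>y. indicator {0..} y *\<^sub>R (etheta w (of_real y) * exp ((q - 1 / 2) * of_real y)))"
    proof
      fix y :: real
      have "exp (of_real y / 2) * exp ((q - 1 / 2) * of_real y) = exp (q * of_real y)"
        "exp (of_real y / 2) * exp (- of_real y) * exp ((q - 1 / 2) * of_real y) = exp (- (1 - q) * of_real y)"
        by (simp_all add: algebra_simps flip: exp_add)
      then have "etheta w (of_real y) * exp ((q - 1 / 2) * of_real y) = ctheta w (exp (of_real y)) * exp (q * of_real y) - (exp (w\<^sup>2 / 4) / 2) * exp (- (1 - q) * of_real y)"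
        unfolding etheta_def by (simp add: algebra_simps)
      then show "(indicator {0..} y *\<^sub>R ctheta w (exp (of_real y))) * exp (q * of_real y) - (exp (w\<^sup>2 / 4) / 2) * (indicator {0..} y *\<^sub>R exp (- (1 - q) * of_real y)) =
         indicator {0..} y *\<^sub>R (etheta w (of_real y) * exp ((q - 1 / 2) * of_real y))"
        by (cases "y \<ge> 0") auto
    qed
    finally show ?thesis .
  qed
  let ?f = "\<lambda>y. etheta z (of_real y) * exp (\<i> * of_real t * of_real y)"
  have 1: "has_bochner_integral lborel (\<lambda>y. indicator {0..} y *\<^sub>R ?f y) (atheta z p - exp (z\<^sup>2 / 4) / 2 * (1 / (1 - p)))"
    using part[of p z] p by (simp add: p_def)
  have "has_bochner_integral lborel (\<lambda>y. exp (z\<^sup>2 / 4) * (indicator {0..} y *\<^sub>R (etheta (\<i> * z) (of_real y) * exp (((1 - p) - 1 / 2) * of_real y))))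
     (exp (z\<^sup>2 / 4) * (atheta (\<i> * z) (1 - p) - exp ((\<i> * z)\<^sup>2 / 4) / 2 * (1 / (1 - (1 - p)))))"
    by (intro has_bochner_integral_mult_right part) (use p in simp)
  moreover have "exp (z\<^sup>2 / 4) * (indicator {0..} y *\<^sub>R (etheta (\<i> * z) (of_real y) * exp (((1 - p) - 1 / 2) * of_real y))) = indicator {0..} y *\<^sub>R ?f (- y)" for y
  proof -
    have "etheta z (- complex_of_real y) = exp (z\<^sup>2 / 4) * etheta (\<i> * z) (of_real y)"
      by (rule etheta_uminus) (simp add: strip_def)
    moreover have "((1 - p) - 1 / 2) * of_real y = \<i> * of_real t * of_real (- y)" by (simp add: p_def)
    ultimately show ?thesis by (simp add: mult_ac)
  qed
  ultimately have 2: "has_bochner_integral lborel (\<lambda>y. indicator {0..} y *\<^sub>R ?f (- y)) (exp (z\<^sup>2 / 4) * (atheta (\<i> * z) (1 - p) - exp ((\<i> * z)\<^sup>2 / 4) / 2 * (1 / (1 - (1 - p)))))"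
    by (simp only:)
  have m: "?f \<in> borel_measurable borel"
  proof -
    have [measurable]: "(\<lambda>y::real. exp (\<i> * of_real t * of_real y)) \<in> borel_measurable borel"
      by (intro borel_measurable_continuous_onI continuous_intros)
    note etheta_measurable[measurable]
    show ?thesis by measurable
  qed
  have e: "exp (z\<^sup>2 / 4) * exp ((\<i> * z)\<^sup>2 / 4) = 1" by (simp add: power_mult_distrib flip: exp_add)
  have "atheta z p - exp (z\<^sup>2 / 4) / 2 * (1 / (1 - p)) + exp (z\<^sup>2 / 4) * (atheta (\<i> * z) (1 - p) - exp ((\<i> * z)\<^sup>2 / 4) / 2 * (1 / (1 - (1 - p))))
     = atheta z p - exp (z\<^sup>2 / 4) / (2 * (1 - p)) + exp (z\<^sup>2 / 4) * atheta (\<i> * z) (1 - p) - (exp (z\<^sup>2 / 4) * exp ((\<i> * z)\<^sup>2 / 4)) / (2 * p)"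
    by (simp add: algebra_simps)
  also have "\<dots> = ltheta z p"
  proof -
    have "2 * (1 - p) = - (2 * (p - 1))" by simp
    then have "exp (z\<^sup>2 / 4) / (2 * (1 - p)) = - (exp (z\<^sup>2 / 4) / (2 * (p - 1)))" by (simp only: divide_minus_right)
    then show ?thesis unfolding e ltheta_def by simp
  qed
  finally show ?thesis using has_bochner_integral_split_at_0[OF 1 2 m] by (simp add: p_def)
qed

text \<open>Raising the line of integration by \<open>\<theta>\<close> multiplies the exponential by
  \<open>exp (- t * \<theta>)\<close>, which is compensated on the right. The strip where
  \<open>etheta\<close> is holomorphic limits \<open>\<theta>\<close> to less than
  \<open>pi / 4\<close>.\<close>

lemma ltheta_rotated:
  assumes th: "\<bar>\<theta>\<bar> < pi / 4"
  shows "has_bochner_integral lborel (\<lambda>y. etheta z (of_real y + \<i> * of_real \<theta>) * exp (\<i> * of_real t * of_real y))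
     (exp (of_real (t * \<theta>)) * ltheta z (1 / 2 + \<i> * of_real t))"
proof -
  obtain C where C: "C > 0" "\<And>\<zeta>. \<bar>Im \<zeta>\<bar> \<le> \<bar>\<theta>\<bar> \<Longrightarrow> norm (etheta z \<zeta>) \<le> C * exp (- \<bar>Re \<zeta>\<bar> / 2)"
    using etheta_decay[OF th] by metis
  let ?g = "\<lambda>\<zeta>. etheta z \<zeta> * exp (\<i> * of_real t * \<zeta>)"
  have hol: "?g holomorphic_on {\<zeta>. \<bar>Im \<zeta>\<bar> < pi / 4}"
    using etheta_holomorphic unfolding strip_def by (intro holomorphic_intros)
  have bnd: "norm (?g \<zeta>) \<le> (C * exp (\<bar>t\<bar> * \<bar>\<theta>\<bar>)) * exp (- (1/2) * \<bar>Re \<zeta>\<bar>)" if "\<bar>Im \<zeta>\<bar> \<le> \<bar>\<theta>\<bar>" for \<zeta>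
  proof -
    have "- (t * Im \<zeta>) \<le> \<bar>t * Im \<zeta>\<bar>" by linarith
    also have "\<dots> \<le> \<bar>t\<bar> * \<bar>\<theta>\<bar>" unfolding abs_mult using that by (intro mult_left_mono) auto
    finally have "norm (exp (\<i> * of_real t * \<zeta>)) \<le> exp (\<bar>t\<bar> * \<bar>\<theta>\<bar>)" by (simp add: algebra_simps)
    with C(2)[OF that] have "norm (?g \<zeta>) \<le> (C * exp (- \<bar>Re \<zeta>\<bar> / 2)) * exp (\<bar>t\<bar> * \<bar>\<theta>\<bar>)"
      unfolding norm_mult using C(1) by (intro mult_mono) auto
    then show ?thesis by (simp add: mult_ac)
  qed
  note sh = integral_strip_shift[OF hol th _ bnd]
  have i: "integrable lborel (\<lambda>y. ?g (of_real y + \<i> * of_real \<theta>))" by (rule sh(1)) auto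
  have "(LBINT y. ?g (of_real y + \<i> * of_real \<theta>)) = ltheta z (1 / 2 + \<i> * of_real t)"
    using sh(2) has_bochner_integral_integral_eq[OF ltheta_critical_line[of z t]] by simp
  with i have "has_bochner_integral lborel (\<lambda>y. ?g (of_real y + \<i> * of_real \<theta>)) (ltheta z (1 / 2 + \<i> * of_real t))"
    by (simp add: has_bochner_integral_iff)
  then have "has_bochner_integral lborel (\<lambda>y. exp (of_real (t * \<theta>)) * ?g (of_real y + \<i> * of_real \<theta>)) (exp (of_real (t * \<theta>)) * ltheta z (1 / 2 + \<i> * of_real t))"
    by (rule has_bochner_integral_mult_right)
  moreover have "exp (of_real (t * \<theta>)) * ?g (of_real y + \<i> * of_real \<theta>) = etheta z (of_real y + \<i> * of_real \<theta>) * exp (\<i> * of_real t * of_real y)" for y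
  proof -
    have "exp (of_real (t * \<theta>)) * exp (\<i> * of_real t * (of_real y + \<i> * of_real \<theta>)) = exp (\<i> * of_real t * of_real y)"
      by (simp add: algebra_simps flip: exp_add)
    then show ?thesis by (metis mult.left_commute)
  qed
  ultimately show ?thesis by (simp only:)
qed

text \<open>The Gaussians \<open>E n\<close> make Fubini available. The inner integral becomes a
  Gaussian of width \<open>1 / (n + 1)\<close> around \<open>y0\<close>, an approximate identity for
  the bounded continuous \<open>g\<close>; on the other side the regulariser disappears because
  \<open>G\<close> is integrable.\<close>

theorem fourier_inversion:
  fixes g :: "real \<Rightarrow> complex"
  assumes cont: "continuous_on UNIV g" and int: "integrable lborel g" and bnd: "\<And>y. norm (g y) \<le> B"
    and G: "\<And>t. G t = (LBINT y. g y * exp (\<i> * of_real t * of_real y))"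
    and Gint: "integrable lborel G"
  shows "(LBINT t. G t * exp (- \<i> * of_real t * of_real y0)) = 2 * of_real pi * g y0"
proof -
  define E where "E = (\<lambda>(n::nat) (t::real). exp (- complex_of_real (t\<^sup>2 / (2 * (real (Suc n))\<^sup>2))))"
  have [measurable]: "g \<in> borel_measurable borel" using cont by (rule borel_measurable_continuous_onI)
  have [measurable]: "G \<in> borel_measurable borel" using Gint by simp
  have [measurable]: "E n \<in> borel_measurable borel" for n
    unfolding E_def by (intro borel_measurable_continuous_onI continuous_intros) auto
  have [measurable]: "(\<lambda>t::real. exp (- \<i> * of_real t * of_real y0)) \<in> borel_measurable borel"
    by (intro borel_measurable_continuous_onI continuous_intros)
  have E1: "norm (E n t) \<le> 1" for n t by (simp add: E_def)
  have L1: "(\<lambda>n. LBINT t. G t * exp (- \<i> * of_real t * of_real y0) * E n t) \<longlonglongrightarrow> (LBINT t. G t * exp (- \<i> * of_real t * of_real y0))"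
  proof (rule integral_dominated_convergence)
    show "integrable lborel (\<lambda>t. norm (G t))" using Gint by simp
    show "AE t in lborel. (\<lambda>n. G t * exp (- \<i> * of_real t * of_real y0) * E n t) \<longlonglongrightarrow> G t * exp (- \<i> * of_real t * of_real y0)"
    proof (rule AE_I2)
      fix t :: real
      have "(\<lambda>n. t\<^sup>2 / (2 * (real (Suc n))\<^sup>2)) \<longlonglongrightarrow> 0" by real_asymp
      then have "(\<lambda>n. E n t) \<longlonglongrightarrow> exp (- complex_of_real 0)" unfolding E_def by (intro tendsto_intros)
      then have "(\<lambda>n. G t * exp (- \<i> * of_real t * of_real y0) * E n t) \<longlonglongrightarrow> G t * exp (- \<i> * of_real t * of_real y0) * exp (- complex_of_real 0)"
        by (intro tendsto_intros)
      then show "(\<lambda>n. G t * exp (- \<i> * of_real t * of_real y0) * E n t) \<longlonglongrightarrow> G t * exp (- \<i> * of_real t * of_real y0)" by simp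
    qed
    show "AE t in lborel. norm (G t * exp (- \<i> * of_real t * of_real y0) * E n t) \<le> norm (G t)" for n
    proof (rule AE_I2)
      fix t show "norm (G t * exp (- \<i> * of_real t * of_real y0) * E n t) \<le> norm (G t)"
        using E1[of n t] by (simp add: norm_mult mult_left_le)
    qed
  qed measurable
  have eq: "(LBINT t. G t * exp (- \<i> * of_real t * of_real y0) * E n t) =
     (LBINT x. g (y0 + x / real (Suc n)) * of_real (sqrt (2 * pi) * exp (- x\<^sup>2 / 2)))" for n
  proof -
    define m where "m = real (Suc n)"
    have m: "m > 0" by (simp add: m_def)
    define f where "f = (\<lambda>t y. g y * exp (\<i> * of_real t * of_real (y - y0)) * E n t)"
    have f_meas: "(\<lambda>(t, y). f t y) \<in> borel_measurable (lborel \<Otimes>\<^sub>M lborel)"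
    proof -
      have [measurable]: "(\<lambda>p::real \<times> real. exp (\<i> * of_real (fst p) * of_real (snd p - y0))) \<in> borel_measurable (borel \<Otimes>\<^sub>M borel)"
        unfolding borel_prod by (intro borel_measurable_continuous_onI continuous_intros)
      show ?thesis unfolding f_def case_prod_beta by measurable
    qed
    have nf: "norm (f t y) = norm (g y) * norm (E n t)" for t y
      by (simp add: f_def norm_mult)
    have Ei: "integrable lborel (E n)"
    proof -
      have "integrable lborel (\<lambda>t::real. exp (- (1 / (2 * of_real m ^ 2)) * (of_real t)\<^sup>2 + 0 * of_real t + 0 :: complex))"
        by (rule gaussian_integrable) (use m in \<open>simp flip: of_real_power of_real_mult of_real_divide\<close>)
      then show ?thesis by (simp add: E_def m_def)
    qed
    have fint: "integrable (lborel \<Otimes>\<^sub>M lborel) (\<lambda>(t, y). f t y)"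
    proof (rule lborel_pair.Fubini_integrable[OF f_meas])
      show "integrable lborel (\<lambda>t. LBINT y. norm (case (t, y) of (t, y) \<Rightarrow> f t y))"
        unfolding prod.case nf using Ei by simp
      show "AE t in lborel. integrable lborel (\<lambda>y. case (t, y) of (t, y) \<Rightarrow> f t y)"
      proof (rule AE_I2)
        fix t
        show "integrable lborel (\<lambda>y. case (t, y) of (t, y) \<Rightarrow> f t y)"
          unfolding prod.case
        proof (rule Bochner_Integration.integrable_bound)
          show "integrable lborel (\<lambda>y. norm (g y) * norm (E n t))" using int by simp
          have [measurable]: "(\<lambda>y::real. exp (\<i> * of_real t * of_real (y - y0))) \<in> borel_measurable borel"
            by (intro borel_measurable_continuous_onI continuous_intros)
          show "f t \<in> borel_measurable lborel" unfolding f_def by measurable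
          show "AE y in lborel. norm (f t y) \<le> norm (norm (g y) * norm (E n t))" unfolding nf by simp
        qed
      qed
    qed
    have "(LBINT t. G t * exp (- \<i> * of_real t * of_real y0) * E n t) = (LBINT t. LBINT y. f t y)"
    proof (rule Bochner_Integration.integral_cong[OF refl])
      fix t :: real
      have "G t * exp (- \<i> * of_real t * of_real y0) * E n t = (LBINT y. g y * exp (\<i> * of_real t * of_real y) * (exp (- \<i> * of_real t * of_real y0) * E n t))"
        unfolding G integral_mult_left_zero by (rule mult.assoc)
      also have "\<dots> = (LBINT y. f t y)"
      proof (rule Bochner_Integration.integral_cong[OF refl])
        fix y :: real
        have "exp (\<i> * of_real t * of_real y) * exp (- \<i> * of_real t * of_real y0) = exp (\<i> * of_real t * of_real (y - y0))"
          by (simp add: algebra_simps flip: exp_add)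
        then show "g y * exp (\<i> * of_real t * of_real y) * (exp (- \<i> * of_real t * of_real y0) * E n t) = f t y"
          unfolding f_def by (metis mult.assoc)
      qed
      finally show "G t * exp (- \<i> * of_real t * of_real y0) * E n t = (LBINT y. f t y)" .
    qed
    also have "\<dots> = (LBINT y. LBINT t. f t y)" by (rule lborel_pair.Fubini_integral[OF fint, symmetric])
    also have "\<dots> = (LBINT y. g y * of_real (m * sqrt (2 * pi) * exp (- (m\<^sup>2 * (y - y0)\<^sup>2) / 2)))"
    proof (rule Bochner_Integration.integral_cong[OF refl])
      fix y :: real
      define c where "c = - \<i> * of_real (m\<^sup>2 * (y - y0))"
      define \<eta> where "\<eta> = complex_of_real (2 * pi * m\<^sup>2)"
      have eta: "Re \<eta> > 0" using m by (simp add: \<eta>_def del: of_real_mult of_real_power)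
      have cs: "csqrt \<eta> = of_real (m * sqrt (2 * pi))"
        unfolding \<eta>_def using m by (subst csqrt_of_real_nonneg) (auto simp: real_sqrt_mult)
      have "exp (\<i> * of_real t * of_real (y - y0)) * E n t = exp (- of_real (m\<^sup>2 * (y - y0)\<^sup>2 / 2)) * exp (- (of_real pi * (of_real t + c)\<^sup>2 / \<eta>))" for t
        unfolding E_def m_def[symmetric] exp_add[symmetric] c_def \<eta>_def
        using m by (intro arg_cong[of _ _ exp]) (simp add: field_simps power2_eq_square)
      then have "f t y = (g y * exp (- of_real (m\<^sup>2 * (y - y0)\<^sup>2 / 2))) * exp (- (of_real pi * (of_real t + c)\<^sup>2 / \<eta>))" for t
        by (simp add: f_def mult.assoc)
      then have "(LBINT t. f t y) = (g y * exp (- of_real (m\<^sup>2 * (y - y0)\<^sup>2 / 2))) * csqrt \<eta>"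
        using has_bochner_integral_integral_eq[OF gaussian_integral_complex[OF eta, of c]] by simp
      also have "exp (- complex_of_real (m\<^sup>2 * (y - y0)\<^sup>2 / 2)) = of_real (exp (- (m\<^sup>2 * (y - y0)\<^sup>2) / 2))"
        by (simp add: exp_of_real[symmetric])
      finally show "(LBINT t. f t y) = g y * of_real (m * sqrt (2 * pi) * exp (- (m\<^sup>2 * (y - y0)\<^sup>2) / 2))"
        unfolding cs by (simp add: mult_ac)
    qed
    also have "\<dots> = \<bar>1 / m\<bar> *\<^sub>R (LBINT x. g (y0 + (1 / m) * x) * of_real (m * sqrt (2 * pi) * exp (- (m\<^sup>2 * (y0 + (1 / m) * x - y0)\<^sup>2) / 2)))"
      by (rule lborel_integral_real_affine) (use m in simp)
    also have "\<dots> = (LBINT x. \<bar>1 / m\<bar> *\<^sub>R (g (y0 + (1 / m) * x) * of_real (m * sqrt (2 * pi) * exp (- (m\<^sup>2 * (y0 + (1 / m) * x - y0)\<^sup>2) / 2))))"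
      by simp
    also have "\<dots> = (LBINT x. g (y0 + x / m) * of_real (sqrt (2 * pi) * exp (- x\<^sup>2 / 2)))"
    proof (rule Bochner_Integration.integral_cong[OF refl])
      fix x
      have "m\<^sup>2 * (y0 + (1 / m) * x - y0)\<^sup>2 = x\<^sup>2" using m by (simp add: power_divide)
      then show "\<bar>1 / m\<bar> *\<^sub>R (g (y0 + (1 / m) * x) * of_real (m * sqrt (2 * pi) * exp (- (m\<^sup>2 * (y0 + (1 / m) * x - y0)\<^sup>2) / 2))) =
        g (y0 + x / m) * of_real (sqrt (2 * pi) * exp (- x\<^sup>2 / 2))"
        using m by (simp add: scaleR_conv_of_real)
    qed
    finally show ?thesis by (simp add: m_def)
  qed
  have gi: "has_bochner_integral lborel (\<lambda>x::real. sqrt (2 * pi) * exp (- x\<^sup>2 / 2)) (2 * pi)"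
  proof -
    have "has_bochner_integral lborel (\<lambda>x. 2 * pi * std_normal_density x) (2 * pi * 1)"
      by (intro has_bochner_integral_mult_right) (simp add: has_bochner_integral_iff)
    moreover have "2 * pi * std_normal_density x = sqrt (2 * pi) * exp (- x\<^sup>2 / 2)" for x
    proof -
      have e: "2 * pi * (1 / sqrt (2 * pi)) = sqrt (2 * pi)" using real_div_sqrt[of "2 * pi"] by simp
      have "2 * pi * std_normal_density x = 2 * pi * (1 / sqrt (2 * pi)) * exp (- x\<^sup>2 / 2)"
        unfolding std_normal_density_def by (simp only: mult.assoc)
      then show ?thesis unfolding e .
    qed
    ultimately show ?thesis by simp
  qed
  have L2: "(\<lambda>n. LBINT x. g (y0 + x / real (Suc n)) * of_real (sqrt (2 * pi) * exp (- x\<^sup>2 / 2))) \<longlonglongrightarrow> (LBINT x. g y0 * of_real (sqrt (2 * pi) * exp (- x\<^sup>2 / 2)))"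
  proof (rule integral_dominated_convergence)
    show "integrable lborel (\<lambda>x. B * (sqrt (2 * pi) * exp (- x\<^sup>2 / 2)))"
      by (rule integrable_mult_right) (rule conjunct1[OF gi[unfolded has_bochner_integral_iff]])
    show "AE x in lborel. (\<lambda>n. g (y0 + x / real (Suc n)) * of_real (sqrt (2 * pi) * exp (- x\<^sup>2 / 2))) \<longlonglongrightarrow> g y0 * of_real (sqrt (2 * pi) * exp (- x\<^sup>2 / 2))"
    proof (rule AE_I2)
      fix x :: real
      have "(\<lambda>n. y0 + x / real (Suc n)) \<longlonglongrightarrow> y0" by real_asymp
      moreover have "isCont g y0" using cont by (simp add: continuous_on_eq_continuous_at)
      ultimately have "(\<lambda>n. g (y0 + x / real (Suc n))) \<longlonglongrightarrow> g y0" using isCont_tendsto_compose by blast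
      then show "(\<lambda>n. g (y0 + x / real (Suc n)) * of_real (sqrt (2 * pi) * exp (- x\<^sup>2 / 2))) \<longlonglongrightarrow> g y0 * of_real (sqrt (2 * pi) * exp (- x\<^sup>2 / 2))"
        by (intro tendsto_intros)
    qed
    show "AE x in lborel. norm (g (y0 + x / real (Suc n)) * of_real (sqrt (2 * pi) * exp (- x\<^sup>2 / 2))) \<le> B * (sqrt (2 * pi) * exp (- x\<^sup>2 / 2))" for n
    proof (rule AE_I2)
      fix x :: real
      have "norm (complex_of_real (sqrt (2 * pi) * exp (- x\<^sup>2 / 2))) = sqrt (2 * pi) * exp (- x\<^sup>2 / 2)"
        unfolding norm_of_real by (intro abs_of_nonneg) auto
      then show "norm (g (y0 + x / real (Suc n)) * of_real (sqrt (2 * pi) * exp (- x\<^sup>2 / 2))) \<le> B * (sqrt (2 * pi) * exp (- x\<^sup>2 / 2))"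
        unfolding norm_mult[of "g _"] by (simp only:) (intro mult_right_mono bnd, simp)
    qed
  qed measurable
  have "(LBINT x. g y0 * of_real (sqrt (2 * pi) * exp (- x\<^sup>2 / 2))) = g y0 * of_real (2 * pi)"
    using has_bochner_integral_integral_eq[OF has_bochner_integral_mult_right[OF has_bochner_integral_of_real[OF gi]], of "g y0"] by (simp only:)
  with L2 have "(\<lambda>n. LBINT t. G t * exp (- \<i> * of_real t * of_real y0) * E n t) \<longlonglongrightarrow> g y0 * of_real (2 * pi)"
    unfolding eq by (simp only:)
  from LIMSEQ_unique[OF L1 this] show ?thesis by (simp add: mult.commute)
qed

lemma ctheta_uminus: "ctheta (- z) \<beta> = ctheta z \<beta>"
  by (simp add: ctheta_def ctheta_term_def)

lemma atheta_uminus: "atheta (- z) p = atheta z p"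
  by (simp add: atheta_def ctheta_uminus)

lemma ltheta_reflect: "ltheta z (1 - p) = exp (z\<^sup>2 / 4) * ltheta (\<i> * z) p"
proof -
  define a where "a = exp (z\<^sup>2 / 4)"
  have a: "exp ((\<i> * z)\<^sup>2 / 4) = 1 / a" "a \<noteq> 0"
    by (auto simp: a_def power_mult_distrib exp_minus inverse_eq_divide)
  have i: "\<i> * (\<i> * z) = - z" by simp
  have d: "a / (2 * ((1 - p) - 1)) = - (a / (2 * p))" "1 / (2 * (1 - p)) = - (1 / (2 * (p - 1)))"
    by (simp_all add: minus_divide_right[symmetric]) (metis minus_diff_eq minus_divide_right mult_minus_right)
  have "a * ltheta (\<i> * z) p = a * atheta (\<i> * z) p + atheta z (1 - p) + 1 / (2 * (p - 1)) - a / (2 * p)"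
  proof -
    have "a * ltheta (\<i> * z) p = a * atheta (\<i> * z) p + a * (1 / a * atheta z (1 - p)) + a * (1 / a / (2 * (p - 1))) - a * (1 / (2 * p))"
      unfolding ltheta_def a(1) i atheta_uminus by (simp only: distrib_left right_diff_distrib)
    then show ?thesis using a(2) by simp
  qed
  also have "\<dots> = ltheta z (1 - p)"
    unfolding ltheta_def a_def[symmetric] d by simp
  finally show ?thesis by (simp add: a_def)
qed

text \<open>The second half of the summand involves \<open>cnj z\<close> at
  \<open>1 / 2 - i * t\<close>. The functional equation \<open>ltheta_reflect\<close> moves it to
  \<open>1 / 2 + i * t\<close> at the cost of the exponential factor and the parameter
  \<open>i * cnj z\<close>, so that both halves are transforms at the same frequency.\<close>

definition etot :: "complex \<Rightarrow> complex \<Rightarrow> complex" where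
  "etot z \<zeta> = etheta z \<zeta> + exp ((cnj z)\<^sup>2 / 4) * etheta (\<i> * cnj z) \<zeta>"

definition hfun :: "complex \<Rightarrow> real \<Rightarrow> real" where
  "hfun z t = 2 * Re (ltheta z (1 / 2 + \<i> * of_real t))"

lemma ltheta_cnj: "ltheta (cnj z) (1 / 2 - \<i> * of_real t) = cnj (ltheta z (1 / 2 + \<i> * of_real t))"
proof -
  have "(LBINT y. etheta (cnj z) (of_real y) * exp (\<i> * of_real (- t) * of_real y)) = (LBINT y. cnj (etheta z (of_real y) * exp (\<i> * of_real t * of_real y)))"
    by (rule Bochner_Integration.integral_cong) (auto simp: etheta_cnj exp_cnj)
  also have "\<dots> = cnj (LBINT y. etheta z (of_real y) * exp (\<i> * of_real t * of_real y))"
    by (rule has_bochner_integral_integral_eq)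
       (use has_bochner_integral_bounded_linear[OF bounded_linear_cnj ltheta_critical_line[of z t]]
          has_bochner_integral_integral_eq[OF ltheta_critical_line[of z t]] in simp)
  finally show ?thesis
    using has_bochner_integral_integral_eq[OF ltheta_critical_line[of "cnj z" "- t"]]
      has_bochner_integral_integral_eq[OF ltheta_critical_line[of z t]] by simp
qed

lemma hfun_eq: "complex_of_real (hfun z t) = ltheta z (1 / 2 + \<i> * of_real t) + ltheta (cnj z) (1 / 2 - \<i> * of_real t)"
  unfolding ltheta_cnj hfun_def by (simp add: complex_eq_iff)

lemma hfun_fourier:
  assumes "\<bar>\<theta>\<bar> < pi / 4"
  shows "has_bochner_integral lborel (\<lambda>y. etot z (of_real y + \<i> * of_real \<theta>) * exp (\<i> * of_real t * of_real y))
     (of_real (exp (t * \<theta>) * hfun z t))"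
proof -
  have "has_bochner_integral lborel (\<lambda>y. etheta z (of_real y + \<i> * of_real \<theta>) * exp (\<i> * of_real t * of_real y)
      + exp ((cnj z)\<^sup>2 / 4) * (etheta (\<i> * cnj z) (of_real y + \<i> * of_real \<theta>) * exp (\<i> * of_real t * of_real y)))
     (exp (of_real (t * \<theta>)) * ltheta z (1 / 2 + \<i> * of_real t) + exp ((cnj z)\<^sup>2 / 4) * (exp (of_real (t * \<theta>)) * ltheta (\<i> * cnj z) (1 / 2 + \<i> * of_real t)))"
    by (intro has_bochner_integral_add has_bochner_integral_mult_right ltheta_rotated assms)
  moreover have "ltheta (cnj z) (1 / 2 - \<i> * of_real t) = exp ((cnj z)\<^sup>2 / 4) * ltheta (\<i> * cnj z) (1 / 2 + \<i> * of_real t)"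
    using ltheta_reflect[of "cnj z" "1 / 2 + \<i> * of_real t"] by simp
  then have "exp (of_real (t * \<theta>)) * ltheta z (1 / 2 + \<i> * of_real t) + exp ((cnj z)\<^sup>2 / 4) * (exp (of_real (t * \<theta>)) * ltheta (\<i> * cnj z) (1 / 2 + \<i> * of_real t)) =
     of_real (exp (t * \<theta>) * hfun z t)"
    by (simp add: hfun_eq exp_of_real[symmetric] algebra_simps)
  ultimately show ?thesis by (simp add: etot_def algebra_simps)
qed

lemma etot_decay:
  assumes "\<theta> < pi / 4"
  obtains C where "C > 0" "\<And>\<zeta>. \<bar>Im \<zeta>\<bar> \<le> \<theta> \<Longrightarrow> norm (etot z \<zeta>) \<le> C * exp (- \<bar>Re \<zeta>\<bar> / 2)"
proof -
  obtain C1 where C1: "C1 > 0" "\<And>\<zeta>. \<bar>Im \<zeta>\<bar> \<le> \<theta> \<Longrightarrow> norm (etheta z \<zeta>) \<le> C1 * exp (- \<bar>Re \<zeta>\<bar> / 2)"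
    using etheta_decay[OF assms] by metis
  obtain C2 where C2: "C2 > 0" "\<And>\<zeta>. \<bar>Im \<zeta>\<bar> \<le> \<theta> \<Longrightarrow> norm (etheta (\<i> * cnj z) \<zeta>) \<le> C2 * exp (- \<bar>Re \<zeta>\<bar> / 2)"
    using etheta_decay[OF assms] by metis
  show ?thesis
  proof (rule that[of "C1 + norm (exp ((cnj z)\<^sup>2 / 4)) * C2"])
    show "C1 + norm (exp ((cnj z)\<^sup>2 / 4)) * C2 > 0" using C1(1) C2(1) by (intro add_pos_nonneg mult_nonneg_nonneg) auto
    fix \<zeta> assume z: "\<bar>Im \<zeta>\<bar> \<le> \<theta>"
    have "norm (etot z \<zeta>) \<le> norm (etheta z \<zeta>) + norm (exp ((cnj z)\<^sup>2 / 4)) * norm (etheta (\<i> * cnj z) \<zeta>)"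
      unfolding etot_def norm_mult[symmetric] by (rule norm_triangle_ineq)
    also have "\<dots> \<le> C1 * exp (- \<bar>Re \<zeta>\<bar> / 2) + norm (exp ((cnj z)\<^sup>2 / 4)) * (C2 * exp (- \<bar>Re \<zeta>\<bar> / 2))"
      by (intro add_mono C1(2)[OF z] mult_left_mono C2(2)[OF z]) simp
    finally show "norm (etot z \<zeta>) \<le> (C1 + norm (exp ((cnj z)\<^sup>2 / 4)) * C2) * exp (- \<bar>Re \<zeta>\<bar> / 2)"
      by (simp add: algebra_simps)
  qed
qed

text \<open>The absolute integral along the line at height \<open>\<theta>\<close> bounds
  \<open>exp (t * \<theta>) * hfun z t\<close>, which settles positive \<open>t\<close>; height
  \<open>- \<theta>\<close> settles negative \<open>t\<close>.\<close>

lemma hfun_bound: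
  assumes "\<theta> < pi / 4" "\<theta> \<ge> 0"
  obtains N where "N > 0" "\<And>t. \<bar>hfun z t\<bar> \<le> N * exp (- \<theta> * \<bar>t\<bar>)"
proof -
  define I where "I = (\<lambda>\<theta>. LBINT y. norm (etot z (of_real y + \<i> * of_real \<theta>)))"
  have b: "exp (t * \<theta>) * \<bar>hfun z t\<bar> \<le> I \<theta>" if "\<bar>\<theta>\<bar> < pi / 4" for \<theta> t
  proof -
    note hb = hfun_fourier[OF that, of z t]
    have "norm (complex_of_real (exp (t * \<theta>) * hfun z t)) \<le> (LBINT y. norm (etot z (of_real y + \<i> * of_real \<theta>) * exp (\<i> * of_real t * of_real y)))"
      unfolding has_bochner_integral_integral_eq[OF hb, symmetric] by (rule integral_norm_bound)
    also have "\<dots> = I \<theta>" unfolding I_def by (simp add: norm_mult)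
    finally show ?thesis unfolding norm_of_real abs_mult by simp
  qed
  show ?thesis
  proof (rule that[of "\<bar>I \<theta>\<bar> + \<bar>I (- \<theta>)\<bar> + 1"])
    fix t :: real
    have "exp (\<theta> * \<bar>t\<bar>) * \<bar>hfun z t\<bar> \<le> \<bar>I \<theta>\<bar> + \<bar>I (- \<theta>)\<bar> + 1"
      using b[of \<theta> t] b[of "- \<theta>" t] assms by (cases "t \<ge> 0") (auto simp: mult.commute)
    then have "exp (- \<theta> * \<bar>t\<bar>) * (exp (\<theta> * \<bar>t\<bar>) * \<bar>hfun z t\<bar>) \<le> exp (- \<theta> * \<bar>t\<bar>) * (\<bar>I \<theta>\<bar> + \<bar>I (- \<theta>)\<bar> + 1)"
      by (intro mult_left_mono) auto
    moreover have "exp (- \<theta> * \<bar>t\<bar>) * (exp (\<theta> * \<bar>t\<bar>) * \<bar>hfun z t\<bar>) = \<bar>hfun z t\<bar>"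
      by (simp add: mult.assoc[symmetric] flip: exp_add)
    ultimately show "\<bar>hfun z t\<bar> \<le> (\<bar>I \<theta>\<bar> + \<bar>I (- \<theta>)\<bar> + 1) * exp (- \<theta> * \<bar>t\<bar>)" by (simp only: mult.commute)
  qed simp
qed

lemma hfun_continuous: "continuous_on UNIV (hfun z)"
  unfolding hfun_def
  by (intro continuous_intros continuous_on_compose2[OF holomorphic_on_imp_continuous_on[OF ltheta_holomorphic]])
     (auto simp: complex_eq_iff)

lemma hfun_transform:
  assumes th: "\<bar>\<theta>\<bar> < pi / 4"
  shows "has_bochner_integral lborel (\<lambda>t. of_real (exp (t * \<theta>) * hfun z t) * exp (- \<i> * of_real t * of_real y))
     (2 * of_real pi * etot z (of_real y + \<i> * of_real \<theta>))"
proof -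
  \<comment> \<open>Midway between \<open>\<bar>\<theta>\<bar>\<close> and \<open>pi / 4\<close>, so
    that the decay of \<open>hfun\<close> at rate \<open>\<theta>'\<close> beats the tilt
    \<open>exp (t * \<theta>)\<close>.\<close>
  define \<theta>' where "\<theta>' = (\<bar>\<theta>\<bar> + pi / 4) / 2"
  have th': "\<theta>' < pi / 4" "\<theta>' \<ge> 0" "\<bar>\<theta>\<bar> < \<theta>'" using th by (auto simp: \<theta>'_def)
  obtain N where N: "N > 0" "\<And>t. \<bar>hfun z t\<bar> \<le> N * exp (- \<theta>' * \<bar>t\<bar>)" using hfun_bound[OF th'(1,2)] by metis
  obtain C where C: "C > 0" "\<And>\<zeta>. \<bar>Im \<zeta>\<bar> \<le> \<bar>\<theta>\<bar> \<Longrightarrow> norm (etot z \<zeta>) \<le> C * exp (- \<bar>Re \<zeta>\<bar> / 2)"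
    using etot_decay[OF th] by metis
  have cH: "continuous_on UNIV (\<lambda>t. complex_of_real (exp (t * \<theta>) * hfun z t))"
    by (intro continuous_intros hfun_continuous)
  have Gint: "integrable lborel (\<lambda>t. complex_of_real (exp (t * \<theta>) * hfun z t))"
  proof (rule Bochner_Integration.integrable_bound)
    show "integrable lborel (\<lambda>t. N * exp (- (\<theta>' - \<bar>\<theta>\<bar>) * \<bar>t\<bar>))"
      by (intro integrable_mult_right integrable_exp_neg_abs) (use th' in simp)
    show "(\<lambda>t. complex_of_real (exp (t * \<theta>) * hfun z t)) \<in> borel_measurable lborel"
      using borel_measurable_continuous_onI[OF cH] by simp
    show "AE t in lborel. norm (complex_of_real (exp (t * \<theta>) * hfun z t)) \<le> norm (N * exp (- (\<theta>' - \<bar>\<theta>\<bar>) * \<bar>t\<bar>))"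
    proof (rule AE_I2)
      fix t :: real
      have "t * \<theta> \<le> \<bar>t * \<theta>\<bar>" by simp
      then have "exp (t * \<theta>) * \<bar>hfun z t\<bar> \<le> exp (\<bar>t\<bar> * \<bar>\<theta>\<bar>) * (N * exp (- \<theta>' * \<bar>t\<bar>))"
        by (intro mult_mono N(2)) (auto simp: abs_mult)
      also have "\<dots> = N * exp (- (\<theta>' - \<bar>\<theta>\<bar>) * \<bar>t\<bar>)" by (simp add: algebra_simps flip: exp_add)
      finally show "norm (complex_of_real (exp (t * \<theta>) * hfun z t)) \<le> norm (N * exp (- (\<theta>' - \<bar>\<theta>\<bar>) * \<bar>t\<bar>))"
        using N(1) unfolding norm_of_real abs_mult by simp
    qed
  qed
  have line: "of_real y + \<i> * of_real \<theta> \<in> strip (pi / 4)" for y using th by (simp add: strip_def)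
  have cE: "continuous_on UNIV (\<lambda>y. etot z (of_real y + \<i> * of_real \<theta>))"
    unfolding etot_def
    by (intro continuous_intros continuous_on_compose2[OF holomorphic_on_imp_continuous_on[OF etheta_holomorphic]]) (use line in auto)
  have iE: "integrable lborel (\<lambda>y. etot z (of_real y + \<i> * of_real \<theta>))"
    using hfun_fourier[OF th, of z 0] by (simp add: has_bochner_integral_iff)
  have bE: "norm (etot z (of_real y + \<i> * of_real \<theta>)) \<le> C" for y
  proof -
    have "norm (etot z (of_real y + \<i> * of_real \<theta>)) \<le> C * exp (- \<bar>Re (of_real y + \<i> * of_real \<theta>)\<bar> / 2)"
      by (rule C(2)) simp
    also have "\<dots> \<le> C * 1" using C(1) by (intro mult_left_mono) auto
    finally show ?thesis by simp
  qed
  have "(LBINT t. of_real (exp (t * \<theta>) * hfun z t) * exp (- \<i> * of_real t * of_real y)) = 2 * of_real pi * etot z (of_real y + \<i> * of_real \<theta>)"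
    by (rule fourier_inversion[OF cE iE bE _ Gint]) (rule has_bochner_integral_integral_eq[OF hfun_fourier[OF th], symmetric])
  moreover have "integrable lborel (\<lambda>t. complex_of_real (exp (t * \<theta>) * hfun z t) * exp (- \<i> * of_real t * of_real y))"
  proof (rule Bochner_Integration.integrable_bound[OF Gint])
    have "continuous_on UNIV (\<lambda>t. complex_of_real (exp (t * \<theta>) * hfun z t) * exp (- \<i> * of_real t * of_real y))"
      by (intro continuous_intros hfun_continuous)
    then show "(\<lambda>t. complex_of_real (exp (t * \<theta>) * hfun z t) * exp (- \<i> * of_real t * of_real y)) \<in> borel_measurable lborel"
      using borel_measurable_continuous_onI by simp
  qed (simp add: norm_mult)
  ultimately show ?thesis by (simp only: has_bochner_integral_iff)
qed

section \<open>Superposition of the shifted transforms\<close>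

definition gsum :: "(nat \<Rightarrow> real) \<Rightarrow> (nat \<Rightarrow> real) \<Rightarrow> complex \<Rightarrow> real \<Rightarrow> real" where
  "gsum c l z t = (\<Sum>\<^sub>\<infinity>j. c j * hfun z (t - l j))"

definition csum :: "(nat \<Rightarrow> real) \<Rightarrow> (nat \<Rightarrow> real) \<Rightarrow> complex \<Rightarrow> complex" where
  "csum c l \<zeta> = (\<Sum>\<^sub>\<infinity>j. of_real (c j) * exp (- \<i> * of_real (l j) * \<zeta>))"

lemma abs_summable_on_nat: "summable (\<lambda>j. \<bar>c j\<bar>) \<Longrightarrow> (\<lambda>j. \<bar>c j\<bar> * K) summable_on UNIV" for c :: "nat \<Rightarrow> real"
  by (intro summable_on_cmult_left norm_summable_imp_summable_on) simp

lemma gsum_summable: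
  assumes c: "summable (\<lambda>j. \<bar>c j\<bar>)"
  shows "(\<lambda>j. norm (c j * hfun z (t - l j))) summable_on UNIV"
proof -
  obtain N where N: "N > 0" "\<And>t. \<bar>hfun z t\<bar> \<le> N * exp (- 0 * \<bar>t\<bar>)" using hfun_bound[of 0 z] by (metis order_refl pi_gt_zero zero_less_divide_iff zero_less_numeral)
  show ?thesis
    by (rule summable_on_comparison_test[OF abs_summable_on_nat[OF c, of N]])
       (use N in \<open>auto simp: abs_mult intro!: mult_left_mono\<close>)
qed

lemma gsum_continuous:
  assumes c: "summable (\<lambda>j. \<bar>c j\<bar>)"
  shows "continuous_on UNIV (gsum c l z)"
proof -
  obtain N where N: "N > 0" "\<And>t. \<bar>hfun z t\<bar> \<le> N * exp (- 0 * \<bar>t\<bar>)" using hfun_bound[of 0 z] by (metis order_refl pi_gt_zero zero_less_divide_iff zero_less_numeral)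
  have "uniform_limit UNIV (\<lambda>X t. \<Sum>j\<in>X. c j * hfun z (t - l j)) (\<lambda>t. \<Sum>\<^sub>\<infinity>j\<in>UNIV. c j * hfun z (t - l j)) (finite_subsets_at_top UNIV)"
    by (rule Weierstrass_m_test_general[where M = "\<lambda>j. \<bar>c j\<bar> * N"])
       (use N abs_summable_on_nat[OF c] in \<open>auto simp: abs_mult intro!: mult_left_mono\<close>)
  then have "continuous_on UNIV (\<lambda>t. \<Sum>\<^sub>\<infinity>j\<in>UNIV. c j * hfun z (t - l j))"
    by (rule uniform_limit_theorem[rotated])
       (auto intro!: always_eventually continuous_intros continuous_on_compose2[OF hfun_continuous])
  then show ?thesis by (simp add: gsum_def[abs_def])
qed

text \<open>At \<open>s = 1 / 2 - i * t\<close> the shift by \<open>i * l j\<close> becomes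
  \<open>t - l j\<close>. The completed zeta function is symmetric on this line, so it may be taken
  at the argument that matches each hypergeometric factor; \<open>completed_zeta_hyp_1F1\<close>
  then gives the two terms of \<open>hfun_eq\<close>.\<close>

lemma F_eq_gsum:
  assumes c: "summable (\<lambda>j. \<bar>c j\<bar>)"
  shows "F c l z (1 / 2 - \<i> * of_real t) = of_real (2 * gsum c l z t)"
proof -
  have "of_real (c j) * completed_zeta (1 / 2 - \<i> * of_real t + \<i> * of_real (l j)) *
     (hyp_1F1 ((1 - (1 / 2 - \<i> * of_real t + \<i> * of_real (l j))) / 2) (1 / 2) (z ^ 2 / 4) +
      hyp_1F1 ((1 - (cnj (1 / 2 - \<i> * of_real t) - \<i> * of_real (l j))) / 2) (1 / 2) (cnj z ^ 2 / 4)) =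
     of_real (2 * (c j * hfun z (t - l j)))" for j
  proof -
    define \<tau> where "\<tau> = t - l j"
    have e: "1 / 2 - \<i> * of_real t + \<i> * of_real (l j) = 1 / 2 - \<i> * of_real \<tau>"
      "1 - (1 / 2 - \<i> * of_real \<tau>) = 1 / 2 + \<i> * of_real \<tau>"
      "1 - (cnj (1 / 2 - \<i> * of_real t) - \<i> * of_real (l j)) = 1 / 2 - \<i> * of_real \<tau>"
      by (simp_all add: \<tau>_def algebra_simps)
    have p: "Re (1 / 2 + \<i> * complex_of_real \<tau>) > 0" "1 / 2 + \<i> * complex_of_real \<tau> \<noteq> 1"
       "Re (1 / 2 - \<i> * complex_of_real \<tau>) > 0" "1 / 2 - \<i> * complex_of_real \<tau> \<noteq> 1"
      by (auto simp: complex_eq_iff)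
    have "ltheta 0 (1 - (1 / 2 + \<i> * complex_of_real \<tau>)) = ltheta 0 (1 / 2 + \<i> * complex_of_real \<tau>)"
      unfolding ltheta_reflect by simp
    moreover have "1 - (1 / 2 + \<i> * complex_of_real \<tau>) = 1 / 2 - \<i> * of_real \<tau>" by simp
    ultimately have cz: "completed_zeta (1 / 2 - \<i> * of_real \<tau>) = completed_zeta (1 / 2 + \<i> * of_real \<tau>)"
      by (simp add: completed_zeta_eq_ltheta[OF p(1,2)] completed_zeta_eq_ltheta[OF p(3,4)])
    have "completed_zeta (1 / 2 - \<i> * of_real \<tau>) * (hyp_1F1 ((1 / 2 + \<i> * of_real \<tau>) / 2) (1 / 2) (z ^ 2 / 4) + hyp_1F1 ((1 / 2 - \<i> * of_real \<tau>) / 2) (1 / 2) (cnj z ^ 2 / 4))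
       = completed_zeta (1 / 2 + \<i> * of_real \<tau>) * hyp_1F1 ((1 / 2 + \<i> * of_real \<tau>) / 2) (1 / 2) (z ^ 2 / 4)
       + completed_zeta (1 / 2 - \<i> * of_real \<tau>) * hyp_1F1 ((1 / 2 - \<i> * of_real \<tau>) / 2) (1 / 2) (cnj z ^ 2 / 4)"
      by (simp only: distrib_left cz)
    also have "\<dots> = 2 * of_real (hfun z \<tau>)"
      unfolding hfun_eq completed_zeta_hyp_1F1[OF p(1,2)] completed_zeta_hyp_1F1[OF p(3,4)] by simp
    finally have h: "completed_zeta (1 / 2 - \<i> * of_real \<tau>) * (hyp_1F1 ((1 / 2 + \<i> * of_real \<tau>) / 2) (1 / 2) (z ^ 2 / 4) + hyp_1F1 ((1 / 2 - \<i> * of_real \<tau>) / 2) (1 / 2) (cnj z ^ 2 / 4)) = 2 * of_real (hfun z \<tau>)" .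
    show ?thesis unfolding e mult.assoc h by (simp add: \<tau>_def)
  qed
  note term_eq = this
  have 1: "F c l z (1 / 2 - \<i> * of_real t) = (\<Sum>j. of_real (2 * (c j * hfun z (t - l j))))"
    unfolding F_def by (rule suminf_cong) (rule term_eq)
  have "((\<lambda>j. c j * hfun z (t - l j)) has_sum gsum c l z t) UNIV"
    unfolding gsum_def by (rule has_sum_infsum[OF abs_summable_summable[OF gsum_summable[OF c]]])
  from sums_of_real[OF sums_mult[OF has_sum_imp_sums[OF this], of 2]]
  have 2: "(\<lambda>j. of_real (2 * (c j * hfun z (t - l j))) :: complex) sums of_real (2 * gsum c l z t)" .
  show ?thesis unfolding 1 by (rule sums_unique[OF 2, symmetric])
qed

lemma gsum_transform:
  assumes c: "summable (\<lambda>j. \<bar>c j\<bar>)" and l: "bounded (range l)" and th: "\<bar>\<theta>\<bar> < pi / 4"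
  shows "has_bochner_integral lborel (\<lambda>t. of_real (exp (t * \<theta>) * gsum c l z t) * exp (- \<i> * of_real t * of_real y))
     (2 * of_real pi * csum c l (of_real y + \<i> * of_real \<theta>) * etot z (of_real y + \<i> * of_real \<theta>))"
proof -
  define \<zeta> where "\<zeta> = of_real y + \<i> * of_real \<theta>"
  define B where "B = (\<lambda>t. of_real (exp (t * \<theta>) * hfun z t) * exp (- \<i> * complex_of_real t * of_real y))"
  have Bi: "has_bochner_integral lborel B (2 * of_real pi * etot z \<zeta>)"
    unfolding B_def \<zeta>_def by (rule hfun_transform[OF th])
  obtain L where L: "\<And>j. \<bar>l j\<bar> \<le> L" using l by (auto simp: bounded_iff)
  define f where "f = (\<lambda>j t. of_real (exp (t * \<theta>) * (c j * hfun z (t - l j))) * exp (- \<i> * complex_of_real t * of_real y))"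
  \<comment> \<open>Translation by \<open>l j\<close> also translates the tilt
    \<open>exp (t * \<theta>)\<close>; this is why the character appears at the complex point
    \<open>\<zeta>\<close> and not at \<open>y\<close>.\<close>
  have fB: "f j t = (of_real (c j) * exp (- \<i> * of_real (l j) * \<zeta>)) * B (- l j + 1 * t)" for j t
  proof -
    have "exp (- \<i> * of_real (l j) * \<zeta>) * (of_real (exp ((t - l j) * \<theta>)) * exp (- \<i> * complex_of_real (t - l j) * of_real y)) =
       of_real (exp (t * \<theta>)) * exp (- \<i> * complex_of_real t * of_real y)"
      unfolding exp_of_real[symmetric] exp_add[symmetric] \<zeta>_def by (rule arg_cong[of _ _ exp]) (simp add: algebra_simps)
    then show ?thesis unfolding f_def B_def by (simp add: mult_ac) 
  qed
  have Bs: "has_bochner_integral lborel (\<lambda>t. B (- l j + 1 * t)) (2 * of_real pi * etot z \<zeta>)" for j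
    using Bi lborel_has_bochner_integral_real_affine_iff[of 1 B _ "- l j"] by simp
  have fi: "has_bochner_integral lborel (f j) ((of_real (c j) * exp (- \<i> * of_real (l j) * \<zeta>)) * (2 * of_real pi * etot z \<zeta>))" for j
    unfolding fB[abs_def] by (rule has_bochner_integral_mult_right[OF Bs])
  define K where "K = (LBINT t. norm (B t))"
  have K0: "K \<ge> 0" by (simp add: K_def)
  have nfi: "(LBINT t. norm (f j t)) \<le> \<bar>c j\<bar> * (exp (L * \<bar>\<theta>\<bar>) * K)" for j
  proof -
    have "(LBINT t. norm (f j t)) = norm (of_real (c j) * exp (- \<i> * of_real (l j) * \<zeta>)) * (LBINT t. norm (B (- l j + 1 * t)))"
      unfolding fB norm_mult[of _ "B _"] by simp
    also have "(LBINT t. norm (B (- l j + 1 * t))) = K"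
      unfolding K_def using lborel_integral_real_affine[of 1 "\<lambda>y. norm (B y)" "- l j"] by simp
    also have "norm (of_real (c j) * exp (- \<i> * of_real (l j) * \<zeta>)) = \<bar>c j\<bar> * exp (l j * \<theta>)"
      by (simp add: norm_mult \<zeta>_def)
    also have "\<dots> \<le> \<bar>c j\<bar> * exp (L * \<bar>\<theta>\<bar>)"
    proof -
      have "l j * \<theta> \<le> \<bar>l j\<bar> * \<bar>\<theta>\<bar>" by (metis abs_ge_self abs_mult)
      also have "\<dots> \<le> L * \<bar>\<theta>\<bar>" using L by (intro mult_right_mono) auto
      finally show ?thesis by (intro mult_left_mono) auto
    qed
    finally show ?thesis using K0 by (simp add: mult_right_mono mult.assoc)
  qed
  have ii: "((\<lambda>j. LBINT t. f j t) has_sum (LBINT t. (\<Sum>\<^sub>\<infinity>j. f j t))) UNIV \<and> integrable lborel (\<lambda>t. \<Sum>\<^sub>\<infinity>j. f j t)"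
  proof (intro conjI integral_infsum)
    show "integrable lborel (f j)" "integrable lborel (f j)" for j using fi[of j] by (simp_all add: has_bochner_integral_iff)
    have "norm (f j t) = exp (t * \<theta>) * norm (c j * hfun z (t - l j))" for j t
      by (simp add: f_def norm_mult abs_mult)
    moreover have "(\<lambda>j. exp (t * \<theta>) * norm (c j * hfun z (t - l j))) summable_on UNIV" for t
      by (rule summable_on_cmult_right[OF gsum_summable[OF c]])
    ultimately show "(\<lambda>j. norm (f j t)) summable_on UNIV" "(\<lambda>j. norm (f j t)) summable_on UNIV" for t
      by (simp_all only:)
    show "(\<lambda>j. LBINT t. norm (f j t)) summable_on UNIV" "(\<lambda>j. LBINT t. norm (f j t)) summable_on UNIV"
      by (rule summable_on_comparison_test[OF abs_summable_on_nat[OF c] nfi], simp)+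
  qed simp_all
  have fsum: "(\<Sum>\<^sub>\<infinity>j. f j t) = of_real (exp (t * \<theta>) * gsum c l z t) * exp (- \<i> * of_real t * of_real y)" for t
  proof -
    have "((\<lambda>j. c j * hfun z (t - l j)) has_sum gsum c l z t) UNIV"
      unfolding gsum_def by (rule has_sum_infsum[OF abs_summable_summable[OF gsum_summable[OF c]]])
    from has_sum_cmult_left[OF has_sum_of_real[OF has_sum_cmult_right[OF this]]]
    have "((\<lambda>j. f j t) has_sum of_real (exp (t * \<theta>) * gsum c l z t) * exp (- \<i> * of_real t * of_real y)) UNIV"
      unfolding f_def .
    then show ?thesis by (rule infsumI)
  qed
  have cs: "((\<lambda>j. of_real (c j) * exp (- \<i> * of_real (l j) * \<zeta>) * (2 * of_real pi * etot z \<zeta>)) has_sum (LBINT t. of_real (exp (t * \<theta>) * gsum c l z t) * exp (- \<i> * of_real t * of_real y))) UNIV"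
    using conjunct1[OF ii] unfolding fsum has_bochner_integral_integral_eq[OF fi] .
  then have "(\<Sum>\<^sub>\<infinity>j. of_real (c j) * exp (- \<i> * of_real (l j) * \<zeta>) * (2 * of_real pi * etot z \<zeta>)) = (LBINT t. of_real (exp (t * \<theta>) * gsum c l z t) * exp (- \<i> * of_real t * of_real y))"
    by (rule infsumI)
  then have "(LBINT t. of_real (exp (t * \<theta>) * gsum c l z t) * exp (- \<i> * of_real t * of_real y)) = csum c l \<zeta> * (2 * of_real pi * etot z \<zeta>)"
    unfolding csum_def infsum_cmult_left' by (rule sym)
  moreover have "integrable lborel (\<lambda>t. of_real (exp (t * \<theta>) * gsum c l z t) * exp (- \<i> * of_real t * of_real y))"
    using conjunct2[OF ii] unfolding fsum .
  ultimately have "has_bochner_integral lborel (\<lambda>t. of_real (exp (t * \<theta>) * gsum c l z t) * exp (- \<i> * of_real t * of_real y)) (csum c l \<zeta> * (2 * of_real pi * etot z \<zeta>))"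
    by (simp only: has_bochner_integral_iff)
  moreover have "csum c l \<zeta> * (2 * of_real pi * etot z \<zeta>) = 2 * of_real pi * csum c l \<zeta> * etot z \<zeta>" by (simp only: mult_ac)
  ultimately show ?thesis by (simp only: \<zeta>_def)
qed

section \<open>Behaviour of the theta function at a cusp\<close>

text \<open>Majorant for the theta series after Poisson summation at a cusp. As \<open>A\<close>
  grows, only a term with \<open>m\<close> close to \<open>- x\<close> can survive.\<close>

definition gs :: "real \<Rightarrow> real \<Rightarrow> real" where
  "gs A x = (\<Sum>\<^sub>\<infinity>m::int. exp (- (pi * A * (of_int m + x)\<^sup>2)))"

lemma gs_term_bound:
  obtains C where "C > 0" "\<And>A x m. A \<ge> 1 \<Longrightarrow> 0 \<le> x \<Longrightarrow> x \<le> 1 \<Longrightarrow> exp (- (pi * A * (of_int m + x)\<^sup>2)) \<le> C * exp (- real_of_int \<bar>m\<bar>)"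
proof -
  obtain C where C: "C > 0" "\<And>(\<zeta>::complex) m. norm \<zeta> \<le> 1 \<Longrightarrow> norm (exp (- (of_real pi * 1 * (\<zeta> + of_int m)\<^sup>2))) \<le> C * exp (- real_of_int \<bar>m\<bar>)"
    using gaussian_term_bound[of "1::complex" 1] by (metis one_complex.sel(1) zero_less_one)
  show ?thesis
  proof (rule that[OF C(1)])
    fix A x :: real and m :: int assume A: "A \<ge> 1" and x: "0 \<le> x" "x \<le> 1"
    have e: "exp (- (of_real pi * 1 * (complex_of_real x + of_int m)\<^sup>2)) = of_real (exp (- (pi * (of_int m + x)\<^sup>2)))"
      unfolding exp_of_real[symmetric] by (simp add: add.commute)
    have "exp (- (pi * (of_int m + x)\<^sup>2)) \<le> C * exp (- real_of_int \<bar>m\<bar>)"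
      using C(2)[of "of_real x" m] x unfolding e by simp
    moreover have "1 * (pi * (of_int m + x)\<^sup>2) \<le> A * (pi * (of_int m + x)\<^sup>2)" using A by (intro mult_right_mono) auto
    then have "exp (- (pi * A * (of_int m + x)\<^sup>2)) \<le> exp (- (pi * (of_int m + x)\<^sup>2))" by (simp add: mult_ac)
    ultimately show "exp (- (pi * A * (of_int m + x)\<^sup>2)) \<le> C * exp (- real_of_int \<bar>m\<bar>)" by linarith
  qed
qed

lemma gs_shift:
  "(\<lambda>m::int. exp (- (pi * A * (of_int m + x)\<^sup>2))) summable_on UNIV \<longleftrightarrow> (\<lambda>m::int. exp (- (pi * A * (of_int m + (x - of_int k))\<^sup>2))) summable_on UNIV"
  "gs A x = gs A (x - of_int k)"
proof -
  have b: "bij (\<lambda>m::int. m + k)" by (rule bij_betw_byWitness[of _ "\<lambda>m. m - k"]) auto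
  have e: "exp (- (pi * A * (of_int (m + k) + (x - of_int k))\<^sup>2)) = exp (- (pi * A * (of_int m + x)\<^sup>2))" for m :: int
    by simp
  show "gs A x = gs A (x - of_int k)"
    unfolding gs_def using infsum_reindex_bij_betw[OF b, of "\<lambda>m. exp (- (pi * A * (of_int m + (x - of_int k))\<^sup>2))"] unfolding e by simp
  show "(\<lambda>m::int. exp (- (pi * A * (of_int m + x)\<^sup>2))) summable_on UNIV \<longleftrightarrow> (\<lambda>m::int. exp (- (pi * A * (of_int m + (x - of_int k))\<^sup>2))) summable_on UNIV"
    using summable_on_reindex_bij_betw[OF b, of "\<lambda>m. exp (- (pi * A * (of_int m + (x - of_int k))\<^sup>2))"] unfolding e by simp
qed

lemma gs_summable:
  assumes "A \<ge> 1" shows "(\<lambda>m::int. exp (- (pi * A * (of_int m + x)\<^sup>2))) summable_on UNIV"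
proof -
  obtain C where C: "C > 0" "\<And>A x m. A \<ge> 1 \<Longrightarrow> 0 \<le> x \<Longrightarrow> x \<le> 1 \<Longrightarrow> exp (- (pi * A * (of_int m + x)\<^sup>2)) \<le> C * exp (- real_of_int \<bar>m\<bar>)"
    using gs_term_bound by metis
  have x: "0 \<le> x - of_int \<lfloor>x\<rfloor>" "x - of_int \<lfloor>x\<rfloor> \<le> 1" by linarith+
  show ?thesis unfolding gs_shift(1)[of A x "\<lfloor>x\<rfloor>"]
    by (rule summable_on_comparison_test[OF summable_on_int_exp_abs C(2)[OF assms x]]) simp
qed

lemma gs_bounded: obtains K where "K > 0" "\<And>A x. A \<ge> 1 \<Longrightarrow> gs A x \<le> K"
proof -
  obtain C where C: "C > 0" "\<And>A x m. A \<ge> 1 \<Longrightarrow> 0 \<le> x \<Longrightarrow> x \<le> 1 \<Longrightarrow> exp (- (pi * A * (of_int m + x)\<^sup>2)) \<le> C * exp (- real_of_int \<bar>m\<bar>)"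
    using gs_term_bound by metis
  define K where "K = (\<Sum>\<^sub>\<infinity>m::int. C * exp (- real_of_int \<bar>m\<bar>))"
  have K0: "K \<ge> 0" unfolding K_def using C(1) by (intro infsum_nonneg) auto
  show ?thesis
  proof (rule that[of "K + 1"])
    fix A x :: real assume A: "A \<ge> 1"
    have x: "0 \<le> x - of_int \<lfloor>x\<rfloor>" "x - of_int \<lfloor>x\<rfloor> \<le> 1" by linarith+
    have "gs A x \<le> K" unfolding gs_shift(2)[of A x "\<lfloor>x\<rfloor>"] unfolding gs_def K_def
      by (intro infsum_mono gs_summable A summable_on_int_exp_abs C(2)[OF A x])
    then show "gs A x \<le> K + 1" by simp
  qed (use K0 in simp)
qed

text \<open>Splitting \<open>A = (A - 1) + 1\<close> spends the first part on the distance
  \<open>d\<close> and keeps the second for summability.\<close>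

lemma gs_term_le:
  fixes A d t :: real
  assumes "A \<ge> 1" "d \<le> \<bar>t\<bar>" "d \<ge> 0"
  shows "exp (- (pi * A * t\<^sup>2)) \<le> exp (- (pi * (A - 1) * d\<^sup>2)) * exp (- (pi * 1 * t\<^sup>2))"
proof -
  have "d\<^sup>2 \<le> \<bar>t\<bar>\<^sup>2" using assms by (intro power_mono) auto
  then have "pi * (A - 1) * d\<^sup>2 \<le> pi * (A - 1) * t\<^sup>2" using assms by (intro mult_left_mono) auto
  then show ?thesis unfolding exp_add[symmetric] by (simp add: algebra_simps)
qed

lemma gs_le_far:
  assumes A: "A \<ge> 1" and d: "\<And>m::int. d \<le> \<bar>of_int m + x\<bar>" "d \<ge> 0"
  shows "gs A x \<le> exp (- (pi * (A - 1) * d\<^sup>2)) * gs 1 x"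
proof -
  have "gs A x \<le> (\<Sum>\<^sub>\<infinity>m::int. exp (- (pi * (A - 1) * d\<^sup>2)) * exp (- (pi * 1 * (of_int m + x)\<^sup>2)))"
    unfolding gs_def
    by (intro infsum_mono gs_summable A summable_on_cmult_right gs_term_le d) auto
  then show ?thesis unfolding gs_def infsum_cmult_right' .
qed

text \<open>Every integer other than \<open>m0\<close> has distance at least \<open>1 / 2\<close>
  from \<open>- x\<close>, so \<open>gs_term_le\<close> applies to the rest with
  \<open>d = 1 / 2\<close>.\<close>

lemma gs_le_near:
  assumes A: "A \<ge> 1" and m0: "\<bar>of_int m0 + x\<bar> \<le> 1/2"
  shows "gs A x - exp (- (pi * A * (of_int m0 + x)\<^sup>2)) \<le> exp (- (pi * (A - 1) * (1/2)\<^sup>2)) * gs 1 x"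
proof -
  let ?t = "\<lambda>A (m::int). exp (- (pi * A * (of_int m + x)\<^sup>2))"
  have s: "?t B summable_on S" if "B \<ge> 1" for B S
    by (rule summable_on_subset_banach[OF gs_summable[OF that]]) auto
  have "gs A x = infsum (?t A) (insert m0 (UNIV - {m0}))" unfolding gs_def by (simp add: insert_absorb)
  also have "\<dots> = ?t A m0 + infsum (?t A) (UNIV - {m0})"
    by (subst infsum_insert) (auto intro: s A)
  finally have 1: "gs A x - ?t A m0 = infsum (?t A) (UNIV - {m0})" by simp
  have "infsum (?t A) (UNIV - {m0}) \<le> (\<Sum>\<^sub>\<infinity>m\<in>UNIV - {m0}. exp (- (pi * (A - 1) * (1/2)\<^sup>2)) * ?t 1 m)"
  proof (intro infsum_mono s A summable_on_cmult_right)
    fix m assume "m \<in> UNIV - {m0}"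
    then have "m \<ge> m0 + 1 \<or> m \<le> m0 - 1" by auto
    then have "real_of_int m \<ge> real_of_int m0 + 1 \<or> real_of_int m \<le> real_of_int m0 - 1" by linarith
    then have "1/2 \<le> \<bar>of_int m + x\<bar>" using m0 by linarith
    then show "?t A m \<le> exp (- (pi * (A - 1) * (1/2)\<^sup>2)) * ?t 1 m" by (intro gs_term_le A) auto
  qed auto
  also have "\<dots> = exp (- (pi * (A - 1) * (1/2)\<^sup>2)) * infsum (?t 1) (UNIV - {m0})" by (rule infsum_cmult_right')
  also have "infsum (?t 1) (UNIV - {m0}) \<le> gs 1 x"
    unfolding gs_def by (intro infsum_mono_neutral s) auto
  finally show ?thesis unfolding 1 by simp
qed

text \<open>
  In these coordinates the reflection \<open>z \<mapsto> i * cnj z\<close>, which exchanges the two terms of the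
  summand, becomes \<open>v \<mapsto> - v\<close>.
\<close>

definition zz :: "real \<Rightarrow> real \<Rightarrow> complex" where
  "zz u v = 2 * of_real (sqrt pi) * cis (pi / 4) * Complex u v"

lemma cis_quarter_squared: "(cis (pi / 4))\<^sup>2 = \<i>"
proof -
  have "(cis (pi / 4))\<^sup>2 = cis (pi / 2)" by (simp add: power2_eq_square cis_mult)
  then show ?thesis by (simp only: cis_pi_half)
qed

lemma zz_squared: "(zz u v)\<^sup>2 = 4 * of_real pi * \<i> * (Complex u v)\<^sup>2"
  unfolding zz_def power_mult_distrib sqrt_pi_squared_complex cis_quarter_squared by simp

lemma i_cnj_zz: "\<i> * cnj (zz u v) = zz u (- v)"
proof -
  have 1: "\<i> * cnj (cis (pi / 4)) = cis (pi / 4)"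
    by (simp add: complex_eq_iff cos_45 sin_45)
  have 2: "cnj (Complex u v) = Complex u (- v)" by (simp add: complex_eq_iff)
  have "\<i> * cnj (zz u v) = 2 * of_real (sqrt pi) * (\<i> * cnj (cis (pi / 4))) * cnj (Complex u v)"
    unfolding zz_def by (simp only: complex_cnj_mult complex_cnj_complex_of_real complex_cnj_numeral mult_ac)
  then show ?thesis unfolding 1 2 zz_def .
qed

text \<open>The inverse of the growth ratio in \<open>cuspM_uminus\<close>: the factor before the
  reflected term of \<open>etot\<close> exactly balances the two growth rates.\<close>

lemma norm_exp_cnj_zz: "norm (exp ((cnj (zz u v))\<^sup>2 / 4)) = exp (- 2 * pi * u * v)"
proof -
  have "Re ((cnj (zz u v))\<^sup>2 / 4) = Re (cnj ((zz u v)\<^sup>2 / 4))"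
    by (simp only: complex_cnj_divide complex_cnj_power complex_cnj_numeral)
  also have "\<dots> = Re ((zz u v)\<^sup>2 / 4)" by (simp only: cnj.sel)
  also have "\<dots> = - 2 * pi * u * v" unfolding zz_squared by (simp add: power2_eq_square)
  finally show ?thesis by (simp only: norm_exp_eq_Re)
qed

text \<open>In \<open>(exp \<zeta>)^2 = i * r + \<eta>\<close> the cusp value \<open>i * r\<close>
  contributes, by \<open>H\<close>, only a linear character of frequency \<open>q\<close>. There
  remains a theta series with parameter \<open>\<eta>\<close>, which is small near the cusp and has
  positive real part, and Poisson summation inverts it.\<close>

lemma cusp_expansion:
  fixes r x a q u v :: real
  assumes r: "r > 0" and a: "0 < a" "a < pi / 4"
    and H: "\<And>n::int. exp (- (of_real pi * \<i> * of_real r * (of_int n)\<^sup>2)) = exp (2 * of_real pi * \<i> * of_int n * of_real q)"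
  defines "\<eta> \<equiv> \<i> * of_real r * (exp (of_real (2 * x) - 2 * \<i> * of_real a) - 1)"
    and "b \<equiv> of_real (sqrt r) * exp (of_real x - \<i> * of_real a) * Complex u v"
    and "\<zeta> \<equiv> of_real (ln r / 2 + x) + \<i> * of_real (pi / 4 - a)"
  shows "Re \<eta> = r * exp (2 * x) * sin (2 * a)"
    and "csqrt \<eta> * gtheta (zz u v) (exp \<zeta>) = (\<Sum>\<^sub>\<infinity>m::int. exp (- (of_real pi * (of_int m + (of_real q + b))\<^sup>2 / \<eta>)))"
proof -
  show re: "Re \<eta> = r * exp (2 * x) * sin (2 * a)" unfolding \<eta>_def by (simp add: Re_exp Im_exp)
  have "sin (2 * a) > 0" using a by (intro sin_gt_zero) auto
  then have eta: "Re \<eta> > 0" unfolding re using r by simp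
  have rt: "of_real (exp (ln r / 2)) = complex_of_real (sqrt r)"
    using r by (simp add: powr_half_sqrt[symmetric] powr_def)
  have ez: "exp \<zeta> = of_real (sqrt r) * exp (of_real x - \<i> * of_real a) * cis (pi / 4)"
    unfolding \<zeta>_def rt[symmetric] exp_of_real[symmetric] cis_conv_exp exp_add[symmetric]
    by (rule arg_cong[of _ _ exp]) (simp add: algebra_simps)
  have b2: "(exp \<zeta>)\<^sup>2 = \<i> * of_real r + \<eta>"
  proof -
    note cis_quarter_squared
    moreover have "(complex_of_real (sqrt r))\<^sup>2 = of_real r" using r by (simp flip: of_real_power)
    moreover have "(exp (of_real x - \<i> * of_real a))\<^sup>2 = exp (of_real (2 * x) - 2 * \<i> * of_real a)"
      by (simp add: exp_double[symmetric] algebra_simps)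
    ultimately show ?thesis unfolding ez power_mult_distrib \<eta>_def by (simp add: algebra_simps)
  qed
  have sb: "of_real (sqrt pi) * exp \<zeta> * zz u v = 2 * of_real pi * \<i> * b"
  proof -
    have "of_real (sqrt pi) * exp \<zeta> * zz u v = 2 * (of_real (sqrt pi))\<^sup>2 * (cis (pi / 4))\<^sup>2 * b"
      unfolding ez zz_def b_def by (simp add: power2_eq_square mult_ac)
    moreover note cis_quarter_squared
    ultimately show ?thesis by (simp only: sqrt_pi_squared_complex)
  qed
  have t: "exp (- (of_real pi * (exp \<zeta>)\<^sup>2 * (of_int n)\<^sup>2) + of_real (sqrt pi) * exp \<zeta> * of_int n * zz u v) =
    exp (- (of_real pi * \<eta> * (of_int n)\<^sup>2) + 2 * of_real pi * \<i> * of_int n * (of_real q + b))" for n :: int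
  proof -
    have "- (of_real pi * (exp \<zeta>)\<^sup>2 * (of_int n)\<^sup>2) + of_real (sqrt pi) * exp \<zeta> * of_int n * zz u v =
      - (of_real pi * \<i> * of_real r * (of_int n)\<^sup>2) + (- (of_real pi * \<eta> * (of_int n)\<^sup>2) + of_int n * (of_real (sqrt pi) * exp \<zeta> * zz u v))"
      unfolding b2 by (simp add: algebra_simps)
    also have "\<dots> = - (of_real pi * \<i> * of_real r * (of_int n)\<^sup>2) + (- (of_real pi * \<eta> * (of_int n)\<^sup>2) + 2 * of_real pi * \<i> * of_int n * b)"
      unfolding sb by simp
    finally have "exp (- (of_real pi * (exp \<zeta>)\<^sup>2 * (of_int n)\<^sup>2) + of_real (sqrt pi) * exp \<zeta> * of_int n * zz u v) =
       exp (2 * of_real pi * \<i> * of_int n * of_real q) * exp (- (of_real pi * \<eta> * (of_int n)\<^sup>2) + 2 * of_real pi * \<i> * of_int n * b)"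
      by (simp only: exp_add H)
    then show ?thesis unfolding exp_add[symmetric] by (simp add: algebra_simps)
  qed
  show "csqrt \<eta> * gtheta (zz u v) (exp \<zeta>) = (\<Sum>\<^sub>\<infinity>m::int. exp (- (of_real pi * (of_int m + (of_real q + b))\<^sup>2 / \<eta>)))"
    unfolding gtheta_def t using poisson_summation_gaussian(3)[OF eta, of "of_real q + b"] by simp
qed

text \<open>Completing the square in the real variable \<open>p\<close>. The part independent of
  \<open>p\<close> becomes the exponential growth at the cusp, the shift of \<open>p\<close> the
  position of the Gaussians.\<close>

lemma Re_quadratic_divide:
  fixes \<eta> b :: complex and p :: real
  assumes "Re \<eta> > 0"
  shows "Re ((of_real p + b)\<^sup>2 / \<eta>) = Re \<eta> / (norm \<eta>)\<^sup>2 * (p + (Re b + Im b * Im \<eta> / Re \<eta>))\<^sup>2 - (Im b)\<^sup>2 / Re \<eta>"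
proof -
  define e1 e2 b1 b2 where "e1 = Re \<eta>" and "e2 = Im \<eta>" and "b1 = Re b" and "b2 = Im b"
  have e: "e1 > 0" "(norm \<eta>)\<^sup>2 = e1\<^sup>2 + e2\<^sup>2" using assms by (auto simp: e1_def e2_def cmod_power2)
  have n: "e1\<^sup>2 + e2\<^sup>2 > 0" using e(1) by (simp add: add_pos_nonneg)
  have "Re ((of_real p + b)\<^sup>2 / \<eta>) = (((p + b1)\<^sup>2 - b2\<^sup>2) * e1 + 2 * (p + b1) * b2 * e2) / (e1\<^sup>2 + e2\<^sup>2)"
    unfolding Re_divide by (simp add: e1_def e2_def b1_def b2_def power2_eq_square algebra_simps add_divide_distrib diff_divide_distrib)
  also have "\<dots> = e1 / (e1\<^sup>2 + e2\<^sup>2) * (p + (b1 + b2 * e2 / e1))\<^sup>2 - b2\<^sup>2 / e1"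
  proof -
    define k where "k = e2 / e1"
    have k: "e2 = k * e1" "b2 * e2 / e1 = b2 * k" using e(1) by (auto simp: k_def)
    have N: "e1\<^sup>2 + e2\<^sup>2 = e1 * (e1 * (1 + k\<^sup>2))" unfolding k(1) by (simp add: power2_eq_square algebra_simps)
    then have n': "e1 * (1 + k\<^sup>2) > 0" using e(1) by (simp add: add_pos_nonneg)
    have "((p + b1)\<^sup>2 - b2\<^sup>2) * e1 + 2 * (p + b1) * b2 * e2 = e1 * ((p + (b1 + b2 * k))\<^sup>2 - b2\<^sup>2 * (1 + k\<^sup>2))"
      unfolding k(1) by (simp add: power2_eq_square algebra_simps)
    then have "(((p + b1)\<^sup>2 - b2\<^sup>2) * e1 + 2 * (p + b1) * b2 * e2) / (e1\<^sup>2 + e2\<^sup>2) = ((p + (b1 + b2 * k))\<^sup>2 - b2\<^sup>2 * (1 + k\<^sup>2)) / (e1 * (1 + k\<^sup>2))"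
      unfolding N using e(1) by simp
    also have "\<dots> = (p + (b1 + b2 * k))\<^sup>2 / (e1 * (1 + k\<^sup>2)) - b2\<^sup>2 / e1"
    proof -
      have "b2\<^sup>2 * (1 + k\<^sup>2) / (e1 * (1 + k\<^sup>2)) = b2\<^sup>2 / e1" using n' by (auto simp: mult_divide_mult_cancel_right)
      then show ?thesis by (simp add: diff_divide_distrib)
    qed
    also have "(p + (b1 + b2 * k))\<^sup>2 / (e1 * (1 + k\<^sup>2)) = e1 / (e1\<^sup>2 + e2\<^sup>2) * (p + (b1 + b2 * k))\<^sup>2"
      unfolding N using e(1) by simp
    finally show ?thesis unfolding k(2) .
  qed
  finally show ?thesis unfolding e(2) e1_def e2_def b1_def b2_def .
qed

text \<open>The part of \<open>etheta\<close> that can grow at a cusp; the elementary terms split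
  off from it are collected in \<open>epol\<close>.\<close>

definition thmain :: "complex \<Rightarrow> complex \<Rightarrow> complex" where
  "thmain z \<zeta> = exp (\<zeta> / 2) * gtheta z (exp \<zeta>) / 2"

text \<open>This is the square of the modulus of \<open>2 * sinh w\<close> for
  \<open>w = x - i * a\<close>; it measures \<open>\<eta>\<close>, because
  \<open>\<eta> = i * r * exp w * (2 * sinh w)\<close>.\<close>

definition cuspD :: "real \<Rightarrow> real \<Rightarrow> real" where
  "cuspD x a = 4 * ((sinh x)\<^sup>2 + (sin a)\<^sup>2)"

definition cuspX :: "real \<Rightarrow> real \<Rightarrow> real \<Rightarrow> real \<Rightarrow> real" where
  "cuspX u v x a = v * (sinh x / sin a) + u * (cosh x / cos a)"

definition cuspQ :: "real \<Rightarrow> real \<Rightarrow> real \<Rightarrow> real" where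
  "cuspQ u v a = v * cos a - u * sin a"

text \<open>
  For \<open>\<zeta> = cuspz r x a\<close> we have \<open>(exp \<zeta>)\<^sup>2 = i * r * exp (2 * x - 2 * i * a)\<close>, which tends to the
  cusp \<open>i * r\<close> as \<open>x\<close> and \<open>a\<close> tend to 0.
\<close>

definition cuspz :: "real \<Rightarrow> real \<Rightarrow> real \<Rightarrow> complex" where
  "cuspz r x a = of_real (ln r / 2 + x) + \<i> * of_real (pi / 4 - a)"

text \<open>Everything is rational in \<open>E = exp x\<close>, \<open>S = sin a\<close> and
  \<open>c = cos a\<close>. The dependence on \<open>r\<close> separates as a power of
  \<open>sqrt r\<close>, so that \<open>cuspD\<close>, \<open>cuspX\<close> and \<open>cuspQ\<close>
  are common to all cusps.\<close>

lemma cusp_parameters: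
  fixes r x a u v :: real
  assumes r: "r > 0" and a: "0 < a" "a < pi / 4"
  defines "\<eta> \<equiv> \<i> * of_real r * (exp (of_real (2 * x) - 2 * \<i> * of_real a) - 1)"
    and "b \<equiv> of_real (sqrt r) * exp (of_real x - \<i> * of_real a) * Complex u v"
  shows "norm \<eta> = r * exp x * sqrt (cuspD x a)"
    and "Re \<eta> / (norm \<eta>)\<^sup>2 = sin (2 * a) / (r * cuspD x a)"
    and "(Im b)\<^sup>2 / Re \<eta> = (cuspQ u v a)\<^sup>2 / sin (2 * a)"
    and "Re b + Im b * Im \<eta> / Re \<eta> = sqrt r * cuspX u v x a"
proof -
  define E S c where "E = exp x" and "S = sin a" and "c = cos a"
  have E: "E > 0" by (simp add: E_def)
  have S: "S > 0" unfolding S_def using a by (intro sin_gt_zero) auto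
  have c: "c > 0" unfolding c_def using a by (intro cos_gt_zero_pi) auto
  have Sc: "S\<^sup>2 + c\<^sup>2 = 1" by (simp add: S_def c_def)
  have E2: "exp (2 * x) = E\<^sup>2" by (simp add: E_def exp_double)
  have s2: "sin (2 * a) = 2 * S * c" by (simp add: S_def c_def sin_double)
  have c2: "cos (2 * a) = c\<^sup>2 - S\<^sup>2" by (simp add: S_def c_def cos_double)
  have re: "Re \<eta> = r * (E\<^sup>2 * (2 * S * c))" unfolding \<eta>_def by (simp add: Re_exp Im_exp E2 s2)
  have im: "Im \<eta> = r * (E\<^sup>2 * (c\<^sup>2 - S\<^sup>2) - 1)" unfolding \<eta>_def by (simp add: Re_exp Im_exp E2 c2)
  have rb: "Re b = sqrt r * (E * (u * c + v * S))" unfolding b_def by (simp add: Re_exp Im_exp E_def S_def c_def algebra_simps)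
  have ib: "Im b = sqrt r * (E * (v * c - u * S))" unfolding b_def by (simp add: Re_exp Im_exp E_def S_def c_def algebra_simps)
  have sh: "sinh x = (E - 1 / E) / 2" "cosh x = (E + 1 / E) / 2"
    by (simp_all add: sinh_def cosh_def E_def exp_minus inverse_eq_divide)
  have D: "E\<^sup>2 * cuspD x a = (E\<^sup>2 - 1)\<^sup>2 + 4 * E\<^sup>2 * S\<^sup>2"
    unfolding cuspD_def sh S_def[symmetric] using E by (simp add: field_simps power2_eq_square)
  have D0: "cuspD x a > 0" unfolding cuspD_def S_def[symmetric] using S by (simp add: add_nonneg_pos)
  have c4: "c\<^sup>2 = 1 - S\<^sup>2" using Sc by linarith
  have n2: "(norm \<eta>)\<^sup>2 = r\<^sup>2 * (E\<^sup>2 * cuspD x a)"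
  proof -
    have "(E\<^sup>2 * (2 * S * c))\<^sup>2 + (E\<^sup>2 * (c\<^sup>2 - S\<^sup>2) - 1)\<^sup>2 = (E\<^sup>2)\<^sup>2 * (4 * S\<^sup>2 * c\<^sup>2) + (E\<^sup>2 * (c\<^sup>2 - S\<^sup>2) - 1)\<^sup>2"
      by (simp add: power_mult_distrib)
    also have "\<dots> = (E\<^sup>2 - 1)\<^sup>2 + 4 * E\<^sup>2 * S\<^sup>2"
      unfolding c4 by (simp add: power2_eq_square algebra_simps)
    finally have "(E\<^sup>2 * (2 * S * c))\<^sup>2 + (E\<^sup>2 * (c\<^sup>2 - S\<^sup>2) - 1)\<^sup>2 = E\<^sup>2 * cuspD x a" unfolding D .
    moreover have "(norm \<eta>)\<^sup>2 = r\<^sup>2 * ((E\<^sup>2 * (2 * S * c))\<^sup>2 + (E\<^sup>2 * (c\<^sup>2 - S\<^sup>2) - 1)\<^sup>2)"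
      unfolding cmod_power2 re im power_mult_distrib[of r] by (simp only: distrib_left)
    ultimately show ?thesis by simp
  qed
  show "norm \<eta> = r * exp x * sqrt (cuspD x a)"
  proof (rule power2_eq_imp_eq)
    show "(norm \<eta>)\<^sup>2 = (r * exp x * sqrt (cuspD x a))\<^sup>2" unfolding n2 using D0 by (simp add: power_mult_distrib E_def)
  qed (use r D0 in auto)
  show "Re \<eta> / (norm \<eta>)\<^sup>2 = sin (2 * a) / (r * cuspD x a)"
    unfolding n2 re s2 using r E D0 by (simp add: power2_eq_square)
  show "(Im b)\<^sup>2 / Re \<eta> = (cuspQ u v a)\<^sup>2 / sin (2 * a)"
    unfolding ib re s2 cuspQ_def S_def[symmetric] c_def[symmetric] using r E S c
    by (simp add: power_mult_distrib)
  show "Re b + Im b * Im \<eta> / Re \<eta> = sqrt r * cuspX u v x a"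
  proof -
    have "Im b * Im \<eta> / Re \<eta> = sqrt r * (E * (v * c - u * S) * (E\<^sup>2 * (c\<^sup>2 - S\<^sup>2) - 1) / (E\<^sup>2 * (2 * S * c)))"
      unfolding ib re im using r by simp
    then have 1: "Re b + Im b * Im \<eta> / Re \<eta> = sqrt r * (E * (u * c + v * S) + E * (v * c - u * S) * (E\<^sup>2 * (c\<^sup>2 - S\<^sup>2) - 1) / (E\<^sup>2 * (2 * S * c)))"
      unfolding rb by (simp add: distrib_left)
    define Z where "Z = 2 * S * c * E"
    have Z: "Z \<noteq> 0" using S c E by (simp add: Z_def)
    have "E * (v * c - u * S) * (E\<^sup>2 * (c\<^sup>2 - S\<^sup>2) - 1) / (E\<^sup>2 * (2 * S * c)) = (v * c - u * S) * (E\<^sup>2 * (c\<^sup>2 - S\<^sup>2) - 1) / Z"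
      using E by (simp add: Z_def power2_eq_square)
    moreover have "E * (u * c + v * S) = E * (u * c + v * S) * Z / Z" using Z by simp
    ultimately have 2: "E * (u * c + v * S) + E * (v * c - u * S) * (E\<^sup>2 * (c\<^sup>2 - S\<^sup>2) - 1) / (E\<^sup>2 * (2 * S * c)) =
      (E * (u * c + v * S) * Z + (v * c - u * S) * (E\<^sup>2 * (c\<^sup>2 - S\<^sup>2) - 1)) / Z" by (simp only: add_divide_distrib)
    have "cuspX u v x a * Z = v * c * (E\<^sup>2 - 1) + u * S * (E\<^sup>2 + 1)"
      unfolding cuspX_def sh S_def[symmetric] c_def[symmetric] Z_def using S c E by (simp add: field_simps power2_eq_square)
    then have 3: "cuspX u v x a = (v * c * (E\<^sup>2 - 1) + u * S * (E\<^sup>2 + 1)) / Z" using Z by (simp add: eq_divide_eq)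
    have "E * (u * c + v * S) * Z + (v * c - u * S) * (E\<^sup>2 * (c\<^sup>2 - S\<^sup>2) - 1) =
      u * S * (E\<^sup>2 * (S\<^sup>2 + c\<^sup>2) + 1) + v * c * (E\<^sup>2 * (S\<^sup>2 + c\<^sup>2) - 1)"
      by (simp add: Z_def power2_eq_square algebra_simps)
    then show ?thesis unfolding 1 2 3 Sc by (simp add: add.commute)
  qed
qed

text \<open>The upper bound takes absolute values in the transformed series. The lower bound
  compares the term at \<open>m0\<close> with the sum of all others, hence the form
  \<open>2 * exp _ - gs _ _\<close>.\<close>

lemma thmain_bounds:
  fixes r x a q u v :: real
  assumes r: "r > 0" and a: "0 < a" "a < pi / 4"
    and H: "\<And>n::int. exp (- (of_real pi * \<i> * of_real r * (of_int n)\<^sup>2)) = exp (2 * of_real pi * \<i> * of_int n * of_real q)"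
    and A: "sin (2 * a) / (r * cuspD x a) \<ge> 1"
  defines "A' \<equiv> sin (2 * a) / (r * cuspD x a)"
    and "X \<equiv> q + sqrt r * cuspX u v x a"
    and "M \<equiv> exp (pi * (cuspQ u v a)\<^sup>2 / sin (2 * a)) / (2 * sqrt (sqrt (r * cuspD x a)))"
  shows "norm (thmain (zz u v) (cuspz r x a)) \<le> M * gs A' X"
    and "norm (thmain (zz u v) (cuspz r x a)) \<ge> M * (2 * exp (- (pi * A' * (of_int m0 + X)\<^sup>2)) - gs A' X)"
proof -
  define \<eta> where "\<eta> = \<i> * of_real r * (exp (of_real (2 * x) - 2 * \<i> * of_real a) - 1)"
  define b where "b = of_real (sqrt r) * exp (of_real x - \<i> * of_real a) * Complex u v"
  define \<zeta> where "\<zeta> = cuspz r x a"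
  note ce = cusp_expansion(1)[OF r a H, where x = x, folded \<eta>_def]
    cusp_expansion(2)[OF r a H, where x = x and u = u and v = v, folded \<eta>_def b_def, folded cuspz_def, folded \<zeta>_def]
  note cp = cusp_parameters(1,2)[OF r a, where x = x, folded \<eta>_def] cusp_parameters(3,4)[OF r a, where u = u and v = v and x = x, folded \<eta>_def b_def]
  have s2: "sin (2 * a) > 0" using a by (intro sin_gt_zero) auto
  have eta: "Re \<eta> > 0" unfolding ce(1) using r s2 by simp
  have sa: "sin a > 0" using a by (intro sin_gt_zero) auto
  have D0: "cuspD x a > 0" unfolding cuspD_def using sa by (simp add: add_nonneg_pos)
  define W where "W = exp (pi * (cuspQ u v a)\<^sup>2 / sin (2 * a))"
  define t where "t = (\<lambda>m::int. exp (- (of_real pi * (of_int m + (of_real q + b))\<^sup>2 / \<eta>)))"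
  have nt: "norm (t m) = W * exp (- (pi * A' * (of_int m + X)\<^sup>2))" for m
  proof -
    have "Re ((of_real (of_int m + q) + b)\<^sup>2 / \<eta>) = A' * ((of_int m + q) + sqrt r * cuspX u v x a)\<^sup>2 - (cuspQ u v a)\<^sup>2 / sin (2 * a)"
      unfolding Re_quadratic_divide[OF eta] cp(2-4) A'_def .. 
    moreover have "complex_of_int m + (of_real q + b) = of_real (of_int m + q) + b" by simp
    ultimately have R: "Re ((of_int m + (of_real q + b))\<^sup>2 / \<eta>) = A' * (of_int m + X)\<^sup>2 - (cuspQ u v a)\<^sup>2 / sin (2 * a)"
      by (simp only: X_def add.assoc)
    have "- (of_real pi * (of_int m + (of_real q + b))\<^sup>2 / \<eta>) = of_real (- pi) * ((of_int m + (of_real q + b))\<^sup>2 / \<eta>)" by simp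
    then have "Re (- (of_real pi * (of_int m + (of_real q + b))\<^sup>2 / \<eta>)) = - pi * Re ((of_int m + (of_real q + b))\<^sup>2 / \<eta>)"
      by (simp only: Re_complex_of_real Im_complex_of_real times_complex.sel mult_zero_left diff_zero)
    also have "\<dots> = pi * (cuspQ u v a)\<^sup>2 / sin (2 * a) + - (pi * A' * (of_int m + X)\<^sup>2)"
      unfolding R by (simp add: right_diff_distrib)
    finally have "Re (- (of_real pi * (of_int m + (of_real q + b))\<^sup>2 / \<eta>)) = pi * (cuspQ u v a)\<^sup>2 / sin (2 * a) + - (pi * A' * (of_int m + X)\<^sup>2)" .
    then show ?thesis unfolding t_def norm_exp_eq_Re W_def by (simp only: exp_add)
  qed
  have As: "A' \<ge> 1" using A by (simp add: A'_def)
  have nts: "(\<lambda>m. norm (t m)) summable_on UNIV" unfolding nt by (intro summable_on_cmult_right gs_summable As)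
  have ts: "t summable_on S" for S
    by (rule summable_on_subset_banach[OF abs_summable_summable[OF nts]]) auto
  have nts': "(\<lambda>m. norm (t m)) summable_on S" for S
    by (rule summable_on_subset_banach[OF nts]) auto
  have nsum: "(\<Sum>\<^sub>\<infinity>m. norm (t m)) = W * gs A' X" unfolding nt gs_def by (rule infsum_cmult_right')
  have nle: "norm (infsum t S) \<le> (\<Sum>\<^sub>\<infinity>m\<in>S. norm (t m))" for S
    by (rule norm_infsum_bound) (rule nts')
  define T where "T = infsum t UNIV"
  have up: "norm T \<le> W * gs A' X" using nle[of UNIV] unfolding nsum T_def .
  have lo: "norm T \<ge> W * (2 * exp (- (pi * A' * (of_int m0 + X)\<^sup>2)) - gs A' X)"
  proof -
    have "T = infsum t (insert m0 (UNIV - {m0}))" unfolding T_def by (simp add: insert_absorb)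
    also have "\<dots> = t m0 + infsum t (UNIV - {m0})" by (subst infsum_insert) (auto intro: ts)
    finally have 1: "T = t m0 + infsum t (UNIV - {m0})" .
    have "W * gs A' X = infsum (\<lambda>m. norm (t m)) (insert m0 (UNIV - {m0}))" unfolding nsum[symmetric] by (simp add: insert_absorb)
    also have "\<dots> = norm (t m0) + infsum (\<lambda>m. norm (t m)) (UNIV - {m0})" by (subst infsum_insert) (auto intro: nts')
    finally have 2: "infsum (\<lambda>m. norm (t m)) (UNIV - {m0}) = W * gs A' X - norm (t m0)" by simp
    have "norm T \<ge> norm (t m0) - norm (infsum t (UNIV - {m0}))" unfolding 1 by (rule norm_diff_ineq)
    then have "norm T \<ge> norm (t m0) - (W * gs A' X - norm (t m0))" using nle[of "UNIV - {m0}"] 2 by linarith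
    then show ?thesis unfolding nt by (simp add: algebra_simps)
  qed
  have csq: "norm (csqrt \<eta>) > 0" using eta by auto
  have g: "gtheta (zz u v) (exp \<zeta>) = T / csqrt \<eta>"
    using ce(2) csq unfolding T_def t_def by (auto simp: eq_divide_eq mult.commute)
  have ne: "norm (exp (\<zeta> / 2)) = sqrt (sqrt r * exp x)"
  proof -
    have "norm (exp (\<zeta> / 2)) = exp ((ln r / 2 + x) / 2)" by (simp add: \<zeta>_def cuspz_def)
    moreover have "(exp ((ln r / 2 + x) / 2))\<^sup>2 = exp (ln r / 2 + x)" by (simp add: exp_double[symmetric])
    moreover have "exp (ln r / 2 + x) = sqrt r * exp x"
      using r by (simp add: exp_add powr_half_sqrt[symmetric] powr_def)
    ultimately show ?thesis by (metis exp_ge_zero real_sqrt_unique)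
  qed
  \<comment> \<open>The prefactor \<open>exp (\<zeta> / 2)\<close> cancels the dependence of
    \<open>norm \<eta>\<close> on \<open>exp x\<close>, leaving only the fourth root of
    \<open>r * cuspD x a\<close>.\<close>
  have ratio: "norm (exp (\<zeta> / 2)) / norm (csqrt \<eta>) = 1 / sqrt (sqrt (r * cuspD x a))"
  proof -
    have "sqrt r * exp x / (r * exp x * sqrt (cuspD x a)) = 1 / sqrt (r * cuspD x a)"
    proof -
      have "r = sqrt r * sqrt r" using r by simp
      then have "sqrt r * exp x / (r * exp x * sqrt (cuspD x a)) = sqrt r * exp x / (sqrt r * sqrt r * exp x * sqrt (cuspD x a))" by simp
      also have "\<dots> = 1 / (sqrt r * sqrt (cuspD x a))"
      proof -
        have "k * e / (k * k * e * d) = 1 / (k * d)" if "k \<noteq> 0" "e \<noteq> 0" for k e d :: real using that by simp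
        from this[of "sqrt r" "exp x" "sqrt (cuspD x a)"] r show ?thesis by simp
      qed
      finally show ?thesis by (simp only: real_sqrt_mult)
    qed
    then show ?thesis unfolding norm_csqrt ne cp(1) real_sqrt_divide[symmetric] by (simp only: real_sqrt_divide real_sqrt_one)
  qed
  have nth: "norm (thmain (zz u v) (cuspz r x a)) = (1 / (2 * sqrt (sqrt (r * cuspD x a)))) * norm T"
  proof -
    have "norm (thmain (zz u v) (cuspz r x a)) = (norm (exp (\<zeta> / 2)) / norm (csqrt \<eta>)) * norm T / 2"
      unfolding thmain_def \<zeta>_def[symmetric] g by (simp add: norm_mult norm_divide)
    then show ?thesis unfolding ratio by simp
  qed
  have pos: "1 / (2 * sqrt (sqrt (r * cuspD x a))) \<ge> 0" using r D0 by simp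
  show "norm (thmain (zz u v) (cuspz r x a)) \<le> M * gs A' X"
    using mult_left_mono[OF up pos] unfolding nth M_def W_def by (simp add: mult_ac)
  show "norm (thmain (zz u v) (cuspz r x a)) \<ge> M * (2 * exp (- (pi * A' * (of_int m0 + X)\<^sup>2)) - gs A' X)"
    using mult_left_mono[OF lo pos] unfolding nth M_def W_def by (simp add: mult_ac)
qed

text \<open>
  The growth of the theta function at the cusp; it is the same at every cusp, which makes
  the values of the kernel at different cusps comparable.
\<close>

definition cuspM :: "real \<Rightarrow> real \<Rightarrow> real \<Rightarrow> real" where
  "cuspM u v a = exp (pi * (cuspQ u v a)\<^sup>2 / sin (2 * a)) / sqrt a"

section \<open>Limits along the paths \<open>x = s * a\<close>\<close>

lemma cuspD_limit: "((\<lambda>a. cuspD (s * a) a / a\<^sup>2) \<longlongrightarrow> 4 * (s\<^sup>2 + 1)) (at_right 0)"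
proof -
  have 1: "((\<lambda>a::real. sinh (s * a) / a) \<longlongrightarrow> s) (at_right 0)" by real_asymp
  have 2: "((\<lambda>a::real. sin a / a) \<longlongrightarrow> 1) (at_right 0)" by real_asymp
  have "((\<lambda>a. 4 * ((sinh (s * a) / a)\<^sup>2 + (sin a / a)\<^sup>2)) \<longlongrightarrow> 4 * (s\<^sup>2 + 1\<^sup>2)) (at_right 0)"
    by (intro tendsto_intros 1 2)
  then show ?thesis by (simp add: cuspD_def power_divide add_divide_distrib)
qed

lemma cuspA_limit:
  assumes r: "r > 0"
  shows "((\<lambda>a. a * (sin (2 * a) / (r * cuspD (s * a) a))) \<longlongrightarrow> 2 / (r * (4 * (s\<^sup>2 + 1)))) (at_right 0)"
    and "filterlim (\<lambda>a. sin (2 * a) / (r * cuspD (s * a) a)) at_top (at_right 0)"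
proof -
  have p: "r * (4 * (s\<^sup>2 + 1)) > 0" using r by (simp add: add_nonneg_pos)
  have 1: "((\<lambda>a::real. sin (2 * a) / a) \<longlongrightarrow> 2) (at_right 0)" by real_asymp
  have 2: "((\<lambda>a. (sin (2 * a) / a) / (r * (cuspD (s * a) a / a\<^sup>2))) \<longlongrightarrow> 2 / (r * (4 * (s\<^sup>2 + 1)))) (at_right 0)"
    by (intro tendsto_intros 1 cuspD_limit) (use p in linarith)
  have e: "eventually (\<lambda>a::real. a > 0) (at_right 0)" by (simp add: eventually_at_right_less)
  then have "eventually (\<lambda>a. (sin (2 * a) / a) / (r * (cuspD (s * a) a / a\<^sup>2)) = a * (sin (2 * a) / (r * cuspD (s * a) a))) (at_right 0)"
    by eventually_elim (simp add: power2_eq_square)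
  from Lim_transform_eventually[OF 2 this]
  show 3: "((\<lambda>a. a * (sin (2 * a) / (r * cuspD (s * a) a))) \<longlongrightarrow> 2 / (r * (4 * (s\<^sup>2 + 1)))) (at_right 0)" .
  have 4: "filterlim (\<lambda>a. a * (sin (2 * a) / (r * cuspD (s * a) a)) * inverse a) at_top (at_right 0)"
    by (rule filterlim_tendsto_pos_mult_at_top[OF 3 _ filterlim_inverse_at_top_right]) (use p in simp)
  have "eventually (\<lambda>a. a * (sin (2 * a) / (r * cuspD (s * a) a)) * inverse a = sin (2 * a) / (r * cuspD (s * a) a)) (at_right 0)"
    using e by eventually_elim simp
  from filterlim_mono_eventually[OF 4 order_refl order_refl this]
  show "filterlim (\<lambda>a. sin (2 * a) / (r * cuspD (s * a) a)) at_top (at_right 0)" .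
qed

text \<open>Bare convergence would not do: the factor \<open>A\<close> in the exponent is of order
  \<open>1 / a\<close>. An error of order less than \<open>a\<close> in \<open>cuspX\<close> makes
  \<open>A\<close> times its square vanish.\<close>

lemma cuspX_limit:
  "((\<lambda>a. (cuspX u v (s * a) a - (u + s * v)) / a) \<longlongrightarrow> 0) (at_right 0)"
  "((\<lambda>a. cuspX u v (s * a) a) \<longlongrightarrow> u + s * v) (at_right 0)"
proof -
  have 1: "((\<lambda>a::real. (sinh (s * a) / sin a - s) / a) \<longlongrightarrow> 0) (at_right 0)" by real_asymp
  have 2: "((\<lambda>a::real. (cosh (s * a) / cos a - 1) / a) \<longlongrightarrow> 0) (at_right 0)" by real_asymp
  have "((\<lambda>a. v * ((sinh (s * a) / sin a - s) / a) + u * ((cosh (s * a) / cos a - 1) / a)) \<longlongrightarrow> v * 0 + u * 0) (at_right 0)"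
    by (intro tendsto_intros 1 2)
  moreover have "v * ((sinh (s * a) / sin a - s) / a) + u * ((cosh (s * a) / cos a - 1) / a) = (cuspX u v (s * a) a - (u + s * v)) / a" for a
    by (simp add: cuspX_def add_divide_distrib[symmetric] diff_divide_distrib[symmetric] algebra_simps)
  ultimately show 3: "((\<lambda>a. (cuspX u v (s * a) a - (u + s * v)) / a) \<longlongrightarrow> 0) (at_right 0)" by simp
  have "((\<lambda>a::real. a) \<longlongrightarrow> 0) (at_right 0)" by (rule tendsto_ident_at)
  then have 4: "((\<lambda>a. (cuspX u v (s * a) a - (u + s * v)) / a * a + (u + s * v)) \<longlongrightarrow> 0 * 0 + (u + s * v)) (at_right 0)"
    by (intro tendsto_intros 3)
  have "eventually (\<lambda>a::real. a > 0) (at_right 0)" by (simp add: eventually_at_right_less)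
  then have "eventually (\<lambda>a. (cuspX u v (s * a) a - (u + s * v)) / a * a + (u + s * v) = cuspX u v (s * a) a) (at_right 0)"
    by eventually_elim simp
  from Lim_transform_eventually[OF 4 this]
  show "((\<lambda>a. cuspX u v (s * a) a) \<longlongrightarrow> u + s * v) (at_right 0)" by simp
qed

lemma gs_tendsto_0:
  assumes A: "filterlim A at_top Fl" and X: "(X \<longlongrightarrow> x) Fl" and x: "\<And>m::int. of_int m + x \<noteq> (0::real)"
  shows "((\<lambda>a. gs (A a) (X a)) \<longlongrightarrow> 0) Fl"
proof -
  obtain K where K: "K > 0" "\<And>A x. A \<ge> 1 \<Longrightarrow> gs A x \<le> K" using gs_bounded by metis
  \<comment> \<open>Half the distance from \<open>x\<close> to the nearest integer; the other half
    leaves room for the motion of \<open>X a\<close>.\<close>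
  define d where "d = min (x - of_int \<lfloor>x\<rfloor>) (of_int \<lfloor>x\<rfloor> + 1 - x) / 2"
  have "x - of_int \<lfloor>x\<rfloor> \<noteq> 0" using x[of "- \<lfloor>x\<rfloor>"] by simp
  then have "x - of_int \<lfloor>x\<rfloor> > 0" "of_int \<lfloor>x\<rfloor> + 1 - x > 0" by linarith+
  then have d0: "d > 0" unfolding d_def by simp
  have dle: "2 * d \<le> x - of_int \<lfloor>x\<rfloor>" "2 * d \<le> of_int \<lfloor>x\<rfloor> + 1 - x" by (simp_all add: d_def)
  have far: "2 * d \<le> \<bar>of_int m + x\<bar>" for m :: int
  proof (cases "m \<ge> - \<lfloor>x\<rfloor>")
    case True
    then have "real_of_int m \<ge> - of_int \<lfloor>x\<rfloor>" by linarith
    then show ?thesis using dle by linarith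
  next
    case False
    then have "m \<le> - \<lfloor>x\<rfloor> - 1" by simp
    then have "real_of_int m \<le> - of_int \<lfloor>x\<rfloor> - 1" by linarith
    then show ?thesis using dle by linarith
  qed
  have e1: "eventually (\<lambda>a. \<bar>X a - x\<bar> < d) Fl" using tendstoD[OF X d0] by (simp add: dist_real_def)
  have e2: "eventually (\<lambda>a. A a \<ge> 1) Fl" using A by (simp add: filterlim_at_top)
  have ev: "eventually (\<lambda>a. norm (gs (A a) (X a)) \<le> exp (- (pi * (A a - 1) * d\<^sup>2)) * K) Fl"
    using e1 e2
  proof eventually_elim
    case (elim a)
    have "d \<le> \<bar>of_int m + X a\<bar>" for m :: int using far[of m] elim by linarith
    then have "gs (A a) (X a) \<le> exp (- (pi * (A a - 1) * d\<^sup>2)) * gs 1 (X a)"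
      using d0 elim by (intro gs_le_far) auto
    also have "\<dots> \<le> exp (- (pi * (A a - 1) * d\<^sup>2)) * K" by (intro mult_left_mono K) auto
    finally have "gs (A a) (X a) \<le> exp (- (pi * (A a - 1) * d\<^sup>2)) * K" .
    moreover have "gs (A a) (X a) \<ge> 0" unfolding gs_def by (intro infsum_nonneg) auto
    ultimately show ?case by simp
  qed
  have "((\<lambda>y::real. exp (- (pi * (y - 1) * d\<^sup>2)) * K) \<longlongrightarrow> 0) at_top" using d0 by real_asymp
  from filterlim_compose[OF this A] show ?thesis by (rule Lim_null_comparison[OF ev])
qed

text \<open>Only the Gaussian at \<open>m0\<close> survives, and \<open>AX\<close> forces it to be
  evaluated so close to its centre that it tends to 1. The second limit serves the lower bound of
  \<open>thmain_bounds\<close>.\<close>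

lemma gs_tendsto_1:
  assumes A: "filterlim A at_top Fl" and X: "(X \<longlongrightarrow> x) Fl" and x: "of_int m0 + x = (0::real)"
    and AX: "((\<lambda>a. A a * (X a - x)\<^sup>2) \<longlongrightarrow> 0) Fl"
  shows "((\<lambda>a. gs (A a) (X a)) \<longlongrightarrow> 1) Fl" "((\<lambda>a. 2 * exp (- (pi * A a * (of_int m0 + X a)\<^sup>2)) - gs (A a) (X a)) \<longlongrightarrow> 1) Fl"
proof -
  obtain K where K: "K > 0" "\<And>A x. A \<ge> 1 \<Longrightarrow> gs A x \<le> K" using gs_bounded by metis
  define E where "E = (\<lambda>a. exp (- (pi * A a * (of_int m0 + X a)\<^sup>2)))"
  have "((\<lambda>a. exp (- (pi * (A a * (X a - x)\<^sup>2)))) \<longlongrightarrow> exp (- (pi * 0))) Fl" by (intro tendsto_intros AX)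
  moreover have "exp (- (pi * (A a * (X a - x)\<^sup>2))) = E a" for a
  proof -
    have "X a - x = of_int m0 + X a" using x by linarith
    then show ?thesis by (simp only: E_def mult.assoc)
  qed
  ultimately have E1: "(E \<longlongrightarrow> 1) Fl" by simp
  have e1: "eventually (\<lambda>a. \<bar>X a - x\<bar> < 1/2) Fl" using tendstoD[OF X, of "1/2"] by (simp add: dist_real_def)
  have e2: "eventually (\<lambda>a. A a \<ge> 1) Fl" using A by (simp add: filterlim_at_top)
  have ev: "eventually (\<lambda>a. norm (gs (A a) (X a) - E a) \<le> exp (- (pi * (A a - 1) * (1/2)\<^sup>2)) * K) Fl"
    using e1 e2
  proof eventually_elim
    case (elim a)
    have m: "\<bar>of_int m0 + X a\<bar> \<le> 1/2" using x elim by linarith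
    have "gs (A a) (X a) - E a \<le> exp (- (pi * (A a - 1) * (1/2)\<^sup>2)) * gs 1 (X a)"
      unfolding E_def by (rule gs_le_near[OF elim(2) m])
    also have "\<dots> \<le> exp (- (pi * (A a - 1) * (1/2)\<^sup>2)) * K" by (intro mult_left_mono K) auto
    finally have "gs (A a) (X a) - E a \<le> exp (- (pi * (A a - 1) * (1/2)\<^sup>2)) * K" .
    moreover have "infsum (\<lambda>m::int. exp (- (pi * A a * (of_int m + X a)\<^sup>2))) {m0} \<le> gs (A a) (X a)"
      unfolding gs_def by (intro infsum_mono_neutral gs_summable elim) auto
    then have "gs (A a) (X a) - E a \<ge> 0" unfolding E_def by simp
    ultimately show ?case by simp
  qed
  have "((\<lambda>y::real. exp (- (pi * (y - 1) * (1/2)\<^sup>2)) * K) \<longlongrightarrow> 0) at_top" by real_asymp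
  from filterlim_compose[OF this A] have G: "((\<lambda>a. gs (A a) (X a) - E a) \<longlongrightarrow> 0) Fl" by (rule Lim_null_comparison[OF ev])
  have "((\<lambda>a. (gs (A a) (X a) - E a) + E a) \<longlongrightarrow> 0 + 1) Fl" by (intro tendsto_intros G E1)
  then show g: "((\<lambda>a. gs (A a) (X a)) \<longlongrightarrow> 1) Fl" by simp
  have "((\<lambda>a. 2 * E a - gs (A a) (X a)) \<longlongrightarrow> 2 * 1 - 1) Fl" by (intro tendsto_intros g E1)
  then show "((\<lambda>a. 2 * exp (- (pi * A a * (of_int m0 + X a)\<^sup>2)) - gs (A a) (X a)) \<longlongrightarrow> 1) Fl" by (simp add: E_def)
qed

text \<open>
  The multiplier at the cusp: on integers \<open>n\<close>, the quadratic character of \<open>r\<close> is the linear one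
  with frequency \<open>q\<close>, so that Poisson summation centres the Gaussians at \<open>- q\<close> modulo 1.
\<close>

definition cuspH :: "real \<Rightarrow> real \<Rightarrow> bool" where
  "cuspH r q \<longleftrightarrow> r > 0 \<and> (\<forall>n::int. exp (- (of_real pi * \<i> * of_real r * (of_int n)\<^sup>2)) = exp (2 * of_real pi * \<i> * of_int n * of_real q))"

lemma cuspH_even: "k > 0 \<Longrightarrow> cuspH (2 * real k) 0"
  unfolding cuspH_def
proof (intro conjI allI)
  fix n :: int
  have "exp (- (of_real pi * \<i> * of_real (2 * real k) * (of_int n)\<^sup>2)) = exp (0 + \<i> * (of_int (- int k * n\<^sup>2) * (of_real pi * 2)))"
    by (rule arg_cong[of _ _ exp]) simp
  then show "exp (- (of_real pi * \<i> * of_real (2 * real k) * (of_int n)\<^sup>2)) = exp (2 * of_real pi * \<i> * of_int n * of_real 0)"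
    by (simp only: exp_plus_2pin of_real_0 mult_zero_right)
qed simp

text \<open>\<open>n^2\<close> and \<open>n\<close> have the same parity, so the quadratic character
  at \<open>r = 1\<close> alternates in sign with \<open>n\<close>. The resulting offset
  \<open>1 / 2\<close> is what makes the diagonal of the kernel negligible unless \<open>u\<close>
  is half of an odd integer.\<close>

lemma cuspH_1: "cuspH 1 (1/2)"
  unfolding cuspH_def
proof (intro conjI allI)
  fix n :: int
  have "even (n * (n + 1))" by simp
  then obtain N where N: "n * (n + 1) = 2 * N" by (rule dvdE)
  have "complex_of_int (n * (n + 1)) = of_int (2 * N)" by (simp only: N)
  then have sq: "(of_int n)\<^sup>2 = 2 * of_int N - (of_int n :: complex)" by (simp add: power2_eq_square algebra_simps)
  have "exp (- (of_real pi * \<i> * of_real 1 * (of_int n)\<^sup>2)) = exp (2 * of_real pi * \<i> * of_int n * of_real (1/2) + \<i> * (of_int (- N) * (of_real pi * 2)))"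
    unfolding sq by (intro arg_cong[of _ _ exp]) (simp add: algebra_simps)
  then show "exp (- (of_real pi * \<i> * of_real 1 * (of_int n)\<^sup>2)) = exp (2 * of_real pi * \<i> * of_int n * of_real (1/2))"
    by (simp only: exp_plus_2pin)
qed simp

text \<open>The limit of the prefactor \<open>1 / (2 * (r * cuspD x a) powr (1/4))\<close> times
  \<open>sqrt a\<close>, as \<open>cuspD\<close> is asymptotic to
  \<open>4 * (s^2 + 1) * a^2\<close>; it is the strength of a resonance.\<close>

definition cuspk :: "real \<Rightarrow> real \<Rightarrow> real" where
  "cuspk r s = sqrt (sqrt (1 / (r * (4 * (s\<^sup>2 + 1))))) / 2"

lemma cuspM_pos: "a > 0 \<Longrightarrow> cuspM u v a > 0"
  by (simp add: cuspM_def)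

lemma cuspM_at_top: "filterlim (cuspM u v) at_top (at_right 0)"
proof (rule filterlim_at_top_mono)
  show "filterlim (\<lambda>a::real. 1 / sqrt a) at_top (at_right 0)" by real_asymp
  have "eventually (\<lambda>a::real. a \<in> {0<..<1}) (at_right 0)" by (rule eventually_at_right_real) simp
  then show "eventually (\<lambda>a. 1 / sqrt a \<le> cuspM u v a) (at_right 0)"
  proof eventually_elim
    case (elim a)
    then have "sin (2 * a) > 0" using pi_gt3 by (intro sin_gt_zero) auto
    then have "exp (pi * (cuspQ u v a)\<^sup>2 / sin (2 * a)) \<ge> 1" by simp
    then show ?case unfolding cuspM_def using elim by (intro divide_right_mono) auto
  qed
qed

text \<open>The squares of \<open>cuspQ u (- v) a\<close> and \<open>cuspQ u v a\<close> differ by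
  \<open>2 * u * v * sin (2 * a)\<close>, and the denominator cancels the sine. Both terms of
  \<open>etot\<close> therefore grow at the same rate, and only the direction of approach separates
  them.\<close>

lemma cuspM_uminus:
  assumes "0 < a" "a < pi / 4"
  shows "cuspM u (- v) a = exp (2 * pi * u * v) * cuspM u v a"
proof -
  have s: "sin (2 * a) > 0" using assms by (intro sin_gt_zero) auto
  have "(cuspQ u (- v) a)\<^sup>2 = (cuspQ u v a)\<^sup>2 + 2 * u * v * (2 * sin a * cos a)"
    by (simp add: cuspQ_def power2_eq_square algebra_simps)
  then have "(cuspQ u (- v) a)\<^sup>2 = (cuspQ u v a)\<^sup>2 + 2 * u * v * sin (2 * a)" by (simp only: sin_double)
  then have "pi * (cuspQ u (- v) a)\<^sup>2 / sin (2 * a) = 2 * pi * u * v + pi * (cuspQ u v a)\<^sup>2 / sin (2 * a)"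
    using s by (simp add: distrib_left add_divide_distrib)
  then show ?thesis unfolding cuspM_def by (simp only: exp_add times_divide_eq_right)
qed

lemma cusp_factor_limit:
  assumes r: "r > 0"
  shows "((\<lambda>a. sqrt (sqrt (a\<^sup>2 / (r * cuspD (s * a) a))) / 2) \<longlongrightarrow> cuspk r s) (at_right 0)"
proof -
  have p: "r * (4 * (s\<^sup>2 + 1)) > 0" using r by (simp add: add_nonneg_pos)
  have "((\<lambda>a. sqrt (sqrt (1 / (r * (cuspD (s * a) a / a\<^sup>2)))) / 2) \<longlongrightarrow> cuspk r s) (at_right 0)"
    unfolding cuspk_def by (intro tendsto_intros cuspD_limit) (use p in linarith, simp)
  then show ?thesis by simp
qed

lemma cusp_eventually:
  assumes r: "r > 0"
  shows "eventually (\<lambda>a. 0 < a \<and> a < pi / 4 \<and> sin (2 * a) / (r * cuspD (s * a) a) \<ge> 1) (at_right 0)"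
proof -
  have 1: "eventually (\<lambda>a::real. a \<in> {0<..<pi/4}) (at_right 0)" by (rule eventually_at_right_real) simp
  have 2: "eventually (\<lambda>a. sin (2 * a) / (r * cuspD (s * a) a) \<ge> 1) (at_right 0)"
    using cuspA_limit(2)[OF r, of s] by (simp add: filterlim_at_top)
  show ?thesis using 1 2 by eventually_elim auto
qed

lemma thmain_normalized_bounds:
  fixes u v r q x a :: real
  assumes H: "cuspH r q" and a: "0 < a" "a < pi / 4" "sin (2 * a) / (r * cuspD x a) \<ge> 1"
  defines "A' \<equiv> sin (2 * a) / (r * cuspD x a)"
    and "X \<equiv> q + sqrt r * cuspX u v x a" and "\<rho> \<equiv> sqrt (sqrt (a\<^sup>2 / (r * cuspD x a))) / 2"
  shows "norm (thmain (zz u v) (cuspz r x a)) / cuspM u v a \<le> \<rho> * gs A' X"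
    and "norm (thmain (zz u v) (cuspz r x a)) / cuspM u v a \<ge> \<rho> * (2 * exp (- (pi * A' * (of_int m0 + X)\<^sup>2)) - gs A' X)"
proof -
  have r: "r > 0" and H': "\<And>n::int. exp (- (of_real pi * \<i> * of_real r * (of_int n)\<^sup>2)) = exp (2 * of_real pi * \<i> * of_int n * of_real q)"
    using H by (auto simp: cuspH_def)
  note b = thmain_bounds[OF r a(1,2) H' a(3), of u v, folded A'_def X_def]
  have sa: "sqrt a > 0" using a by simp
  have e: "exp (pi * (cuspQ u v a)\<^sup>2 / sin (2 * a)) / (2 * sqrt (sqrt (r * cuspD x a))) = \<rho> * cuspM u v a"
  proof -
    have "sqrt (sqrt (a\<^sup>2)) = sqrt a" using a by simp
    then show ?thesis unfolding \<rho>_def cuspM_def real_sqrt_divide using sa by simp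
  qed
  have M: "cuspM u v a > 0" using a by (simp add: cuspM_pos)
  show "norm (thmain (zz u v) (cuspz r x a)) / cuspM u v a \<le> \<rho> * gs A' X"
    using b(1) M unfolding e by (simp add: divide_le_eq mult_ac)
  show "norm (thmain (zz u v) (cuspz r x a)) / cuspM u v a \<ge> \<rho> * (2 * exp (- (pi * A' * (of_int m0 + X)\<^sup>2)) - gs A' X)"
    using b(2)[of m0] M unfolding e by (simp add: le_divide_eq mult_ac)
qed

lemma cusp_X_tendsto: "((\<lambda>a. q + sqrt r * cuspX u v (s * a) a) \<longlongrightarrow> q + sqrt r * (u + s * v)) (at_right 0)"
  by (intro tendsto_intros cuspX_limit)

lemma thmain_limit_0:
  assumes H: "cuspH r q" and nr: "\<And>m::int. of_int m + (q + sqrt r * (u + s * v)) \<noteq> 0"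
  shows "((\<lambda>a. norm (thmain (zz u v) (cuspz r (s * a) a)) / cuspM u v a) \<longlongrightarrow> 0) (at_right 0)"
proof (rule Lim_null_comparison)
  have r: "r > 0" using H by (simp add: cuspH_def)
  have "((\<lambda>a. sqrt (sqrt (a\<^sup>2 / (r * cuspD (s * a) a))) / 2 * gs (sin (2 * a) / (r * cuspD (s * a) a)) (q + sqrt r * cuspX u v (s * a) a)) \<longlongrightarrow> cuspk r s * 0) (at_right 0)"
    by (intro tendsto_mult cusp_factor_limit r gs_tendsto_0[OF cuspA_limit(2)[OF r] cusp_X_tendsto nr])
  then show "((\<lambda>a. sqrt (sqrt (a\<^sup>2 / (r * cuspD (s * a) a))) / 2 * gs (sin (2 * a) / (r * cuspD (s * a) a)) (q + sqrt r * cuspX u v (s * a) a)) \<longlongrightarrow> 0) (at_right 0)" by simp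
  show "eventually (\<lambda>a. norm (norm (thmain (zz u v) (cuspz r (s * a) a)) / cuspM u v a) \<le> sqrt (sqrt (a\<^sup>2 / (r * cuspD (s * a) a))) / 2 * gs (sin (2 * a) / (r * cuspD (s * a) a)) (q + sqrt r * cuspX u v (s * a) a)) (at_right 0)"
    using cusp_eventually[OF r, of s]
  proof eventually_elim
    case (elim a)
    then show ?case using thmain_normalized_bounds(1)[OF H, of a "s * a" u v] cuspM_pos[of a u v] by simp
  qed
qed

text \<open>Both bounds of \<open>thmain_normalized_bounds\<close> have the same limit, the lower
  one when the resonant index \<open>m0\<close> is singled out.\<close>

lemma thmain_limit_resonant:
  assumes H: "cuspH r q" and res: "of_int m0 + (q + sqrt r * (u + s * v)) = 0"
  shows "((\<lambda>a. norm (thmain (zz u v) (cuspz r (s * a) a)) / cuspM u v a) \<longlongrightarrow> cuspk r s) (at_right 0)"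
proof -
  have r: "r > 0" using H by (simp add: cuspH_def)
  let ?A = "\<lambda>a. sin (2 * a) / (r * cuspD (s * a) a)"
  let ?X = "\<lambda>a. q + sqrt r * cuspX u v (s * a) a"
  let ?\<rho> = "\<lambda>a. sqrt (sqrt (a\<^sup>2 / (r * cuspD (s * a) a))) / 2"
  have e: "eventually (\<lambda>a::real. a > 0) (at_right 0)" by (simp add: eventually_at_right_less)
  \<comment> \<open>\<open>A * (X - x)^2\<close> with the powers of \<open>a\<close> distributed so
    that each factor converges: \<open>a * A\<close> is bounded, and a spare factor \<open>a\<close>
    remains.\<close>
  have "((\<lambda>a. (a * ?A a) * (r * a * ((cuspX u v (s * a) a - (u + s * v)) / a)\<^sup>2)) \<longlongrightarrow> 2 / (r * (4 * (s\<^sup>2 + 1))) * (r * 0 * 0\<^sup>2)) (at_right 0)"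
    by (intro tendsto_intros cuspA_limit(1) r cuspX_limit(1))
  then have l: "((\<lambda>a. (a * ?A a) * (r * a * ((cuspX u v (s * a) a - (u + s * v)) / a)\<^sup>2)) \<longlongrightarrow> 0) (at_right 0)" by simp
  have "eventually (\<lambda>a. (a * ?A a) * (r * a * ((cuspX u v (s * a) a - (u + s * v)) / a)\<^sup>2) = ?A a * (?X a - (q + sqrt r * (u + s * v)))\<^sup>2) (at_right 0)"
    using e
  proof eventually_elim
    case (elim a)
    have "?X a - (q + sqrt r * (u + s * v)) = sqrt r * (cuspX u v (s * a) a - (u + s * v))" by (simp add: algebra_simps)
    then have 1: "(?X a - (q + sqrt r * (u + s * v)))\<^sup>2 = r * (cuspX u v (s * a) a - (u + s * v))\<^sup>2" using r by (simp add: power_mult_distrib)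
    have "(a * B) * (r * a * (Y / a)\<^sup>2) = B * (r * Y\<^sup>2)" for B Y using elim by (simp add: field_simps power2_eq_square)
    then show ?case unfolding 1 by blast
  qed
  from Lim_transform_eventually[OF l this]
  have AX: "((\<lambda>a. ?A a * (?X a - (q + sqrt r * (u + s * v)))\<^sup>2) \<longlongrightarrow> 0) (at_right 0)" .
  note g = gs_tendsto_1[OF cuspA_limit(2)[OF r] cusp_X_tendsto res AX]
  have up: "((\<lambda>a. ?\<rho> a * gs (?A a) (?X a)) \<longlongrightarrow> cuspk r s * 1) (at_right 0)"
    by (intro tendsto_mult cusp_factor_limit r g)
  have lo: "((\<lambda>a. ?\<rho> a * (2 * exp (- (pi * ?A a * (of_int m0 + ?X a)\<^sup>2)) - gs (?A a) (?X a))) \<longlongrightarrow> cuspk r s * 1) (at_right 0)"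
    by (intro tendsto_mult cusp_factor_limit r g)
  have "((\<lambda>a. norm (thmain (zz u v) (cuspz r (s * a) a)) / cuspM u v a) \<longlongrightarrow> cuspk r s * 1) (at_right 0)"
  proof (rule tendsto_sandwich[OF _ _ lo up])
    show "eventually (\<lambda>a. ?\<rho> a * (2 * exp (- (pi * ?A a * (of_int m0 + ?X a)\<^sup>2)) - gs (?A a) (?X a)) \<le> norm (thmain (zz u v) (cuspz r (s * a) a)) / cuspM u v a) (at_right 0)"
      using cusp_eventually[OF r, of s] by eventually_elim (use thmain_normalized_bounds(2)[OF H] in blast)
    show "eventually (\<lambda>a. norm (thmain (zz u v) (cuspz r (s * a) a)) / cuspM u v a \<le> ?\<rho> a * gs (?A a) (?X a)) (at_right 0)"
      using cusp_eventually[OF r, of s] by eventually_elim (use thmain_normalized_bounds(1)[OF H] in blast)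
  qed
  then show ?thesis by simp
qed

lemma thmain_bounded:
  assumes H: "cuspH r q"
  shows "\<exists>B. eventually (\<lambda>a. norm (thmain (zz u v) (cuspz r (s * a) a)) / cuspM u v a \<le> B) (at_right 0)"
proof -
  have r: "r > 0" using H by (simp add: cuspH_def)
  obtain K where K: "K > 0" "\<And>A x. A \<ge> 1 \<Longrightarrow> gs A x \<le> K" using gs_bounded by metis
  have "eventually (\<lambda>a. sqrt (sqrt (a\<^sup>2 / (r * cuspD (s * a) a))) / 2 < cuspk r s + 1) (at_right 0)"
    by (rule order_tendstoD(2)[OF cusp_factor_limit[OF r]]) simp
  then have "eventually (\<lambda>a. norm (thmain (zz u v) (cuspz r (s * a) a)) / cuspM u v a \<le> (cuspk r s + 1) * K) (at_right 0)"
    using cusp_eventually[OF r, of s]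
  proof eventually_elim
    case (elim a)
    have rho: "0 \<le> sqrt (sqrt (a\<^sup>2 / (r * cuspD (s * a) a))) / 2" using r by (simp add: cuspD_def)
    have "sqrt (sqrt (a\<^sup>2 / (r * cuspD (s * a) a))) / 2 * gs (sin (2 * a) / (r * cuspD (s * a) a)) (q + sqrt r * cuspX u v (s * a) a) \<le> (cuspk r s + 1) * K"
      using elim rho K(1) by (intro mult_mono' K(2)) (auto simp: gs_def intro!: infsum_nonneg)
    then show ?case using thmain_normalized_bounds(1)[OF H, of a "s * a" u v] elim by linarith
  qed
  then show ?thesis by blast
qed

section \<open>Almost periodic sums\<close>

text \<open>
  Consecutive values of \<open>k\<close> cannot both be resonant, which leaves candidates close to every large real.
\<close>

lemma no_adjacent_squares:
  fixes t :: real
  assumes t: "t > 0" and k: "real k > t"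
  shows "(\<forall>m::int. of_int (m\<^sup>2) \<noteq> t * real k) \<or> (\<forall>m::int. of_int (m\<^sup>2) \<noteq> t * (real k + 1))"
proof (rule ccontr)
  assume "\<not> ?thesis"
  then obtain m n :: int where m: "of_int (m\<^sup>2) = t * real k" and n: "of_int (n\<^sup>2) = t * (real k + 1)" by metis
  define p q where "p = \<bar>real_of_int m\<bar>" and "q = \<bar>real_of_int n\<bar>"
  have p2: "p * p = t * real k" using m by (simp only: p_def abs_mult_self_eq power2_eq_square of_int_mult)
  have q2: "q * q = t * (real k + 1)" using n by (simp only: q_def abs_mult_self_eq power2_eq_square of_int_mult)
  have p0: "p \<ge> 0" "q \<ge> 0" by (simp_all only: p_def q_def abs_ge_zero)
  have e: "t * (real k + 1) = t * real k + t" by (simp only: distrib_left mult_1_right)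
  \<comment> \<open>For integers \<open>0 \<le> p < q\<close> one has
    \<open>2 * p + 1 \<le> q^2 - p^2 = t\<close>. Hence \<open>p \<le> t < k\<close> and
    \<open>p^2 \<le> t * p < t * k\<close>, against \<open>p^2 = t * k\<close>.\<close>
  have "p < q"
  proof (rule ccontr)
    assume "\<not> p < q"
    then have "q * q \<le> p * p" using p0 by (intro mult_mono) linarith+
    then show False using p2 q2 e t by linarith
  qed
  then have "\<bar>m\<bar> < \<bar>n\<bar>" by (simp only: p_def q_def of_int_abs[symmetric] of_int_less_iff)
  then have "p + 1 \<le> q" unfolding p_def q_def of_int_abs[symmetric] by linarith
  then have "(p + 1) * (p + 1) \<le> q * q" using p0 by (intro mult_mono) linarith+
  moreover have "(p + 1) * (p + 1) = p * p + 2 * p + 1" by (simp only: distrib_left distrib_right mult_1_left mult_1_right)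
  ultimately have "2 * p + 1 \<le> t" using p2 q2 e by linarith
  then have "p \<le> t" using p0 by linarith
  then have "p * p \<le> t * p" using p0 by (intro mult_right_mono)
  moreover have "t * p < t * real k" using t k \<open>p \<le> t\<close> by (intro mult_strict_left_mono) linarith+
  ultimately show False using p2 by linarith
qed

text \<open>An integer equal to \<open>2 * u * sqrt (2 * k)\<close> has the square
  \<open>8 * u^2 * k\<close>, so \<open>no_adjacent_squares\<close> with \<open>t = 8 * u^2\<close>
  leaves one of the first two integers from \<open>x\<close> on. The threshold for \<open>x\<close>
  ensures \<open>k > t\<close>.\<close>

lemma exists_good_even:
  fixes u x :: real
  assumes "x \<ge> 1 + 8 * u\<^sup>2"
  shows "\<exists>k::nat. k > 0 \<and> x \<le> real k \<and> real k \<le> x + 2 \<and> (u = 0 \<or> (\<forall>m::int. of_int m \<noteq> 2 * u * sqrt (2 * real k)))"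
proof -
  define k where "k = nat \<lceil>x\<rceil>"
  have "u\<^sup>2 \<ge> 0" by simp
  then have x1: "x \<ge> 1" using assms by linarith
  have k: "real k \<ge> x" "real k \<le> x + 1" "k > 0" unfolding k_def using x1 by linarith+
  show ?thesis
  proof (cases "u = 0")
    case True then show ?thesis using k by (intro exI[of _ k]) auto
  next
    case False
    have sq: "of_int (m\<^sup>2) = 8 * u\<^sup>2 * real j" if "of_int m = 2 * u * sqrt (2 * real j)" for m :: int and j :: nat
    proof -
      have "real_of_int (m\<^sup>2) = (2 * u * sqrt (2 * real j))\<^sup>2" by (simp only: of_int_power that)
      also have "\<dots> = 2\<^sup>2 * u\<^sup>2 * (2 * real j)" by (simp only: power_mult_distrib) simp
      finally show ?thesis by simp
    qed
    have u0: "8 * u\<^sup>2 > 0" using False by simp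
    have "(\<forall>m::int. of_int (m\<^sup>2) \<noteq> 8 * u\<^sup>2 * real k) \<or> (\<forall>m::int. of_int (m\<^sup>2) \<noteq> 8 * u\<^sup>2 * (real k + 1))"
      by (rule no_adjacent_squares[OF u0]) (use k assms in linarith)
    then show ?thesis
    proof
      assume "\<forall>m::int. of_int (m\<^sup>2) \<noteq> 8 * u\<^sup>2 * real k"
      then have "\<forall>m::int. of_int m \<noteq> 2 * u * sqrt (2 * real k)" using sq by blast
      moreover have "k > 0 \<and> x \<le> real k \<and> real k \<le> x + 2" using k by auto
      ultimately show ?thesis by blast
    next
      assume "\<forall>m::int. of_int (m\<^sup>2) \<noteq> 8 * u\<^sup>2 * (real k + 1)"
      moreover have sk: "real (Suc k) = real k + 1" by simp
      ultimately have "\<forall>m::int. of_int m \<noteq> 2 * u * sqrt (2 * real (Suc k))" using sq[of _ "Suc k"] unfolding sk by blast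
      moreover have "Suc k > 0 \<and> x \<le> real (Suc k) \<and> real (Suc k) \<le> x + 2" unfolding sk using k by auto
      ultimately show ?thesis by blast
    qed
  qed
qed

lemma norm_exp_i_diff_le: "norm (exp (- \<i> * complex_of_real x) - exp (- \<i> * complex_of_real y)) \<le> \<bar>x - y\<bar>"
proof -
  have "exp (- \<i> * complex_of_real x) - exp (- \<i> * complex_of_real y) = exp (- \<i> * complex_of_real y) * (iexp (y - x) - 1)"
    by (simp add: algebra_simps flip: exp_add)
  then have "norm (exp (- \<i> * complex_of_real x) - exp (- \<i> * complex_of_real y)) = norm (iexp (y - x) - 1)"
    by (simp add: norm_mult)
  also have "\<dots> \<le> \<bar>y - x\<bar>" using iexp_approx1[of "y - x" 0] by simp
  finally show ?thesis by simp
qed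

lemma mean_root_of_unit_tendsto_0:
  fixes \<omega> :: complex
  assumes "norm \<omega> = 1" "\<omega> \<noteq> 1"
  shows "(\<lambda>N. norm ((\<Sum>n<N. \<omega> ^ n) / of_nat N)) \<longlonglongrightarrow> 0"
proof (rule Lim_null_comparison)
  show "(\<lambda>N. (2 / norm (\<omega> - 1)) / real N) \<longlonglongrightarrow> 0" by (rule lim_const_over_n)
  show "eventually (\<lambda>N. norm (norm ((\<Sum>n<N. \<omega> ^ n) / of_nat N)) \<le> (2 / norm (\<omega> - 1)) / real N) sequentially"
  proof (intro always_eventually allI)
    fix N
    have "norm (\<Sum>n<N. \<omega> ^ n) = norm (\<omega> ^ N - 1) / norm (\<omega> - 1)"
      using geometric_sum[OF assms(2), of N] by (simp add: norm_divide)
    also have "\<dots> \<le> 2 / norm (\<omega> - 1)"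
      using norm_triangle_ineq4[of "\<omega> ^ N" 1] assms by (intro divide_right_mono) (auto simp: norm_power)
    finally have "norm (\<Sum>n<N. \<omega> ^ n) / real N \<le> (2 / norm (\<omega> - 1)) / real N"
      by (rule divide_right_mono) simp
    then have "norm ((\<Sum>n<N. \<omega> ^ n) / of_nat N) \<le> (2 / norm (\<omega> - 1)) / real N"
      by (simp only: norm_divide norm_of_nat)
    then show "norm (norm ((\<Sum>n<N. \<omega> ^ n) / of_nat N)) \<le> (2 / norm (\<omega> - 1)) / real N"
      by (simp only: real_norm_def abs_norm_cancel)
  qed
qed

text \<open>Means over blocks of \<open>N\<close> consecutive indices keep the constant term
  \<open>d 0\<close>, while for suitable \<open>N\<close> all others together stay below half of it.
  This holds at every starting point \<open>T\<close>, because powers of \<open>\<omega> j\<close>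
  have modulus 1; so the block means cannot tend to 0.\<close>

lemma almost_periodic_not_tendsto_0:
  fixes d :: "nat \<Rightarrow> real" and \<omega> :: "nat \<Rightarrow> complex" and a :: "nat \<Rightarrow> complex"
  assumes ds: "summable (\<lambda>j. \<bar>d j\<bar>)" and d0: "d 0 \<noteq> 0" and w0: "\<omega> 0 = 1"
    and wn: "\<And>j. norm (\<omega> j) = 1" and w1: "\<And>j. \<omega> (Suc j) \<noteq> 1"
    and as: "\<And>n. (\<lambda>j. of_real (d j) * \<omega> j ^ n) sums a n"
  shows "\<not> a \<longlonglongrightarrow> 0"
proof
  assume a0: "a \<longlonglongrightarrow> 0"
  define g where "g = (\<lambda>j N. (\<Sum>n<N. \<omega> j ^ n) / of_nat N)"
  have g1: "norm (g j N) \<le> 1" for j N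
  proof (cases "N = 0")
    case False
    have "norm (\<Sum>n<N. \<omega> j ^ n) \<le> (\<Sum>n<N. norm (\<omega> j ^ n))" by (rule norm_sum)
    also have "\<dots> = real N" by (simp add: norm_power wn)
    finally show ?thesis using False by (simp add: g_def norm_divide)
  qed (simp add: g_def)
  have "(\<lambda>N. \<Sum>j. \<bar>d (Suc j)\<bar> * norm (g (Suc j) N)) \<longlonglongrightarrow> (\<Sum>j. \<bar>d (Suc j)\<bar> * 0)"
  proof (rule tannerys_theorem[THEN conjunct2, THEN conjunct2])
    show "(\<lambda>N. \<bar>d (Suc j)\<bar> * norm (g (Suc j) N)) \<longlonglongrightarrow> \<bar>d (Suc j)\<bar> * 0" for j
      unfolding g_def by (intro tendsto_intros mean_root_of_unit_tendsto_0 wn w1)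
    show "summable (\<lambda>j. \<bar>d (Suc j)\<bar>)" using ds by (subst summable_Suc_iff)
    have "norm (\<bar>d (Suc j)\<bar> * norm (g (Suc j) N)) \<le> \<bar>d (Suc j)\<bar>" for j N
      using mult_left_le[OF g1[of "Suc j" N], of "\<bar>d (Suc j)\<bar>"] by simp
    then show "eventually (\<lambda>(j, N). norm (\<bar>d (Suc j)\<bar> * norm (g (Suc j) N)) \<le> \<bar>d (Suc j)\<bar>) (at_top \<times>\<^sub>F sequentially)"
      by (intro always_eventually) auto
  qed simp
  then have lim: "(\<lambda>N. \<Sum>j. \<bar>d (Suc j)\<bar> * norm (g (Suc j) N)) \<longlonglongrightarrow> 0" by simp
  have d0: "\<bar>d 0\<bar> > 0" using d0 by simp
  have "eventually (\<lambda>N. (\<Sum>j. \<bar>d (Suc j)\<bar> * norm (g (Suc j) N)) < \<bar>d 0\<bar> / 2) sequentially"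
    by (rule order_tendstoD(2)[OF lim]) (use d0 in simp)
  then have "eventually (\<lambda>N. (\<Sum>j. \<bar>d (Suc j)\<bar> * norm (g (Suc j) N)) < \<bar>d 0\<bar> / 2 \<and> N > 0) sequentially"
    using eventually_gt_at_top[of 0] by eventually_elim auto
  then obtain N where N: "(\<Sum>j. \<bar>d (Suc j)\<bar> * norm (g (Suc j) N)) < \<bar>d 0\<bar> / 2" "N > 0"
    using eventually_happens'[OF sequentially_bot] by blast
  define b where "b = (\<lambda>T. (\<Sum>n<N. a (T + n)) / of_nat N)"
  have b0: "b \<longlonglongrightarrow> 0"
  proof -
    have "(\<lambda>T. (\<Sum>n<N. a (T + n)) / of_nat N) \<longlonglongrightarrow> (\<Sum>n<N. 0) / of_nat N"
      by (intro tendsto_intros LIMSEQ_ignore_initial_segment a0) (use N in simp)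
    then show ?thesis by (simp add: b_def)
  qed
  have bs: "(\<lambda>j. of_real (d j) * \<omega> j ^ T * g j N) sums b T" for T
  proof -
    have "(\<lambda>j. (\<Sum>n<N. of_real (d j) * \<omega> j ^ (T + n)) / of_nat N) sums b T"
      unfolding b_def by (intro sums_divide sums_sum as)
    moreover have "(\<Sum>n<N. of_real (d j) * \<omega> j ^ (T + n)) / of_nat N = of_real (d j) * \<omega> j ^ T * g j N" for j
      by (simp add: g_def power_add sum_distrib_left mult.assoc)
    ultimately show ?thesis by simp
  qed
  have blow: "norm (b T) \<ge> \<bar>d 0\<bar> / 2" for T
  proof -
    let ?f = "\<lambda>j. of_real (d j) * \<omega> j ^ T * g j N"
    have "(\<lambda>j. ?f (Suc j)) sums (b T - ?f 0)" using sums_split_initial_segment[OF bs[of T], of 1] by simp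
    then have "b T - ?f 0 = (\<Sum>j. ?f (Suc j))" by (rule sums_unique)
    also have "norm \<dots> \<le> (\<Sum>j. \<bar>d (Suc j)\<bar> * norm (g (Suc j) N))"
    proof (rule norm_suminf_le)
      show "norm (?f (Suc j)) \<le> \<bar>d (Suc j)\<bar> * norm (g (Suc j) N)" for j by (simp add: norm_mult norm_power wn)
      show "summable (\<lambda>j. \<bar>d (Suc j)\<bar> * norm (g (Suc j) N))"
      proof (rule summable_comparison_test)
        show "summable (\<lambda>j. \<bar>d (Suc j)\<bar>)" using ds by (subst summable_Suc_iff)
        have "norm (\<bar>d (Suc j)\<bar> * norm (g (Suc j) N)) \<le> \<bar>d (Suc j)\<bar>" for j
          using mult_left_le[OF g1[of "Suc j" N], of "\<bar>d (Suc j)\<bar>"] by simp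
        then show "\<exists>M. \<forall>j\<ge>M. norm (\<bar>d (Suc j)\<bar> * norm (g (Suc j) N)) \<le> \<bar>d (Suc j)\<bar>" by blast
      qed
    qed
    finally have 1: "norm (b T - ?f 0) < \<bar>d 0\<bar> / 2" using N(1) by linarith
    have "g 0 N = 1" using N(2) by (simp add: g_def w0 del: of_nat_sum)
    then have "?f 0 = of_real (d 0)" by (simp only: w0 power_one mult_1_right)
    then have f0: "norm (?f 0) = \<bar>d 0\<bar>" by (simp only: norm_of_real)
    have "norm (?f 0) - norm (b T) \<le> norm (b T - ?f 0)" by (subst norm_minus_commute) (rule norm_triangle_ineq2)
    then show ?thesis using 1 unfolding f0 by linarith
  qed
  have "eventually (\<lambda>T. norm (b T) < \<bar>d 0\<bar> / 2) sequentially"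
    using tendstoD[OF b0, of "\<bar>d 0\<bar> / 2"] d0 by simp
  then obtain T where "norm (b T) < \<bar>d 0\<bar> / 2" using eventually_happens'[OF sequentially_bot] by blast
  then show False using blow[of T] by linarith
qed

text \<open>If \<open>csum\<close> vanished at all admissible points \<open>ln (2 * k) / 2\<close>,
  whose gaps shrink like \<open>exp (- 2 * y)\<close>, then by its Lipschitz bound the almost
  periodic function \<open>D\<close> would tend to 0. Sampling it along an arithmetic progression
  contradicts \<open>almost_periodic_not_tendsto_0\<close>.\<close>

lemma csum_nonzero_exists:
  fixes c l :: "nat \<Rightarrow> real" and u :: real
  assumes c: "summable (\<lambda>j. \<bar>c j\<bar>)" and c0: "c 0 \<noteq> 0" and inj: "inj l" and bd: "bounded (range l)"
  shows "\<exists>k::nat. k > 0 \<and> (u = 0 \<or> (\<forall>m::int. of_int m \<noteq> 2 * u * sqrt (2 * real k))) \<and>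
     csum c l (of_real (ln (2 * real k) / 2) + \<i> * of_real (pi / 4)) \<noteq> 0"
proof (rule ccontr)
  assume contra: "\<not> ?thesis"
  obtain L where L: "\<And>j. \<bar>l j\<bar> \<le> L" using bd by (auto simp: bounded_iff)
  have L0: "L \<ge> 0" using L[of 0] by linarith
  define d where "d = (\<lambda>j. c j * exp (l j * pi / 4))"
  define D where "D = (\<lambda>y::real. \<Sum>j. of_real (d j) * exp (- \<i> * complex_of_real (l j * y)))"
  have ds: "summable (\<lambda>j. \<bar>d j\<bar>)"
  proof (rule summable_comparison_test)
    show "summable (\<lambda>j. \<bar>c j\<bar> * exp (L * pi / 4))" using c by (rule summable_mult2)
    have "\<bar>d j\<bar> \<le> \<bar>c j\<bar> * exp (L * pi / 4)" for j
    proof -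
      have "l j \<le> L" using L[of j] by linarith
      then have "l j * pi / 4 \<le> L * pi / 4" by simp
      then show ?thesis unfolding d_def abs_mult by (intro mult_left_mono) auto
    qed
    then show "\<exists>N. \<forall>n\<ge>N. norm \<bar>d n\<bar> \<le> \<bar>c n\<bar> * exp (L * pi / 4)" by auto
  qed
  have terms: "summable (\<lambda>j. norm (of_real (d j) * exp (- \<i> * complex_of_real (l j * y))))" for y
    using ds by (simp add: norm_mult)
  have Ds: "(\<lambda>j. of_real (d j) * exp (- \<i> * complex_of_real (l j * y))) sums D y" for y
    unfolding D_def by (rule summable_sums[OF summable_norm_cancel[OF terms]])
  have csD: "csum c l (of_real y + \<i> * of_real (pi / 4)) = D y" for y
  proof -
    have "of_real (c j) * exp (- \<i> * of_real (l j) * (of_real y + \<i> * of_real (pi / 4))) = of_real (d j) * exp (- \<i> * complex_of_real (l j * y))" for j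
    proof -
      have "exp (- \<i> * of_real (l j) * (of_real y + \<i> * of_real (pi / 4))) = exp (complex_of_real (l j * pi / 4)) * exp (- \<i> * complex_of_real (l j * y))"
        unfolding exp_add[symmetric] by (rule arg_cong[of _ _ exp]) (simp add: algebra_simps)
      then show ?thesis by (simp only: d_def of_real_mult[of "c j"] exp_of_real mult.assoc)
    qed
    moreover have "((\<lambda>j. of_real (d j) * exp (- \<i> * complex_of_real (l j * y))) has_sum D y) UNIV"
      by (rule norm_summable_imp_has_sum[OF terms Ds])
    ultimately show ?thesis unfolding csum_def by (simp add: infsumI)
  qed
  define W where "W = (\<Sum>j. \<bar>d j\<bar>) * L"
  have Lip: "norm (D y - D y') \<le> W * \<bar>y - y'\<bar>" for y y'
  proof -
    let ?t = "\<lambda>j. of_real (d j) * exp (- \<i> * complex_of_real (l j * y)) - of_real (d j) * exp (- \<i> * complex_of_real (l j * y'))"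
    have tb: "norm (?t j) \<le> \<bar>d j\<bar> * (L * \<bar>y - y'\<bar>)" for j
    proof -
      have "norm (?t j) = \<bar>d j\<bar> * norm (exp (- \<i> * complex_of_real (l j * y)) - exp (- \<i> * complex_of_real (l j * y')))"
        by (simp only: right_diff_distrib[symmetric] norm_mult norm_of_real)
      also have "\<dots> \<le> \<bar>d j\<bar> * \<bar>l j * y - l j * y'\<bar>" by (intro mult_left_mono norm_exp_i_diff_le) simp
      also have "\<bar>l j * y - l j * y'\<bar> = \<bar>l j\<bar> * \<bar>y - y'\<bar>" by (simp add: right_diff_distrib[symmetric] abs_mult)
      also have "\<bar>d j\<bar> * (\<bar>l j\<bar> * \<bar>y - y'\<bar>) \<le> \<bar>d j\<bar> * (L * \<bar>y - y'\<bar>)" using L by (intro mult_left_mono mult_right_mono) auto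
      finally show ?thesis .
    qed
    have "D y - D y' = suminf ?t" by (rule sums_unique[OF sums_diff[OF Ds Ds]])
    also have "norm \<dots> \<le> (\<Sum>j. \<bar>d j\<bar> * (L * \<bar>y - y'\<bar>))"
      by (rule norm_suminf_le[OF tb summable_mult2[OF ds]])
    also have "\<dots> = (\<Sum>j. \<bar>d j\<bar>) * (L * \<bar>y - y'\<bar>)" by (rule suminf_mult2[symmetric, OF ds])
    finally show ?thesis by (simp add: W_def mult.assoc)
  qed
  have W0: "W \<ge> 0" unfolding W_def using L0 suminf_nonneg[OF ds] by simp
  \<comment> \<open>The admissible \<open>k\<close> nearest above \<open>exp (2 * y) / 2\<close>
    exceeds it by at most 2, so the corresponding point is within \<open>2 * exp (- 2 * y)\<close>
    of \<open>y\<close>.\<close>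
  have Dsmall: "norm (D y) \<le> W * (2 * exp (- 2 * y))" if y: "exp (2 * y) / 2 \<ge> 1 + 8 * u\<^sup>2" for y
  proof -
    define x where "x = exp (2 * y) / 2"
    have x0: "x > 0" by (simp add: x_def)
    obtain k :: nat where k: "k > 0" "x \<le> real k" "real k \<le> x + 2" "u = 0 \<or> (\<forall>m::int. of_int m \<noteq> 2 * u * sqrt (2 * real k))"
      using exists_good_even[OF y] unfolding x_def by blast
    have "csum c l (of_real (ln (2 * real k) / 2) + \<i> * of_real (pi / 4)) = 0" using contra k(1,4) by blast
    then have "D (ln (2 * real k) / 2) = 0" unfolding csD .
    then have "norm (D y) \<le> W * \<bar>y - ln (2 * real k) / 2\<bar>" using Lip[of y "ln (2 * real k) / 2"] by simp
    also have "\<bar>y - ln (2 * real k) / 2\<bar> \<le> 2 * exp (- 2 * y)"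
    proof -
      have yy: "2 * y = ln 2 + ln x"
      proof -
        have "ln (2 * x) = ln 2 + ln x" using x0 by (simp add: ln_mult_pos)
        moreover have "ln (2 * x) = 2 * y" by (simp add: x_def)
        ultimately show ?thesis by linarith
      qed
      have k0: "real k > 0" using k(1) by simp
      have lk: "ln (2 * real k) = ln 2 + ln (real k)" using k0 by (simp add: ln_mult_pos)
      have ld: "ln (real k / x) = ln (real k) - ln x" using k0 x0 by (simp add: ln_divide_pos)
      have "real k / x \<ge> 1" using x0 k(2) by simp
      then have 1: "ln (real k / x) \<ge> 0" by (rule ln_ge_zero)
      have 2: "ln (real k / x) \<le> real k / x - 1" using x0 k0 by (intro ln_le_minus_one divide_pos_pos)
      have "real k / x \<le> (x + 2) / x" using x0 k(3) by (intro divide_right_mono) auto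
      also have "\<dots> = 1 + 2 / x" using x0 by (simp add: add_divide_distrib)
      finally have 3: "real k / x \<le> 1 + 2 / x" .
      have "exp (2 * y) * exp (- 2 * y) = 1" by (simp flip: exp_add)
      then have "2 / x = 4 * exp (- 2 * y)" unfolding x_def by (simp add: divide_simps mult.commute)
      then have "ln (real k / x) \<le> 4 * exp (- 2 * y)" using 2 3 by linarith
      then have up: "ln (real k) - ln x \<le> 4 * exp (- 2 * y)" unfolding ld .
      have gen: "\<bar>p - (q + r) / 2\<bar> \<le> 2 * e" if "2 * p = q + s" "0 \<le> r - s" "r - s \<le> 4 * e" for p q r s e :: real
        using that by (simp add: abs_le_iff field_simps)
      show ?thesis unfolding lk by (rule gen[OF yy 1[unfolded ld] up])
    qed
    finally show ?thesis using W0 by (simp add: mult_left_mono)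
  qed
  \<comment> \<open>Differences of the \<open>l j\<close> are at most \<open>2 * L\<close>, so with
    this step the angles stay below 2 in modulus. They are then never a nonzero multiple of
    \<open>2 * pi\<close>, and distinct \<open>l j\<close> give distinct roots.\<close>
  define h where "h = 1 / (L + 1)"
  have h0: "h > 0" using L0 by (simp add: h_def)
  define \<omega> where "\<omega> = (\<lambda>j. exp (\<i> * complex_of_real ((l 0 - l j) * h)))"
  have w0: "\<omega> 0 = 1" by (simp add: \<omega>_def)
  have wn: "norm (\<omega> j) = 1" for j by (simp add: \<omega>_def)
  have w1: "\<omega> (Suc j) \<noteq> 1" for j
  proof
    assume "\<omega> (Suc j) = 1"
    then obtain n :: int where n: "(l 0 - l (Suc j)) * h = of_int (2 * n) * pi" by (auto simp: \<omega>_def exp_eq_1)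
    have "\<bar>l 0 - l (Suc j)\<bar> * h \<le> (2 * L) * h" using L[of 0] L[of "Suc j"] h0 by (intro mult_right_mono) auto
    also have "\<dots> < 2" using L0 by (simp add: h_def field_simps)
    finally have "\<bar>(l 0 - l (Suc j)) * h\<bar> < 2" using h0 by (simp add: abs_mult)
    then have "\<bar>of_int (2 * n) * pi\<bar> < 2" unfolding n .
    moreover have "\<bar>of_int (2 * n) * pi\<bar> = 2 * \<bar>of_int n\<bar> * pi" by (simp add: abs_mult)
    ultimately have a: "\<bar>of_int n\<bar> * pi < 1" by simp
    have "n = 0"
    proof (rule ccontr)
      assume "n \<noteq> 0"
      then have "\<bar>real_of_int n\<bar> \<ge> 1" by simp
      then have "1 * pi \<le> \<bar>real_of_int n\<bar> * pi" by (intro mult_right_mono) auto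
      then show False using a pi_gt3 by linarith
    qed
    then have "l 0 = l (Suc j)" using n h0 by simp
    then show False using inj by (auto dest: injD)
  qed
  \<comment> \<open>The rotation by the character of \<open>l 0\<close> makes index 0 the constant
    term without changing the modulus.\<close>
  define a where "a = (\<lambda>n::nat. D (h * real n) * exp (\<i> * complex_of_real (l 0 * (h * real n))))"
  have as: "(\<lambda>j. of_real (d j) * \<omega> j ^ n) sums a n" for n
  proof -
    have "of_real (d j) * exp (- \<i> * complex_of_real (l j * (h * real n))) * exp (\<i> * complex_of_real (l 0 * (h * real n))) = of_real (d j) * \<omega> j ^ n" for j
    proof -
      have "exp (- \<i> * complex_of_real (l j * (h * real n))) * exp (\<i> * complex_of_real (l 0 * (h * real n))) = exp (of_nat n * (\<i> * complex_of_real ((l 0 - l j) * h)))"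
        unfolding exp_add[symmetric] by (rule arg_cong[of _ _ exp]) (simp add: algebra_simps)
      then show ?thesis by (simp only: \<omega>_def exp_of_nat_mult mult.assoc)
    qed
    then show ?thesis using sums_mult2[OF Ds, of "h * real n" "exp (\<i> * complex_of_real (l 0 * (h * real n)))"] by (simp only: a_def)
  qed
  have a0: "a \<longlonglongrightarrow> 0"
  proof (rule Lim_null_comparison)
    show "(\<lambda>n. W * (2 * exp (- 2 * (h * real n)))) \<longlonglongrightarrow> 0" using h0 by real_asymp
    have "filterlim (\<lambda>n. exp (2 * (h * real n)) / 2) at_top sequentially" using h0 by real_asymp
    then have "eventually (\<lambda>n. exp (2 * (h * real n)) / 2 \<ge> 1 + 8 * u\<^sup>2) sequentially" unfolding filterlim_at_top by blast
    then show "eventually (\<lambda>n. norm (a n) \<le> W * (2 * exp (- 2 * (h * real n)))) sequentially"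
    proof eventually_elim
      case (elim n)
      then show ?case using Dsmall[OF elim] by (simp add: a_def norm_mult)
    qed
  qed
  have "d 0 \<noteq> 0" using c0 by (simp add: d_def)
  from almost_periodic_not_tendsto_0[OF ds this w0 wn w1 as] a0 show False by contradiction
qed

section \<open>The almost positive definite kernel\<close>

definition gker :: "(nat \<Rightarrow> real) \<Rightarrow> (nat \<Rightarrow> real) \<Rightarrow> complex \<Rightarrow> real \<Rightarrow> real \<Rightarrow> complex" where
  "gker c l z \<theta> y = 2 * of_real pi * csum c l (of_real y + \<i> * of_real \<theta>) * etot z (of_real y + \<i> * of_real \<theta>)"

lemma gker_uminus:
  assumes c: "summable (\<lambda>j. \<bar>c j\<bar>)" and l: "bounded (range l)" and th: "\<bar>\<theta>\<bar> < pi / 4"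
  shows "gker c l z \<theta> (- y) = cnj (gker c l z \<theta> y)"
proof -
  let ?f = "\<lambda>y t. of_real (exp (t * \<theta>) * gsum c l z t) * exp (- \<i> * complex_of_real t * of_real y)"
  have h: "has_bochner_integral lborel (?f y) (gker c l z \<theta> y)" for y
    unfolding gker_def by (rule gsum_transform[OF c l th])
  have "has_bochner_integral lborel (\<lambda>t. cnj (?f y t)) (cnj (gker c l z \<theta> y))"
    using h by (rule has_bochner_integral_cnj)
  moreover have "cnj (?f y t) = ?f (- y) t" for t by (simp add: exp_cnj)
  ultimately have "has_bochner_integral lborel (?f (- y)) (cnj (gker c l z \<theta> y))" by (simp only:)
  then show ?thesis by (rule has_bochner_integral_eq[OF h])
qed

text \<open>The quadratic form is the integral of \<open>exp (t * \<theta>) * gsum c l z t\<close>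
  against the square of the modulus of a trigonometric sum. Only \<open>t \<le> T\<close> can
  contribute negatively, and there the tilt is at most
  \<open>exp (\<bar>T\<bar> * (pi / 4))\<close>; hence \<open>C\<close> is independent of
  \<open>\<theta>\<close>.\<close>

lemma gker_almost_psd:
  assumes c: "summable (\<lambda>j. \<bar>c j\<bar>)" and l: "bounded (range l)"
    and pos: "\<And>t. t > T \<Longrightarrow> gsum c l z t \<ge> 0"
  shows "\<exists>C\<ge>0. \<forall>\<theta> (x :: nat \<Rightarrow> complex) y n. 0 \<le> \<theta> \<longrightarrow> \<theta> < pi / 4 \<longrightarrow>
    - (C * (\<Sum>i<n. norm (x i))\<^sup>2) \<le> Re (\<Sum>i<n. \<Sum>j<n. x i * cnj (x j) * gker c l z \<theta> (y i - y j))"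
proof (intro exI conjI allI impI)
  show "0 \<le> exp (\<bar>T\<bar> * (pi / 4)) * (LBINT t. \<bar>gsum c l z t\<bar>)" by simp
  fix \<theta> :: real and x :: "nat \<Rightarrow> complex" and y :: "nat \<Rightarrow> real" and n :: nat
  assume t0: "0 \<le> \<theta>" and t1: "\<theta> < pi / 4"
  then have th: "\<bar>\<theta>\<bar> < pi / 4" by simp
  let ?g = "gsum c l z"
  let ?f = "\<lambda>y t. of_real (exp (t * \<theta>) * ?g t) * exp (- \<i> * complex_of_real t * of_real y)"
  define S where "S = (\<Sum>i<n. norm (x i))"
  define P where "P = (\<lambda>t. \<Sum>i<n. x i * exp (- \<i> * complex_of_real t * of_real (y i)))"
  have h: "has_bochner_integral lborel (?f y) (gker c l z \<theta> y)" for y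
    unfolding gker_def by (rule gsum_transform[OF c l th])
  have "has_bochner_integral lborel (\<lambda>t. \<Sum>i<n. \<Sum>j<n. x i * cnj (x j) * ?f (y i - y j) t)
      (\<Sum>i<n. \<Sum>j<n. x i * cnj (x j) * gker c l z \<theta> (y i - y j))"
    by (intro has_bochner_integral_sum has_bochner_integral_mult_right h)
  moreover have "(\<Sum>i<n. \<Sum>j<n. x i * cnj (x j) * ?f (y i - y j) t) = of_real (exp (t * \<theta>) * ?g t * (norm (P t))\<^sup>2)" for t
  proof -
    have e: "exp (- \<i> * complex_of_real t * of_real (y i - y j)) =
       exp (- \<i> * complex_of_real t * of_real (y i)) * cnj (exp (- \<i> * complex_of_real t * of_real (y j)))" for i j
      by (simp add: exp_cnj algebra_simps flip: exp_add)
    have "of_real ((norm (P t))\<^sup>2) = P t * cnj (P t)" by (rule complex_norm_square)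
    also have "\<dots> = (\<Sum>i<n. \<Sum>j<n. x i * cnj (x j) * exp (- \<i> * complex_of_real t * of_real (y i - y j)))"
      unfolding P_def e cnj_sum sum_product complex_cnj_mult by (intro sum.cong refl) (simp only: mult_ac)
    finally have "of_real (exp (t * \<theta>) * ?g t) * of_real ((norm (P t))\<^sup>2) =
      of_real (exp (t * \<theta>) * ?g t) * (\<Sum>i<n. \<Sum>j<n. x i * cnj (x j) * exp (- \<i> * complex_of_real t * of_real (y i - y j)))" by simp
    then show ?thesis unfolding sum_distrib_left of_real_mult[symmetric] by (simp only: mult_ac)
  qed
  ultimately have H: "has_bochner_integral lborel (\<lambda>t. complex_of_real (exp (t * \<theta>) * ?g t * (norm (P t))\<^sup>2))
      (\<Sum>i<n. \<Sum>j<n. x i * cnj (x j) * gker c l z \<theta> (y i - y j))" by (simp only:)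
  have Hr: "has_bochner_integral lborel (\<lambda>t. exp (t * \<theta>) * ?g t * (norm (P t))\<^sup>2)
      (Re (\<Sum>i<n. \<Sum>j<n. x i * cnj (x j) * gker c l z \<theta> (y i - y j)))"
    using has_bochner_integral_Re[OF H] by (simp only: Re_complex_of_real)
  have gi: "integrable lborel (\<lambda>t. \<bar>?g t\<bar>)"
  proof -
    have "integrable lborel (\<lambda>t. complex_of_real (?g t))"
      using gsum_transform[OF c l, of 0 z 0] by (auto simp: has_bochner_integral_iff)
    from integrable_norm[OF this] show ?thesis by simp
  qed
  \<comment> \<open>For \<open>t > T\<close> the integrand is nonnegative. For the rest, the tilt
    and the trigonometric sum are estimated by their largest possible values.\<close>
  have lower: "- (exp (\<bar>T\<bar> * (pi / 4)) * S\<^sup>2) * \<bar>?g t\<bar> \<le> exp (t * \<theta>) * ?g t * (norm (P t))\<^sup>2" for t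
  proof (cases "t > T")
    case True
    then have "0 \<le> exp (t * \<theta>) * ?g t * (norm (P t))\<^sup>2" using pos by simp
    moreover have "- (exp (\<bar>T\<bar> * (pi / 4)) * S\<^sup>2) * \<bar>?g t\<bar> \<le> 0" by simp
    ultimately show ?thesis by linarith
  next
    case False
    have "t * \<theta> \<le> \<bar>T\<bar> * \<theta>" using False t0 by (intro mult_right_mono) auto
    also have "\<dots> \<le> \<bar>T\<bar> * (pi / 4)" using t1 by (intro mult_left_mono) auto
    finally have e: "exp (t * \<theta>) \<le> exp (\<bar>T\<bar> * (pi / 4))" by simp
    have "norm (P t) \<le> (\<Sum>i<n. norm (x i * exp (- \<i> * complex_of_real t * of_real (y i))))"
      unfolding P_def by (rule norm_sum)
    also have "\<dots> = S" by (simp add: S_def norm_mult)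
    finally have p: "(norm (P t))\<^sup>2 \<le> S\<^sup>2" by (intro power_mono) auto
    have "exp (t * \<theta>) * (norm (P t))\<^sup>2 * \<bar>?g t\<bar> \<le> exp (\<bar>T\<bar> * (pi / 4)) * S\<^sup>2 * \<bar>?g t\<bar>"
      using e p by (intro mult_right_mono mult_mono) auto
    moreover have "exp (t * \<theta>) * (norm (P t))\<^sup>2 * (- \<bar>?g t\<bar>) \<le> exp (t * \<theta>) * (norm (P t))\<^sup>2 * ?g t"
      by (intro mult_left_mono) auto
    ultimately show ?thesis by (simp add: mult_ac)
  qed
  have "(LBINT t. - (exp (\<bar>T\<bar> * (pi / 4)) * S\<^sup>2) * \<bar>?g t\<bar>) \<le> (LBINT t. exp (t * \<theta>) * ?g t * (norm (P t))\<^sup>2)"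
    by (intro integral_mono integrable_mult_right gi lower) (use Hr in \<open>auto simp: has_bochner_integral_iff\<close>)
  also have "\<dots> = Re (\<Sum>i<n. \<Sum>j<n. x i * cnj (x j) * gker c l z \<theta> (y i - y j))"
    using Hr by (simp add: has_bochner_integral_iff)
  finally show "- ((exp (\<bar>T\<bar> * (pi / 4)) * (LBINT t. \<bar>?g t\<bar>)) * (\<Sum>i<n. norm (x i))\<^sup>2) \<le>
     Re (\<Sum>i<n. \<Sum>j<n. x i * cnj (x j) * gker c l z \<theta> (y i - y j))"
    by (simp add: S_def mult_ac)
qed

text \<open>
  Test the form on the vector with entries 1 and \<open>- K i / A\<close>, rotated to make the cross terms negative.
\<close>

lemma bessel_of_almost_psd:
  fixes \<Phi> :: "'a \<Rightarrow> real \<Rightarrow> complex" and y :: "nat \<Rightarrow> 'a \<Rightarrow> real" and M :: "'a \<Rightarrow> real"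
  assumes nt: "Fl \<noteq> bot"
    and psd: "eventually (\<lambda>a. \<forall>(x :: nat \<Rightarrow> complex) y (n :: nat). - (C * (\<Sum>i<n. norm (x i))\<^sup>2) \<le> Re (\<Sum>i<n. \<Sum>j<n. x i * cnj (x j) * \<Phi> a (y i - y j))) Fl"
    and C: "C \<ge> 0"
    and herm: "eventually (\<lambda>a. \<forall>y. \<Phi> a (- y) = cnj (\<Phi> a y)) Fl"
    and M: "filterlim M at_top Fl"
    and diag: "eventually (\<lambda>a. norm (\<Phi> a 0) / M a \<le> A) Fl" and A: "A > 0"
    and K: "\<And>i. i < n \<Longrightarrow> ((\<lambda>a. norm (\<Phi> a (y i a)) / M a) \<longlongrightarrow> K i) Fl"
    and off: "\<And>i j. i < n \<Longrightarrow> j < n \<Longrightarrow> i \<noteq> j \<Longrightarrow> ((\<lambda>a. norm (\<Phi> a (y i a - y j a)) / M a) \<longlongrightarrow> 0) Fl"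
  shows "(\<Sum>i<n. (K i)\<^sup>2) \<le> A\<^sup>2"
proof -
  define p where "p = (\<lambda>i. K i / A)"
  have Mpos: "eventually (\<lambda>a. M a > 0) Fl" using M by (auto simp: filterlim_at_top_dense)
  have K0: "K i \<ge> 0" if "i < n" for i
  proof (rule tendsto_lowerbound[OF K[OF that] _ nt])
    show "eventually (\<lambda>a. 0 \<le> norm (\<Phi> a (y i a)) / M a) Fl" using Mpos by eventually_elim simp
  qed
  have p0: "p i \<ge> 0" if "i < n" for i using K0[OF that] A by (simp add: p_def)
  define O1 where "O1 = (\<lambda>a. \<Sum>i<n. \<Sum>j<n. if i = j then 0 else p i * p j * (norm (\<Phi> a (y i a - y j a)) / M a))"
  have O1: "(O1 \<longlongrightarrow> 0) Fl"
  proof -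
    have "((\<lambda>a. if i = j then 0 else p i * p j * (norm (\<Phi> a (y i a - y j a)) / M a)) \<longlongrightarrow> 0) Fl" if "i < n" "j < n" for i j
      using tendsto_mult[OF tendsto_const[of "p i * p j"] off[OF that]] by (cases "i = j") auto
    then have "(O1 \<longlongrightarrow> (\<Sum>i<n. \<Sum>j<n. 0)) Fl" unfolding O1_def by (intro tendsto_sum) auto
    then show ?thesis by simp
  qed
  \<comment> \<open>An upper bound for the quadratic form divided by \<open>M a\<close>, with the
    positivity error moved to this side. That error vanishes in the limit since \<open>M\<close>
    tends to infinity.\<close>
  define L where "L = (\<lambda>a. A * (1 + (\<Sum>i<n. (p i)\<^sup>2)) - 2 * (\<Sum>i<n. p i * (norm (\<Phi> a (y i a)) / M a)) + O1 a + C * (1 + (\<Sum>i<n. p i))\<^sup>2 / M a)"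
  have Ml: "((\<lambda>a. C * (1 + (\<Sum>i<n. p i))\<^sup>2 / M a) \<longlongrightarrow> 0) Fl"
    by (rule real_tendsto_divide_at_top[OF tendsto_const M])
  have Llim: "(L \<longlongrightarrow> A * (1 + (\<Sum>i<n. (p i)\<^sup>2)) - 2 * (\<Sum>i<n. p i * K i) + 0 + 0) Fl"
    unfolding L_def by (intro tendsto_add tendsto_diff tendsto_const tendsto_mult tendsto_sum O1 Ml K) auto
  have Lpos: "eventually (\<lambda>a. 0 \<le> L a) Fl"
    using psd herm diag Mpos
  proof eventually_elim
    case (elim a)
    define w where "w = (\<lambda>i. case i of 0 \<Rightarrow> 0 | Suc i \<Rightarrow> y i a)"
    define x where "x = (\<lambda>i. case i of 0 \<Rightarrow> 1 | Suc i \<Rightarrow> - of_real (p i) * cnj (sgn (\<Phi> a (y i a))))"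
    have xs: "norm (x (Suc i)) \<le> p i" if "i < n" for i
      using p0[OF that] by (auto simp: x_def norm_mult norm_sgn)
    have "(\<Sum>i<Suc n. norm (x i)) = 1 + (\<Sum>i<n. norm (x (Suc i)))"
      by (subst sum.lessThan_Suc_shift) (simp add: x_def)
    also have "\<dots> \<le> 1 + (\<Sum>i<n. p i)" using xs by (intro add_left_mono sum_mono) auto
    finally have xsum: "(\<Sum>i<Suc n. norm (x i))\<^sup>2 \<le> (1 + (\<Sum>i<n. p i))\<^sup>2" by (intro power_mono sum_nonneg) auto
    have sg: "Re (x (Suc i) * \<Phi> a (y i a)) = - (p i * norm (\<Phi> a (y i a)))" for i
    proof -
      have "cnj (sgn (\<Phi> a (y i a))) * \<Phi> a (y i a) = of_real (norm (\<Phi> a (y i a)))"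
      proof (cases "\<Phi> a (y i a) = 0")
        case False
        have "cnj (sgn (\<Phi> a (y i a))) * \<Phi> a (y i a) = (\<Phi> a (y i a) * cnj (\<Phi> a (y i a))) / of_real (norm (\<Phi> a (y i a)))"
          by (simp add: sgn_eq)
        also have "\<dots> = of_real (norm (\<Phi> a (y i a)))" unfolding complex_norm_square[symmetric] using False by (simp add: power2_eq_square)
        finally show ?thesis .
      qed simp
      then have "x (Suc i) * \<Phi> a (y i a) = of_real (- (p i * norm (\<Phi> a (y i a))))" by (simp add: x_def mult.assoc)
      then show ?thesis by (simp only: Re_complex_of_real)
    qed
    have "(\<Sum>i<Suc n. \<Sum>j<Suc n. x i * cnj (x j) * \<Phi> a (w i - w j)) =
       \<Phi> a 0 + (\<Sum>j<n. cnj (x (Suc j)) * \<Phi> a (- y j a)) + (\<Sum>i<n. x (Suc i) * \<Phi> a (y i a)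
         + (\<Sum>j<n. x (Suc i) * cnj (x (Suc j)) * \<Phi> a (y i a - y j a)))"
      by (simp only: sum.lessThan_Suc_shift) (simp add: w_def x_def)
    also have "(\<Sum>j<n. cnj (x (Suc j)) * \<Phi> a (- y j a)) = cnj (\<Sum>j<n. x (Suc j) * \<Phi> a (y j a))"
      using elim(2) by (simp add: cnj_sum)
    finally have t: "(\<Sum>i<Suc n. \<Sum>j<Suc n. x i * cnj (x j) * \<Phi> a (w i - w j)) =
       \<Phi> a 0 + cnj (\<Sum>j<n. x (Suc j) * \<Phi> a (y j a)) + (\<Sum>i<n. x (Suc i) * \<Phi> a (y i a)
         + (\<Sum>j<n. x (Suc i) * cnj (x (Suc j)) * \<Phi> a (y i a - y j a)))" .
    have tot: "Re (\<Sum>i<Suc n. \<Sum>j<Suc n. x i * cnj (x j) * \<Phi> a (w i - w j)) =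
       Re (\<Phi> a 0) - 2 * (\<Sum>i<n. p i * norm (\<Phi> a (y i a))) + (\<Sum>i<n. \<Sum>j<n. Re (x (Suc i) * cnj (x (Suc j)) * \<Phi> a (y i a - y j a)))"
      unfolding t plus_complex.sel cnj.sel Re_sum sg sum.distrib sum_negf by simp
    have bd: "Re (x (Suc i) * cnj (x (Suc j)) * \<Phi> a (y i a - y j a)) \<le> (if i = j then (p i)\<^sup>2 * norm (\<Phi> a 0) else 0) + (if i = j then 0 else p i * p j * norm (\<Phi> a (y i a - y j a)))"
      if "i < n" "j < n" for i j
    proof -
      have "Re (x (Suc i) * cnj (x (Suc j)) * \<Phi> a (y i a - y j a)) \<le> norm (x (Suc i)) * norm (x (Suc j)) * norm (\<Phi> a (y i a - y j a))"
        using complex_Re_le_cmod[of "x (Suc i) * cnj (x (Suc j)) * \<Phi> a (y i a - y j a)"] by (simp only: norm_mult complex_mod_cnj)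
      also have "\<dots> \<le> p i * p j * norm (\<Phi> a (y i a - y j a))"
        using xs that p0 by (intro mult_right_mono mult_mono) auto
      finally show ?thesis by (cases "i = j") (auto simp: power2_eq_square)
    qed
    have "(\<Sum>i<n. \<Sum>j<n. Re (x (Suc i) * cnj (x (Suc j)) * \<Phi> a (y i a - y j a))) \<le>
       (\<Sum>i<n. \<Sum>j<n. (if i = j then (p i)\<^sup>2 * norm (\<Phi> a 0) else 0) + (if i = j then 0 else p i * p j * norm (\<Phi> a (y i a - y j a))))"
      using bd by (intro sum_mono) auto
    also have "\<dots> = (\<Sum>i<n. (p i)\<^sup>2) * norm (\<Phi> a 0) + O1 a * M a"
    proof -
      have "(\<Sum>i<n. \<Sum>j<n. if i = j then (p i)\<^sup>2 * norm (\<Phi> a 0) else 0) = (\<Sum>i<n. (p i)\<^sup>2) * norm (\<Phi> a 0)"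
        by (simp add: sum_distrib_right)
      moreover have "O1 a * M a = (\<Sum>i<n. \<Sum>j<n. if i = j then 0 else p i * p j * norm (\<Phi> a (y i a - y j a)))"
        unfolding O1_def sum_distrib_right using elim(4) by (intro sum.cong) auto
      ultimately show ?thesis by (simp add: sum.distrib)
    qed
    finally have b2: "Re (\<Sum>i<Suc n. \<Sum>j<Suc n. x i * cnj (x j) * \<Phi> a (w i - w j)) \<le>
        norm (\<Phi> a 0) * (1 + (\<Sum>i<n. (p i)\<^sup>2)) - 2 * (\<Sum>i<n. p i * norm (\<Phi> a (y i a))) + O1 a * M a"
      unfolding tot using complex_Re_le_cmod[of "\<Phi> a 0"] by (simp add: algebra_simps)
    have "- (C * (1 + (\<Sum>i<n. p i))\<^sup>2) \<le> - (C * (\<Sum>i<Suc n. norm (x i))\<^sup>2)" using xsum C by (intro le_imp_neg_le mult_left_mono)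
    also have "\<dots> \<le> Re (\<Sum>i<Suc n. \<Sum>j<Suc n. x i * cnj (x j) * \<Phi> a (w i - w j))" using elim(1) by blast
    also note b2
    also have "norm (\<Phi> a 0) * (1 + (\<Sum>i<n. (p i)\<^sup>2)) \<le> (A * M a) * (1 + (\<Sum>i<n. (p i)\<^sup>2))"
      using elim(3,4) by (intro mult_right_mono add_nonneg_nonneg sum_nonneg) (auto simp: field_simps)
    finally have "0 \<le> (A * M a) * (1 + (\<Sum>i<n. (p i)\<^sup>2)) - 2 * (\<Sum>i<n. p i * norm (\<Phi> a (y i a))) + O1 a * M a + C * (1 + (\<Sum>i<n. p i))\<^sup>2"
      by linarith
    also have "\<dots> = L a * M a"
    proof -
      have "(\<Sum>i<n. p i * (norm (\<Phi> a (y i a)) / M a)) * M a = (\<Sum>i<n. p i * norm (\<Phi> a (y i a)))"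
        unfolding sum_distrib_right using elim(4) by (intro sum.cong) auto
      then show ?thesis using elim(4) by (simp add: L_def algebra_simps)
    qed
    finally show ?case using elim(4) by (simp add: zero_le_mult_iff)
  qed
  have "0 \<le> A * (1 + (\<Sum>i<n. (p i)\<^sup>2)) - 2 * (\<Sum>i<n. p i * K i) + 0 + 0"
    by (rule tendsto_lowerbound[OF Llim Lpos nt])
  moreover have "(\<Sum>i<n. (p i)\<^sup>2) = (\<Sum>i<n. (K i)\<^sup>2) / A\<^sup>2" by (simp add: p_def power_divide sum_divide_distrib)
  moreover have "(\<Sum>i<n. p i * K i) = (\<Sum>i<n. (K i)\<^sup>2) / A" by (simp add: p_def power2_eq_square sum_divide_distrib)
  \<comment> \<open>With the weights \<open>K i / A\<close> the quadratic and the linear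
    contribution combine to \<open>A\<close> minus the sum of squares over \<open>A\<close>.\<close>
  ultimately have "0 \<le> A * (1 + (\<Sum>i<n. (K i)\<^sup>2) / A\<^sup>2) - 2 * ((\<Sum>i<n. (K i)\<^sup>2) / A)" by simp
  also have "\<dots> = (A\<^sup>2 - (\<Sum>i<n. (K i)\<^sup>2)) / A" using A by (simp add: field_simps power2_eq_square)
  finally show ?thesis using A by (simp add: zero_le_divide_iff)
qed

section \<open>The kernel at a cusp\<close>

definition epol :: "complex \<Rightarrow> complex \<Rightarrow> complex" where
  "epol z \<zeta> = exp (\<zeta> / 2) / 2 + exp (z\<^sup>2 / 4) * exp (- \<zeta> / 2) / 2"

lemma Re_exp_cuspz_squared:
  assumes "0 < a" "a < pi / 4"
  shows "Re ((exp (cuspz r x a))\<^sup>2) > 0"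
proof -
  have "(exp (cuspz r x a))\<^sup>2 = exp (2 * cuspz r x a)" by (simp add: exp_double)
  moreover have "Re (exp (2 * cuspz r x a)) = exp (2 * (ln r / 2 + x)) * cos (2 * (pi / 4 - a))"
    by (simp add: Re_exp cuspz_def)
  moreover have "cos (2 * (pi / 4 - a)) > 0" using assms by (intro cos_gt_zero_pi) auto
  ultimately show ?thesis by simp
qed

lemma etheta_eq_thmain:
  assumes "Re ((exp \<zeta>)\<^sup>2) > 0"
  shows "etheta z \<zeta> = thmain z \<zeta> - epol z \<zeta>"
proof -
  have "exp (\<zeta> / 2) * exp (- \<zeta>) = exp (- \<zeta> / 2)" by (simp flip: exp_add)
  then have "exp (\<zeta> / 2) * (exp (z\<^sup>2 / 4) * exp (- \<zeta>) / 2) = exp (z\<^sup>2 / 4) * exp (- \<zeta> / 2) / 2" by simp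
  then show ?thesis unfolding etheta_def thmain_def epol_def gtheta_eq_ctheta[OF assms]
    by (simp add: algebra_simps)
qed

lemma epol_negligible:
  "((\<lambda>a. norm (epol z (cuspz r (s * a) a)) / cuspM u v a) \<longlongrightarrow> 0) (at_right 0)"
proof -
  have "((\<lambda>a. norm (epol z (cuspz r (s * a) a))) \<longlongrightarrow> norm (epol z (cuspz r (s * 0) 0))) (at_right 0)"
    unfolding epol_def cuspz_def by (intro tendsto_intros) auto
  then show ?thesis by (rule real_tendsto_divide_at_top[OF _ cuspM_at_top])
qed

text \<open>The exponential factor in \<open>etot\<close> turns \<open>cuspM u (- v)\<close> into
  \<open>cuspM u v\<close>, so the reflected theta function enters normalized by its own growth and
  with weight 1. \<open>R\<close> collects the elementary terms, which stay bounded at the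
  cusp.\<close>

lemma etot_normalized:
  obtains R where "(R \<longlongrightarrow> 0) (at_right 0)"
    "eventually (\<lambda>a. \<bar>norm (etot (zz u v) (cuspz r (s * a) a)) / cuspM u v a - norm (thmain (zz u v) (cuspz r (s * a) a)) / cuspM u v a\<bar>
       \<le> norm (thmain (zz u (- v)) (cuspz r (s * a) a)) / cuspM u (- v) a + R a) (at_right 0)"
proof
  define e where "e = exp ((cnj (zz u v))\<^sup>2 / 4)"
  define R where "R = (\<lambda>a. norm (epol (zz u v) (cuspz r (s * a) a)) / cuspM u v a + norm e * (norm (epol (zz u (- v)) (cuspz r (s * a) a)) / cuspM u v a))"
  have "(R \<longlongrightarrow> 0 + norm e * 0) (at_right 0)"
    unfolding R_def by (intro tendsto_intros epol_negligible)
  then show "(R \<longlongrightarrow> 0) (at_right 0)" by simp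
  have "eventually (\<lambda>a. a < pi / 4) (at_right 0)" by (rule order_tendstoD(2)[OF tendsto_ident_at]) simp
  moreover have "eventually (\<lambda>a::real. 0 < a) (at_right 0)" by (simp add: eventually_at_right_less)
  ultimately show "eventually (\<lambda>a. \<bar>norm (etot (zz u v) (cuspz r (s * a) a)) / cuspM u v a - norm (thmain (zz u v) (cuspz r (s * a) a)) / cuspM u v a\<bar>
       \<le> norm (thmain (zz u (- v)) (cuspz r (s * a) a)) / cuspM u (- v) a + R a) (at_right 0)"
  proof eventually_elim
    case (elim a)
    define \<zeta> where "\<zeta> = cuspz r (s * a) a"
    have m: "cuspM u v a > 0" using elim by (intro cuspM_pos)
    have re: "Re ((exp \<zeta>)\<^sup>2) > 0" unfolding \<zeta>_def using elim by (intro Re_exp_cuspz_squared)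
    have d: "etot (zz u v) \<zeta> - thmain (zz u v) \<zeta> = e * thmain (zz u (- v)) \<zeta> - epol (zz u v) \<zeta> - e * epol (zz u (- v)) \<zeta>"
      unfolding etot_def i_cnj_zz etheta_eq_thmain[OF re] e_def[symmetric] by (simp add: algebra_simps)
    have "\<bar>norm (etot (zz u v) \<zeta>) - norm (thmain (zz u v) \<zeta>)\<bar> \<le> norm (etot (zz u v) \<zeta> - thmain (zz u v) \<zeta>)"
      by (rule norm_triangle_ineq3)
    also have "\<dots> \<le> norm e * norm (thmain (zz u (- v)) \<zeta>) + norm (epol (zz u v) \<zeta>) + norm e * norm (epol (zz u (- v)) \<zeta>)"
      unfolding d using norm_triangle_ineq4[of "e * thmain (zz u (- v)) \<zeta> - epol (zz u v) \<zeta>" "e * epol (zz u (- v)) \<zeta>"]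
        norm_triangle_ineq4[of "e * thmain (zz u (- v)) \<zeta>" "epol (zz u v) \<zeta>"] by (simp only: norm_mult)
    finally have b: "\<bar>norm (etot (zz u v) \<zeta>) - norm (thmain (zz u v) \<zeta>)\<bar> \<le> norm e * norm (thmain (zz u (- v)) \<zeta>) + norm (epol (zz u v) \<zeta>) + norm e * norm (epol (zz u (- v)) \<zeta>)" .
    have "cuspM u (- v) a = exp (2 * pi * u * v) * cuspM u v a" using elim by (intro cuspM_uminus)
    moreover have ne: "norm e * exp (2 * pi * u * v) = 1" unfolding e_def norm_exp_cnj_zz by (simp flip: exp_add)
    ultimately have "norm e * cuspM u (- v) a = cuspM u v a" by simp
    then have "norm (thmain (zz u (- v)) \<zeta>) / cuspM u (- v) a = norm e * norm (thmain (zz u (- v)) \<zeta>) / cuspM u v a"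
      using ne by (metis mult_divide_mult_cancel_left mult_zero_left zero_neq_one)
    then have "norm (thmain (zz u (- v)) \<zeta>) / cuspM u (- v) a + R a = (norm e * norm (thmain (zz u (- v)) \<zeta>) + norm (epol (zz u v) \<zeta>) + norm e * norm (epol (zz u (- v)) \<zeta>)) / cuspM u v a"
      by (simp add: R_def \<zeta>_def add_divide_distrib)
    then show ?case using divide_right_mono[OF b, of "cuspM u v a"] m
      by (simp add: \<zeta>_def[symmetric] diff_divide_distrib[symmetric] abs_divide)
  qed
qed

lemma etot_limit:
  assumes "((\<lambda>a. norm (thmain (zz u v) (cuspz r (s * a) a)) / cuspM u v a) \<longlongrightarrow> \<kappa>) (at_right 0)"
    and "((\<lambda>a. norm (thmain (zz u (- v)) (cuspz r (s * a) a)) / cuspM u (- v) a) \<longlongrightarrow> 0) (at_right 0)"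
  shows "((\<lambda>a. norm (etot (zz u v) (cuspz r (s * a) a)) / cuspM u v a) \<longlongrightarrow> \<kappa>) (at_right 0)"
proof -
  obtain R where R: "(R \<longlongrightarrow> 0) (at_right 0)"
    "eventually (\<lambda>a. \<bar>norm (etot (zz u v) (cuspz r (s * a) a)) / cuspM u v a - norm (thmain (zz u v) (cuspz r (s * a) a)) / cuspM u v a\<bar>
       \<le> norm (thmain (zz u (- v)) (cuspz r (s * a) a)) / cuspM u (- v) a + R a) (at_right 0)"
    by (rule etot_normalized)
  have "((\<lambda>a. norm (thmain (zz u (- v)) (cuspz r (s * a) a)) / cuspM u (- v) a + R a) \<longlongrightarrow> 0) (at_right 0)"
    using tendsto_add[OF assms(2) R(1)] by simp
  then have "((\<lambda>a. norm (etot (zz u v) (cuspz r (s * a) a)) / cuspM u v a - norm (thmain (zz u v) (cuspz r (s * a) a)) / cuspM u v a) \<longlongrightarrow> 0) (at_right 0)"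
    by (rule Lim_null_comparison[rotated]) (use R(2) in simp)
  from tendsto_add[OF this assms(1)] show ?thesis by simp
qed

lemma etot_limit_0:
  assumes H: "cuspH r q" and "\<And>m::int. of_int m + (q + sqrt r * (u + s * v)) \<noteq> 0"
    and "\<And>m::int. of_int m + (q + sqrt r * (u - s * v)) \<noteq> 0"
  shows "((\<lambda>a. norm (etot (zz u v) (cuspz r (s * a) a)) / cuspM u v a) \<longlongrightarrow> 0) (at_right 0)"
  by (intro etot_limit thmain_limit_0[OF H]) (use assms in auto)

lemma etot_limit_resonant:
  assumes H: "cuspH r q" and "of_int m0 + (q + sqrt r * (u + s * v)) = 0"
    and "\<And>m::int. of_int m + (q + sqrt r * (u - s * v)) \<noteq> 0"
  shows "((\<lambda>a. norm (etot (zz u v) (cuspz r (s * a) a)) / cuspM u v a) \<longlongrightarrow> cuspk r s) (at_right 0)"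
  by (intro etot_limit thmain_limit_resonant[OF H, of m0] thmain_limit_0[OF H]) (use assms in auto)

lemma etot_bounded:
  assumes H: "cuspH r q"
  shows "\<exists>B. eventually (\<lambda>a. norm (etot (zz u v) (cuspz r (s * a) a)) / cuspM u v a \<le> B) (at_right 0)"
proof -
  obtain R where R: "(R \<longlongrightarrow> 0) (at_right 0)"
    "eventually (\<lambda>a. \<bar>norm (etot (zz u v) (cuspz r (s * a) a)) / cuspM u v a - norm (thmain (zz u v) (cuspz r (s * a) a)) / cuspM u v a\<bar>
       \<le> norm (thmain (zz u (- v)) (cuspz r (s * a) a)) / cuspM u (- v) a + R a) (at_right 0)"
    by (rule etot_normalized)
  obtain B1 where B1: "eventually (\<lambda>a. norm (thmain (zz u v) (cuspz r (s * a) a)) / cuspM u v a \<le> B1) (at_right 0)"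
    using thmain_bounded[OF H] by blast
  obtain B2 where B2: "eventually (\<lambda>a. norm (thmain (zz u (- v)) (cuspz r (s * a) a)) / cuspM u (- v) a \<le> B2) (at_right 0)"
    using thmain_bounded[OF H] by blast
  have "eventually (\<lambda>a. R a < 1) (at_right 0)" by (rule order_tendstoD(2)[OF R(1)]) simp
  with B1 B2 R(2) have "eventually (\<lambda>a. norm (etot (zz u v) (cuspz r (s * a) a)) / cuspM u v a \<le> B1 + B2 + 1) (at_right 0)"
    by eventually_elim linarith
  then show ?thesis by blast
qed

text \<open>For \<open>u = 0\<close> the reflected parameter is \<open>- z\<close>, and the theta
  function is even in \<open>z\<close>. Both terms then resonate together, so this explicit factor
  replaces the separation by slopes.\<close>

lemma etot_zz_0: "etot (zz 0 v) \<zeta> = (1 + exp ((cnj (zz 0 v))\<^sup>2 / 4)) * etheta (zz 0 v) \<zeta>"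
proof -
  have "zz 0 (- v) = - zz 0 v" by (simp add: zz_def complex_eq_iff)
  moreover have "etheta (- z) \<zeta> = etheta z \<zeta>" for z by (simp add: etheta_def ctheta_uminus)
  ultimately show ?thesis unfolding etot_def i_cnj_zz by (simp add: distrib_right)
qed

lemma etot_limit_imaginary:
  assumes H: "cuspH r 0"
  shows "((\<lambda>a. norm (etot (zz 0 v) (cuspz r (0 * a) a)) / cuspM 0 v a) \<longlongrightarrow>
     norm (1 + exp ((cnj (zz 0 v))\<^sup>2 / 4)) * cuspk r 0) (at_right 0)"
proof -
  have "((\<lambda>a. norm (thmain (zz 0 v) (cuspz r (0 * a) a)) / cuspM 0 v a) \<longlongrightarrow> cuspk r 0) (at_right 0)"
    by (rule thmain_limit_resonant[OF H, of 0]) simp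
  moreover have "((\<lambda>a. norm (etheta (zz 0 v) (cuspz r (0 * a) a)) / cuspM 0 v a - norm (thmain (zz 0 v) (cuspz r (0 * a) a)) / cuspM 0 v a) \<longlongrightarrow> 0) (at_right 0)"
  proof (rule Lim_null_comparison[OF _ epol_negligible[of "zz 0 v" r 0]])
    have "eventually (\<lambda>a. a < pi / 4) (at_right 0)" by (rule order_tendstoD(2)[OF tendsto_ident_at]) simp
    moreover have "eventually (\<lambda>a::real. 0 < a) (at_right 0)" by (simp add: eventually_at_right_less)
    ultimately show "eventually (\<lambda>a. norm (norm (etheta (zz 0 v) (cuspz r (0 * a) a)) / cuspM 0 v a - norm (thmain (zz 0 v) (cuspz r (0 * a) a)) / cuspM 0 v a)
       \<le> norm (epol (zz 0 v) (cuspz r (0 * a) a)) / cuspM 0 v a) (at_right 0)"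
    proof eventually_elim
      case (elim a)
      define \<zeta> where "\<zeta> = cuspz r (0 * a) a"
      have m: "cuspM 0 v a > 0" using elim by (intro cuspM_pos)
      have re: "Re ((exp \<zeta>)\<^sup>2) > 0" unfolding \<zeta>_def using elim by (intro Re_exp_cuspz_squared)
      have "\<bar>norm (etheta (zz 0 v) \<zeta>) - norm (thmain (zz 0 v) \<zeta>)\<bar> \<le> norm (etheta (zz 0 v) \<zeta> - thmain (zz 0 v) \<zeta>)"
        by (rule norm_triangle_ineq3)
      also have "\<dots> = norm (epol (zz 0 v) \<zeta>)" by (simp add: etheta_eq_thmain[OF re])
      finally show ?case unfolding \<zeta>_def[symmetric] real_norm_def diff_divide_distrib[symmetric] abs_divide
        using m by (simp add: divide_right_mono)
    qed
  qed
  ultimately have "((\<lambda>a. norm (etheta (zz 0 v) (cuspz r (0 * a) a)) / cuspM 0 v a) \<longlongrightarrow> cuspk r 0) (at_right 0)"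
    using tendsto_add by fastforce
  then have "((\<lambda>a. norm (1 + exp ((cnj (zz 0 v))\<^sup>2 / 4)) * (norm (etheta (zz 0 v) (cuspz r (0 * a) a)) / cuspM 0 v a)) \<longlongrightarrow>
     norm (1 + exp ((cnj (zz 0 v))\<^sup>2 / 4)) * cuspk r 0) (at_right 0)"
    by (rule tendsto_mult_left)
  then show ?thesis by (simp only: etot_zz_0 norm_mult times_divide_eq_right)
qed

section \<open>Limits of the kernel at the cusps\<close>

lemma csum_continuous:
  assumes c: "summable (\<lambda>j. \<bar>c j\<bar>)" and l: "bounded (range l)"
  shows "continuous_on {\<zeta>. \<bar>Im \<zeta>\<bar> \<le> 1} (csum c l)"
proof -
  obtain L where L: "\<And>j. \<bar>l j\<bar> \<le> L" using l by (auto simp: bounded_iff)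
  have b: "norm (of_real (c j) * exp (- \<i> * of_real (l j) * \<zeta>)) \<le> \<bar>c j\<bar> * exp L" if "\<bar>Im \<zeta>\<bar> \<le> 1" for j \<zeta>
  proof -
    have "l j * Im \<zeta> \<le> \<bar>l j\<bar> * \<bar>Im \<zeta>\<bar>" by (metis abs_ge_self abs_mult)
    also have "\<dots> \<le> L * 1" using L[of j] that by (intro mult_mono) auto
    finally show ?thesis by (simp add: norm_mult mult_left_mono)
  qed
  have "uniform_limit {\<zeta>. \<bar>Im \<zeta>\<bar> \<le> 1} (\<lambda>X \<zeta>. \<Sum>j\<in>X. of_real (c j) * exp (- \<i> * of_real (l j) * \<zeta>))
      (\<lambda>\<zeta>. \<Sum>\<^sub>\<infinity>j\<in>UNIV. of_real (c j) * exp (- \<i> * of_real (l j) * \<zeta>)) (finite_subsets_at_top UNIV)"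
    by (rule Weierstrass_m_test_general[where M = "\<lambda>j. \<bar>c j\<bar> * exp L"])
       (use b abs_summable_on_nat[OF c] in auto)
  then have "continuous_on {\<zeta>. \<bar>Im \<zeta>\<bar> \<le> 1} (\<lambda>\<zeta>. \<Sum>\<^sub>\<infinity>j\<in>UNIV. of_real (c j) * exp (- \<i> * of_real (l j) * \<zeta>))"
    by (rule uniform_limit_theorem[rotated]) (auto intro!: always_eventually continuous_intros)
  then show ?thesis by (simp add: csum_def[abs_def])
qed

lemma eventually_at_right_0_pi4: "eventually (\<lambda>a. 0 < a \<and> a < pi / 4) (at_right 0)"
proof -
  have "eventually (\<lambda>a. a < pi / 4) (at_right 0)" by (rule order_tendstoD(2)[OF tendsto_ident_at]) simp
  moreover have "eventually (\<lambda>a::real. 0 < a) (at_right 0)" by (simp add: eventually_at_right_less)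
  ultimately show ?thesis by eventually_elim simp
qed

lemma csum_cusp_tendsto:
  assumes c: "summable (\<lambda>j. \<bar>c j\<bar>)" and l: "bounded (range l)"
  shows "((\<lambda>a. csum c l (cuspz r (s * a) a)) \<longlongrightarrow> csum c l (of_real (ln r / 2) + \<i> * of_real (pi / 4))) (at_right 0)"
proof (rule continuous_on_tendsto_compose[OF csum_continuous[OF c l]])
  have "((\<lambda>a. cuspz r (s * a) a) \<longlongrightarrow> of_real (ln r / 2 + s * 0) + \<i> * of_real (pi / 4 - 0)) (at_right 0)"
    unfolding cuspz_def by (intro tendsto_intros)
  then show "((\<lambda>a. cuspz r (s * a) a) \<longlongrightarrow> of_real (ln r / 2) + \<i> * of_real (pi / 4)) (at_right 0)" by simp
  have p: "pi / 4 \<le> 1" using pi_less_4 by simp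
  then show "of_real (ln r / 2) + \<i> * of_real (pi / 4) \<in> {\<zeta>. \<bar>Im \<zeta>\<bar> \<le> 1}" by simp
  show "eventually (\<lambda>a. cuspz r (s * a) a \<in> {\<zeta>. \<bar>Im \<zeta>\<bar> \<le> 1}) (at_right 0)"
    using eventually_at_right_0_pi4
  proof eventually_elim
    case (elim a)
    have "Im (cuspz r (s * a) a) = pi / 4 - a" by (simp add: cuspz_def)
    then show ?case using elim p by auto
  qed
qed

lemma gker_cusp:
  "gker c l z (pi / 4 - a) (ln r / 2 + x) = 2 * of_real pi * csum c l (cuspz r x a) * etot z (cuspz r x a)"
  by (simp add: gker_def cuspz_def)

lemma gker_cusp_limit:
  assumes c: "summable (\<lambda>j. \<bar>c j\<bar>)" and l: "bounded (range l)"
    and E: "((\<lambda>a. norm (etot (zz u v) (cuspz r (s * a) a)) / cuspM u v a) \<longlongrightarrow> \<kappa>) (at_right 0)"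
  shows "((\<lambda>a. norm (gker c l (zz u v) (pi / 4 - a) (ln r / 2 + s * a)) / cuspM u v a) \<longlongrightarrow>
     2 * pi * norm (csum c l (of_real (ln r / 2) + \<i> * of_real (pi / 4))) * \<kappa>) (at_right 0)"
proof -
  have "((\<lambda>a. 2 * pi * norm (csum c l (cuspz r (s * a) a)) * (norm (etot (zz u v) (cuspz r (s * a) a)) / cuspM u v a)) \<longlongrightarrow>
     2 * pi * norm (csum c l (of_real (ln r / 2) + \<i> * of_real (pi / 4))) * \<kappa>) (at_right 0)"
    by (intro tendsto_intros csum_cusp_tendsto c l E)
  then show ?thesis by (simp add: gker_cusp norm_mult)
qed

lemma gker_diagonal_bounded:
  assumes c: "summable (\<lambda>j. \<bar>c j\<bar>)" and l: "bounded (range l)"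
  shows "\<exists>A>0. eventually (\<lambda>a. norm (gker c l (zz u v) (pi / 4 - a) 0) / cuspM u v a \<le> A) (at_right 0)"
proof -
  \<comment> \<open>The argument 0 of the kernel is the cusp \<open>r = 1\<close> approached along
    \<open>x = 0\<close>, as \<open>ln 1 = 0\<close>.\<close>
  obtain B where B: "eventually (\<lambda>a. norm (etot (zz u v) (cuspz 1 (0 * a) a)) / cuspM u v a \<le> B) (at_right 0)"
    using etot_bounded[OF cuspH_1] by blast
  define S where "S = norm (csum c l (of_real (ln 1 / 2) + \<i> * of_real (pi / 4))) + 1"
  have "eventually (\<lambda>a. norm (csum c l (cuspz 1 (0 * a) a)) < S) (at_right 0)"
    by (rule order_tendstoD(2)[OF tendsto_norm[OF csum_cusp_tendsto[OF c l]]]) (simp add: S_def)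
  then have "eventually (\<lambda>a. norm (gker c l (zz u v) (pi / 4 - a) 0) / cuspM u v a \<le> 2 * pi * S * (\<bar>B\<bar> + 1)) (at_right 0)"
    using B eventually_at_right_0_pi4
  proof eventually_elim
    case (elim a)
    have m: "cuspM u v a > 0" using elim by (intro cuspM_pos) simp
    have "norm (gker c l (zz u v) (pi / 4 - a) 0) / cuspM u v a = 2 * pi * norm (csum c l (cuspz 1 (0 * a) a)) * (norm (etot (zz u v) (cuspz 1 (0 * a) a)) / cuspM u v a)"
      using gker_cusp[of c l "zz u v" a 1 "0 * a"] by (simp add: norm_mult)
    also have "\<dots> \<le> 2 * pi * S * (\<bar>B\<bar> + 1)"
      using elim m by (intro mult_mono mult_nonneg_nonneg) (auto simp: S_def)
    finally show ?case .
  qed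
  moreover have "2 * pi * S * (\<bar>B\<bar> + 1) > 0" by (intro mult_pos_pos) (auto simp: S_def add_nonneg_pos)
  ultimately show ?thesis by blast
qed

text \<open>The square equals \<open>1 / (8 * sqrt r * sqrt (s^2 + 1))\<close>, which decays only
  like \<open>1 / \<bar>s\<bar>\<close>. This slow decay is what makes the squares of the resonances
  sum to infinity.\<close>

lemma cuspk_squared_ge:
  assumes "r > 0" "\<bar>s\<bar> + 1 \<le> b"
  shows "1 / (8 * sqrt r * b) \<le> (cuspk r s)\<^sup>2"
proof -
  have "sqrt (s\<^sup>2 + 1) \<le> sqrt ((\<bar>s\<bar> + 1)\<^sup>2)" by (intro real_sqrt_le_mono) (simp add: power2_eq_square algebra_simps)
  then have sb: "sqrt (s\<^sup>2 + 1) \<le> b" using assms(2) by simp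
  have s0: "s\<^sup>2 + 1 > 0" by (simp add: add_nonneg_pos)
  have "sqrt (4::real) = 2" using real_sqrt_abs[of 2] by simp
  then have "sqrt (1 / (r * (4 * (s\<^sup>2 + 1)))) = 1 / (sqrt r * (2 * sqrt (s\<^sup>2 + 1)))"
    by (simp only: real_sqrt_divide real_sqrt_mult real_sqrt_one)
  then have "(cuspk r s)\<^sup>2 = 1 / (8 * sqrt r * sqrt (s\<^sup>2 + 1))"
    using assms(1) by (simp add: cuspk_def power_divide)
  moreover have "1 / (8 * sqrt r * b) \<le> 1 / (8 * sqrt r * sqrt (s\<^sup>2 + 1))"
    using sb s0 assms by (intro divide_left_mono mult_left_mono mult_pos_pos) auto
  ultimately show ?thesis by simp
qed

text \<open>For \<open>u = 0\<close> this rules out that the factor in \<open>etot_zz_0\<close> is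
  zero, in which case \<open>gsum\<close> would vanish identically.\<close>

lemma etot_not_identically_0:
  assumes c: "summable (\<lambda>j. \<bar>c j\<bar>)" and g: "gsum c l z t \<noteq> 0"
  shows "\<exists>\<zeta>. etot z \<zeta> \<noteq> 0"
proof (rule ccontr)
  assume "\<not> ?thesis"
  then have "etot z = (\<lambda>_. 0)" by auto
  then have "hfun z t = 0" for t
    using hfun_fourier[of 0 z t] by (auto simp: has_bochner_integral_iff)
  then have "gsum c l z t = 0" by (simp add: gsum_def)
  then show False using g by simp
qed

text \<open>If \<open>n * sqrt (2 * k)\<close> is the integer \<open>d\<close>, then
  \<open>n^2\<close> divides \<open>d^2\<close>, so \<open>n\<close> divides \<open>d\<close> and
  \<open>sqrt (2 * k)\<close> is an integer. As \<open>2 * u\<close> is an integer as well,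
  \<open>irr\<close> is violated. Used to see that distinct resonant characters are asymptotically
  orthogonal.\<close>

lemma half_integer_sqrt_ratio:
  fixes u :: real and k i j :: nat and n m1 :: int
  assumes k: "k > 0" and u: "of_int m1 + (1 / 2 + u) = 0"
    and irr: "\<And>m::int. of_int m \<noteq> 2 * u * sqrt (2 * real k)" and ij: "i \<noteq> j"
  shows "of_int n \<noteq> (real i - real j) / sqrt (2 * real k)"
proof
  assume h: "of_int n = (real i - real j) / sqrt (2 * real k)"
  define d where "d = int i - int j"
  have d0: "d \<noteq> 0" using ij by (simp add: d_def)
  have w0: "sqrt (2 * real k) > 0" using k by simp
  have nd: "real_of_int n * sqrt (2 * real k) = of_int d" using h w0 by (simp add: d_def)
  then have "(real_of_int n * sqrt (2 * real k))\<^sup>2 = (of_int d)\<^sup>2" by simp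
  then have "(real_of_int n)\<^sup>2 * (2 * real k) = (of_int d)\<^sup>2" by (simp add: power_mult_distrib)
  then have "real_of_int (n\<^sup>2 * (2 * int k)) = real_of_int (d\<^sup>2)" by simp
  then have "n\<^sup>2 * (2 * int k) = d\<^sup>2" by (simp only: of_int_eq_iff)
  then have "n\<^sup>2 dvd d\<^sup>2" by (metis dvd_triv_left)
  then have "n dvd d" by simp
  then obtain e where e: "d = n * e" by (rule dvdE)
  have n0: "n \<noteq> 0" using d0 e by auto
  have "sqrt (2 * real k) = of_int e" using nd n0 by (simp add: e)
  moreover have "2 * u = of_int (- 2 * m1 - 1)" using u by simp
  ultimately have "2 * u * sqrt (2 * real k) = of_int ((- 2 * m1 - 1) * e)" by (simp only: of_int_mult)
  then show False using irr by metis
qed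

lemma gsum_not_eventually_nonneg:
  assumes c: "summable (\<lambda>j. \<bar>c j\<bar>)" and l: "bounded (range l)" and c0: "c 0 \<noteq> 0" and inj: "inj l"
    and uv: "v \<noteq> 0 \<or> u = 0"
    and pos: "\<And>t. t > T \<Longrightarrow> gsum c l (zz u v) t \<ge> 0" and nz: "gsum c l (zz u v) t0 \<noteq> 0"
  shows False
proof -
  obtain C where C: "C \<ge> 0" "\<And>\<theta> (x :: nat \<Rightarrow> complex) y n. 0 \<le> \<theta> \<Longrightarrow> \<theta> < pi / 4 \<Longrightarrow>
    - (C * (\<Sum>i<n. norm (x i))\<^sup>2) \<le> Re (\<Sum>i<n. \<Sum>j<n. x i * cnj (x j) * gker c l (zz u v) \<theta> (y i - y j))"
    using gker_almost_psd[OF c l pos] by blast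
  define \<Phi> where "\<Phi> = (\<lambda>a. gker c l (zz u v) (pi / 4 - a))"
  have psd: "eventually (\<lambda>a. \<forall>(x :: nat \<Rightarrow> complex) y (n :: nat). - (C * (\<Sum>i<n. norm (x i))\<^sup>2) \<le> Re (\<Sum>i<n. \<Sum>j<n. x i * cnj (x j) * \<Phi> a (y i - y j))) (at_right 0)"
    using eventually_at_right_0_pi4 by eventually_elim (use C(2) in \<open>auto simp: \<Phi>_def\<close>)
  have herm: "eventually (\<lambda>a. \<forall>y. \<Phi> a (- y) = cnj (\<Phi> a y)) (at_right 0)"
    using eventually_at_right_0_pi4 by eventually_elim (auto simp: \<Phi>_def intro!: gker_uminus[OF c l])
  note bessel = bessel_of_almost_psd[OF _ psd C(1) herm cuspM_at_top[of u v], simplified]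
  obtain k :: nat where k: "k > 0" and irr: "u = 0 \<or> (\<forall>m::int. of_int m \<noteq> 2 * u * sqrt (2 * real k))"
    and cs: "csum c l (of_real (ln (2 * real k) / 2) + \<i> * of_real (pi / 4)) \<noteq> 0"
    using csum_nonzero_exists[OF c c0 inj l, of u] by blast
  define w where "w = sqrt (2 * real k)"
  have w0: "w > 0" using k by (simp add: w_def)
  define G where "G = 2 * pi * norm (csum c l (of_real (ln (2 * real k) / 2) + \<i> * of_real (pi / 4)))"
  have G0: "G > 0" using cs by (simp add: G_def)
  have kp: "cuspk (2 * real k) s > 0" for s
    using k by (simp add: cuspk_def add_nonneg_pos)
  note H2 = cuspH_even[OF k]
  note lim = gker_cusp_limit[OF c l, of u v]
  \<comment> \<open>If the reflected term resonated as well, the sum of the two integrality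
    conditions would make \<open>2 * u * w\<close> an integer, which the choice of \<open>k\<close>
    excludes.\<close>
  have res: "((\<lambda>a. norm (\<Phi> a (ln (2 * real k) / 2 + s * a)) / cuspM u v a) \<longlongrightarrow> G * cuspk (2 * real k) s) (at_right 0)"
    if "u \<noteq> 0" "of_int m + w * (u + s * v) = 0" for m :: int and s
  proof -
    have "of_int n + w * (u - s * v) \<noteq> 0" for n :: int
    proof
      assume "of_int n + w * (u - s * v) = 0"
      then have "real_of_int (- n - m) = 2 * u * w" using that(2) by (simp add: algebra_simps)
      then show False using irr that(1) unfolding w_def by blast
    qed
    then have "((\<lambda>a. norm (etot (zz u v) (cuspz (2 * real k) (s * a) a)) / cuspM u v a) \<longlongrightarrow> cuspk (2 * real k) s) (at_right 0)"
      using that(2) by (intro etot_limit_resonant[OF H2, of m]) (auto simp: w_def)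
    from lim[OF this] show ?thesis by (simp only: \<Phi>_def G_def)
  qed
  \<comment> \<open>Arguments that shrink with \<open>a\<close> belong to the cusp 1, whence the
    offset \<open>1 / 2\<close>; both terms of \<open>etot\<close> must be off resonance.\<close>
  have off: "((\<lambda>a. norm (\<Phi> a (s * a)) / cuspM u v a) \<longlongrightarrow> 0) (at_right 0)"
    if "\<And>m::int. of_int m + (1 / 2 + (u + s * v)) \<noteq> 0" "\<And>m::int. of_int m + (1 / 2 + (u - s * v)) \<noteq> 0" for s
  proof -
    have "((\<lambda>a. norm (etot (zz u v) (cuspz 1 (s * a) a)) / cuspM u v a) \<longlongrightarrow> 0) (at_right 0)"
      using that by (intro etot_limit_0[OF cuspH_1]) auto
    from lim[OF this] show ?thesis by (simp add: \<Phi>_def)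
  qed
  show False
  proof (cases "\<exists>m::int. of_int m + (1 / 2 + u) = 0")
    case False
    \<comment> \<open>The slope with \<open>u + s * v = 0\<close>, which resonates at the integer 0;
      for \<open>u = 0\<close> it is 0, also when \<open>v = 0\<close>.\<close>
    define s where "s = - u / v"
    obtain K where K: "K > 0" "((\<lambda>a. norm (\<Phi> a (ln (2 * real k) / 2 + s * a)) / cuspM u v a) \<longlongrightarrow> K) (at_right 0)"
    proof (cases "u = 0")
      case True
      have "1 + exp ((cnj (zz 0 v))\<^sup>2 / 4) \<noteq> 0"
        using etot_not_identically_0[OF c nz] unfolding True etot_zz_0 by auto
      then have "G * (norm (1 + exp ((cnj (zz 0 v))\<^sup>2 / 4)) * cuspk (2 * real k) 0) > 0" using G0 kp by simp
      moreover have "((\<lambda>a. norm (\<Phi> a (ln (2 * real k) / 2 + s * a)) / cuspM u v a) \<longlongrightarrow>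
          G * (norm (1 + exp ((cnj (zz 0 v))\<^sup>2 / 4)) * cuspk (2 * real k) 0)) (at_right 0)"
      proof -
        have s: "s = 0" by (simp add: s_def True)
        show ?thesis unfolding s \<Phi>_def G_def True by (rule gker_cusp_limit[OF c l etot_limit_imaginary[OF H2]])
      qed
      ultimately show ?thesis by (rule that)
    next
      case u0: False
      then have "of_int 0 + w * (u + s * v) = 0" using uv by (simp add: s_def)
      from res[OF u0 this] show ?thesis by (rule that[rotated]) (use G0 kp in simp)
    qed
    have d0: "((\<lambda>a. norm (\<Phi> a (0 * a)) / cuspM u v a) \<longlongrightarrow> 0) (at_right 0)"
      using False by (intro off) auto
    \<comment> \<open>Any bound below \<open>K\<close> will do: with \<open>K / 2\<close>, the
      Bessel inequality for one character reads \<open>K^2 \<le> (K / 2)^2\<close>.\<close>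
    have diag: "eventually (\<lambda>a. norm (\<Phi> a 0) / cuspM u v a \<le> K / 2) (at_right 0)"
      using order_tendstoD(2)[OF d0, of "K / 2"] K(1) by (auto elim: eventually_mono)
    have "(\<Sum>i<Suc 0. K\<^sup>2) \<le> (K / 2)\<^sup>2"
      by (rule bessel_of_almost_psd[where y = "\<lambda>_ a. ln (2 * real k) / 2 + s * a", OF _ psd C(1) herm cuspM_at_top diag])
         (use K in auto)
    then show False using K(1) by (simp add: power_divide)
  next
    case True
    then obtain m1 :: int where m1: "of_int m1 + (1 / 2 + u) = 0" by blast
    have u0: "u \<noteq> 0"
    proof
      assume "u = 0"
      then have "real_of_int (2 * m1 + 1) = of_int 0" using m1 by simp
      then have "2 * m1 + 1 = 0" by (simp only: of_int_eq_iff)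
      then show False by presburger
    qed
    then have v0: "v \<noteq> 0" and ir: "\<And>m::int. of_int m \<noteq> 2 * u * sqrt (2 * real k)" using uv irr by auto
    \<comment> \<open>Chosen so that \<open>w * (u + s m * v) = - m\<close>: every natural number
      \<open>m\<close> gives a resonant slope at the cusp \<open>2 * k\<close>, and hence one
      character for the Bessel inequality.\<close>
    define s where "s = (\<lambda>m::nat. - (real m / w + u) / v)"
    have sv: "s m * v = - (real m / w + u)" for m using v0 by (simp add: s_def)
    have rs: "((\<lambda>a. norm (\<Phi> a (ln (2 * real k) / 2 + s m * a)) / cuspM u v a) \<longlongrightarrow> G * cuspk (2 * real k) (s m)) (at_right 0)" for m
    proof (rule res[OF u0, of "int m"])
      show "of_int (int m) + w * (u + s m * v) = 0" unfolding sv using w0 by simp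
    qed
    have ofs: "((\<lambda>a. norm (\<Phi> a ((ln (2 * real k) / 2 + s i * a) - (ln (2 * real k) / 2 + s j * a))) / cuspM u v a) \<longlongrightarrow> 0) (at_right 0)" if "i \<noteq> j" for i j
    proof -
      have d: "(s i - s j) * v = - ((real i - real j) / w)" by (simp add: left_diff_distrib sv diff_divide_distrib)
      have ne: "of_int n \<noteq> (real i - real j) / w" for n :: int
        unfolding w_def by (rule half_integer_sqrt_ratio[OF k m1 ir that])
      have "((\<lambda>a. norm (\<Phi> a ((s i - s j) * a)) / cuspM u v a) \<longlongrightarrow> 0) (at_right 0)"
      proof (rule off)
        fix m :: int
        show "of_int m + (1 / 2 + (u + (s i - s j) * v)) \<noteq> 0" unfolding d using ne[of "m - m1"] m1 by simp
        show "of_int m + (1 / 2 + (u - (s i - s j) * v)) \<noteq> 0" unfolding d using ne[of "m1 - m"] m1 by simp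
      qed
      moreover have "(ln (2 * real k) / 2 + s i * a) - (ln (2 * real k) / 2 + s j * a) = (s i - s j) * a" for a
        by (simp add: left_diff_distrib)
      ultimately show ?thesis by presburger
    qed
    obtain A where A: "A > 0" "eventually (\<lambda>a. norm (\<Phi> a 0) / cuspM u v a \<le> A) (at_right 0)"
      using gker_diagonal_bounded[OF c l] unfolding \<Phi>_def by blast
    have bes: "(\<Sum>m<n. (G * cuspk (2 * real k) (s m))\<^sup>2) \<le> A\<^sup>2" for n
      by (rule bessel_of_almost_psd[where y = "\<lambda>m a. ln (2 * real k) / 2 + s m * a", OF _ psd C(1) herm cuspM_at_top A(2,1) rs ofs]) simp
    \<comment> \<open>The slopes grow at most linearly in \<open>m\<close>, so the squared limits
      dominate a multiple of the harmonic series.\<close>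
    define b where "b = 1 / (w * \<bar>v\<bar>) + \<bar>u / v\<bar> + 1"
    have b0: "b > 0" using w0 v0 by (simp add: b_def add_nonneg_pos)
    have sb: "\<bar>s m\<bar> + 1 \<le> b * (real m + 1)" for m
    proof -
      have "s m = - (real m * (1 / (w * v))) - u / v" using v0 w0 by (simp add: s_def field_simps)
      then have "\<bar>s m\<bar> \<le> real m * (1 / (w * \<bar>v\<bar>)) + \<bar>u / v\<bar>"
        using abs_triangle_ineq4[of "- (real m * (1 / (w * v)))" "u / v"] w0 by (simp add: abs_mult)
      moreover have "0 \<le> 1 / (w * \<bar>v\<bar>) + (real m * \<bar>u / v\<bar> + real m)" using w0 by simp
      moreover have "(p + q + 1) * (x + 1) = x * p + p + x * q + q + x + 1" for p q x :: real by (simp add: algebra_simps)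
      then have "b * (real m + 1) = real m * (1 / (w * \<bar>v\<bar>)) + 1 / (w * \<bar>v\<bar>) + real m * \<bar>u / v\<bar> + \<bar>u / v\<bar> + real m + 1"
        unfolding b_def by blast
      ultimately show ?thesis by linarith
    qed
    define D where "D = G\<^sup>2 / (8 * w * b)"
    have D0: "D > 0" using G0 w0 b0 by (simp add: D_def)
    have low: "D * (1 / real (Suc m)) \<le> (G * cuspk (2 * real k) (s m))\<^sup>2" for m
    proof -
      have "1 / (8 * w * (b * (real m + 1))) \<le> (cuspk (2 * real k) (s m))\<^sup>2"
        unfolding w_def by (rule cuspk_squared_ge) (use k sb in auto)
      then have "G\<^sup>2 * (1 / (8 * w * (b * (real m + 1)))) \<le> G\<^sup>2 * (cuspk (2 * real k) (s m))\<^sup>2" by (rule mult_left_mono) simp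
      then show ?thesis by (simp add: D_def power_mult_distrib add.commute mult.assoc)
    qed
    have "summable (\<lambda>m. D * (1 / real (Suc m)))"
    proof (rule summableI_nonneg_bounded)
      show "(\<Sum>m<n. D * (1 / real (Suc m))) \<le> A\<^sup>2" for n
        using sum_mono[of "{..<n}", OF low] bes[of n] by (meson order_trans)
    qed (use D0 in simp)
    then have "summable (\<lambda>m. 1 / real (Suc m))" using D0 by (simp only: summable_cmult_iff) simp
    then have "summable (\<lambda>m. 1 / real m)" by (subst (asm) summable_Suc_iff)
    then show False using not_summable_harmonic[where 'a = real] unfolding inverse_eq_divide by (rule notE[rotated])
  qed
qed

text \<open>By continuity \<open>gsum\<close> has one sign beyond its last zero. Replacing
  \<open>c\<close> by \<open>- c\<close> reduces the negative sign to the positive one.\<close>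

lemma gsum_infinitely_many_zeros:
  assumes c: "summable (\<lambda>j. \<bar>c j\<bar>)" and l: "bounded (range l)" and c0: "c 0 \<noteq> 0" and inj: "inj l"
    and uv: "v \<noteq> 0 \<or> u = 0"
  shows "infinite {t. gsum c l (zz u v) t = 0}"
proof
  let ?g = "gsum c l (zz u v)"
  assume "finite {t. ?g t = 0}"
  then obtain T where T: "\<And>t. ?g t = 0 \<Longrightarrow> t \<le> T"
    using bdd_above_finite unfolding bdd_above_def by fastforce
  have nz: "?g t \<noteq> 0" if "t > T" for t using T[of t] that by auto
  have sgn: "?g t > 0 \<longleftrightarrow> ?g (T + 1) > 0" if "t > T" for t
  proof (rule ccontr)
    assume a: "\<not> ?thesis"
    have "connected (?g ` {T<..})"
      by (rule connected_continuous_image[OF continuous_on_subset[OF gsum_continuous[OF c]]]) auto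
    moreover have "?g t \<in> ?g ` {T<..}" "?g (T + 1) \<in> ?g ` {T<..}" using that by auto
    moreover have "?g t < 0 \<and> 0 < ?g (T + 1) \<or> ?g (T + 1) < 0 \<and> 0 < ?g t"
      using a nz[OF that] nz[of "T + 1"] by linarith
    ultimately have "0 \<in> ?g ` {T<..}" by (meson connectedD_interval less_imp_le)
    then show False using nz by auto
  qed
  show False
  proof (cases "?g (T + 1) > 0")
    case True
    then have "?g t \<ge> 0" if "t > T" for t using sgn[OF that] by simp
    then show False by (rule gsum_not_eventually_nonneg[OF c l c0 inj uv _ nz[of "T + 1"]]) simp_all
  next
    case False
    have neg: "gsum (\<lambda>j. - c j) l z t = - gsum c l z t" for z t
      by (simp add: gsum_def infsum_uminus)
    have "gsum (\<lambda>j. - c j) l (zz u v) t \<ge> 0" if "t > T" for t using sgn[OF that] False unfolding neg by simp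
    moreover have "summable (\<lambda>j. \<bar>- c j\<bar>)" "- c 0 \<noteq> 0" "gsum (\<lambda>j. - c j) l (zz u v) (T + 1) \<noteq> 0"
      using c c0 nz[of "T + 1"] by (simp_all add: neg)
    ultimately show False using gsum_not_eventually_nonneg[OF _ l _ inj uv, of "\<lambda>j. - c j" T "T + 1"] by blast
  qed
qed

section \<open>Conjugation of the parameter and the final result\<close>

lemma gsum_cnj: "gsum c l (cnj z) t = gsum c (\<lambda>j. - l j) z (- t)"
proof -
  have "hfun (cnj z) (t - l j) = hfun z (- t - - l j)" for j
  proof -
    have "complex_of_real (hfun (cnj z) t) = of_real (hfun z (- t))" for t by (simp add: hfun_eq add.commute)
    from this[of "t - l j"] show ?thesis by (simp only: of_real_eq_iff minus_diff_eq) simp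
  qed
  then show ?thesis by (simp add: gsum_def)
qed

text \<open>Conjugation exchanges the two coordinates up to sign. It carries the case
  \<open>v = 0\<close>, where the slope has no influence on resonance, to the case
  \<open>u = 0\<close>.\<close>

lemma cnj_zz: "cnj (zz u v) = zz (- v) (- u)"
proof -
  have "cnj (zz u v) = - \<i> * zz u (- v)" by (simp flip: i_cnj_zz)
  also have "\<dots> = zz (- v) (- u)" unfolding zz_def by (simp add: complex_eq_iff algebra_simps)
  finally show ?thesis .
qed

lemma zz_surj: "\<exists>u v. z = zz u v"
proof -
  define w where "w = z / (2 * of_real (sqrt pi) * cis (pi / 4))"
  have "z = zz (Re w) (Im w)" by (simp add: zz_def w_def)
  then show ?thesis by blast
qed

theorem theorem2:
  fixes c l :: "nat \<Rightarrow> real" and z :: complex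
  assumes "\<And>j. c j \<noteq> 0"
    and "summable (\<lambda>j. \<bar>c j\<bar>)"
    and "bounded (range l)"
    and "inj l"
    and "Sup (range l) \<in> range l"
    and "Inf (range l) \<in> range l"
    and "z \<in> region_D"
  shows "infinite {s :: complex. Re s = 1 / 2 \<and> F c l z s = 0}"
proof -
  have inf: "infinite {t. gsum c l z t = 0}"
  proof -
    obtain u v where z: "z = zz u v" using zz_surj by blast
    show ?thesis
    proof (cases "v \<noteq> 0 \<or> u = 0")
      case True
      then show ?thesis unfolding z by (intro gsum_infinitely_many_zeros assms)
    next
      case False
      then have cz: "cnj z = zz 0 (- u)" by (simp add: z cnj_zz)
      have "{t. gsum c (\<lambda>j. - l j) (zz 0 (- u)) t = 0} = uminus ` {t. gsum c l z t = 0}"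
      proof -
        have "gsum c (\<lambda>j. - l j) (cnj z) t = gsum c l z (- t)" for t
          using gsum_cnj[of c "\<lambda>j. - l j" z t] by simp
        then show ?thesis unfolding cz[symmetric] by (auto simp: image_iff) (metis minus_minus)
      qed
      moreover have "infinite {t. gsum c (\<lambda>j. - l j) (zz 0 (- u)) t = 0}"
      proof (rule gsum_infinitely_many_zeros[OF assms(2) _ assms(1)])
        have "range (\<lambda>j. - l j) = uminus ` range l" by auto
        then show "bounded (range (\<lambda>j. - l j))" using assms(3) by simp
        show "inj (\<lambda>j. - l j)" using assms(4) by (simp add: inj_def)
      qed simp
      ultimately show ?thesis by (metis finite_imageI)
    qed
  qed
  have "inj (\<lambda>t. 1 / 2 - \<i> * complex_of_real t)" by (simp add: inj_def)
  then have "infinite ((\<lambda>t. 1 / 2 - \<i> * complex_of_real t) ` {t. gsum c l z t = 0})"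
    using inf by (simp add: finite_image_iff inj_on_subset)
  moreover have "(\<lambda>t. 1 / 2 - \<i> * complex_of_real t) ` {t. gsum c l z t = 0} \<subseteq> {s. Re s = 1 / 2 \<and> F c l z s = 0}"
    using F_eq_gsum[OF assms(2)] by auto
  ultimately show ?thesis by (rule infinite_super[rotated])
qed

end
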